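(* Let $2\le p\le\infty$, $1/p+1/q=1$, and let $M$ be a $d\times d$ dilation matrix. Suppose: (i) $\varphi\in\mathcal L_p$ and there exists $B_\varphi>0$ such that $\sum_{k\in\mathbb Z^d}|\widehat\varphi(\xi+k)|^q<B_\varphi$ for all $\xi\in\mathbb R^d$; (ii) $\widetilde\varphi$ is a tempered distribution on $\mathbb R^d$ whose Fourier transform $\widehat{\widetilde\varphi}$ is a function on $\mathbb R^d$ such that, for some $N=N(\widetilde\varphi)\ge0$ and constants $C_{\widetilde\varphi},C'_{\widetilde\varphi}$, $|\widehat{\widetilde\varphi}(\xi)|\le C_{\widetilde\varphi}|\xi|^{N}$ for almost all $\xi\notin\mathbb T^d$ and $|\widehat{\widetilde\varphi}(\xi)|\le C'_{\widetilde\varphi}$ for almost all $\xi\in\mathbb T^d$; (iii) $f(x)=\widehat g(-x)$, where $g\in L_q(\mathbb R^d)$ and $g(\xi)=O(|\xi|^{-N-d-\varepsilon})$ as $|\xi|\to\infty$, $\varepsilon>0$. Then: (a) If $\widehat{\widetilde\varphi}$ is continuous at zero and $\widehat\varphi(\mathbf 0)\widehat{\widetilde\varphi}(\mathbf 0)=1$, then the Strang-Fix condition of order $1$ for $\varphi$ is necessary and sufficient for the convergence of $Q_j(\varphi,\widetilde\varphi,f)$ to $f$ in the $L_p$-norm as $j\to+\infty$. (b) Suppose there exist $n\in\mathbb N$ and $\delta\in(0,1/2)$ such that: $\widehat\varphi\,\widehat{\widetilde\varphi}$ is boundedly differentiable up to order $n$ on $\{|\xi|<\delta\}$; $\widehat\varphi$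 is boundedly differentiable up to order $n$ on $\{|\xi+l|<\delta\}$ for all $l\in\mathbb Z^d\setminus\{\mathbf 0\}$; the function $\sum_{l\in\mathbb Z^d,\,l\ne\mathbf 0}|D^\beta\widehat\varphi(\xi+l)|$ is bounded on $\{|\xi|<\delta\}$ for $[\beta]=n$; $D^\beta(1-\widehat\varphi\,\widehat{\widetilde\varphi})(\mathbf 0)=0$ for all $\beta\in\Delta_n$; the Strang-Fix condition of order $n$ holds for $\varphi$; and $\gamma\in(N+\frac dp,\,N+\frac dp+\varepsilon)$ for $p\neq\infty$, $\gamma=N$ for $p=\infty$. Then $$\|f-Q_j(\varphi,\widetilde\varphi,f)\|_p^q\le C_1\|M^{*-j}\|^{\gamma q}\int_{|M^{*-j}\xi|\ge\delta}|\xi|^{q\gamma}|g(\xi)|^q\,d\xi+C_2\|M^{*-j}\|^{nq}\int_{|M^{*-j}\xi|<\delta}|\xi|^{qn}|g(\xi)|^q\,d\xi,$$ where $C_1$ and $C_2$ do not depend on $j$ and $f$.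
   Context: A dilation matrix is an integer $d\times d$ matrix $M$ all of whose eigenvalues are greater than $1$ in modulus; $m=|\det M|$, $M^*$ is the conjugate (transpose) matrix, $M^{*-j}=(M^* )^{-j}$. $\mathbb Z_+=\{0,1,2,\dots\}$, $\mathbb T^d=[-\frac12,\frac12]^d$. For $\beta\in\mathbb Z_+^d$, $[\beta]=\beta_1+\dots+\beta_d$ and $D^\beta$ is the corresponding partial derivative; $\Delta_n=\{\beta\in\mathbb Z_+^d:[\beta]<n\}$. Fourier transform: $\widehat f(\xi)=\int_{\mathbb R^d}f(x)e^{-2\pi i(x,\xi)}dx$ for $f\in L_1$, extended to tempered distributions by $\langle\widehat f,\widehat\varphi\rangle=\langle f,\varphi\rangle$ ($f$ Schwartz), where $\langle f,g\rangle=\int f\overline g$ when $f\overline g\in L_1$. $\mathcal L_p$ is the space of $f\in L_p(\mathbb R^d)$ with $\|f\|_{\mathcal L_p}:=\big\|\sum_{k\in\mathbb Z^d}|f(\cdot+k)|\big\|_{L_p(\mathbb T^d)}<\infty$. For a function $\varphi$ on $\mathbb R^d$: $\varphi_{jk}(x)=m^{j/2}\varphi(M^jx+k)$. For a tempered distribution $\widetilde\varphi$, $\widetilde\varphi_{jk}$ is defined by $\langle f,\widetilde\varphi_{jk}\rangle=\langle f_{-j,-M^{-j}k},\widetilde\varphi\rangle$ for all Schwartz $f$; if $\widehat{\widetilde\varphi}$ is a function, then $\widehat{\widetilde\varphi_{jk}}(\xi)=m^{-j/2}\widehat{\widetilde\varphi}(M^{*-j}\xi)e^{2\pi i(k,M^{*-j}\xi)}$.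 For $f(x)=\widehat g(-x)$, $$Q_j(\varphi,\widetilde\varphi,f)=\sum_{k\in\mathbb Z^d}\langle g,\widehat{\widetilde\varphi_{jk}}\rangle\,\varphi_{jk},\qquad j\in\mathbb Z_+,$$ the series converging unconditionally in $L_p$. A function $\varphi\in L_1(\mathbb R^d)$ satisfies the Strang-Fix condition of order $n$ if $D^\beta\widehat\varphi(k)=0$ for all $k\in\mathbb Z^d\setminus\{\mathbf 0\}$ and all $\beta\in\Delta_n$. "Boundedly differentiable up to order $n$ on a set" means $n$ times differentiable there with all partial derivatives of order at most $n$ bounded there.
   Formalization: The product of the two Fourier transforms in (a), (b) is taken with the second factor conjugated; sufficiency in (a) for p=∞ also assumes the sum in (i) is continuous at 0; necessity in (a) is for f not identically zero. As printed these claims fail. *)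

theory Defs
  imports "HOL-Probability.Probability"
begin

definition int_lattice :: "(real^'d) set" where
  "int_lattice = {k. \<forall>i. k $ i \<in> \<int>}"

definition torus :: "(real^'d) set" where
  "torus = cbox (\<chi> i. - 1/2) (\<chi> i. 1/2)"

definition dilation_matrix :: "real^'d^'d \<Rightarrow> bool" where
  "dilation_matrix M \<longleftrightarrow>
     (\<forall>i j. M $ i $ j \<in> \<int>) \<and>
     (\<forall>(c::complex) (v::complex^'d).
        v \<noteq> 0 \<and> (\<chi> i j. complex_of_real (M $ i $ j)) *v v = c *s v \<longrightarrow> cmod c > 1)"

text \<open>Powers for the matrix product: the overloaded product on \<^typ>\<open>real^'d^'d\<close> is
  componentwise, so the generic power operation cannot be used.\<close>

definition mat_pow :: "real^'d^'d \<Rightarrow> nat \<Rightarrow> real^'d^'d" where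
  "mat_pow A n = (((**) A) ^^ n) (mat 1)"

definition mat_powi :: "real^'d^'d \<Rightarrow> int \<Rightarrow> real^'d^'d" where
  "mat_powi A j = (if j \<ge> 0 then mat_pow A (nat j) else mat_pow (matrix_inv A) (nat (- j)))"

text \<open>\<open>dilate M j k f\<close> is $f_{jk}(x) = m^{j/2} f(M^j x + k)$ with $m = |\det M|$; the indices
  \<open>j\<close> and \<open>k\<close> may be negative and non-integral, respectively, as needed for
  $f_{-j,-M^{-j}k}$.\<close>

definition dilate ::
  "real^'d^'d \<Rightarrow> int \<Rightarrow> real^'d \<Rightarrow> (real^'d \<Rightarrow> complex) \<Rightarrow> real^'d \<Rightarrow> complex" where
  "dilate M j k f = (\<lambda>x. of_real (\<bar>det M\<bar> powr (of_int j / 2)) * f (mat_powi M j *v x + k))"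

definition partial :: "'d \<Rightarrow> (real^'d \<Rightarrow> complex) \<Rightarrow> real^'d \<Rightarrow> complex" where
  "partial i f x = vector_derivative (\<lambda>t. f (x + t *\<^sub>R axis i 1)) (at 0)"

text \<open>The index type carries no order, so one enumeration of the coordinates is fixed in which the
  partial derivatives are taken. For functions that are \<open>n\<close> times differentiable in the sense of
  \<open>n_times_differentiable\<close> below, the choice does not affect \<open>D \<beta> f\<close> for \<open>mi_order \<beta> \<le> n\<close>.\<close>

definition coords :: "'d::finite list" where
  "coords = (SOME is. distinct is \<and> set is = UNIV)"

definition mi_order :: "('d::finite \<Rightarrow> nat) \<Rightarrow> nat" where
  "mi_order \<beta> = (\<Sum>i\<in>UNIV. \<beta> i)"

definition D :: "('d::finite \<Rightarrow> nat) \<Rightarrow> (real^'d \<Rightarrow> complex) \<Rightarrow> real^'d \<Rightarrow> complex" where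
  "D \<beta> f = foldr (\<lambda>i h. (partial i ^^ \<beta> i) h) coords f"

text \<open>Total differentiability, iterated: a function is \<open>Suc n\<close> times differentiable iff it is
  differentiable and all its first-order partial derivatives are \<open>n\<close> times differentiable.\<close>

fun n_times_differentiable :: "nat \<Rightarrow> (real^'d \<Rightarrow> complex) \<Rightarrow> (real^'d) set \<Rightarrow> bool" where
  "n_times_differentiable 0 f S \<longleftrightarrow> True"
| "n_times_differentiable (Suc n) f S \<longleftrightarrow>
     (\<forall>x\<in>S. f differentiable (at x)) \<and> (\<forall>i. n_times_differentiable n (partial i f) S)"

definition boundedly_differentiable ::
  "nat \<Rightarrow> (real^'d \<Rightarrow> complex) \<Rightarrow> (real^'d) set \<Rightarrow> bool" where
  "boundedly_differentiable n f S \<longleftrightarrow>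
     n_times_differentiable n f S \<and> (\<forall>\<beta>. mi_order \<beta> \<le> n \<longrightarrow> bounded (D \<beta> f ` S))"

definition ennpowr :: "ennreal \<Rightarrow> real \<Rightarrow> ennreal" where
  "ennpowr a r = (if a = \<infinity> then \<infinity> else ennreal (enn2real a powr r))"

text \<open>Defined for functions with values in $[0,\infty]$, so that it also applies to
  $\sum_{k\in\mathbb Z^d} |f(\cdot+k)|$, which may be infinite.\<close>

definition Lp_enorm :: "ennreal \<Rightarrow> 'a measure \<Rightarrow> ('a \<Rightarrow> ennreal) \<Rightarrow> ennreal" where
  "Lp_enorm p \<mu> u =
     (if p = \<infinity> then esssup \<mu> u
      else ennpowr (\<integral>\<^sup>+ x. ennpowr (u x) (enn2real p) \<partial>\<mu>) (1 / enn2real p))"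

abbreviation Lp_norm :: "ennreal \<Rightarrow> (real^'d \<Rightarrow> complex) \<Rightarrow> ennreal" where
  "Lp_norm p f \<equiv> Lp_enorm p lebesgue (\<lambda>x. ennreal (cmod (f x)))"

definition Lp_space :: "ennreal \<Rightarrow> (real^'d \<Rightarrow> complex) set" where
  "Lp_space p = {f \<in> borel_measurable lebesgue. Lp_norm p f < \<infinity>}"

definition calLp :: "ennreal \<Rightarrow> (real^'d \<Rightarrow> complex) set" where
  "calLp p = {f \<in> Lp_space p.
     Lp_enorm p (lebesgue_on torus) (\<lambda>x. \<Sum>\<^sub>\<infinity>k\<in>int_lattice. ennreal (cmod (f (x + k)))) < \<infinity>}"

definition pairing :: "(real^'d \<Rightarrow> complex) \<Rightarrow> (real^'d \<Rightarrow> complex) \<Rightarrow> complex" where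
  "pairing f g = (LINT x|lebesgue. f x * cnj (g x))"

definition fourier :: "(real^'d \<Rightarrow> complex) \<Rightarrow> real^'d \<Rightarrow> complex" where
  "fourier f \<xi> = (LINT x|lebesgue. f x * cis (- 2 * pi * (x \<bullet> \<xi>)))"

definition schwartz_term ::
  "('d::finite \<Rightarrow> nat) \<Rightarrow> ('d \<Rightarrow> nat) \<Rightarrow> (real^'d \<Rightarrow> complex) \<Rightarrow> real^'d \<Rightarrow> complex" where
  "schwartz_term \<alpha> \<beta> f x = of_real (\<Prod>i\<in>UNIV. (x $ i) ^ \<alpha> i) * D \<beta> f x"

definition schwartz :: "(real^'d \<Rightarrow> complex) set" where
  "schwartz = {f. (\<forall>n. n_times_differentiable n f UNIV) \<and>
                  (\<forall>\<alpha> \<beta>. bounded (range (schwartz_term \<alpha> \<beta> f)))}"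

text \<open>A tempered distribution $\widetilde\varphi$ is represented by the linear functional
  $T f = \langle f, \widetilde\varphi\rangle$ on the Schwartz space; sequential continuity is
  continuity, the Schwartz space being metrizable. The values of \<open>T\<close> at other functions are
  irrelevant.\<close>

definition tempered_distribution :: "((real^'d \<Rightarrow> complex) \<Rightarrow> complex) \<Rightarrow> bool" where
  "tempered_distribution T \<longleftrightarrow>
     (\<forall>f\<in>schwartz. \<forall>g\<in>schwartz. T (\<lambda>x. f x + g x) = T f + T g) \<and>
     (\<forall>f\<in>schwartz. \<forall>c. T (\<lambda>x. c * f x) = c * T f) \<and>
     (\<forall>F :: nat \<Rightarrow> real^'d \<Rightarrow> complex.
        (\<forall>n. F n \<in> schwartz) \<and>
        (\<forall>\<alpha> \<beta>. (\<lambda>n. SUP x. cmod (schwartz_term \<alpha> \<beta> (F n) x)) \<longlonglongrightarrow> 0)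
        \<longrightarrow> (\<lambda>n. T (F n)) \<longlonglongrightarrow> 0)"

text \<open>The Fourier transform of $\widetilde\varphi$ is the function \<open>h\<close>:
  $\langle\widehat f, h\rangle = \langle f,\widetilde\varphi\rangle$ for all Schwartz \<open>f\<close>. Such an
  \<open>h\<close> is unique up to a null set.\<close>

definition has_fourier_function ::
  "((real^'d \<Rightarrow> complex) \<Rightarrow> complex) \<Rightarrow> (real^'d \<Rightarrow> complex) \<Rightarrow> bool" where
  "has_fourier_function T h \<longleftrightarrow>
     h \<in> borel_measurable lebesgue \<and>
     (\<forall>f\<in>schwartz. integrable lebesgue (\<lambda>\<xi>. fourier f \<xi> * cnj (h \<xi>)) \<and>
                    pairing (fourier f) h = T f)"

definition dist_fourier ::
  "((real^'d \<Rightarrow> complex) \<Rightarrow> complex) \<Rightarrow> real^'d \<Rightarrow> complex" where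
  "dist_fourier T = (SOME h. has_fourier_function T h)"

definition dist_dilate ::
  "real^'d^'d \<Rightarrow> int \<Rightarrow> real^'d \<Rightarrow> ((real^'d \<Rightarrow> complex) \<Rightarrow> complex) \<Rightarrow>
   (real^'d \<Rightarrow> complex) \<Rightarrow> complex" where
  "dist_dilate M j k T = (\<lambda>f. T (dilate M (- j) (- (mat_powi M (- j) *v k)) f))"

text \<open>Unconditional convergence in $L_p$ is convergence of the net of finite partial sums.\<close>

definition has_Lp_sum ::
  "ennreal \<Rightarrow> ('k \<Rightarrow> real^'d \<Rightarrow> complex) \<Rightarrow> 'k set \<Rightarrow> (real^'d \<Rightarrow> complex) \<Rightarrow> bool" where
  "has_Lp_sum p u K F \<longleftrightarrow>
     F \<in> Lp_space p \<and>
     ((\<lambda>A. Lp_norm p (\<lambda>x. F x - (\<Sum>k\<in>A. u k x))) \<longlongrightarrow> 0) (finite_subsets_at_top K)"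

text \<open>\<open>Q p M \<phi> T g j\<close> is $Q_j(\varphi,\widetilde\varphi,f)$ for $f(x) = \widehat g(-x)$, i.e. a
  representative of the $L_p$-sum, which is unique up to a null set. With \<open>h\<close> the Fourier transform
  of $\widetilde\varphi$, the Fourier transform of \<open>dist_dilate M j k T\<close> is
  $m^{-j/2} h(M^{*-j}\xi) e^{2\pi i(k,M^{*-j}\xi)}$ almost everywhere. As \<open>pairing\<close> conjugates its
  second argument, the symbol that has to be close to 1 for $Q_j$ to reproduce \<open>f\<close> is
  $\widehat\varphi\,\overline h$.\<close>

definition Q ::
  "ennreal \<Rightarrow> real^'d^'d \<Rightarrow> (real^'d \<Rightarrow> complex) \<Rightarrow> ((real^'d \<Rightarrow> complex) \<Rightarrow> complex) \<Rightarrow>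
   (real^'d \<Rightarrow> complex) \<Rightarrow> nat \<Rightarrow> real^'d \<Rightarrow> complex" where
  "Q p M \<phi> T g j = (SOME F. has_Lp_sum p
     (\<lambda>k x. pairing g (dist_fourier (dist_dilate M (int j) k T)) * dilate M (int j) k \<phi> x)
     int_lattice F)"

definition strang_fix :: "nat \<Rightarrow> (real^'d \<Rightarrow> complex) \<Rightarrow> bool" where
  "strang_fix n \<phi> \<longleftrightarrow>
     (\<forall>k\<in>int_lattice - {0}. \<forall>\<beta>. mi_order \<beta> < n \<longrightarrow> D \<beta> (fourier \<phi>) k = 0)"

text \<open>The bound at infinity is imposed up to a null set only, \<open>g\<close> standing for an element of
  $L_q$.\<close>

definition Lq_decay :: "real \<Rightarrow> real \<Rightarrow> (real^'d \<Rightarrow> complex) \<Rightarrow> bool" where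
  "Lq_decay q s g \<longleftrightarrow>
     g \<in> Lp_space (ennreal q) \<and>
     (\<exists>C R. AE \<xi> in lebesgue. norm \<xi> \<ge> R \<longrightarrow> cmod (g \<xi>) \<le> C * norm \<xi> powr (- s))"

end

(* After the scaling g_j(eta) = m g(M*^j eta), the error f - Q_j is E g_j composed with M^j, where
   E g = inv_fourier g - quasi_proj phi h g. If g is supported in the unit cell, then for fixed x the
   values E g(x+k), k in Z^d, are the Fourier coefficients of
   g(eta) e(x eta) (1 - conj(h(eta)) Z(x,eta)) with Z(., eta) the periodic function whose Fourier
   coefficients are phi^(eta+l). Hausdorff-Young on the torus, integrated over x in the cell, bounds
   the low frequencies; the high frequencies are bounded by periodizing g and g h. For necessity, E g_j
   at M^j x is close to f(x) (1 - conj(h(0)) Z(M^j x, 0)), whose L1 norm on a ball where f is bounded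
   away from 0 tends to 0 only if Z(., 0) is constant. *)
theory Submission
  imports Defs "HOL-Computational_Algebra.Fundamental_Theorem_Algebra"
begin

text \<open>All constants must be uniform in \<open>j\<close>. This works because the scalings
  cancel: with m the Jacobian, composing with M^j costs m^(-1/p) in L_p, while the weighted L_q norm
  of g_j gains m^((q-1)/q), and (q-1)/q = 1/p; only the norm of the inverse transposed power
  survives. The assumption p >= 2 enters twice: in Hausdorff-Young, and through q <= p when the L_p
  norm in x and the L_q norm in eta are interchanged. The threshold N + d/p for gamma is the price
  of periodizing: Hoelder against |eta+l|^(-s), summable over the lattice for s > d, with s =
  (gamma-N)p; for p = infinity there is q = 1 and nothing is lost. The low frequencies depend on the
  L_p norm in x of 1 - conj(h(eta)) Z(x,eta). At eta = 0 the Strang-Fix condition removes all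
  coefficients of Z except the zeroth. Taylor expansion makes this quantitative in (b). In (a)
  continuity of Z in eta takes over, in L_p by dominated convergence; that argument is confined to
  finite p, and for p = infinity continuity of the absolute sum of the coefficients replaces
  it.\<close>

abbreviation (input) nn_lborel :: "('a::euclidean_space \<Rightarrow> ennreal) \<Rightarrow> ennreal" (binder \<open>INTR \<close> 10)
  where "nn_lborel \<equiv> integral\<^sup>N lborel"

abbreviation (input) bm where "bm \<equiv> borel_measurable borel"

abbreviation (input) enorm :: "complex \<Rightarrow> ennreal" where "enorm z \<equiv> ennreal (cmod z)"

abbreviation (input) seq_lim (infix \<open>~~>\<close> 60) where "X ~~> l \<equiv> X \<longlonglongrightarrow> l"

abbreviation (input) infy :: ennreal where "infy \<equiv> \<infinity>"

section \<open>Linear change of variables over an arbitrary finite index type\<close>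

typedef ('d::finite) idx = "{..<CARD('d)}" by (auto intro!: exI[of _ 0])

instantiation idx :: (finite) "{finite, wellorder}"
begin
definition less_eq_idx :: "'a idx => 'a idx => bool" where "less_eq_idx a b \<longleftrightarrow> Rep_idx a <= Rep_idx b"
definition less_idx :: "'a idx => 'a idx => bool" where "less_idx a b \<longleftrightarrow> Rep_idx a < Rep_idx b"
instance
proof
 show "finite (UNIV :: 'a idx set)"
  by (metis finite_imageI finite_lessThan type_definition.Abs_image type_definition_idx)
 fix P :: "'a idx => bool" and a
 assume step: "!!x. (!!y. y < x ==> P y) ==> P x"
 show "P a"
 proof (induction a rule: measure_induct_rule[of Rep_idx])
  case (less x)
  show ?case by (rule step, rule less) (simp add: less_idx_def)
 qed
qed (auto simp: less_eq_idx_def less_idx_def Rep_idx_inject)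
end

lemma ex_bij_idx: "\<exists>b :: 'd::finite idx => 'd. bij b"
proof -
 have "CARD('d idx) = CARD('d)"
  using type_definition.card[OF type_definition_idx] by simp
 then show ?thesis
  using finite_same_card_bij[of "UNIV :: 'd idx set" "UNIV :: 'd set"] by auto
qed

lemma emeasure_lborel_box_cart:
 fixes l u :: "real^'d::finite"
 assumes "!!i. l $ i <= u $ i"
 shows "emeasure lborel (box l u) = (\<Prod>i\<in>UNIV. u $ i - l $ i)"
proof -
 have "l \<bullet> b <= u \<bullet> b" if "b : Basis" for b
  using that assms by (auto simp: Basis_vec_def inner_axis)
 then have "emeasure lborel (box l u) = ennreal (measure lborel (cbox l u))"
  by (auto simp: emeasure_lborel_box_eq emeasure_eq_ennreal_measure measure_lborel_cbox_eq)
 also have "measure lborel (cbox l u) = (\<Prod>i\<in>UNIV. u $ i - l $ i)"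
  using assms by (subst content_cbox_cart) (auto simp: interval_ne_empty_cart)
 finally show ?thesis .
qed

lemma distr_lborel_reindex:
 fixes b :: "'e::finite => 'd::finite"
 assumes "bij b"
 shows "distr lborel borel (%x::real^'d. \<chi> i. x $ b i) = (lborel :: (real^'e) measure)"
proof (rule lborel_eqI[symmetric])
 fix l u :: "real^'e"
 assume lu: "!!c. c : Basis ==> l \<bullet> c <= u \<bullet> c"
 then have lu': "l $ i <= u $ i" for i
  by (metis axis_in_Basis_iff cart_eq_inner_axis Basis_real_def singletonI)
 define c where "c = inv b"
 have [simp]: "b (c i) = i" "c (b j) = j" for i j
  using assms by (auto simp: c_def bij_is_surj surj_f_inv_f bij_is_inj inv_f_f)
 have m[measurable]: "(%x::real^'d. \<chi> i. x $ b i) : bm"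
  by (intro borel_measurable_continuous_onI continuous_intros)
 have eq: "(%x::real^'d. \<chi> i. x $ b i) -` box l u = box (\<chi> i. l $ c i) (\<chi> i. u $ c i)"
  by (auto simp: mem_box_cart) (metis \<open>!!i. b (c i) = i\<close> \<open>!!j. c (b j) = j\<close>)+
 have "emeasure (distr lborel borel (%x::real^'d. \<chi> i. x $ b i)) (box l u)
   = emeasure lborel (box (\<chi> i. l $ c i) (\<chi> i. u $ c i) :: (real^'d) set)"
  by (subst emeasure_distr) (auto simp: eq)
 also have "... = (\<Prod>i\<in>UNIV. u $ c i - l $ c i)"
  by (subst emeasure_lborel_box_cart) (auto simp: lu')
 also have "(\<Prod>i\<in>UNIV. u $ c i - l $ c i) = (\<Prod>j\<in>UNIV. u $ j - l $ j)"
  using assms by (intro prod.reindex_bij_betw[of c UNIV UNIV "%j. u $ j - l $ j"]) (simp add: c_def bij_imp_bij_inv)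
 also have "ennreal ... = emeasure lborel (box l u)"
  by (subst emeasure_lborel_box_cart) (auto simp: lu')
 also have "... = (\<Prod>b\<in>Basis. (u - l) \<bullet> b)"
  using lu by (simp add: emeasure_lborel_box_eq)
 finally show "emeasure (distr lborel borel (%x::real^'d. \<chi> i. x $ b i)) (box l u) = ennreal (\<Prod>b\<in>Basis. (u - l) \<bullet> b)" .
qed simp

text \<open>By \<open>lborel_eqI\<close> boxes suffice. The preimage of a box under \<open>A\<close>
  is its image under the inverse \<open>B\<close>, whose measure is |det B| times that of the box,
  and the two determinants multiply to 1.\<close>

lemma lborel_density_linear_wellorder:
 fixes A :: "real^'n::{finite,wellorder}^'n::{finite,wellorder}"
 assumes "invertible A"
 shows "lborel = density (distr lborel borel ((*v) A)) (%_. ennreal \<bar>det A\<bar>)"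
proof (rule lborel_eqI)
 fix l u :: "(real,'n) vec"
 assume lu: "!!c. c : Basis ==> l \<bullet> c <= u \<bullet> c"
 have m[measurable]: "(*v) A : bm"
  by (intro borel_measurable_continuous_onI continuous_intros)
 obtain B where B: "A ** B = mat 1" "B ** A = mat 1"
  using assms unfolding invertible_def by auto
 have eq: "(*v) A -` box l u = (*v) B ` box l u" (is "?L = ?R")
 proof (intro equalityI subsetI)
  fix x assume "x : ?L"
  then have "A *v x : box l u" "x = B *v (A *v x)"
   using B by (auto simp: matrix_vector_mul_assoc)
  then show "x : ?R" by blast
 next
  fix x assume "x : ?R" then show "x : ?L" using B by (auto simp: matrix_vector_mul_assoc)
 qed
 have dd: "det A * det B = 1"
  using B by (metis det_I det_mul)
 have ms: "measure lebesgue ((*v) B ` box l u) = \<bar>det B\<bar> * measure lebesgue (box l u)"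
  using measure_linear_image[of "(*v) B" "box l u"] by (simp add: matrix_vector_mul_linear)
 have lm: "((*v) B ` box l u) : lmeasurable"
  by (rule measurable_linear_image) (auto simp: matrix_vector_mul_linear)
 have bs: "(*v) B ` box l u : sets borel"
  using measurable_sets[OF m, of "box l u"] by (simp add: eq)
 have "emeasure (density (distr lborel borel ((*v) A)) (%_. ennreal \<bar>det A\<bar>)) (box l u)
   = ennreal \<bar>det A\<bar> * emeasure lborel ((*v) B ` box l u)"
  by (subst emeasure_density) (auto simp: nn_integral_cmult emeasure_distr eq)
 also have "emeasure lborel ((*v) B ` box l u) = emeasure lebesgue ((*v) B ` box l u)"
  using bs by (simp add: emeasure_completion)
 also have "... = ennreal (measure lebesgue ((*v) B ` box l u))"
  using lm by (intro emeasure_eq_ennreal_measure) (auto simp: fmeasurable_def)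
 also have "ennreal \<bar>det A\<bar> * ... = ennreal (measure lebesgue (box l u))"
  using dd by (simp add: ms ennreal_mult[symmetric] abs_mult[symmetric] mult.assoc[symmetric])
 also have "... = ennreal (\<Prod>b\<in>Basis. (u - l) \<bullet> b)"
  using lu by (simp add: measure_completion measure_lborel_box_eq)
 finally show "emeasure (density (distr lborel borel ((*v) A)) (%_. ennreal \<bar>det A\<bar>)) (box l u) = ennreal (\<Prod>b\<in>Basis. (u - l) \<bullet> b)" .
qed simp

text \<open>The linear change of variables of \<^theory>\<open>HOL-Analysis.Change_Of_Vars\<close> needs a wellordered
 index type, so it is transferred from \<^typ>\<open>'d idx\<close>. The constant is $|\det A|$; all that matters
 later is that \<open>A\<close> and its transpose share it.\<close>

lemma lborel_density_linear:
 fixes A :: "real^'d::finite^'d"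
 assumes "invertible A"
 shows "\<exists>c>0. lborel = density (distr lborel borel ((*v) A)) (%_. ennreal c) \<and>
        lborel = density (distr lborel borel ((*v) (transpose A))) (%_. ennreal c)"
proof -
 obtain b :: "'d idx => 'd" where b: "bij b"
  using ex_bij_idx by blast
 define c where "c = inv b"
 have bc[simp]: "b (c i) = i" "c (b j) = j" for i j
  using b by (auto simp: c_def bij_is_surj surj_f_inv_f bij_is_inj inv_f_f)
 have bijc: "bij c" using b by (simp add: c_def bij_imp_bij_inv)
 define R where "R = (%x::real^'d. (\<chi> i. x $ b i) :: real^'d idx)"
 define R' where "R' = (%x::real^'d idx. (\<chi> i. x $ c i) :: real^'d)"
 \<comment> \<open>\<open>re A\<close> is \<open>A\<close> with rows and columns relabelled by
   \<open>b\<close>. \<open>R'\<close> after \<open>re A\<close> after \<open>R\<close> is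
   \<open>A\<close> again, and both relabellings preserve Lebesgue measure, so the change of
   variables for \<open>re A\<close> carries over.\<close>
 define re where "re = (%A::real^'d^'d. (\<chi> i j. A $ b i $ b j) :: real^'d idx^'d idx)"
 have [measurable]: "R : bm" "R' : bm"
  unfolding R_def R'_def by (intro borel_measurable_continuous_onI continuous_intros)+
 have dR: "distr lborel borel R = lborel" "distr lborel borel R' = lborel"
  unfolding R_def R'_def using distr_lborel_reindex[OF b] distr_lborel_reindex[OF bijc] by auto
 have reA: "R' (re A *v R x) = A *v x" for A x
  by (simp add: R_def R'_def re_def matrix_vector_mult_def vec_eq_iff
    sum.reindex_bij_betw[OF b, where g = "%j. A $ _ $ j * x $ j"])
 have re1: "re (mat 1) = mat 1"
  using bij_is_inj[OF b] by (auto simp: re_def mat_def vec_eq_iff inj_eq)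
 have remul: "re (A ** B) = re A ** re B" for A B
  by (simp add: re_def matrix_matrix_mult_def vec_eq_iff
    sum.reindex_bij_betw[OF b, where g = "%k. A $ _ $ k * B $ k $ _"])
 have inv: "invertible (re A)" if "invertible A" for A
  using that unfolding invertible_def by (metis re1 remul)
 have *: "lborel = density (distr lborel borel ((*v) A)) (%_. ennreal \<bar>det (re A)\<bar>)" if "invertible A" for A
 proof (rule measure_eqI)
  fix X :: "(real^'d) set" assume "X : sets lborel"
  then have [measurable]: "X : sets borel" by simp
  have [measurable]: "(*v) A : bm" "(*v) (re A) : bm"
   by (intro borel_measurable_continuous_onI continuous_intros)+
  have "emeasure lborel X = emeasure lborel (R' -` X)"
   by (subst dR(2)[symmetric], subst emeasure_distr) auto
  also have "... = emeasure (density (distr lborel borel ((*v) (re A))) (%_. ennreal \<bar>det (re A)\<bar>)) (R' -` X)"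
   using lborel_density_linear_wellorder[OF inv[OF that]] by simp
  also have "... = ennreal \<bar>det (re A)\<bar> * emeasure lborel ((*v) (re A) -` R' -` X)"
   using measurable_sets[OF \<open>R' : _\<close>, of X] 
   by (subst emeasure_density) (auto simp: nn_integral_cmult emeasure_distr)
  also have "emeasure lborel ((*v) (re A) -` R' -` X) = emeasure lborel ((*v) A -` X)"
   by (subst dR(1)[symmetric], subst emeasure_distr)
     (auto simp: reA vimage_def intro!: measurable_sets_borel)
  also have "ennreal \<bar>det (re A)\<bar> * emeasure lborel ((*v) A -` X) =
   emeasure (density (distr lborel borel ((*v) A)) (%_. ennreal \<bar>det (re A)\<bar>)) X"
   by (subst emeasure_density) (auto simp: nn_integral_cmult emeasure_distr)
  finally show "emeasure lborel X = emeasure (density (distr lborel borel ((*v) A)) (%_. ennreal \<bar>det (re A)\<bar>)) X" .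
 qed simp
 have "det (re A) ~= 0" using inv[OF assms] by (simp add: invertible_det_nz)
 moreover have "re (transpose A) = transpose (re A)"
  by (simp add: re_def transpose_def vec_eq_iff)
 ultimately show ?thesis
  using *[OF assms] *[of "transpose A"] assms
  by (intro exI[of _ "\<bar>det (re A)\<bar>"]) (simp add: transpose_invertible det_transpose)
qed

section \<open>Powers, Jensen's inequality and L_p norms for functions with values in
  [0, infinity]\<close>

lemma ennpowr_ennreal: "ennpowr (ennreal x) r = ennreal ((max 0 x) powr r)"
 by (cases "x >= 0") (auto simp: ennpowr_def max_def ennreal_neg)

lemma ennpowr_simps [simp]:
 "ennpowr infy r = infy" "ennpowr top r = top" "ennpowr 0 r = 0" "ennpowr a 1 = a"
 by (auto simp: ennpowr_def less_top)

lemma ennpowr_eq_0_iff [simp]: "ennpowr a r = 0 \<longleftrightarrow> a = 0"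
 by (cases a) (auto simp: ennpowr_ennreal ennreal_eq_0_iff)

lemma ennpowr_eq_top_iff [simp]: "ennpowr a r = top \<longleftrightarrow> a = top"
 by (cases a) (auto simp: ennpowr_ennreal)

lemma ennpowr_mult: "ennpowr (a * b) r = ennpowr a r * ennpowr b r"
proof (cases a; cases b)
 fix x y assume "0 <= x" "a = ennreal x" "0 <= y" "b = ennreal y"
 then show ?thesis
  by (simp add: ennreal_mult[symmetric] ennpowr_ennreal powr_mult)
qed (auto simp: ennreal_mult_top ennreal_top_mult ennpowr_ennreal split: if_splits)

lemma ennpowr_ennpowr [simp]: "ennpowr (ennpowr a r) s = ennpowr a (r * s)"
 by (cases a) (auto simp: ennpowr_ennreal powr_powr)

lemma ennpowr_mono: "a <= b ==> r >= 0 ==> ennpowr a r <= ennpowr b r"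
 by (cases a; cases b) (auto simp: ennpowr_ennreal intro!: ennreal_leI powr_mono2 simp: top_unique)

lemma ennpowr_add: "a ~= 0 ==> a ~= top ==> ennpowr a (r + s) = ennpowr a r * ennpowr a s"
 by (cases a) (auto simp: ennpowr_ennreal powr_add ennreal_mult)

text \<open>From \<open>a + b <= 2 * max a b\<close>. The crude constant holds for every exponent r
  >= 0 alike, without convexity.\<close>

lemma ennpowr_sum_le:
 assumes "r >= 0"
 shows "ennpowr (a + b) r <= ennreal (2 powr r) * (ennpowr a r + ennpowr b r)"
proof -
 have "a + b <= 2 * max a b"
  by (metis add_mono max.cobounded1 max.cobounded2 mult_2)
 then have "ennpowr (a + b) r <= ennpowr (2 * max a b) r"
  by (rule ennpowr_mono) fact
 also have "... = ennreal (2 powr r) * ennpowr (max a b) r"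
  using ennpowr_ennreal[of 2 r] by (simp add: ennpowr_mult)
 also have "ennpowr (max a b) r <= ennpowr a r + ennpowr b r"
  by (auto simp: max_def)
 finally show ?thesis by (simp add: mult_left_mono)
qed

lemma ennpowr_le_iff:
 assumes "r > 0"
 shows "ennpowr a r <= ennpowr b r \<longleftrightarrow> a <= b"
proof
 assume "ennpowr a r <= ennpowr b r"
 then have "ennpowr (ennpowr a r) (1 / r) <= ennpowr (ennpowr b r) (1 / r)"
  by (rule ennpowr_mono) (use assms in simp)
 moreover have "r * (1 / r) = 1" using assms by simp
 ultimately show "a <= b" unfolding ennpowr_ennpowr by simp
qed (use assms in \<open>auto intro: ennpowr_mono\<close>)

lemma measurable_ennpowr [measurable (raw)]:
 assumes [measurable]: "f : borel_measurable M"
 shows "(%x. ennpowr (f x) r) : borel_measurable M"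
 unfolding ennpowr_def by measurable

lemma tendsto_ennpowr_0:
 assumes "(f \<longlongrightarrow> 0) F" "r > 0"
 shows "((%x. ennpowr (f x) r) \<longlongrightarrow> 0) F"
proof (rule order_tendstoI)
 fix a :: ennreal assume "a > 0"
 have "ennpowr (min a 1) (1 / r) > 0"
  using \<open>a > 0\<close> by (auto simp: zero_less_iff_neq_zero min_def)
 then have "eventually (%x. f x < ennpowr (min a 1) (1 / r)) F"
  using assms(1) by (auto simp: order_tendsto_iff)
 then show "eventually (%x. ennpowr (f x) r < a) F"
 proof eventually_elim
  case (elim x)
  have "ennpowr (f x) r < min a 1"
   using elim ennpowr_le_iff[of r "ennpowr (min a 1) (1 / r)" "f x"] assms(2) by (auto simp: not_le[symmetric])
  then show ?case by simp
 qed
qed auto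

text \<open>The convex function x powr s lies above its tangent at y; Young's inequality with
  exponents s and s/(s-1), applied to x and y powr (s-1), says exactly this.\<close>

lemma Young_tangent:
 fixes x y s :: real
 assumes "0 <= x" "0 < y" "1 <= s"
 shows "s * y powr (s - 1) * x <= x powr s + (s - 1) * y powr s"
proof (cases "s = 1")
 case False
 then have s: "s > 1" using assms by simp
 have e: "(s - 1) * (s / (s - 1)) = s" using s by simp
 have "x * y powr (s - 1) <= x powr s / s + (y powr (s - 1)) powr (s / (s - 1)) / (s / (s - 1))"
  using s assms by (intro Youngs_inequality) (auto simp: field_simps)
 also have "(y powr (s - 1)) powr (s / (s - 1)) = y powr s"
  unfolding powr_powr e ..
 finally have "s * (x * y powr (s - 1)) <= s * (x powr s / s + y powr s / (s / (s - 1)))"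
  using s by (intro mult_left_mono) auto
 also have "s * (x powr s / s + y powr s / (s / (s - 1))) = x powr s + (s - 1) * y powr s"
  using s by (simp add: field_simps)
 finally show ?thesis by (simp add: mult_ac)
qed (use assms in auto)

text \<open>Integrating the tangent inequality at y against the weight \<open>a\<close>, and then
  taking y to be the weighted mean of \<open>c\<close>, gives Jensen's inequality. The weight is not
  normalised, whence the factor with exponent s - 1; all integrals may be infinite.\<close>

lemma nn_integral_Jensen:
 assumes [measurable]: "a : borel_measurable M" "c : borel_measurable M" and s: "1 <= s"
 shows "ennpowr (\<integral>\<^sup>+x. c x * a x \<partial>M) s <= ennpowr (\<integral>\<^sup>+x. a x \<partial>M) (s - 1) * (\<integral>\<^sup>+x. ennpowr (c x) s * a x \<partial>M)"
proof -
 define A where "A = (\<integral>\<^sup>+x. a x \<partial>M)"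
 define I where "I = (\<integral>\<^sup>+x. c x * a x \<partial>M)"
 define X where "X = (\<integral>\<^sup>+x. ennpowr (c x) s * a x \<partial>M)"
 have tan: "ennreal (s * y powr (s - 1)) * I <= X + ennreal ((s - 1) * y powr s) * A" if y: "y > 0" for y
 proof -
  have "ennreal (s * y powr (s - 1)) * (c x * a x) <= ennpowr (c x) s * a x + ennreal ((s - 1) * y powr s) * a x" for x
  proof -
   have "ennreal (s * y powr (s - 1)) * c x <= ennpowr (c x) s + ennreal ((s - 1) * y powr s)"
    using Young_tangent[OF _ y s] s
    by (cases "c x") (auto simp: ennpowr_ennreal ennreal_mult[symmetric] ennreal_plus[symmetric] simp del: ennreal_plus intro!: ennreal_leI)
   then have "ennreal (s * y powr (s - 1)) * c x * a x <= (ennpowr (c x) s + ennreal ((s - 1) * y powr s)) * a x"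
    by (rule mult_right_mono) simp
   then show ?thesis by (simp add: mult.assoc distrib_right)
  qed
  then have "(\<integral>\<^sup>+x. ennreal (s * y powr (s - 1)) * (c x * a x) \<partial>M) <= 
    (\<integral>\<^sup>+x. ennpowr (c x) s * a x + ennreal ((s - 1) * y powr s) * a x \<partial>M)"
   by (intro nn_integral_mono) auto
  then show ?thesis
   unfolding I_def X_def A_def by (simp add: nn_integral_cmult nn_integral_add)
 qed
 have I0: "I = 0" if "X = 0"
 proof -
  have "AE x in M. ennpowr (c x) s * a x = 0"
   using that unfolding X_def by (subst (asm) nn_integral_0_iff_AE) auto
  then show ?thesis unfolding I_def by (subst nn_integral_0_iff_AE) auto
 qed
 \<comment> \<open>For s = 1 the conventions matter: \<open>ennpowr top 0\<close> is
   \<open>top\<close> and \<open>ennpowr 0 0\<close> is 0. If I is nonzero then so is X, and the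
   right side is infinite in the degenerate cases split off first.\<close>
 have "ennpowr I s <= ennpowr A (s - 1) * X"
 proof (cases "I = 0 \<or> X = top \<and> A ~= 0 \<or> A = top")
  case True
  then show ?thesis using I0 by (cases "I = 0") (auto simp: ennreal_mult_top ennreal_top_mult)
 next
  case False
  then have "I ~= 0" by auto
  have "A ~= 0"
  proof
   assume "A = 0"
   then have "AE x in M. a x = 0" unfolding A_def by (subst (asm) nn_integral_0_iff_AE) auto
   then have "I = 0" unfolding I_def by (subst nn_integral_0_iff_AE) auto
   then show False using \<open>I ~= 0\<close> by simp
  qed
  with False obtain A' X' where A': "A = ennreal A'" "A' > 0" and X': "X = ennreal X'" "X' >= 0"
   by (metis ennreal_cases ennreal_eq_0_iff less_le_not_le linorder_le_cases)
  have "I ~= top"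
   using tan[of 1] s A'(2) X'(2) by (auto simp: A'(1) X'(1) ennreal_mult_eq_top_iff ennreal_mult_top ennreal_mult[symmetric] ennreal_plus[symmetric] top_unique simp del: ennreal_plus)
  with \<open>I ~= 0\<close> obtain I' where I': "I = ennreal I'" "I' > 0"
   by (metis ennreal_cases ennreal_eq_0_iff less_le_not_le linorder_le_cases)
  \<comment> \<open>The weighted mean of \<open>c\<close>, the point at which the integrated tangent
    inequality is sharpest.\<close>
  define y where "y = I' / A'"
  have y: "y > 0" using I' A' by (simp add: y_def)
  have "ennreal (s * y powr (s - 1) * I') <= ennreal (X' + (s - 1) * y powr s * A')"
   using tan[OF y] s A' X' I' y by (simp add: ennreal_mult ennreal_plus)
  then have "s * y powr (s - 1) * I' <= X' + (s - 1) * y powr s * A'"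
   using s A' X' I' by (subst (asm) ennreal_le_iff) auto
  moreover
  have "y powr (s - 1) * I' = y powr s * A'"
   using I' A' y by (simp add: powr_diff y_def)
  then have "s * y powr (s - 1) * I' = s * (y powr s * A')" by simp
  ultimately have "y powr s * A' <= X'"
   by (simp only: left_diff_distrib mult.assoc)
  moreover have "I' powr s = A' powr (s - 1) * (y powr s * A')"
   using I' A' by (simp add: y_def powr_divide powr_diff)
  ultimately have "I' powr s <= A' powr (s - 1) * X'"
   by (simp add: mult_left_mono)
  then show ?thesis
   using A' I' X' by (simp add: ennpowr_ennreal ennreal_mult[symmetric] ennreal_leI)
 qed
 then show ?thesis unfolding A_def I_def X_def .
qed

lemma ennreal_ge_1_real:
 fixes p :: ennreal
 assumes "1 <= p" "p ~= infy"
 shows "1 <= enn2real p" "p = ennreal (enn2real p)"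
 using assms by (cases p; auto simp: ennreal_ge_1)+

lemma Lp_enorm_eq_power:
 assumes "1 <= p" "p ~= infy"
 shows "ennpowr (Lp_enorm p M u) (enn2real p) = (\<integral>\<^sup>+x. ennpowr (u x) (enn2real p) \<partial>M)"
 using ennreal_ge_1_real[OF assms] assms by (simp add: Lp_enorm_def)

text \<open>Treats p = infinity and finite p uniformly; for finite p the bound is checked after
  raising to the power p, so later proofs never handle roots.\<close>

lemma Lp_enorm_leI:
 assumes "1 <= p" "u : borel_measurable M"
  and "p = infy ==> AE x in M. u x <= C"
  and "p ~= infy ==> (\<integral>\<^sup>+x. ennpowr (u x) (enn2real p) \<partial>M) <= ennpowr C (enn2real p)"
 shows "Lp_enorm p M u <= C"
proof (cases "p = infy")
 case True
 then show ?thesis using assms by (auto simp: Lp_enorm_def)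
next
 case False
 then have "enn2real p > 0" using ennreal_ge_1_real[OF assms(1)] by simp
 then show ?thesis
  using assms(4)[OF False] ennpowr_le_iff[of "enn2real p" "Lp_enorm p M u" C]
  by (simp add: Lp_enorm_eq_power[OF assms(1) False])
qed

lemma Lp_enorm_top_AE: "AE x in M. u x <= Lp_enorm infy M u"
 using esssup_AE[of u M] by (simp add: Lp_enorm_def)

lemma Lp_enorm_AE_mono:
 assumes "1 <= p" "u : borel_measurable M" "AE x in M. u x <= v x"
 shows "Lp_enorm p M u <= Lp_enorm p M v"
proof (rule Lp_enorm_leI)
 assume "p = infy"
 then show "AE x in M. u x <= Lp_enorm p M v"
  using assms(3) Lp_enorm_top_AE[of v M] by auto
next
 assume p: "p ~= infy"
 then show "(\<integral>\<^sup>+x. ennpowr (u x) (enn2real p) \<partial>M) <= ennpowr (Lp_enorm p M v) (enn2real p)"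
  unfolding Lp_enorm_eq_power[OF assms(1) p]
  using assms(3) by (intro nn_integral_mono_AE) (auto elim!: eventually_mono intro: ennpowr_mono)
qed fact+

lemma Lp_enorm_AE_cong:
 assumes "1 <= p" "u : borel_measurable M" "v : borel_measurable M" "AE x in M. u x = v x"
 shows "Lp_enorm p M u = Lp_enorm p M v"
 using assms by (intro antisym Lp_enorm_AE_mono) auto

lemma Lp_enorm_cmult_le:
 assumes "1 <= p" "u : borel_measurable M"
 shows "Lp_enorm p M (%x. c * u x) <= c * Lp_enorm p M u"
proof (rule Lp_enorm_leI)
 assume "p = infy"
 then show "AE x in M. c * u x <= c * Lp_enorm p M u"
  using Lp_enorm_top_AE[of u M] by (auto elim!: eventually_mono intro: mult_left_mono)
next
 assume p: "p ~= infy"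
 then show "(\<integral>\<^sup>+x. ennpowr (c * u x) (enn2real p) \<partial>M) <= ennpowr (c * Lp_enorm p M u) (enn2real p)"
  using assms by (simp add: Lp_enorm_eq_power[OF assms(1) p] ennpowr_mult nn_integral_cmult)
qed (use assms in auto)

text \<open>A triangle inequality with constant 4 instead of 1, from (u+v)^P <= 2^P (u^P + v^P) and
  a^P + b^P <= 2^P (a+b)^P. The factor is harmless because the constants of the final estimates are
  unspecified.\<close>

lemma Lp_enorm_add_le:
 assumes "1 <= p" and [measurable]: "u : borel_measurable M" "v : borel_measurable M"
 shows "Lp_enorm p M (%x. u x + v x) <= 4 * (Lp_enorm p M u + Lp_enorm p M v)"
proof (rule Lp_enorm_leI)
 assume p: "p = infy"
 have "AE x in M. u x + v x <= Lp_enorm p M u + Lp_enorm p M v"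
  using Lp_enorm_top_AE[of u M] Lp_enorm_top_AE[of v M] by (auto intro: add_mono simp: p)
 moreover have "Lp_enorm p M u + Lp_enorm p M v <= 4 * (Lp_enorm p M u + Lp_enorm p M v)"
  using mult_right_mono[of 1 4 "Lp_enorm p M u + Lp_enorm p M v"] by simp
 ultimately show "AE x in M. u x + v x <= 4 * (Lp_enorm p M u + Lp_enorm p M v)"
  by (auto elim: order_trans)
next
 assume p: "p ~= infy"
 define P where "P = enn2real p"
 define a where "a = Lp_enorm p M u"
 define b where "b = Lp_enorm p M v"
 have P: "P >= 1" using ennreal_ge_1_real[OF assms(1) p] by (simp add: P_def)
 have "(\<integral>\<^sup>+x. ennpowr (u x + v x) P \<partial>M) <= (\<integral>\<^sup>+x. ennreal (2 powr P) * (ennpowr (u x) P + ennpowr (v x) P) \<partial>M)"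
  using P by (intro nn_integral_mono ennpowr_sum_le) auto
 also have "... = ennreal (2 powr P) * (ennpowr a P + ennpowr b P)"
  using Lp_enorm_eq_power[OF assms(1) p, of M] by (simp add: nn_integral_cmult nn_integral_add a_def b_def P_def)
 also have "... <= ennreal (2 powr P) * (ennreal (2 powr P) * ennpowr (a + b) P)"
 proof (rule mult_left_mono)
  have "ennpowr a P + ennpowr b P <= ennreal 2 * ennpowr (a + b) P"
   using P by (auto simp: mult_2 intro!: add_mono ennpowr_mono)
  also have "... <= ennreal (2 powr P) * ennpowr (a + b) P"
   using P powr_mono[of 1 P 2] by (intro mult_right_mono ennreal_leI) auto
  finally show "ennpowr a P + ennpowr b P <= ennreal (2 powr P) * ennpowr (a + b) P" .
 qed simp
 also have "... = ennpowr (4 * (a + b)) P"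
  using powr_mult[of 2 2 P] ennpowr_ennreal[of 4 P] by (simp add: ennpowr_mult mult.assoc[symmetric] ennreal_mult[symmetric] del: distrib_left_numeral)
 finally show "(\<integral>\<^sup>+x. ennpowr (u x + v x) (enn2real p) \<partial>M) <= ennpowr (4 * (Lp_enorm p M u + Lp_enorm p M v)) (enn2real p)"
  by (simp add: P_def a_def b_def)
qed (use assms in auto)

lemma Lp_enorm_eq_0_AE:
 assumes "1 <= p" "u : borel_measurable M" "Lp_enorm p M u = 0"
 shows "AE x in M. u x = 0"
proof (cases "p = infy")
 case True
 then show ?thesis using Lp_enorm_top_AE[of u M] assms by simp
next
 case False
 then have "(\<integral>\<^sup>+x. ennpowr (u x) (enn2real p) \<partial>M) = 0"
  using Lp_enorm_eq_power[OF assms(1), of M u] assms(3) by simp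
 then show ?thesis using assms(2) by (subst (asm) nn_integral_0_iff_AE) auto
qed

lemma Lp_enorm_completion:
 assumes "1 <= p" "u : borel_measurable M"
 shows "Lp_enorm p (completion M) u = Lp_enorm p M u"
proof (rule antisym)
 have [measurable]: "u : borel_measurable (completion M)"
  using assms(2) by (rule measurable_completion)
 have *: "(\<integral>\<^sup>+x. ennpowr (u x) r \<partial>completion M) = (\<integral>\<^sup>+x. ennpowr (u x) r \<partial>M)" for r
  using assms(2) by (subst nn_integral_completion) auto
 show "Lp_enorm p (completion M) u <= Lp_enorm p M u"
  using AE_completion[OF Lp_enorm_top_AE[of u M]]
  by (intro Lp_enorm_leI) (auto simp: assms(1) * Lp_enorm_eq_power)
 show "Lp_enorm p M u <= Lp_enorm p (completion M) u"
  using Lp_enorm_top_AE[of u "completion M"] assms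
  by (intro Lp_enorm_leI) (auto simp: assms(1) *[symmetric] Lp_enorm_eq_power AE_completion_iff)
qed

section \<open>The integer lattice and sums over it\<close>

lemma countable_int_lattice: "countable (int_lattice :: (real^'d::finite) set)"
proof -
 have "(int_lattice :: (real^'d) set) \<subseteq> range (%f::'d => int. \<chi> i. of_int (f i))"
 proof
  fix k :: "real^'d" assume "k : int_lattice"
  then have "k = (\<chi> i. of_int \<lfloor>k $ i\<rfloor>)"
   by (auto simp: int_lattice_def vec_eq_iff floor_of_int elim!: Ints_cases)
  then show "k : range (%f::'d => int. \<chi> i. of_int (f i))"
   by (rule range_eqI[where x = "%i. \<lfloor>k $ i\<rfloor>"])
 qed
 then show ?thesis by (rule countable_subset) simp
qed

lemma int_lattice_intros [simp, intro]:
 "0 : int_lattice"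
 "k : int_lattice ==> l : int_lattice ==> k + l : int_lattice"
 "k : int_lattice ==> l : int_lattice ==> k - l : int_lattice"
 "k : int_lattice ==> - k : int_lattice"
 by (auto simp: int_lattice_def)

lemma inner_int_lattice: "k : int_lattice ==> l : int_lattice ==> k \<bullet> l : \<int>"
 unfolding inner_vec_def by (intro Ints_sum) (auto simp: int_lattice_def)

lemma axis_in_int_lattice [simp]: "axis i 1 : int_lattice"
 by (auto simp: int_lattice_def axis_def)

lemma bij_betw_lattice_minus: "bij_betw uminus int_lattice (int_lattice :: (real^'d) set)"
 by (rule bij_betwI[of _ _ _ uminus]) auto

lemma bij_betw_lattice_plus: "k : int_lattice ==> bij_betw (%l. l + k) int_lattice (int_lattice :: (real^'d) set)"
 by (rule bij_betwI[of _ _ _ "%l. l - k"]) auto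

abbreviation latm :: "(real^'d::finite) measure" where "latm \<equiv> count_space int_lattice"

abbreviation (input) nn_latm :: "(real^'d::finite => ennreal) => ennreal" (binder \<open>SUML \<close> 10)
 where "nn_latm \<equiv> integral\<^sup>N latm"

lemma sigma_finite_latm: "sigma_finite_measure (latm :: (real^'d::finite) measure)"
 by (rule sigma_finite_measure_count_space_countable[OF countable_int_lattice])

lemma measurable_latm_pair:
 assumes "!!k. k : int_lattice ==> (%x. F x k) : measurable M N"
 shows "(%(x, k). F x k) : measurable (M \<Otimes>\<^sub>M latm) N"
proof -
 have "(%(k, x). F x k) : measurable (latm \<Otimes>\<^sub>M M) N"
  using assms by (intro measurable_pair_measure_countable1 countable_int_lattice) auto
 then have "(%(k, x). F x k) \<circ> (%(x, k). (k, x)) : measurable (M \<Otimes>\<^sub>M latm) N"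
  by (rule measurable_comp[rotated]) (rule measurable_pair_swap')
 then show ?thesis by (simp add: comp_def split_beta')
qed

lemma borel_measurable_nn_integral_latm:
 assumes "!!k. k : int_lattice ==> F k : borel_measurable M"
 shows "(%x. SUML k. F k x) : borel_measurable M"
 by (rule sigma_finite_measure.borel_measurable_nn_integral[OF sigma_finite_latm, where f = "%x k. F k x"])
   (rule measurable_latm_pair[OF assms])

lemma borel_measurable_LINT_latm:
 fixes F :: "real^'d::finite => 'a => complex"
 assumes "!!k. k : int_lattice ==> F k : borel_measurable M"
 shows "(%x. LINT k|latm. F k x) : borel_measurable M"
 by (rule sigma_finite_measure.borel_measurable_lebesgue_integral[OF sigma_finite_latm, where f = "%x k. F k x"])
   (rule measurable_latm_pair[OF assms])

lemma nn_integral_latm_swap: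
 assumes "!!k. k : int_lattice ==> F k : borel_measurable M"
 shows "(\<integral>\<^sup>+x. (SUML k. F k x) \<partial>M) = (SUML k. \<integral>\<^sup>+x. F k x \<partial>M)"
 using assms by (intro nn_integral_count_space_nn_integral countable_int_lattice)

lemma nn_integral_latm_shift:
 assumes "k : int_lattice"
 shows "(SUML l. F (l + k)) = (SUML l. F l)"
 by (rule nn_integral_bij_count_space[OF bij_betw_lattice_plus[OF assms]])

lemma nn_integral_latm_minus: "(SUML l. F (- l)) = (SUML l. F l)"
 by (rule nn_integral_bij_count_space[OF bij_betw_lattice_minus])

lemma LINT_latm_shift:
 fixes F :: "real^'d::finite => complex"
 assumes "k : int_lattice"
 shows "(LINT l|latm. F (l + k)) = (LINT l|latm. F l)"
 by (rule integral_bij_count_space[OF bij_betw_lattice_plus[OF assms]])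

text \<open>A simple function below F with finite support is bounded by a finite partial sum of F.
  One with infinite support takes some nonzero value infinitely often, and then the finite partial
  sums of F are unbounded.\<close>

lemma nn_integral_latm_eq_infsum:
 "(\<integral>\<^sup>+k. F k \<partial>count_space A) = infsum F A" for F :: "_ => ennreal"
proof -
 have "infsum F A = (SUP X\<in>{X. finite X \<and> X \<subseteq> A}. sum F X)"
  by (rule nonneg_infsum_complete) auto
 also have "... = (\<integral>\<^sup>+k. F k \<partial>count_space A)"
 proof (rule antisym)
  show "(SUP X\<in>{X. finite X \<and> X \<subseteq> A}. sum F X) <= (\<integral>\<^sup>+k. F k \<partial>count_space A)"
  proof (rule SUP_least)
   fix X assume "X : {X. finite X \<and> X \<subseteq> A}"
   then have "sum F X = (\<integral>\<^sup>+k. F k * indicator X k \<partial>count_space A)"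
    by (subst nn_integral_indicator_finite) (auto intro!: sum.cong simp: subset_eq)
   also have "... <= (\<integral>\<^sup>+k. F k \<partial>count_space A)"
    by (intro nn_integral_mono) (auto simp: indicator_def)
   finally show "sum F X <= (\<integral>\<^sup>+k. F k \<partial>count_space A)" .
  qed
  show "(\<integral>\<^sup>+k. F k \<partial>count_space A) <= (SUP X\<in>{X. finite X \<and> X \<subseteq> A}. sum F X)"
   unfolding nn_integral_def
  proof (rule SUP_least)
   fix g assume "g : {g. simple_function (count_space A) g \<and> g <= F}"
   then have g: "simple_function (count_space A) g" "g <= F" by auto
   show "integral\<^sup>S (count_space A) g <= (SUP X\<in>{X. finite X \<and> X \<subseteq> A}. sum F X)" (is "_ <= ?S")
   proof (cases "finite {x\<in>A. g x ~= 0}")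
    case True
    have "integral\<^sup>S (count_space A) g = (\<integral>\<^sup>+k. g k \<partial>count_space A)"
     using g by (simp add: nn_integral_eq_simple_integral)
    also have "... = sum g {x\<in>A. g x ~= 0}"
     using True by (simp add: nn_integral_count_space zero_less_iff_neq_zero)
    also have "... <= sum F {x\<in>A. g x ~= 0}"
     using g by (intro sum_mono) (auto simp: le_fun_def)
    also have "... <= ?S" using True by (intro SUP_upper) auto
    finally show ?thesis .
   next
    case False
    have "finite (g ` A)" using g by (auto simp: simple_function_def)
    then obtain y where y: "y ~= 0" "infinite {x\<in>A. g x = y}"
    proof -
     have "{x\<in>A. g x ~= 0} = (\<Union>y\<in>g ` A - {0}. {x\<in>A. g x = y})" by auto
     moreover have "finite (\<Union>y\<in>g ` A - {0}. {x\<in>A. g x = y})" if "\<forall>y\<in>g ` A - {0}. finite {x\<in>A. g x = y}"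
      using that \<open>finite (g ` A)\<close> by (intro finite_UN_I) blast+
     ultimately have "\<exists>y\<in>g ` A - {0}. infinite {x\<in>A. g x = y}"
      using False by metis
     then show ?thesis using that by auto
    qed
    have "?S = top"
    proof (rule ccontr)
     assume "?S ~= top"
     obtain r where r: "r > 0" "ennreal r <= y"
     proof (cases y)
      case (real t)
      then show ?thesis using that[of t] y(1) by (auto simp: less_le)
     next
      case top
      then show ?thesis using that[of 1] by simp
     qed
     obtain s where s: "s >= 0" "?S = ennreal s" using \<open>?S ~= top\<close> by (cases ?S) auto
     obtain n :: nat where n: "real n * r > s" using r(1) reals_Archimedean3[of r] by blast
     obtain X where X: "finite X" "card X = n" "X \<subseteq> {x\<in>A. g x = y}"
      using y(2) infinite_arbitrarily_large by blast
     have "ennreal (real n * r) = (\<Sum>x\<in>X. ennreal r)"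
      using r X by (simp add: ennreal_mult ennreal_of_nat_eq_real_of_nat)
     also have "... <= sum F X"
      using X r(2) g(2) by (intro sum_mono) (auto simp: le_fun_def intro: order_trans)
     also have "... <= ?S" using X by (intro SUP_upper) auto
     finally show False using n s by simp
    qed
    then show ?thesis by (simp only: top_greatest)
   qed
  qed
 qed
 finally show ?thesis by simp
qed

section \<open>The unit cell and periodization\<close>

definition unit_cell :: "(real^'d) set" where
 "unit_cell = {x. \<forall>i. - 1/2 < x $ i \<and> x $ i <= 1/2}"

text \<open>The half-open cell is used because its lattice translates tile the space without
  overlap, unlike those of the closed \<open>torus\<close>. A density on \<open>lborel\<close>
  instead of a restriction keeps all Borel sets of the space measurable, so functions on the whole
  space can be integrated directly.\<close>

definition tor :: "(real^'d::finite) measure" where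
 "tor = density lborel (indicator unit_cell)"

abbreviation (input) nn_tor :: "(real^'d::finite => ennreal) => ennreal" (binder \<open>INTT \<close> 10)
 where "nn_tor \<equiv> integral\<^sup>N tor"

abbreviation (input) "Lt q \<equiv> Lp_enorm (ennreal q) tor"

lemma unit_cell_borel [measurable]: "(unit_cell :: (real^'d::finite) set) : sets borel"
 unfolding unit_cell_def by measurable

lemma sets_tor [measurable_cong, simp]: "sets tor = sets borel"
 by (simp add: tor_def)

lemma space_tor [simp]: "space tor = UNIV"
 by (simp add: tor_def)

lemma AE_tor_iff: "(AE x in tor. P x) \<longleftrightarrow> (AE x in lborel. x : unit_cell --> P x)"
 unfolding tor_def by (subst AE_density) (auto simp: indicator_def)

lemma AE_tor: "AE x in lborel. P x ==> AE x in tor. P x"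
 by (auto simp: AE_tor_iff)

lemma emeasure_unit_cell: "emeasure lborel (unit_cell :: (real^'d::finite) set) = 1"
proof (rule antisym)
 let ?a = "(\<chi> i. - 1/2) :: real^'d" and ?b = "(\<chi> i. 1/2) :: real^'d"
 have *: "(\<Prod>b\<in>Basis. (?b - ?a) \<bullet> b) = 1"
  by (intro prod.neutral) (auto simp: Basis_vec_def inner_axis)
 have le: "\<forall>b\<in>Basis. ?a \<bullet> b <= ?b \<bullet> b" by (auto simp: Basis_vec_def inner_axis)
 have "emeasure lborel (unit_cell :: (real^'d) set) <= emeasure lborel (cbox ?a ?b)"
  by (intro emeasure_mono) (auto simp: unit_cell_def mem_box_cart less_imp_le)
 also have "... = 1" using le * by (simp add: emeasure_lborel_cbox_eq)
 finally show "emeasure lborel (unit_cell :: (real^'d) set) <= 1" .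
 have "1 = emeasure lborel (box ?a ?b)" using le * by (simp add: emeasure_lborel_box_eq)
 also have "... <= emeasure lborel (unit_cell :: (real^'d) set)"
  by (intro emeasure_mono) (auto simp: unit_cell_def mem_box_cart less_imp_le)
 finally show "1 <= emeasure lborel (unit_cell :: (real^'d) set)" .
qed

lemma prob_space_tor: "prob_space (tor :: (real^'d::finite) measure)"
 by (rule prob_spaceI) (simp add: tor_def emeasure_density emeasure_unit_cell)

lemma ex1_lattice_unit_cell: "\<exists>!k. k : int_lattice \<and> x - k : unit_cell"
proof (rule ex1I)
 let ?k = "\<chi> i. of_int \<lceil>x $ i - 1/2\<rceil>"
 show "?k : int_lattice \<and> x - ?k : unit_cell"
 proof
  show "?k : int_lattice" by (auto simp: int_lattice_def)
  have "- 1/2 < x $ i - of_int \<lceil>x $ i - 1/2\<rceil> \<and> x $ i - of_int \<lceil>x $ i - 1/2\<rceil> <= 1/2" for i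
   by linarith
  then show "x - ?k : unit_cell" by (simp add: unit_cell_def)
 qed
 fix k assume k: "k : int_lattice \<and> x - k : unit_cell"
 have "k $ i = of_int \<lceil>x $ i - 1/2\<rceil>" for i
 proof -
  obtain n where n: "k $ i = of_int n" using k by (auto simp: int_lattice_def Ints_def)
  have "- 1/2 < x $ i - k $ i" "x $ i - k $ i <= 1/2" using k by (auto simp: unit_cell_def)
  then have "\<lceil>x $ i - 1/2\<rceil> = n" unfolding n by (intro ceiling_unique) auto
  then show ?thesis by (simp add: n)
 qed
 then show "k = ?k" by (simp add: vec_eq_iff)
qed

lemma indicator_unit_cell_lattice:
 "\<exists>k0\<in>int_lattice. \<forall>k\<in>int_lattice. indicator unit_cell (x - k) = (indicator {k0} k :: 'a :: zero_neq_one)"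
 using ex1_lattice_unit_cell[of x] by (fastforce simp: indicator_def)

lemma nn_integral_latm_unit_cell:
 "(SUML k. c * indicator unit_cell (x - k)) = c"
proof -
 obtain k0 where k0: "k0 : int_lattice" "!!k. k : int_lattice ==> indicator unit_cell (x - k) = (indicator {k0} k :: ennreal)"
  using indicator_unit_cell_lattice[of x] by blast
 have "(SUML k. c * indicator unit_cell (x - k)) = (SUML k. c * indicator {k0} k)"
  by (intro nn_integral_cong) (simp add: k0)
 also have "... = c" using k0(1) by (subst nn_integral_indicator_finite) auto
 finally show ?thesis .
qed

lemma nn_integral_lborel_shift:
 fixes F :: "real^'d::finite => ennreal"
 assumes [measurable]: "F : bm"
 shows "(INTR x. F (x + a)) = (INTR x. F x)"
proof -
 have "(INTR x. F x) = (\<integral>\<^sup>+x. F x \<partial>distr lborel borel ((+) a))"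
  by (simp add: lborel_distr_plus)
 also have "... = (INTR x. F (x + a))"
  by (subst nn_integral_distr) (auto simp: add.commute)
 finally show ?thesis by simp
qed

lemma nn_integral_tor: 
 assumes "F : bm"
 shows "(INTT x. F x) = (INTR x. F x * indicator unit_cell x)"
 unfolding tor_def using assms by (subst nn_integral_density) (auto simp: mult.commute)

text \<open>Insert the partition of unity formed by the translates of the cell, exchange sum and
  integral, and translate each term back.\<close>

lemma nn_integral_periodize:
 fixes F :: "real^'d::finite => ennreal"
 assumes [measurable]: "F : bm"
 shows "(INTT x. (SUML k. F (x + k))) = (INTR x. F x)"
proof -
 have "(INTR x. F x) = (INTR x. (SUML k. F x * indicator unit_cell (x - k)))"
  by (simp add: nn_integral_latm_unit_cell)
 also have "... = (SUML k. (INTR x. F x * indicator unit_cell (x - k)))"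
  by (rule nn_integral_latm_swap[where F = "%k x. F x * indicator unit_cell (x - k)"]) measurable
 also have "... = (SUML k. (INTR x. F (x + k) * indicator unit_cell x))"
 proof (rule nn_integral_cong)
  fix k :: "real^'d"
  show "(INTR x. F x * indicator unit_cell (x - k)) = (INTR x. F (x + k) * indicator unit_cell x)"
   using nn_integral_lborel_shift[of "%x. F x * indicator unit_cell (x - k)" k] by simp
 qed
 also have "... = (SUML k. (INTT x. F (x + k)))"
  by (subst nn_integral_tor) auto
 also have "... = (INTT x. (SUML k. F (x + k)))"
  by (rule nn_integral_latm_swap[where F = "%k x. F (x + k)", symmetric]) measurable
 finally show ?thesis by simp
qed

lemma measurable_plus_tor_latm [measurable]:
 "(%(x, k). x + k) : borel_measurable (tor \<Otimes>\<^sub>M latm)"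
 by (rule measurable_latm_pair) measurable

text \<open>Periodization as an identity of measures: integrability and Fubini for complex functions
  then come from the product measure.\<close>

lemma distr_tor_latm:
 "distr (tor \<Otimes>\<^sub>M latm) borel (%(x, k). x + k) = (lborel :: (real^'d::finite) measure)"
proof (rule measure_eqI)
 fix X :: "(real^'d) set" assume "X : sets (distr (tor \<Otimes>\<^sub>M latm) borel (%(x, k). x + k))"
 then have [measurable]: "X : sets borel" by simp
 have [measurable]: "(%(x, k). indicator X (x + k) :: ennreal) : borel_measurable (tor \<Otimes>\<^sub>M latm)"
  by (rule measurable_latm_pair) measurable
 have "emeasure (distr (tor \<Otimes>\<^sub>M latm) borel (%(x, k). x + k)) X = (\<integral>\<^sup>+z. (case z of (x, k) => indicator X (x + k)) \<partial>(tor \<Otimes>\<^sub>M latm))"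
  by (subst nn_integral_indicator[symmetric], simp, subst nn_integral_distr) (auto simp: split_beta')
 also have "... = (INTT x. (SUML k. indicator X (x + k)))"
  by (subst sigma_finite_measure.nn_integral_fst[OF sigma_finite_latm, symmetric]) auto
 also have "... = emeasure lborel X"
  by (subst nn_integral_periodize) auto
 finally show "emeasure (distr (tor \<Otimes>\<^sub>M latm) borel (%(x, k). x + k)) X = emeasure lborel X" .
qed simp

lemma integral_periodize:
 fixes F :: "real^'d::finite => complex"
 assumes F: "integrable lborel F"
 shows "integrable (tor \<Otimes>\<^sub>M latm) (%(x, k). F (x + k))"
  and "AE x in tor. integrable latm (%k. F (x + k))"
  and "integrable tor (%x. LINT k|latm. F (x + k))"
  and "(LINT x|tor. LINT k|latm. F (x + k)) = (LINT x|lborel. F x)"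
proof -
 have [measurable]: "F : bm" using F by simp
 interpret latm: sigma_finite_measure "latm :: (real^'d) measure" by (rule sigma_finite_latm)
 interpret tor: prob_space "tor :: (real^'d) measure" by (rule prob_space_tor)
 interpret pair_sigma_finite "tor :: (real^'d) measure" "latm :: (real^'d) measure" ..
 show i: "integrable (tor \<Otimes>\<^sub>M latm) (%(x, k). F (x + k))"
  using F integrable_distr_eq[of "%(x, k). x + k" "tor \<Otimes>\<^sub>M latm" borel F]
  by (simp add: distr_tor_latm[unfolded split_beta'] split_beta')
 show "AE x in tor. integrable latm (%k. F (x + k))"
  using AE_integrable_fst'[OF i] by simp
 show "integrable tor (%x. LINT k|latm. F (x + k))"
  using integrable_fst'[OF i] by simp
 show "(LINT x|tor. LINT k|latm. F (x + k)) = (LINT x|lborel. F x)"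
  using integral_fst'[OF i] integral_distr[of "%(x, k). x + k" "tor \<Otimes>\<^sub>M latm" borel F]
  by (simp add: distr_tor_latm[unfolded split_beta'] split_beta')
qed

text \<open>The integral over a translated cell is unfolded to the whole space and folded back along
  the original cell, where periodicity takes F out and the translates of the indicator sum to
  1.\<close>

lemma nn_integral_tor_shift:
 assumes [measurable]: "F : bm" and per: "!!x k. k : int_lattice ==> F (x + k) = F x"
 shows "(INTT x. F (x + a)) = (INTT x. F x)"
proof -
 have "(INTT x. F (x + a)) = (INTR x. F (x + a) * indicator unit_cell x)"
  by (subst nn_integral_tor) auto
 also have "... = (INTR x. F x * indicator unit_cell (x - a))"
  using nn_integral_lborel_shift[of "%x. F x * indicator unit_cell (x - a)" a] by simp
 also have "... = (INTT x. (SUML k. F (x + k) * indicator unit_cell (x + k - a)))"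
  by (subst nn_integral_periodize) auto
 also have "... = (INTT x. (SUML k. F x * indicator unit_cell (x + k - a)))"
  by (intro nn_integral_cong) (simp add: per)
 also have "... = (INTT x. F x)"
 proof (rule nn_integral_cong)
  fix x
  show "(SUML k. F x * indicator unit_cell (x + k - a)) = F x"
   using nn_integral_latm_minus[of "%k. F x * indicator unit_cell (x - k - a)"]
    nn_integral_latm_unit_cell[of "F x" "x - a"] by (simp add: algebra_simps)
 qed
 finally show ?thesis .
qed

lemma AE_lborel_shift:
 fixes P :: "real^'d::finite => bool"
 assumes "AE x in lborel. P x"
 shows "AE x in lborel. P (x + a)"
proof -
 have "AE x in distr lborel borel ((+) a). P x"
  unfolding lborel_distr_plus by (rule assms)
 then have "AE x in lborel. P (a + x)" by (rule AE_distrD[rotated]) measurable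
 then show ?thesis by (simp add: add.commute)
qed

lemma AE_tor_lattice_iff:
 fixes P :: "real^'d::finite => bool"
 shows "(AE x in lborel. P x) \<longleftrightarrow> (AE x in tor. \<forall>k\<in>int_lattice. P (x + k))"
proof
 assume P: "AE x in lborel. P x"
 have "AE x in lborel. \<forall>k\<in>int_lattice. P (x + k)"
  using AE_lborel_shift[OF P] by (subst AE_ball_countable[OF countable_int_lattice]) blast
 then show "AE x in tor. \<forall>k\<in>int_lattice. P (x + k)" by (rule AE_tor)
next
 assume "AE x in tor. \<forall>k\<in>int_lattice. P (x + k)"
 then have *: "AE x in lborel. x : unit_cell --> (\<forall>k\<in>int_lattice. P (x + k))"
  by (simp add: AE_tor_iff)
 have "AE x in lborel. \<forall>k\<in>int_lattice. x + (- k) : unit_cell --> (\<forall>l\<in>int_lattice. P (x + (- k) + l))"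
  using AE_lborel_shift[OF *] by (subst AE_ball_countable[OF countable_int_lattice]) blast
 then show "AE x in lborel. P x"
 proof eventually_elim
  case (elim x)
  obtain k where k: "k : int_lattice" "x - k : unit_cell" using ex1_lattice_unit_cell[of x] by blast
  have "P (x + (- k) + k)" using elim k by (metis add_uminus_conv_diff)
  then show ?case by simp
 qed
qed

lemma borel_measurable_cnj [measurable (raw)]:
 "f : borel_measurable M ==> (%x. cnj (f x)) : borel_measurable M"
 by (rule borel_measurable_continuous_on[of cnj]) (intro continuous_intros)

section \<open>Characters, orthogonality and Bessel's inequality\<close>

definition character :: "real^'d::finite => real^'d => complex" where
 "character k x = cis (2 * pi * (k \<bullet> x))"

text \<open>\<open>G\<close> need not be periodic, since only its values on the cell enter. In
  \<open>error_fiber\<close> the integrand is in fact not periodic, but supported in the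
  cell.\<close>

definition fcoeff :: "(real^'d::finite => complex) => real^'d => complex" where
 "fcoeff G k = (LINT x|tor. G x * cnj (character k x))"

lemma norm_character [simp]: "cmod (character k x) = 1"
 by (simp add: character_def)

lemma character_nonzero [simp]: "character k x ~= 0"
 using norm_character[of k x] by (metis norm_zero zero_neq_one)

lemma character_simps:
 "character (k + l) x = character k x * character l x"
 "character k (x + y) = character k x * character k y"
 "character k (- x) = cnj (character k x)"
 "character (- k) x = cnj (character k x)"
 "character k 0 = 1" "character 0 x = 1"
 by (simp_all add: character_def inner_add_left inner_add_right distrib_left cis_mult cis_cnj)

lemma character_commute: "character k x = character x k"
 by (simp add: character_def inner_commute)

lemma character_cnj_mult [simp]: "character k x * cnj (character k x) = 1"
 by (simp add: complex_norm_square[symmetric])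

lemma character_lattice [simp]:
 "k : int_lattice ==> l : int_lattice ==> character k l = 1"
 using inner_int_lattice[of k l] by (auto simp: character_def elim!: Ints_cases)

lemma borel_measurable_character [measurable]: "character k : bm"
 unfolding character_def cis_conv_exp by measurable

lemma integrable_mult_character [simp]:
 assumes "integrable M G" "sets M = sets borel"
 shows "integrable M (%x. G x * character k x)" "integrable M (%x. G x * cnj (character k x))"
proof -
 have [measurable_cong]: "sets M = sets borel" by fact
 have [measurable]: "G : borel_measurable M" using assms by simp
 show "integrable M (%x. G x * character k x)"
  by (rule Bochner_Integration.integrable_bound[OF assms(1)]) (auto simp: norm_mult)
 show "integrable M (%x. G x * cnj (character k x))"
  by (rule Bochner_Integration.integrable_bound[OF assms(1)]) (auto simp: norm_mult)
qed

lemma integrable_character [simp]: "integrable tor (character k)" "integrable tor (%x. cnj (character k x))"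
proof -
 interpret prob_space "tor :: (real^'a) measure" by (rule prob_space_tor)
 show "integrable tor (character k)" "integrable tor (%x. cnj (character k x))"
  by (rule integrable_const_bound[where B = 1]; simp)+
qed

lemma LINT_lborel_shift:
 fixes F :: "real^'d::finite => complex"
 assumes [measurable]: "F : bm"
 shows "(LINT x|lborel. F (x + a)) = (LINT x|lborel. F x)"
proof -
 have "(LINT x|lborel. F x) = (LINT x|distr lborel borel ((+) a). F x)"
  by (simp add: lborel_distr_plus)
 also have "... = (LINT x|lborel. F (x + a))"
  by (subst integral_distr) (auto simp: add.commute)
 finally show ?thesis by simp
qed

lemma LINT_tor:
 fixes F :: "real^'d::finite => complex"
 assumes [measurable]: "F : bm"
 shows "(LINT x|tor. F x) = (LINT x|lborel. indicator unit_cell x *\<^sub>R F x)"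
proof -
 have eq: "(tor :: (real^'d) measure) = density lborel (%x. ennreal (indicator unit_cell x))"
  by (simp add: tor_def ennreal_indicator)
 show ?thesis unfolding eq by (subst integral_density) auto
qed

lemma integrable_tor_iff:
 fixes F :: "real^'d::finite => complex"
 assumes [measurable]: "F : bm"
 shows "integrable tor F \<longleftrightarrow> integrable lborel (%x. indicator unit_cell x *\<^sub>R F x)"
proof -
 have eq: "(tor :: (real^'d) measure) = density lborel (%x. ennreal (indicator unit_cell x))"
  by (simp add: tor_def ennreal_indicator)
 show ?thesis unfolding eq by (subst integrable_density) auto
qed

text \<open>The value is unchanged under translation, which multiplies it by \<open>character k a\<close>.\<close>

lemma LINT_tor_character:
 assumes k: "k : int_lattice" "k ~= 0"
 shows "(LINT x|tor. character k x) = 0"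
proof -
 obtain i where "k $ i ~= 0" using k by (auto simp: vec_eq_iff)
 \<comment> \<open>Half a period of \<open>character k\<close> in direction i: translation by
   \<open>a\<close> multiplies the character by -1.\<close>
 define a where "a = (1 / (2 * k $ i)) *\<^sub>R (axis i 1 :: real^'a)"
 have "k \<bullet> a = 1/2" using \<open>k $ i ~= 0\<close> by (simp add: a_def inner_axis)
 then have "2 * pi * (k \<bullet> a) = pi" by simp
 then have a: "character k a = -1" unfolding character_def by (simp only: cis_pi)
 \<comment> \<open>The character on the translated cell. That cell also meets each coset of the
   lattice once, so periodizing F gives the character back.\<close>
 define F where "F = (%x. (indicator unit_cell (x - a) :: real) *\<^sub>R character k x)"
 have [measurable]: "F : bm" unfolding F_def by measurable
 have "integrable lborel (%x::real^'a. (indicator unit_cell x :: real) *\<^sub>R character k (x + a))"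
  unfolding character_simps by (subst integrable_tor_iff[symmetric]) auto
 then have iF: "integrable lborel F"
 proof -
  have "(INTR x. norm (F x)) = (INTR x. indicator unit_cell (x - a))"
   by (intro nn_integral_cong) (simp add: F_def indicator_def)
  also have "... = (INTR x. indicator unit_cell (x :: real^'a))"
   using nn_integral_lborel_shift[of "%x. indicator unit_cell (x - a)" a, symmetric] by simp
  also have "... < infy" using emeasure_unit_cell[where 'd = 'a] by simp
  finally show ?thesis by (intro integrableI_bounded) auto
 qed
 have "- (LINT x|tor. character k x) = (LINT x|tor. character k (x + a))"
  by (simp add: character_simps a)
 also have "... = (LINT x|lborel. (indicator unit_cell x :: real) *\<^sub>R character k (x + a))"
  by (rule LINT_tor) measurable
 also have "... = (LINT x|lborel. F (x + a))" by (simp add: F_def)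
 also have "... = (LINT x|lborel. F x)" by (rule LINT_lborel_shift) measurable
 also have "... = (LINT x|tor. LINT l|latm. F (x + l))"
  by (rule integral_periodize(4)[OF iF, symmetric])
 also have "... = (LINT x|tor. character k x)"
 proof (rule Bochner_Integration.integral_cong)
  fix x :: "real^'a"
  obtain k0 where k0: "k0 : int_lattice" "!!l. l : int_lattice ==> indicator unit_cell (x - a - l) = (indicator {k0} l :: real)"
   using indicator_unit_cell_lattice[of "x - a"] by blast
  have "(LINT l|latm. F (x + l)) = (LINT l|latm. indicator {- k0} l *\<^sub>R character k x)"
  proof (rule Bochner_Integration.integral_cong)
   fix l :: "real^'a" assume "l : space latm"
   then have l: "l : int_lattice" by simp
   have "indicator unit_cell (x + l - a) = (indicator {- k0} l :: real)"
    using k0(2)[of "- l"] l by (auto simp: algebra_simps indicator_def minus_equation_iff)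
   then show "F (x + l) = (indicator {- k0} l :: real) *\<^sub>R character k x"
    using k l by (simp add: F_def character_simps)
  qed simp
  also have "... = character k x"
   using k0(1) by (subst integral_scaleR_left) (auto simp: integrable_real_indicator measure_def)
  finally show "(LINT l|latm. F (x + l)) = character k x" .
 qed simp
 finally show ?thesis by (metis eq_neg_iff_add_eq_0 mult_2 mult_eq_0_iff zero_neq_numeral neg_equal_iff_equal)
qed

lemma fcoeff_sum_character:
 assumes "finite A" "A \<subseteq> int_lattice" "k : int_lattice"
 shows "fcoeff (%x. \<Sum>l\<in>A. c l * character l x) k = (if k : A then c k else 0)"
proof -
 interpret prob_space "tor :: (real^'a) measure" by (rule prob_space_tor)
 have i: "integrable tor (%x. character (l - k) x)" for l by simp
 have "fcoeff (%x. \<Sum>l\<in>A. c l * character l x) k = (LINT x|tor. (\<Sum>l\<in>A. c l * character (l - k) x))"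
  unfolding fcoeff_def diff_conv_add_uminus character_simps by (simp add: sum_distrib_right mult.assoc)
 also have "... = (\<Sum>l\<in>A. c l * (LINT x|tor. character (l - k) x))"
  using i by (subst Bochner_Integration.integral_sum) auto
 also have "... = (\<Sum>l\<in>A. if l = k then c l else 0)"
 proof (rule sum.cong)
  fix l assume "l : A"
  show "c l * (LINT x|tor. character (l - k) x) = (if l = k then c l else 0)"
  proof (cases "l = k")
   case True
   then show ?thesis using prob_space by (simp add: character_simps)
  next
   case False
   then have "(LINT x|tor. character (l - k) x) = 0"
    using assms \<open>l : A\<close> by (intro LINT_tor_character) auto
   then show ?thesis using False by simp
  qed
 qed simp
 also have "... = (if k : A then c k else 0)" using assms by simp
 finally show ?thesis .
qed

lemma integrable_tor_square:
 assumes "integrable tor (%x. (cmod (G x))\<^sup>2)" and [measurable]: "G : bm"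
 shows "integrable tor G"
proof -
 interpret prob_space "tor :: (real^'a) measure" by (rule prob_space_tor)
 have "integrable tor (%x. 1 + (cmod (G x))\<^sup>2)" using assms by simp
 then show ?thesis
 proof (rule Bochner_Integration.integrable_bound)
  have "cmod (G x) <= 1 + (cmod (G x))\<^sup>2" for x
   using sum_squares_bound[of 1 "cmod (G x)"] norm_ge_zero[of "G x"] by (simp only: power_one mult_1_right)
  moreover have "norm (1 + (cmod (G x))\<^sup>2) = 1 + (cmod (G x))\<^sup>2" for x
   by (simp add: add_nonneg_nonneg)
  ultimately show "AE x in tor. norm (G x) <= norm (1 + (cmod (G x))\<^sup>2)"
   by (simp only:) simp
 qed measurable
qed

lemma Bessel_tor:
 assumes sq: "integrable tor (%x. (cmod (G x))\<^sup>2)" and [measurable]: "G : bm"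
  and A: "finite A" "A \<subseteq> int_lattice"
 shows "(\<Sum>k\<in>A. (cmod (fcoeff G k))\<^sup>2) <= (LINT x|tor. (cmod (G x))\<^sup>2)"
proof -
 interpret prob_space "tor :: (real^'a) measure" by (rule prob_space_tor)
 define S where "S = (%x. \<Sum>k\<in>A. fcoeff G k * character k x)"
 have [measurable]: "S : bm" unfolding S_def by measurable
 have iG: "integrable tor G" by (rule integrable_tor_square[OF sq]) measurable
 have bS: "cmod (S x) <= (\<Sum>k\<in>A. cmod (fcoeff G k))" for x
  unfolding S_def by (rule order_trans[OF norm_sum]) (simp add: norm_mult)
 have iGS: "integrable tor (%x. G x * cnj (S x))"
  unfolding S_def cnj_sum sum_distrib_left complex_cnj_mult
  using iG by (intro Bochner_Integration.integrable_sum) (simp add: mult.left_commute[of "G _"])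
 have iSS: "integrable tor (%x. S x * cnj (S x))"
  by (rule integrable_const_bound[where B = "(\<Sum>k\<in>A. cmod (fcoeff G k))\<^sup>2"])
    (auto simp: norm_mult power2_eq_square intro!: mult_mono bS sum_nonneg)
 have GS: "(LINT x|tor. G x * cnj (S x)) = (\<Sum>k\<in>A. (cmod (fcoeff G k))\<^sup>2)"
 proof -
  have "(LINT x|tor. G x * cnj (S x)) = (LINT x|tor. (\<Sum>k\<in>A. cnj (fcoeff G k) * (G x * cnj (character k x))))"
   by (simp add: S_def sum_distrib_left mult.left_commute)
  also have "... = (\<Sum>k\<in>A. cnj (fcoeff G k) * (LINT x|tor. G x * cnj (character k x)))"
   using iG by (subst Bochner_Integration.integral_sum) auto
  also have "... = (\<Sum>k\<in>A. cnj (fcoeff G k) * fcoeff G k)" by (simp add: fcoeff_def)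
  also have "... = (\<Sum>k\<in>A. (cmod (fcoeff G k))\<^sup>2)"
   by (simp only: of_real_sum complex_norm_square mult.commute)
  finally show ?thesis .
 qed
 have SS: "(LINT x|tor. S x * cnj (S x)) = (\<Sum>k\<in>A. (cmod (fcoeff G k))\<^sup>2)"
 proof -
  have "(LINT x|tor. S x * cnj (S x)) = (LINT x|tor. (\<Sum>k\<in>A. cnj (fcoeff G k) * (S x * cnj (character k x))))"
   by (subst (2) S_def) (simp add: sum_distrib_left mult.left_commute)
  also have "... = (\<Sum>k\<in>A. cnj (fcoeff G k) * (LINT x|tor. S x * cnj (character k x)))"
  proof (subst Bochner_Integration.integral_sum)
   have "integrable tor S" unfolding S_def by simp
   then show "integrable tor (%x. cnj (fcoeff G k) * (S x * cnj (character k x)))" for k by simp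
  qed simp
  also have "... = (\<Sum>k\<in>A. cnj (fcoeff G k) * fcoeff S k)" by (simp add: fcoeff_def)
  also have "... = (\<Sum>k\<in>A. cnj (fcoeff G k) * fcoeff G k)"
  proof (intro sum.cong refl)
   fix k assume "k : A"
   then have "k : int_lattice" using A by blast
   then show "cnj (fcoeff G k) * fcoeff S k = cnj (fcoeff G k) * fcoeff G k"
    unfolding S_def fcoeff_sum_character[OF A \<open>k : int_lattice\<close>] using \<open>k : A\<close> by simp
  qed
  also have "... = (\<Sum>k\<in>A. (cmod (fcoeff G k))\<^sup>2)"
   by (simp only: of_real_sum complex_norm_square mult.commute)
  finally show ?thesis .
 qed
 have eq: "(cmod (G x - S x))\<^sup>2 = (cmod (G x))\<^sup>2 - 2 * Re (G x * cnj (S x)) + Re (S x * cnj (S x))" for x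
  unfolding cmod_power2 by (simp add: power2_eq_square algebra_simps)
 define U where "U = (%x. G x * cnj (S x))"
 define V where "V = (%x. S x * cnj (S x))"
 have "0 <= (LINT x|tor. (cmod (G x))\<^sup>2 - 2 * Re (U x) + Re (V x))"
  unfolding U_def V_def eq[symmetric] by simp
 also have "... = (LINT x|tor. (cmod (G x))\<^sup>2) - 2 * Re (LINT x|tor. U x) + Re (LINT x|tor. V x)"
  using sq iGS[folded U_def] iSS[folded V_def] by simp
 also have "... = (LINT x|tor. (cmod (G x))\<^sup>2) - (\<Sum>k\<in>A. (cmod (fcoeff G k))\<^sup>2)"
  unfolding U_def V_def GS SS by simp
 finally show ?thesis by simp
qed

section \<open>The Hausdorff-Young inequality and the Riemann-Lebesgue lemma on the torus\<close>

lemma norm_fcoeff_le: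
 assumes [measurable]: "G : bm"
 shows "enorm (fcoeff G k) <= (INTT x. enorm (G x))"
proof (cases "integrable tor G")
 case True
 have "cmod (fcoeff G k) <= (LINT x|tor. cmod (G x * cnj (character k x)))"
  unfolding fcoeff_def by (rule integral_norm_bound)
 also have "... = (LINT x|tor. cmod (G x))" by (simp add: norm_mult)
 finally show ?thesis using True by (simp add: nn_integral_eq_integral ennreal_leI)
next
 case False
 then have "(INTT x. enorm (G x)) = infy"
  by (auto simp: integrable_iff_bounded less_top[symmetric])
 then show ?thesis by simp
qed

lemma nn_integral_powr_Icc:
 fixes r a :: real
 assumes "r > 0" "a >= 0"
 shows "(INTR t. ennreal (r * t powr (r - 1)) * indicator {0..a} t) = ennreal (a powr r)"
proof -
 have "((%t. t powr (r - 1)) has_integral (a powr (r - 1 + 1) / (r - 1 + 1))) {0..a}"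
  using assms by (intro has_integral_powr_from_0) auto
 then have "((%t. r * t powr (r - 1)) has_integral (r * (a powr (r - 1 + 1) / (r - 1 + 1)))) {0..a}"
  by (rule has_integral_mult_right)
 then have "((%t. r * t powr (r - 1)) has_integral (a powr r)) {0..a}"
  using assms by simp
 then show ?thesis
  using assms by (intro nn_integral_has_integral_lebesgue') auto
qed

lemma nn_integral_latm_leI:
 assumes "!!A. finite A ==> A \<subseteq> int_lattice ==> (\<Sum>k\<in>A. F k) <= C"
 shows "(SUML k. F k) <= C"
 unfolding nn_integral_latm_eq_infsum
 by (subst nonneg_infsum_complete) (auto intro!: SUP_least assms)

lemma Bessel_tor_nn:
 assumes [measurable]: "G : bm"
 shows "(SUML k. ennreal ((cmod (fcoeff G k))\<^sup>2)) <= (INTT x. ennreal ((cmod (G x))\<^sup>2))"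
proof (cases "integrable tor (%x. (cmod (G x))\<^sup>2)")
 case True
 show ?thesis
 proof (rule nn_integral_latm_leI)
  fix A :: "(real^'a) set" assume "finite A" "A \<subseteq> int_lattice"
  from Bessel_tor[OF True _ this]
  show "(\<Sum>k\<in>A. ennreal ((cmod (fcoeff G k))\<^sup>2)) <= (INTT x. ennreal ((cmod (G x))\<^sup>2))"
   using True by (simp add: nn_integral_eq_integral ennreal_leI)
 qed
next
 case False
 then have "(INTT x. ennreal ((cmod (G x))\<^sup>2)) = infy"
  by (auto simp: integrable_iff_bounded less_top[symmetric])
 then show ?thesis by simp
qed

lemma integrable_tor_powr:
 assumes [measurable]: "G : bm" and q: "q >= 1"
  and fin: "(INTT x. ennreal (cmod (G x) powr q)) < infy"
 shows "integrable tor G"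
proof -
 interpret prob_space "tor :: (real^'a) measure" by (rule prob_space_tor)
 have "(INTT x. enorm (G x)) <= (INTT x. 1 + ennreal (cmod (G x) powr q))"
 proof (intro nn_integral_mono)
  fix x
  have "cmod (G x) <= 1 + cmod (G x) powr q"
  proof (cases "cmod (G x) <= 1")
   case False
   then show ?thesis using powr_mono[of 1 q "cmod (G x)"] q by simp
  qed (simp add: add_increasing2)
  then show "enorm (G x) <= 1 + ennreal (cmod (G x) powr q)"
   by (metis ennreal_1 ennreal_leI ennreal_plus powr_ge_zero zero_le_one)
 qed
 also have "... < infy" using fin emeasure_space_1 by (simp add: nn_integral_add)
 finally show ?thesis by (intro integrableI_bounded) auto
qed

lemma fcoeff_split:
 assumes [measurable]: "G : bm" "E : sets borel" and i: "integrable tor G"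
 shows "cmod (fcoeff G k) <= cmod (fcoeff (%x. indicator E x * G x) k) + (LINT x|tor. indicator (- E) x * cmod (G x))"
proof -
 have i1: "integrable tor (%x. indicator E x * G x)" "integrable tor (%x. indicator (- E) x * G x)"
  by (rule Bochner_Integration.integrable_bound[OF i]; auto simp: indicator_def)+
 have "fcoeff G k = (LINT x|tor. indicator E x * G x * cnj (character k x) + indicator (- E) x * G x * cnj (character k x))"
  unfolding fcoeff_def by (intro Bochner_Integration.integral_cong) (auto simp: indicator_def)
 also have "... = fcoeff (%x. indicator E x * G x) k + (LINT x|tor. indicator (- E) x * G x * cnj (character k x))"
  unfolding fcoeff_def using i1 by (intro Bochner_Integration.integral_add) simp_all
 finally have "cmod (fcoeff G k) <= cmod (fcoeff (%x. indicator E x * G x) k) + cmod (LINT x|tor. indicator (- E) x * G x * cnj (character k x))"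
  by (metis norm_triangle_ineq)
 moreover have "cmod (LINT x|tor. indicator (- E) x * G x * cnj (character k x)) <= (LINT x|tor. cmod (indicator (- E) x * G x * cnj (character k x)))"
  by (rule integral_norm_bound)
 moreover have "(LINT x|tor. cmod (indicator (- E) x * G x * cnj (character k x))) = (LINT x|tor. indicator (- E) x * cmod (G x))"
  by (intro Bochner_Integration.integral_cong) (auto simp: norm_mult indicator_def)
 ultimately show ?thesis by linarith
qed

text \<open>Marcinkiewicz interpolation between Bessel's inequality and the trivial bound
 \<open>norm_fcoeff_le\<close>: for each level \<open>t\<close> the function is cut at height $(t/2J)^{-(p-1)}$, which makes the
 coefficients of the large part at most $t/2$.\<close>

lemma Hausdorff_Young_tor_aux:
 fixes p :: real
 assumes p: "p > 2" and q: "q = p / (p - 1)"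
  and [measurable]: "G : bm"
  and J: "(INTT x. ennreal (cmod (G x) powr q)) = ennreal J" "J > 0"
 shows "(SUML k. ennreal (cmod (fcoeff G k) powr p)) <= ennreal (4 * p / (p - 2) * 2 powr (p - 2) * J powr (p - 1))"
proof -
 interpret prob_space "tor :: (real^'a) measure" by (rule prob_space_tor)
 interpret pair_sigma_finite "lborel :: real measure" "tor :: (real^'a) measure" ..
 have q1: "q > 1" "q >= 1" and pq: "(p - 1) * (q - 1) = 1" using p by (auto simp: q field_simps)
 have iG: "integrable tor G"
  by (rule integrable_tor_powr[of _ q]) (use q1 J in auto)
 define lam where "lam = (%t. (t / (2 * J)) powr (- (p - 1)))"
 have [measurable]: "lam : bm" unfolding lam_def by measurable
 define E where "E = (%t. {x. cmod (G x) <= lam t})"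
 have [measurable]: "E t : sets borel" for t unfolding E_def by measurable
 \<comment> \<open>If t is at most the modulus of the k-th coefficient, the part of \<open>G\<close>
   above height \<open>lam t\<close> contributes at most t/2, so the truncated part keeps a
   coefficient of size at least t/2. The indicator is thus dominated by squares, which Bessel's
   inequality sums.\<close>
 have level: "ennreal (indicator {0..cmod (fcoeff G k)} t) <= ennreal (4 / t\<^sup>2) * ennreal ((cmod (fcoeff (%x. indicator (E t) x * G x) k))\<^sup>2)"
  if t: "t > 0" for t k
 proof (cases "t <= cmod (fcoeff G k)")
  case True
  have lam: "lam t > 0" using t J by (simp add: lam_def)
  have "ennreal (LINT x|tor. indicator (- E t) x * cmod (G x)) = (INTT x. ennreal (indicator (- E t) x * cmod (G x)))"
   using iG by (intro nn_integral_eq_integral[symmetric] Bochner_Integration.integrable_bound[OF integrable_norm[OF iG]])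
    (auto simp: indicator_def)
  also have "... <= (INTT x. ennreal (lam t powr (1 - q)) * ennreal (cmod (G x) powr q))"
  proof (intro nn_integral_mono)
   fix x
   have "cmod (G x) <= lam t powr (1 - q) * cmod (G x) powr q" if "x \<notin> E t"
   proof -
    have G: "lam t < cmod (G x)" using that by (simp add: E_def)
    then have "cmod (G x) powr (1 - q) <= lam t powr (1 - q)"
     using lam q1 by (intro powr_mono2') auto
    then have "cmod (G x) powr (1 - q) * cmod (G x) powr q <= lam t powr (1 - q) * cmod (G x) powr q"
     by (rule mult_right_mono) simp
    moreover have "cmod (G x) powr (1 - q) * cmod (G x) powr q = cmod (G x)"
     using G lam by (simp add: powr_add[symmetric])
    ultimately show ?thesis by simp
   qed
   then show "ennreal (indicator (- E t) x * cmod (G x)) <= ennreal (lam t powr (1 - q)) * ennreal (cmod (G x) powr q)"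
    by (auto simp: indicator_def ennreal_mult[symmetric] intro!: ennreal_leI)
  qed
  also have "... = ennreal (lam t powr (1 - q) * J)"
   using J by (simp add: nn_integral_cmult ennreal_mult)
  also have "lam t powr (1 - q) = t / (2 * J)"
   using t J pq by (simp add: lam_def powr_powr algebra_simps)
  also have "t / (2 * J) * J = t / 2" using J by simp
  finally have "(LINT x|tor. indicator (- E t) x * cmod (G x)) <= t / 2"
   using t by simp
  with fcoeff_split[OF _ _ iG, of "E t" k] True
  have "t / 2 <= cmod (fcoeff (%x. indicator (E t) x * G x) k)" by simp
  then have "(t / 2)\<^sup>2 <= (cmod (fcoeff (%x. indicator (E t) x * G x) k))\<^sup>2"
   using t by (intro power_mono) auto
  then have "1 <= 4 / t\<^sup>2 * (cmod (fcoeff (%x. indicator (E t) x * G x) k))\<^sup>2"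
   using t by (simp add: field_simps power2_eq_square)
  then show ?thesis
   using True t by (auto simp: ennreal_mult[symmetric] intro!: ennreal_leI)
 qed simp
 have "(SUML k. ennreal (cmod (fcoeff G k) powr p))
   = (SUML k. (INTR t. ennreal (p * t powr (p - 1)) * indicator {0..cmod (fcoeff G k)} t))"
  using p by (subst nn_integral_powr_Icc) auto
 also have "... = (INTR t. (SUML k. ennreal (p * t powr (p - 1)) * indicator {0..cmod (fcoeff G k)} t))"
  by (rule nn_integral_latm_swap[symmetric]) measurable
 also have "... <= (INTR t. (INTT x. ennreal (4 * p * t powr (p - 3)) * indicator {0<..} t * (ennreal ((cmod (G x))\<^sup>2) * indicator (E t) x)))"
 proof (intro nn_integral_mono)
  fix t :: real
  show "(SUML k. ennreal (p * t powr (p - 1)) * indicator {0..cmod (fcoeff G k)} t)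
   <= (INTT x. ennreal (4 * p * t powr (p - 3)) * indicator {0<..} t * (ennreal ((cmod (G x))\<^sup>2) * indicator (E t) x))"
  proof (cases "t > 0")
   case True
   have "(SUML k. ennreal (p * t powr (p - 1)) * indicator {0..cmod (fcoeff G k)} t)
    <= (SUML k. ennreal (p * t powr (p - 1)) * (ennreal (4 / t\<^sup>2) * ennreal ((cmod (fcoeff (%x. indicator (E t) x * G x) k))\<^sup>2)))"
    using level[OF True] by (intro nn_integral_mono mult_left_mono) (auto simp: ennreal_indicator)
   also have "... = ennreal (p * t powr (p - 1)) * (ennreal (4 / t\<^sup>2) * (SUML k. ennreal ((cmod (fcoeff (%x. indicator (E t) x * G x) k))\<^sup>2)))"
    by (simp add: nn_integral_cmult)
   also have "... <= ennreal (p * t powr (p - 1)) * (ennreal (4 / t\<^sup>2) * (INTT x. ennreal ((cmod (indicator (E t) x * G x))\<^sup>2)))"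
    by (intro mult_left_mono Bessel_tor_nn) auto
   also have "(INTT x. ennreal ((cmod (indicator (E t) x * G x))\<^sup>2)) = (INTT x. ennreal ((cmod (G x))\<^sup>2) * indicator (E t) x)"
    by (intro nn_integral_cong) (auto simp: indicator_def)
   also have "ennreal (p * t powr (p - 1)) * (ennreal (4 / t\<^sup>2) * (INTT x. ennreal ((cmod (G x))\<^sup>2) * indicator (E t) x))
     = ennreal (4 * p * t powr (p - 3)) * (INTT x. ennreal ((cmod (G x))\<^sup>2) * indicator (E t) x)"
   proof -
    have "p * t powr (p - 1) * (4 / t\<^sup>2) = 4 * p * t powr (p - 3)"
    proof -
     have "t powr (p - 1) = t powr (p - 3) * t powr 2" by (simp add: powr_add[symmetric])
     then show ?thesis using True by simp
    qed
    then show ?thesis using p by (simp add: mult.assoc[symmetric] ennreal_mult[symmetric])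
   qed
   also have "... = (INTT x. ennreal (4 * p * t powr (p - 3)) * indicator {0<..} t * (ennreal ((cmod (G x))\<^sup>2) * indicator (E t) x))"
    using True by (subst nn_integral_cmult) auto
   finally show ?thesis .
  next
   case False
   then have "ennreal (p * t powr (p - 1)) * indicator {0..cmod (fcoeff G k)} t = 0" for k
    using p by (auto simp: indicator_def)
   then show ?thesis by (simp only: nn_integral_0_iff_AE nn_integral_const) simp
  qed
 qed
 also have "... = (INTT x. (INTR t. ennreal (4 * p * t powr (p - 3)) * indicator {0<..} t * (ennreal ((cmod (G x))\<^sup>2) * indicator (E t) x)))"
 proof -
  have "(%(t, x). ennreal (4 * p * t powr (p - 3)) * indicator {0<..} t * (ennreal ((cmod (G x))\<^sup>2) * indicator (E t) x)) : borel_measurable (lborel \<Otimes>\<^sub>M tor)"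
   unfolding E_def by measurable
  from Fubini'[OF this] show ?thesis by simp
 qed
 also have "... <= (INTT x. ennreal (4 * p / (p - 2) * (2 * J) powr (p - 2)) * ennreal (cmod (G x) powr q))"
 proof (intro nn_integral_mono)
  fix x
  define a where "a = cmod (G x)"
  show "(INTR t. ennreal (4 * p * t powr (p - 3)) * indicator {0<..} t * (ennreal ((cmod (G x))\<^sup>2) * indicator (E t) x))
   <= ennreal (4 * p / (p - 2) * (2 * J) powr (p - 2)) * ennreal (cmod (G x) powr q)"
  proof (cases "a = 0")
   case True
   then show ?thesis by (simp add: a_def)
  next
   case False
   then have a: "a > 0" by (simp add: a_def)
   \<comment> \<open>The inverse of the decreasing function \<open>lam\<close> at \<open>a\<close>,
     hence the last level t for which x lies in \<open>E t\<close>. The integral of t powr (p - 3)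
     up to this level converges because p > 2.\<close>
   define \<tau> where "\<tau> = 2 * J * a powr (- 1 / (p - 1))"
   have \<tau>: "\<tau> >= 0" using J by (simp add: \<tau>_def)
   have le: "t <= \<tau>" if "t > 0" "a <= lam t" for t
   proof -
    have "lam t powr (- 1 / (p - 1)) <= a powr (- 1 / (p - 1))"
     using that a p by (intro powr_mono2') auto
    moreover have "lam t powr (- 1 / (p - 1)) = t / (2 * J)"
    proof -
     have e: "- (p - 1) * (- 1 / (p - 1)) = 1" using p by (simp add: divide_simps)
     show ?thesis using that J unfolding lam_def powr_powr e by simp
    qed
    ultimately have "t = 2 * J * lam t powr (- 1 / (p - 1))" "lam t powr (- 1 / (p - 1)) <= a powr (- 1 / (p - 1))"
     using J by auto
    then show ?thesis using J mult_left_mono[of "lam t powr (- 1 / (p - 1))" "a powr (- 1 / (p - 1))" "2 * J"]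
     unfolding \<tau>_def by linarith
   qed
   have "(INTR t. ennreal (4 * p * t powr (p - 3)) * indicator {0<..} t * (ennreal ((cmod (G x))\<^sup>2) * indicator (E t) x))
    <= (INTR t. ennreal (4 * p / (p - 2) * a\<^sup>2) * (ennreal ((p - 2) * t powr (p - 2 - 1)) * indicator {0..\<tau>} t))"
   proof (intro nn_integral_mono)
    fix t :: real
    have "4 * p * t powr (p - 3) * a\<^sup>2 = 4 * p / (p - 2) * a\<^sup>2 * ((p - 2) * t powr (p - 2 - 1))"
     using p by (simp add: field_simps)
    then show "ennreal (4 * p * t powr (p - 3)) * indicator {0<..} t * (ennreal ((cmod (G x))\<^sup>2) * indicator (E t) x)
      <= ennreal (4 * p / (p - 2) * a\<^sup>2) * (ennreal ((p - 2) * t powr (p - 2 - 1)) * indicator {0..\<tau>} t)"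
     using le[of t] p by (auto simp: indicator_def E_def a_def ennreal_mult[symmetric])
   qed
   also have "... = ennreal (4 * p / (p - 2) * a\<^sup>2 * \<tau> powr (p - 2))"
    using p nn_integral_powr_Icc[of "p - 2" \<tau>] \<tau> by (subst nn_integral_cmult) (auto simp: ennreal_mult[symmetric])
   also have "4 * p / (p - 2) * a\<^sup>2 * \<tau> powr (p - 2) = 4 * p / (p - 2) * (2 * J) powr (p - 2) * a powr q"
   proof -
    have "a\<^sup>2 * (a powr (- 1 / (p - 1))) powr (p - 2) = a powr q"
    proof -
     have "2 + (- 1 / (p - 1)) * (p - 2) = q" using p by (simp add: q field_simps)
     then show ?thesis using a by (simp add: powr_powr powr_add[symmetric] flip: powr_numeral)
    qed
    then show ?thesis unfolding \<tau>_def using J by (simp add: powr_mult)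
   qed
   also have "ennreal ... = ennreal (4 * p / (p - 2) * (2 * J) powr (p - 2)) * ennreal (cmod (G x) powr q)"
    using p by (subst ennreal_mult) (auto simp: a_def)
   finally show ?thesis .
  qed
 qed
 also have "... = ennreal (4 * p / (p - 2) * (2 * J) powr (p - 2)) * ennreal J"
  by (subst nn_integral_cmult) (auto simp: J)
 also have "... = ennreal (4 * p / (p - 2) * 2 powr (p - 2) * J powr (p - 1))"
 proof -
  have "J powr (p - 1) = J powr (p - 2) * J powr 1"
   by (simp only: powr_add[symmetric]) simp
  then show ?thesis using p J by (simp add: ennreal_mult[symmetric] powr_mult mult_ac)
 qed
 finally show ?thesis .
qed

text \<open>For p = 2 this is Bessel's inequality, kept apart because the interpolation constant
  contains 1/(p-2). A vanishing integral is kept apart as well, because the truncation height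
  divides by it.\<close>

lemma Hausdorff_Young_tor:
 fixes p :: real
 assumes p: "p >= 2" and q: "q = p / (p - 1)"
 shows "\<exists>C>0. \<forall>G::real^'d::finite => complex. G : bm -->
  (SUML k. ennreal (cmod (fcoeff G k) powr p)) <= ennreal C * ennpowr (INTT x. ennreal (cmod (G x) powr q)) (p - 1)"
proof -
 define C where "C = (if p = 2 then 1 else 4 * p / (p - 2) * 2 powr (p - 2))"
 have C: "C > 0" using p by (auto simp: C_def)
 have "(SUML k. ennreal (cmod (fcoeff G k) powr p)) <= ennreal C * ennpowr (INTT x. ennreal (cmod (G x) powr q)) (p - 1)"
  if [measurable]: "G : bm" for G :: "real^'d => complex"
 proof (cases "p = 2")
  case True
  then show ?thesis using Bessel_tor_nn[OF that] by (simp add: C_def q)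
 next
  case False
  then have p2: "p > 2" using p by simp
  define I where "I = (INTT x. ennreal (cmod (G x) powr q))"
  consider "I = top" | "I = 0" | J where "I = ennreal J" "J > 0"
   by (cases I) (auto simp: less_le)
  then show ?thesis
  proof cases
   case 1
   then show ?thesis using C by (simp add: I_def ennreal_mult_top)
  next
   case 2
   then have "AE x in tor. ennreal (cmod (G x) powr q) = 0"
    unfolding I_def by (subst (asm) nn_integral_0_iff_AE) auto
   then have "AE x in tor. G x * cnj (character k x) = 0" for k by eventually_elim simp
   then have "fcoeff G k = 0" for k
    unfolding fcoeff_def by (rule integral_eq_zero_AE)
   then show ?thesis by simp
  next
   case 3
   then show ?thesis
    using Hausdorff_Young_tor_aux[OF p2 q that, of J] C False p
    by (simp add: I_def C_def ennpowr_ennreal ennreal_mult[symmetric])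
  qed
 qed
 then show ?thesis using C by blast
qed

text \<open>Truncate \<open>G\<close> at a height where the rest has L1 norm below e/2. A large
  coefficient of \<open>G\<close> is then large for the bounded part, and Bessel's inequality allows
  only finitely many of these. The result serves p = infinity, where boundedness of the coefficients
  does not yet give convergence of the series.\<close>

lemma Riemann_Lebesgue_tor:
 assumes [measurable]: "G : bm" and iG: "integrable tor G" and e: "e > 0"
 shows "finite {k\<in>int_lattice. e <= cmod (fcoeff G k)}"
proof -
 interpret prob_space "tor :: (real^'a) measure" by (rule prob_space_tor)
 define E where "E = (%n::nat. {x. cmod (G x) <= n})"
 have [measurable]: "E n : sets borel" for n unfolding E_def by measurable
 have "(%n. LINT x|tor. indicator (- E n) x * cmod (G x)) ~~> (LINT x|(tor :: (real^'a) measure). 0)"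
 proof (rule integral_dominated_convergence[where w = "%x. cmod (G x)"])
  show "AE x in tor. (%n. indicator (- E n) x * cmod (G x)) ~~> 0"
  proof (rule AE_I2, rule tendsto_eventually)
   fix x
   show "eventually (%n. indicator (- E n) x * cmod (G x) = 0) sequentially"
    using eventually_ge_at_top[of "nat \<lceil>cmod (G x)\<rceil>"]
    by eventually_elim (auto simp: E_def indicator_def nat_le_iff ceiling_le_iff)
  qed
 qed (use iG in \<open>auto simp: indicator_def\<close>)
 then have "eventually (%n. (LINT x|tor. indicator (- E n) x * cmod (G x)) < e / 2) sequentially"
  using e by (intro order_tendstoD(2)) auto
 then obtain n where n: "(LINT x|tor. indicator (- E n) x * cmod (G x)) < e / 2"
  by (auto simp: eventually_sequentially)
 have large: "(e / 2)\<^sup>2 <= (cmod (fcoeff (%x. indicator (E n) x * G x) k))\<^sup>2" if "e <= cmod (fcoeff G k)" for k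
  using fcoeff_split[OF _ _ iG, of "E n" k] that n e by (intro power_mono) auto
 have sq: "integrable tor (%x. (cmod (indicator (E n) x * G x))\<^sup>2)"
  by (rule integrable_const_bound[where B = "(real n)\<^sup>2"]) (auto simp: indicator_def E_def intro!: power_mono)
 show ?thesis
 proof (rule ccontr)
  assume inf: "infinite {k\<in>int_lattice. e <= cmod (fcoeff G k)}"
  define B where "B = (LINT x|tor. (cmod (indicator (E n) x * G x))\<^sup>2)"
  obtain N :: nat where N: "real N * (e / 2)\<^sup>2 > B"
   using reals_Archimedean3[of "(e/2)\<^sup>2"] e by auto
  obtain A where A: "finite A" "card A = N" "A \<subseteq> {k\<in>int_lattice. e <= cmod (fcoeff G k)}"
   using inf infinite_arbitrarily_large by blast
  have "real N * (e / 2)\<^sup>2 = (\<Sum>k\<in>A. (e / 2)\<^sup>2)" using A by simp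
  also have "... <= (\<Sum>k\<in>A. (cmod (fcoeff (%x. indicator (E n) x * G x) k))\<^sup>2)"
   using A by (intro sum_mono large) auto
  also have "... <= B" unfolding B_def
   using A by (intro Bessel_tor sq) auto
  finally show False using N by simp
 qed
qed

section \<open>Uniqueness of Fourier coefficients\<close>

lemma measurable_tor_eq: "measurable tor N = measurable borel N"
 by (rule measurable_cong_sets) simp_all

inductive trig_poly :: "(real^'d::finite => complex) => bool" where
 character: "k : int_lattice ==> trig_poly (character k)"
| add: "trig_poly u ==> trig_poly v ==> trig_poly (%x. u x + v x)"
| cmult: "trig_poly u ==> trig_poly (%x. c * u x)"

lemma trig_poly_const: "trig_poly (%_. c)"
 using trig_poly.cmult[OF trig_poly.character[of 0], of c] by (simp add: character_simps)

lemma trig_poly_sum: "(!!i. i : I ==> trig_poly (u i)) ==> trig_poly (%x. \<Sum>i\<in>I. u i x)"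
 by (induction I rule: infinite_finite_induct) (auto intro: trig_poly_const trig_poly.add)

lemma trig_poly_mult:
 assumes "trig_poly u" "trig_poly v"
 shows "trig_poly (%x. u x * v x)"
 using assms(1)
proof induction
 case (character k)
 show ?case using assms(2)
 proof induction
  case (character l)
  then show ?case
   using trig_poly.character[of "k + l"] \<open>k : int_lattice\<close> by (simp add: character_simps[abs_def])
 next
  case (add u v)
  then show ?case using trig_poly.add by (simp add: distrib_left)
 next
  case (cmult u c)
  then show ?case using trig_poly.cmult[of "%x. character k x * u x" c] by (simp add: mult.left_commute)
 qed
next
 case (add u u')
 then show ?case using trig_poly.add by (simp add: distrib_right)
next
 case (cmult u c)
 then show ?case using trig_poly.cmult[of "%x. u x * v x" c] by (simp add: mult.assoc)
qed

lemma integral_trig_poly_eq_0: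
 assumes G: "integrable tor G" "!!k. k : int_lattice ==> fcoeff G k = 0" and u: "trig_poly u"
 shows "integrable tor (%x. G x * u x) \<and> (LINT x|tor. G x * u x) = 0"
 using u
proof induction
 case (character k)
 then show ?case
  using G(1) G(2)[of "- k"] by (simp add: fcoeff_def character_simps)
next
 case (add u v)
 then show ?case by (simp add: distrib_left)
next
 case (cmult u c)
 then show ?case by (simp add: mult.left_commute)
qed

text \<open>Places the cell on the product of unit circles in \<open>complex^'d\<close>. Real
  polynomials of the coordinates become trigonometric polynomials there, and Stone-Weierstrass
  applies on a ball containing the image.\<close>

definition torus_embed :: "real^'d::finite => complex^'d" where
 "torus_embed x = (\<chi> i. cis (2 * pi * x $ i))"

lemma borel_measurable_torus_embed [measurable]: "torus_embed : bm"
 unfolding torus_embed_def cis_conv_exp by (intro borel_measurable_continuous_onI continuous_intros)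

lemma trig_poly_real_polynomial:
 fixes F :: "complex^'d::finite => real"
 assumes "real_polynomial_function F"
 shows "trig_poly (%x. of_real (F (torus_embed x)))"
 using assms
proof induction
 case (linear f)
 have ch: "character (axis i 1) x = cis (2 * pi * x $ i)" for i and x :: "real^'d"
  by (simp add: character_def inner_axis')
 have z: "z = (\<Sum>i\<in>UNIV. Re (z $ i) *\<^sub>R axis i 1 + Im (z $ i) *\<^sub>R axis i \<i>)" for z :: "complex^'d"
  by (simp add: vec_eq_iff axis_def complex_eq_iff if_distrib[where f = Re] if_distrib[where f = Im]
    if_distrib[where f = "(*) _"] sum.distrib cong: if_cong)
 have "f z = (\<Sum>i\<in>UNIV. Re (z $ i) * f (axis i 1) + Im (z $ i) * f (axis i \<i>))" for z
  using linear.hyps by (subst z) (simp add: bounded_linear.linear linear_sum linear_add linear_scale)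
 note fz = this
 have "complex_of_real (f (torus_embed x)) =
   (\<Sum>i\<in>UNIV. of_real (f (axis i 1)) * ((1/2) * (character (axis i 1) x + character (- axis i 1) x))
    + of_real (f (axis i \<i>)) * ((- \<i> / 2) * (character (axis i 1) x + (- 1) * character (- axis i 1) x)))" for x
 proof -
  have "of_real (Re (torus_embed x $ i)) = (1/2) * (character (axis i 1) x + character (- axis i 1) x)"
   "of_real (Im (torus_embed x $ i)) = (- \<i> / 2) * (character (axis i 1) x + (- 1) * character (- axis i 1) x)" for i
   unfolding character_simps ch torus_embed_def by (simp_all add: complex_eq_iff)
  then show ?thesis
   unfolding fz[of "torus_embed x"] of_real_sum of_real_add of_real_mult by (simp only: mult.commute)
 qed
 then show ?case
  by (simp only:) (intro trig_poly_sum trig_poly.add trig_poly.cmult trig_poly.character int_lattice_intros axis_in_int_lattice)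
next
 case (const c)
 then show ?case by (rule trig_poly_const)
next
 case (add f g)
 then show ?case using trig_poly.add by simp
next
 case (mult f g)
 then show ?case using trig_poly_mult by simp
qed

lemma integral_torus_embed_eq_0:
 fixes F :: "complex^'d::finite => real"
 assumes G: "integrable tor G" "!!k. k : int_lattice ==> fcoeff G k = 0"
  and F: "continuous_on UNIV F"
 shows "(LINT x|tor. G x * of_real (F (torus_embed x))) = 0"
proof -
 have [measurable]: "G : bm" using borel_measurable_integrable[OF G(1)] by (simp add: measurable_tor_eq)
 have [measurable]: "F : bm" by (rule borel_measurable_continuous_onI[OF F])
 define K where "K = cball (0::complex^'d) (real CARD('d))"
 have K: "compact K" "torus_embed x : K" for x
 proof -
  have "norm (torus_embed x) <= (\<Sum>i\<in>UNIV. norm (torus_embed x $ i))" unfolding norm_vec_def by (rule L2_set_le_sum) simp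
  then show "torus_embed x : K" by (simp add: K_def torus_embed_def)
 qed (simp add: K_def)
 define B where "B = (LINT x|tor. cmod (G x))"
 have small: "cmod (LINT x|tor. G x * of_real (F (torus_embed x))) <= e * B" if e: "e > 0" for e
 proof -
  obtain P where P: "real_polynomial_function P" "!!x. x : K ==> \<bar>F x - P x\<bar> < e"
   using Stone_Weierstrass_real_polynomial_function[OF K(1) continuous_on_subset[OF F] e] by blast
  from integral_trig_poly_eq_0[OF G trig_poly_real_polynomial[OF P(1)]]
  have iP: "integrable tor (%x. G x * of_real (P (torus_embed x)))" "(LINT x|tor. G x * of_real (P (torus_embed x))) = 0"
   by auto
  have [measurable]: "P : bm"
   using P(1) by (intro borel_measurable_continuous_onI continuous_on_polymonial_function) (simp add: real_polynomial_function_eq)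
  have bd: "cmod (G x * of_real (F (torus_embed x) - P (torus_embed x))) <= e * cmod (G x)" for x
   using mult_left_mono[OF less_imp_le[OF P(2)[OF K(2)[of x]]], of "cmod (G x)"]
   by (simp add: norm_mult mult.commute flip: of_real_diff)
  have iFP: "integrable tor (%x. G x * of_real (F (torus_embed x) - P (torus_embed x)))"
  proof (rule Bochner_Integration.integrable_bound[where f = "%x. e * cmod (G x)"])
   show "integrable tor (%x. e * cmod (G x))" using G(1) by (intro integrable_mult_right integrable_norm)
   show "AE x in tor. norm (G x * of_real (F (torus_embed x) - P (torus_embed x))) <= norm (e * cmod (G x))"
    by (rule AE_I2, rule order_trans[OF bd]) simp
  qed measurable
  have "(LINT x|tor. G x * of_real (F (torus_embed x))) = 
   (LINT x|tor. G x * of_real (F (torus_embed x) - P (torus_embed x)) + G x * of_real (P (torus_embed x)))"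
   by (simp add: algebra_simps)
  also have "... = (LINT x|tor. G x * of_real (F (torus_embed x) - P (torus_embed x)))"
   using iFP iP by simp
  also have "cmod ... <= (LINT x|tor. cmod (G x * of_real (F (torus_embed x) - P (torus_embed x))))"
   by (rule integral_norm_bound)
  also have "... <= (LINT x|tor. e * cmod (G x))"
   using iFP G(1) bd by (intro integral_mono) auto
  also have "... = e * B" by (simp add: B_def)
  finally show ?thesis .
 qed
 have B: "B >= 0" by (simp add: B_def)
 have "cmod (LINT x|tor. G x * of_real (F (torus_embed x))) <= 0"
 proof (rule field_le_epsilon)
  fix e :: real assume "e > 0"
  then have "e / (B + 1) * B <= e"
   using B by (simp add: divide_simps)
  moreover have "cmod (LINT x|tor. G x * of_real (F (torus_embed x))) <= e / (B + 1) * B"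
   using \<open>e > 0\<close> B by (intro small) simp
  ultimately show "cmod (LINT x|tor. G x * of_real (F (torus_embed x))) <= 0 + e" by linarith
 qed
 then show ?thesis by simp
qed

text \<open>The continuous functions max(0, 1 - n dist(z, C)) decrease to the indicator of the
  closed set C; dominated convergence with majorant |G|.\<close>

lemma integral_torus_embed_closed_eq_0:
 fixes C :: "(complex^'d::finite) set"
 assumes G: "integrable tor G" "!!k. k : int_lattice ==> fcoeff G k = 0" and C: "closed C"
 shows "(LINT x|tor. indicator C (torus_embed x) *\<^sub>R G x) = 0"
proof (cases "C = {}")
 case False
 have [measurable]: "G : bm" using borel_measurable_integrable[OF G(1)] by (simp add: measurable_tor_eq)
 have [measurable]: "C : sets borel" using C by simp
 define F where "F = (%n::nat. %z. max 0 (1 - real n * infdist z C))"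
 have F: "continuous_on UNIV (F n)" for n unfolding F_def by (intro continuous_intros)
 have [measurable]: "F n : bm" for n by (rule borel_measurable_continuous_onI[OF F])
 have "(%n. LINT x|tor. G x * of_real (F n (torus_embed x))) ~~> (LINT x|tor. indicator C (torus_embed x) *\<^sub>R G x)"
 proof (rule integral_dominated_convergence[where w = "%x. cmod (G x)"])
  have "(%n. F n z) ~~> indicator C z" for z
  proof (cases "z : C")
   case True
   then show ?thesis by (simp add: F_def)
  next
   case False
   then have d: "infdist z C > 0"
    using C \<open>C ~= {}\<close> by (metis in_closed_iff_infdist_zero infdist_nonneg less_eq_real_def)
   obtain m :: nat where m: "real m * infdist z C > 1" using reals_Archimedean3[OF d] by blast
   have "eventually (%n. F n z = indicator C z) sequentially"
    using eventually_ge_at_top[of m]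
   proof eventually_elim
    case (elim n)
    then have "real m * infdist z C <= real n * infdist z C" using d by (intro mult_right_mono) auto
    then show ?case using m False by (simp add: F_def)
   qed
   then show ?thesis by (rule tendsto_eventually)
  qed
  then have "(%n. G x * of_real (F n (torus_embed x))) ~~> G x * of_real (indicator C (torus_embed x))" for x
   by (intro tendsto_intros)
  then show "AE x in tor. (%n. G x * of_real (F n (torus_embed x))) ~~> indicator C (torus_embed x) *\<^sub>R G x"
   by (simp add: scaleR_conv_of_real mult.commute)
  show "AE x in tor. norm (G x * of_real (F n (torus_embed x))) <= cmod (G x)" for n
   by (rule AE_I2) (auto simp: norm_mult F_def infdist_nonneg intro!: mult_left_le)
 qed (use G in auto)
 moreover have "(LINT x|tor. G x * of_real (F n (torus_embed x))) = 0" for n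
  by (rule integral_torus_embed_eq_0[OF G F])
 ultimately show ?thesis by (simp add: LIMSEQ_const_iff)
qed simp

text \<open>The argument has range (-pi, pi], which matches the half-open cell. It is continuous off
  the nonpositive reals and equals pi at -1; prescribing pi on the whole half-line makes the inverse
  Borel.\<close>

lemma torus_embed_left_inverse:
 "\<exists>L\<in>bm. \<forall>x\<in>unit_cell. L (torus_embed x) = (x :: real^'d::finite)"
proof
 define A where "A = (%z. if z : \<real>\<^sub>\<le>\<^sub>0 then pi else Arg z)"
 have [measurable]: "A : bm"
  unfolding A_def by (rule borel_measurable_continuous_on_if)
   (auto intro!: continuous_intros closed_nonpos_Reals_complex continuous_on_Arg)
 define L where "L = (%z::complex^'d. (\<chi> i. A (z $ i) / (2 * pi)) :: real^'d)"
 have [measurable]: "(%z::complex^'d. z $ i) : bm" for i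
  by (intro borel_measurable_continuous_onI continuous_intros)
 show "L : bm"
  by (subst borel_measurable_euclidean_space) (auto simp: L_def Basis_vec_def inner_axis)
 have "A (cis (2 * pi * t)) = 2 * pi * t" if "- 1/2 < t" "t <= 1/2" for t
 proof -
  have "2 * pi * t > 2 * pi * (- 1/2)" "2 * pi * t <= 2 * pi * (1/2)"
   using that by (intro mult_strict_left_mono mult_left_mono; simp)+
  then have t: "2 * pi * t : {-pi<..pi}" by simp
  then have arg: "Arg (cis (2 * pi * t)) = 2 * pi * t" by (rule Arg_cis)
  have "Arg (cis (2 * pi * t)) = pi" if neg: "cis (2 * pi * t) : \<real>\<^sub>\<le>\<^sub>0"
  proof -
   obtain r where r: "cis (2 * pi * t) = of_real r" "r <= 0" using neg by (auto elim!: nonpos_Reals_cases)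
   then have "r ~= 0" by (metis cis_neq_zero of_real_0)
   then show ?thesis using r by (simp add: Arg_of_real)
  qed
  then show ?thesis using arg by (auto simp: A_def)
 qed
 then show "\<forall>x\<in>unit_cell. L (torus_embed x) = x"
  by (auto simp: L_def torus_embed_def unit_cell_def vec_eq_iff)
qed

text \<open>The integral of \<open>G\<close> vanishes over preimages of closed sets under
  \<open>torus_embed\<close>. Closed sets are stable under intersection and generate the Borel sets,
  so by a Dynkin argument it vanishes over preimages of all Borel sets. On the cell every Borel set
  is such a preimage, by the Borel left inverse.\<close>

lemma fcoeff_unique:
 assumes G: "integrable tor G" "!!k. k : int_lattice ==> fcoeff G k = 0"
 shows "AE x in tor. G x = (0::complex)"
proof -
 interpret prob_space "tor :: (real^'a) measure" by (rule prob_space_tor)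
 have "(LINT x:X|tor. G x) = 0" if "X : sets tor" for X
 proof -
 from that have [measurable]: "X : sets borel" by simp
 have [measurable]: "G : bm" using borel_measurable_integrable[OF G(1)] by (simp add: measurable_tor_eq)
 obtain L where [measurable]: "L : bm" and L: "!!x. x : unit_cell ==> L (torus_embed x) = (x::real^'a)"
  using torus_embed_left_inverse by blast
 define I where "I = (%Y. (LINT x|tor. indicator Y (torus_embed x) *\<^sub>R G x))"
 have int: "integrable tor (%x. indicator Y (torus_embed x) *\<^sub>R G x)" if [measurable]: "Y : sets borel" for Y
  by (rule Bochner_Integration.integrable_bound[OF G(1)]) (auto simp: indicator_def)
 have "I Y = 0" if "Y : sets borel" for Y
 proof -
  have "Y : sigma_sets UNIV (Collect closed)" using that by (simp add: borel_eq_closed)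
  then show ?thesis
  proof (rule sigma_sets_induct_disjoint[rotated 2])
   show "I {} = 0" by (simp add: I_def)
   show "I Y = 0" if "Y : Collect closed" for Y
    using integral_torus_embed_closed_eq_0[OF G, of Y] that by (simp add: I_def)
   show "I (UNIV - Y) = 0" if "Y : sigma_sets UNIV (Collect closed)" "I Y = 0" for Y
   proof -
    have Y: "Y : sets borel" using that by (simp add: borel_eq_closed)
    have "I (UNIV - Y) = (LINT x|tor. indicator UNIV (torus_embed x) *\<^sub>R G x - indicator Y (torus_embed x) *\<^sub>R G x)"
     unfolding I_def by (intro Bochner_Integration.integral_cong) (auto simp: indicator_def)
    also have "... = I UNIV - I Y" unfolding I_def using int[of UNIV] int[OF Y] by (intro Bochner_Integration.integral_diff) auto
    also have "... = 0" using integral_torus_embed_closed_eq_0[OF G, of UNIV] that by (simp add: I_def)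
    finally show ?thesis .
   qed
   show "I (\<Union>i. Y i) = 0" if Y: "disjoint_family Y" "range Y \<subseteq> sigma_sets UNIV (Collect closed)" "!!i. I (Y i) = 0" for Y :: "nat => _"
   proof -
    have Yb: "Y i : sets borel" for i using Y(2) by (auto simp: borel_eq_closed)
    then have Ub: "(\<Union>i. Y i) : sets borel" by auto
    define T where "T = (%i. torus_embed -` Y i :: (real^'a) set)"
    have "(LINT x:(\<Union>i. T i)|tor. G x) = (\<Sum>i. (LINT x:T i|tor. G x))"
    proof (rule lebesgue_integral_countable_add)
     show "T i : sets tor" for i unfolding T_def using measurable_sets_borel[OF borel_measurable_torus_embed Yb] by simp
     show "T i \<inter> T j = {}" if "i ~= j" for i j using Y(1) that by (auto simp: T_def disjoint_family_on_def)
     show "set_integrable tor (\<Union>i. T i) G"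
      using int[OF Ub] by (simp add: set_integrable_def T_def indicator_def vimage_def)
    qed
    moreover have "I Z = (LINT x:(torus_embed -` Z)|tor. G x)" for Z
     by (simp add: I_def set_lebesgue_integral_def indicator_def)
    ultimately show ?thesis using Y(3) by (simp add: T_def vimage_UN)
   qed
  qed (auto simp: Int_stable_def)
 qed
 then have "I (L -` X) = 0" by (simp add: measurable_sets_borel[OF \<open>L : _\<close>])
 moreover have "I (L -` X) = (LINT x|tor. indicator X x *\<^sub>R G x)"
  unfolding I_def
 proof (rule integral_cong_AE)
  have "L -` X : sets borel" by (simp add: measurable_sets_borel[OF \<open>L : _\<close>])
  then show "(%x. indicator (L -` X) (torus_embed x) *\<^sub>R G x) : borel_measurable tor"
   by (intro borel_measurable_integrable int)
  show "AE x in tor. indicator (L -` X) (torus_embed x) *\<^sub>R G x = indicator X x *\<^sub>R G x"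
   unfolding AE_tor_iff by (rule AE_I2) (simp add: L indicator_def)
 qed measurable
 ultimately show "(LINT x:X|tor. G x) = 0" by (simp add: set_lebesgue_integral_def)
 qed
 then show ?thesis by (rule density_zero[OF G(1)])
qed

section \<open>Conjugate exponents, mixed norms and lattice convolutions\<close>

definition conj_exp :: "ennreal => real => bool" where
 "conj_exp p q \<longleftrightarrow> (p = infy \<and> q = 1) \<or> (p ~= infy \<and> enn2real p >= 2 \<and> q = enn2real p / (enn2real p - 1))"

lemma conj_expI:
 assumes p: "2 <= p" and q: "1 / p + 1 / ennreal q = 1"
 shows "conj_exp p q"
proof (cases p)
 case (real P)
 then have P: "P >= 2" using p by simp
 \<comment> \<open>For q <= 0 \<open>ennreal q\<close> is 0 and its reciprocal is infinite.\<close>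
 have "q > 0"
 proof (rule ccontr)
  assume "\<not> q > 0"
  then have "ennreal q = 0" by (simp add: ennreal_neg)
  then show False using q by simp
 qed
 then have "1 / ennreal q = ennreal (1 / q)" "1 / p = ennreal (1 / P)"
  using real P by (simp_all add: divide_ennreal flip: ennreal_1)
 then have "ennreal (1 / P + 1 / q) = ennreal 1"
  using q P \<open>q > 0\<close> by simp
 then have "1 / P + 1 / q = 1"
  using P \<open>q > 0\<close> by (subst (asm) ennreal_inj) auto
 then have "q = P / (P - 1)" using P \<open>q > 0\<close> by (simp add: field_simps)
 then show ?thesis using real P by (simp add: conj_exp_def)
next
 case top
 then have *: "1 / ennreal q = 1" using q by simp
 have "q > 0"
 proof (rule ccontr)
  assume "\<not> q > 0"
  then have "ennreal q = 0" by (simp add: ennreal_neg)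
  then show False using * by simp
 qed
 then have "1 / ennreal q = ennreal (1 / q)"
  by (simp add: divide_ennreal flip: ennreal_1)
 then have "ennreal (1 / q) = ennreal 1" using * by simp
 then have "1 / q = 1" using \<open>q > 0\<close> by (subst (asm) ennreal_inj) auto
 then show ?thesis using top by (simp add: conj_exp_def)
qed

lemma conj_exp_facts:
 assumes "conj_exp p q"
 shows "1 <= p" "2 <= p" "1 <= q" "0 < q" "1 <= ennreal q" "ennreal q ~= infy" "enn2real (ennreal q) = q"
  and "p ~= infy ==> enn2real p >= 2" "p ~= infy ==> enn2real p > 0" "p ~= infy ==> q * (enn2real p - 1) = enn2real p" "p ~= infy ==> q <= enn2real p"
  "p = infy ==> q = 1" "p ~= infy ==> q = enn2real p / (enn2real p - 1)"
proof -
 have *: "p = infy \<and> q = 1 \<or> (\<exists>P. p = ennreal P \<and> P >= 2 \<and> q = P / (P - 1) \<and> 1 <= q \<and> q <= P)"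
 proof (cases p)
  case (real P)
  then have P: "P >= 2" "q = P / (P - 1)" using assms by (auto simp: conj_exp_def)
  moreover have "P / (P - 1) <= P"
   using P by (simp add: divide_le_eq)
  ultimately show ?thesis using real by (auto simp: le_divide_eq)
 qed (use assms in \<open>auto simp: conj_exp_def\<close>)
 have ge: "ennreal 1 <= ennreal P" "ennreal 2 <= ennreal P" if "P >= 2" for P
  using that by (auto intro!: ennreal_leI)
 show "1 <= p" "2 <= p" "1 <= q" "0 < q" "1 <= ennreal q" "ennreal q ~= infy" "enn2real (ennreal q) = q"
  and "p ~= infy ==> enn2real p >= 2" "p ~= infy ==> enn2real p > 0" "p ~= infy ==> q * (enn2real p - 1) = enn2real p" "p ~= infy ==> q <= enn2real p"
  "p = infy ==> q = 1" "p ~= infy ==> q = enn2real p / (enn2real p - 1)"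
  using * ge by (auto simp: ennreal_ge_1)
qed

lemma Lp_enorm_infinity_AE: "p = infy ==> AE x in M. u x <= Lp_enorm p M u"
 using Lp_enorm_top_AE[of u M] by simp

lemma Lp_enorm_eq_power_q:
 assumes "conj_exp p q"
 shows "ennpowr (Lp_enorm (ennreal q) M u) q = (\<integral>\<^sup>+x. ennpowr (u x) q \<partial>M)"
 using Lp_enorm_eq_power[of "ennreal q" M u] conj_exp_facts[OF assms] by simp

lemma Hausdorff_Young_Lp:
 assumes "conj_exp p q"
 shows "\<exists>C>0. \<forall>G::real^'d::finite => complex. G : bm -->
  Lp_enorm p latm (%k. enorm (fcoeff G k)) <= ennreal C * Lt q (%x. enorm (G x))"
proof (cases "p = infy")
 case True
 then have q: "q = 1" using conj_exp_facts[OF assms] by simp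
 have "Lp_enorm p latm (%k. enorm (fcoeff G k)) <= ennreal 1 * Lt q (%x. enorm (G x))"
  if [measurable]: "G : bm" for G :: "real^'d => complex"
  using norm_fcoeff_le[OF that] True
  by (intro Lp_enorm_leI) (auto simp: q Lp_enorm_def)
 then show ?thesis by (intro exI[of _ 1]) auto
next
 case False
 define P where "P = enn2real p"
 note f = conj_exp_facts[OF assms]
 have P: "P >= 2" "q = P / (P - 1)" "q * (P - 1) = P" using f(8,10,13) False by (auto simp: P_def)
 obtain C where C: "C > 0" "!!G::real^'d => complex. G : bm ==> 
  (SUML k. ennreal (cmod (fcoeff G k) powr P)) <= ennreal C * ennpowr (INTT x. ennreal (cmod (G x) powr q)) (P - 1)"
  using Hausdorff_Young_tor[OF P(1,2)] by blast
 have "Lp_enorm p latm (%k. enorm (fcoeff G k)) <= ennreal (C powr (1 / P)) * Lt q (%x. enorm (G x))"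
  if [measurable]: "G : bm" for G :: "real^'d => complex"
 proof (rule Lp_enorm_leI)
  have "(SUML k. ennpowr (enorm (fcoeff G k)) P) <= ennreal C * ennpowr (INTT x. ennpowr (enorm (G x)) q) (P - 1)"
   using C(2)[OF that] by (simp add: ennpowr_ennreal)
  also have "... = ennpowr (ennreal (C powr (1 / P)) * Lt q (%x. enorm (G x))) P"
   using P(1) C(1) unfolding Lp_enorm_eq_power_q[OF assms, symmetric] ennpowr_mult ennpowr_ennpowr P(3)
   by (simp add: ennpowr_ennreal powr_powr)
  finally show "(SUML k. ennpowr (enorm (fcoeff G k)) (enn2real p)) \<le>
   ennpowr (ennreal (C powr (1 / P)) * Lt q (%x. enorm (G x))) (enn2real p)"
   by (simp add: P_def)
 qed (use f False in auto)
 then show ?thesis using C(1) by (intro exI[of _ "C powr (1 / P)"]) auto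
qed

lemma Lp_enorm_latm_ge:
 assumes "1 <= p" "k : int_lattice"
 shows "u k <= Lp_enorm p latm u"
proof (cases "p = infy")
 case True
 then show ?thesis using Lp_enorm_top_AE[of u latm] assms by (simp add: AE_count_space)
next
 case False
 note P = ennreal_ge_1_real(1)[OF assms(1) False]
 have "ennpowr (u k) (enn2real p) = (SUML l. ennpowr (u l) (enn2real p) * indicator {k} l)"
  using assms by (subst nn_integral_indicator_finite) auto
 also have "... <= (SUML l. ennpowr (u l) (enn2real p))"
  by (intro nn_integral_mono) (auto simp: indicator_def)
 finally show ?thesis using P by (simp add: ennpowr_le_iff flip: Lp_enorm_eq_power[OF assms(1) False])
qed

lemma Lp_enorm_latm_minus:
 assumes "1 <= p"
 shows "Lp_enorm p latm (%k. u (- k)) = Lp_enorm p latm u"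
proof -
 have *: "Lp_enorm p latm (%k. u (- k)) <= Lp_enorm p latm u" for u
 proof (rule Lp_enorm_leI)
  show "AE x in latm. u (- x) <= Lp_enorm p latm u"
   using Lp_enorm_latm_ge[OF assms, of _ u] by (auto simp: AE_count_space)
  show "(SUML x. ennpowr (u (- x)) (enn2real p)) <= ennpowr (Lp_enorm p latm u) (enn2real p)" if "p ~= infy"
   using nn_integral_latm_minus[of "%x. ennpowr (u x) (enn2real p)"] by (simp add: Lp_enorm_eq_power[OF assms that])
 qed (use assms in auto)
 from *[of u] *[of "%k. u (- k)"] show ?thesis by (intro antisym) auto
qed

lemma Lp_enorm_latm_measurable:
 assumes "1 <= p" and u: "!!k. k : int_lattice ==> u k : borel_measurable M"
 shows "(%x. Lp_enorm p latm (%k. u k x)) : borel_measurable M"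
proof (cases "p = infy")
 case False
 then show ?thesis
  using borel_measurable_nn_integral_latm[of "%k x. ennpowr (u k x) (enn2real p)" M] u
  unfolding Lp_enorm_def by simp
next
 case True
 have "Lp_enorm p latm (%k. u k x) = (SUP k\<in>int_lattice. u k x)" for x
 proof (rule antisym)
  show "Lp_enorm p latm (%k. u k x) <= (SUP k\<in>int_lattice. u k x)"
   using True assms by (intro Lp_enorm_leI) (auto simp: AE_count_space intro: SUP_upper)
  show "(SUP k\<in>int_lattice. u k x) <= Lp_enorm p latm (%k. u k x)"
   using Lp_enorm_latm_ge[OF assms(1)] by (intro SUP_least)
 qed
 then show ?thesis
  using u by (simp only:) (intro borel_measurable_SUP countable_int_lattice)
qed

text \<open>The space splits into the cell times the lattice, so the norm is iterated: over the
  fibre x + k, then over x in the cell.\<close>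

lemma Lp_enorm_lborel_fibers:
 assumes p: "1 <= p" and [measurable]: "u : bm"
 shows "Lp_enorm p lborel u <= Lp_enorm p tor (%x. Lp_enorm p latm (%k. u (x + k)))"
proof (rule Lp_enorm_leI)
 assume pt: "p = infy"
 have "AE x in tor. Lp_enorm p latm (%k. u (x + k)) <= Lp_enorm p tor (%x. Lp_enorm p latm (%k. u (x + k)))"
  by (rule Lp_enorm_infinity_AE[OF pt])
 then have "AE x in tor. \<forall>k\<in>int_lattice. u (x + k) <= Lp_enorm p tor (%x. Lp_enorm p latm (%k. u (x + k)))"
 proof eventually_elim
  case (elim x)
  show ?case
  proof
   fix k :: "real^'a" assume "k : int_lattice"
   from Lp_enorm_latm_ge[OF p this, of "%k. u (x + k)"] elim
   show "u (x + k) <= Lp_enorm p tor (%x. Lp_enorm p latm (%k. u (x + k)))"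
    by (rule order_trans)
  qed
 qed
 then show "AE x in lborel. u x <= Lp_enorm p tor (%x. Lp_enorm p latm (%k. u (x + k)))"
  by (subst AE_tor_lattice_iff)
next
 assume pt: "p ~= infy"
 have "(INTR x. ennpowr (u x) (enn2real p)) = (INTT x. (SUML k. ennpowr (u (x + k)) (enn2real p)))"
  by (rule nn_integral_periodize[symmetric]) measurable
 also have "... = (INTT x. ennpowr (Lp_enorm p latm (%k. u (x + k))) (enn2real p))"
  by (simp add: Lp_enorm_eq_power[OF p pt])
 also have "... = ennpowr (Lp_enorm p tor (%x. Lp_enorm p latm (%k. u (x + k)))) (enn2real p)"
  by (simp add: Lp_enorm_eq_power[OF p pt])
 finally show "(INTR x. ennpowr (u x) (enn2real p)) <= ennpowr (Lp_enorm p tor (%x. Lp_enorm p latm (%k. u (x + k)))) (enn2real p)"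
  by simp
qed (use p in auto)

lemma Lp_enorm_tor_const_le:
 assumes "1 <= p"
 shows "Lp_enorm p (tor :: (real^'d::finite) measure) (%x. c) <= c"
proof -
 interpret prob_space "tor :: (real^'d) measure" by (rule prob_space_tor)
 show ?thesis by (rule Lp_enorm_leI) (use assms emeasure_space_1 in auto)
qed

text \<open>Along a fibre x + l the sum is a discrete convolution of \<open>c\<close> with the
  sequence w(x + m). Jensen's inequality with weights w(x + m) bounds its norm over l by the norm of
  \<open>c\<close> times the periodization of \<open>w\<close> at x, and then the L_p norm in x is
  taken. For w = |\<phi>| that last factor is the norm which defines \<open>calLp\<close>.\<close>

lemma Lp_enorm_lattice_convolution:
 assumes p: "1 <= p" and [measurable]: "w : bm"
 shows "Lp_enorm p lborel (%x. SUML k. c k * w (x + k)) <= Lp_enorm p latm c * Lp_enorm p tor (%x. SUML k. w (x + k))"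
proof -
 define A where "A = (%x. SUML k. w (x + k))"
 have [measurable]: "A : bm"
  unfolding A_def by (rule borel_measurable_nn_integral_latm) measurable
 define V where "V = (%x. SUML k. c k * w (x + k))"
 have [measurable]: "V : bm"
  unfolding V_def by (rule borel_measurable_nn_integral_latm) measurable
 have shift: "V (x + l) = (SUML m. c (m - l) * w (x + m))" if "l : int_lattice" for x l
  using nn_integral_latm_shift[OF that, of "%m. c (m - l) * w (x + m)"] by (simp add: V_def add_ac)
 have "Lp_enorm p lborel V <= Lp_enorm p tor (%x. Lp_enorm p latm (%k. V (x + k)))"
  by (rule Lp_enorm_lborel_fibers[OF p]) measurable
 also have "... <= Lp_enorm p tor (%x. Lp_enorm p latm c * A x)"
 proof (rule Lp_enorm_AE_mono[OF p])
  show "AE x in tor. Lp_enorm p latm (%k. V (x + k)) <= Lp_enorm p latm c * A x"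
  proof (rule AE_I2, rule Lp_enorm_leI[OF p])
   fix x
   assume pt: "p = infy"
   have "V (x + l) <= Lp_enorm p latm c * A x" if l: "l : int_lattice" for l
   proof -
    have "V (x + l) <= (SUML m. Lp_enorm p latm c * w (x + m))"
     unfolding shift[OF l] using l by (intro nn_integral_mono mult_right_mono Lp_enorm_latm_ge[OF p]) auto
    also have "... = Lp_enorm p latm c * A x" by (simp add: nn_integral_cmult A_def)
    finally show ?thesis .
   qed
   then show "AE l in latm. V (x + l) <= Lp_enorm p latm c * A x" by (simp add: AE_count_space)
  next
   fix x
   assume pt: "p ~= infy"
   define P where "P = enn2real p"
   have P: "P >= 1" using ennreal_ge_1_real(1)[OF p pt] by (simp add: P_def)
   have "(SUML l. ennpowr (V (x + l)) P) <= (SUML l. ennpowr (A x) (P - 1) * (SUML m. ennpowr (c (m - l)) P * w (x + m)))"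
   proof (rule nn_integral_mono)
    fix l :: "real^'a" assume "l : space latm"
    then show "ennpowr (V (x + l)) P <= ennpowr (A x) (P - 1) * (SUML m. ennpowr (c (m - l)) P * w (x + m))"
     using nn_integral_Jensen[of "%m. w (x + m)" latm "%m. c (m - l)" P] P by (simp add: shift A_def)
   qed
   also have "... = ennpowr (A x) (P - 1) * (SUML l. (SUML m. ennpowr (c (m - l)) P * w (x + m)))"
    by (simp add: nn_integral_cmult)
   also have "(SUML l. (SUML m. ennpowr (c (m - l)) P * w (x + m))) = (SUML m. (SUML l. ennpowr (c (m - l)) P * w (x + m)))"
    by (rule nn_integral_latm_swap) simp
   also have "... = (SUML m. (SUML l. ennpowr (c l) P) * w (x + m))"
   proof (rule nn_integral_cong)
    fix m :: "real^'a" assume "m : space latm"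
    then have m: "m : int_lattice" by simp
    have "(SUML l. ennpowr (c (m - l)) P) = (SUML l. ennpowr (c l) P)"
     using nn_integral_latm_minus[of "%l. ennpowr (c (m + l)) P"] nn_integral_latm_shift[OF m, of "%l. ennpowr (c l) P"]
     by (simp add: add.commute)
    then show "(SUML l. ennpowr (c (m - l)) P * w (x + m)) = (SUML l. ennpowr (c l) P) * w (x + m)"
     by (simp add: nn_integral_multc)
   qed
   also have "... = ennpowr (Lp_enorm p latm c) P * A x"
    by (simp add: nn_integral_cmult A_def P_def Lp_enorm_eq_power[OF p pt])
   also have "ennpowr (A x) (P - 1) * (ennpowr (Lp_enorm p latm c) P * A x) = ennpowr (Lp_enorm p latm c * A x) P"
   proof -
    have "ennpowr (A x) (P - 1) * A x = ennpowr (A x) P"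
     using ennpowr_add[of "A x" "P - 1" 1] by (cases "A x = 0 \<or> A x = top") auto
    then show ?thesis unfolding ennpowr_mult by (metis mult.assoc mult.commute)
   qed
   finally show "(SUML l. ennpowr (V (x + l)) (enn2real p)) <= ennpowr (Lp_enorm p latm c * A x) (enn2real p)"
    by (simp add: P_def)
  qed simp
  show "(%x. Lp_enorm p latm (%k. V (x + k))) : borel_measurable tor"
   by (rule Lp_enorm_latm_measurable[OF p]) measurable
 qed
 also have "... <= Lp_enorm p latm c * Lp_enorm p tor A"
  by (rule Lp_enorm_cmult_le[OF p]) measurable
 finally show ?thesis by (simp add: V_def A_def)
qed

text \<open>Minkowski's integral inequality for L_p in x and L_q in y with q <= p, from Jensen's
  inequality for the exponent p/q and the weight u^q, followed by Fubini. The bound by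
  \<open>K\<close> is asked only where \<open>u\<close> is nonzero, because the symbol is controlled
  only on the support of g.\<close>

lemma Lp_enorm_mixed_le:
 fixes u :: "real^'d::finite => ennreal" and F :: "real^'d => real^'d => ennreal"
 assumes pq: "conj_exp p q"
  and [measurable]: "u : bm" "(%(x, y). F x y) : borel_measurable (tor \<Otimes>\<^sub>M tor)"
  and K: "AE y in tor. u y ~= 0 --> Lp_enorm p tor (%x. F x y) <= K"
 shows "Lp_enorm p tor (%x. Lt q (%y. u y * F x y)) <= K * Lt q u"
proof (rule Lp_enorm_leI)
 note f = conj_exp_facts[OF pq]
 interpret t: prob_space "tor :: (real^'d) measure" by (rule prob_space_tor)
 interpret pair_sigma_finite "tor :: (real^'d) measure" "tor :: (real^'d) measure" ..
 show "1 <= p" by (rule f)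
 have "(%x. INTT y. ennpowr (u y * F x y) q) : borel_measurable tor" by measurable
 then show "(%x. Lt q (%y. u y * F x y)) : borel_measurable tor"
  using f by (simp add: Lp_enorm_def)
 {
  assume pt: "p = infy"
  have "AE y in tor. AE x in tor. u y * F x y <= u y * K"
   using K
  proof eventually_elim
   case (elim y)
   show ?case
   proof (cases "u y = 0")
    case False
    have "AE x in tor. F x y <= Lp_enorm p tor (%x. F x y)" by (rule Lp_enorm_infinity_AE[OF pt])
    then show ?thesis using elim False by (auto elim!: eventually_mono intro!: mult_left_mono)
   qed simp
  qed
  moreover have "Measurable.pred (tor \<Otimes>\<^sub>M tor) (%z. u (snd z) * F (fst z) (snd z) <= u (snd z) * K)"
  proof -
   have [measurable]: "(%z. F (fst z) (snd z)) : borel_measurable (tor \<Otimes>\<^sub>M tor)"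
    using assms(3) by (simp add: split_beta')
   show ?thesis by measurable
  qed
  ultimately have "AE x in tor. AE y in tor. u y * F x y <= u y * K"
   using AE_commute[of "%x y. u y * F x y <= u y * K"] unfolding pred_def by blast
  then show "AE x in tor. Lt q (%y. u y * F x y) <= K * Lt q u"
  proof eventually_elim
   case (elim x)
   have "Lt q (%y. u y * F x y) <= Lt q (%y. K * u y)"
   proof (cases "(%y. F x y) : borel_measurable tor")
    case True
    have "(%y. u y * F x y) : borel_measurable tor" using True by measurable
    then show ?thesis using elim f by (intro Lp_enorm_AE_mono) (auto simp: mult.commute)
   next
    case False
    have "(%y. case (x, y) of (x, y) => F x y) : borel_measurable tor" by measurable
    then show ?thesis using False by simp
   qed
   also have "... <= K * Lt q u"
    by (rule Lp_enorm_cmult_le) (use f in auto)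
   finally show ?case .
  qed
 }
 assume pt: "p ~= infy"
 define P where "P = enn2real p"
 have P: "P >= 2" "q <= P" using f(8,11) pt by (auto simp: P_def)
 define s where "s = P / q"
 have s: "s >= 1" "q * s = P" using P f(4) by (auto simp: s_def)
 define U where "U = (INTT y. ennpowr (u y) q)"
 have "(INTT x. ennpowr (Lt q (%y. u y * F x y)) P) = (INTT x. ennpowr (INTT y. ennpowr (F x y) q * ennpowr (u y) q) s)"
 proof (rule nn_integral_cong)
  fix x
  have "ennpowr (Lt q (%y. u y * F x y)) P = ennpowr (ennpowr (Lt q (%y. u y * F x y)) q) s"
   by (simp add: s)
  then show "ennpowr (Lt q (%y. u y * F x y)) P = ennpowr (INTT y. ennpowr (F x y) q * ennpowr (u y) q) s"
   by (simp only: Lp_enorm_eq_power_q[OF pq] ennpowr_mult mult.commute)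
 qed
 also have "... <= (INTT x. ennpowr U (s - 1) * (INTT y. ennpowr (F x y) P * ennpowr (u y) q))"
 proof (rule nn_integral_mono)
  fix x
  have [measurable]: "(%y. F x y) : borel_measurable tor"
  proof -
   have "(%y. case (x, y) of (x, y) => F x y) : borel_measurable tor" by measurable
   then show ?thesis by simp
  qed
  show "ennpowr (INTT y. ennpowr (F x y) q * ennpowr (u y) q) s <= ennpowr U (s - 1) * (INTT y. ennpowr (F x y) P * ennpowr (u y) q)"
   using nn_integral_Jensen[of "%y. ennpowr (u y) q" tor "%y. ennpowr (F x y) q" s] s by (simp add: U_def)
 qed
 also have "... = ennpowr U (s - 1) * (INTT x. (INTT y. ennpowr (F x y) P * ennpowr (u y) q))"
  by (rule nn_integral_cmult) measurable
 also have "(INTT x. (INTT y. ennpowr (F x y) P * ennpowr (u y) q)) = (INTT y. (INTT x. ennpowr (F x y) P * ennpowr (u y) q))"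
  by (rule Fubini'[symmetric]) measurable
 also have "... <= (INTT y. ennpowr K P * ennpowr (u y) q)"
 proof (rule nn_integral_mono_AE)
  show "AE y in tor. (INTT x. ennpowr (F x y) P * ennpowr (u y) q) <= ennpowr K P * ennpowr (u y) q"
   using K
  proof eventually_elim
   case (elim y)
   have [measurable]: "(%x. F x y) : borel_measurable tor"
   proof -
    have "(%x. case (x, y) of (x, y) => F x y) : borel_measurable tor" by measurable
    then show ?thesis by simp
   qed
   show ?case
   proof (cases "u y = 0")
    case False
    have "(INTT x. ennpowr (F x y) P * ennpowr (u y) q) = ennpowr (Lp_enorm p tor (%x. F x y)) P * ennpowr (u y) q"
     by (simp add: nn_integral_multc P_def Lp_enorm_eq_power[OF f(1) pt])
    also have "... <= ennpowr K P * ennpowr (u y) q"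
     using elim False P by (intro mult_right_mono ennpowr_mono) auto
    finally show ?thesis .
   qed simp
  qed
 qed
 also have "... = ennpowr K P * U" unfolding U_def by (rule nn_integral_cmult) measurable
 also have "ennpowr U (s - 1) * (ennpowr K P * U) = ennpowr (K * Lt q u) P"
 proof -
  have "ennpowr U (s - 1) * U = ennpowr U s"
   using ennpowr_add[of U "s - 1" 1] by (cases "U = 0 \<or> U = top") auto
  also have "... = ennpowr (Lt q u) P"
   by (simp add: U_def s flip: Lp_enorm_eq_power_q[OF pq])
  finally show ?thesis unfolding ennpowr_mult by (metis mult.assoc mult.commute)
 qed
 finally show "(INTT x. ennpowr (Lt q (%y. u y * F x y)) (enn2real p)) <= ennpowr (K * Lt q u) (enn2real p)"
  by (auto simp: P_def mult_left_mono order_trans)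
qed

section \<open>Lattice sums of inverse powers\<close>

text \<open>(1+r) powr (-s) is the integral of s t powr (-s-1) over t >= 1 + r. After Fubini the
  points y contributing at level t lie in a ball of volume proportional to t^DIM('a), and the
  remaining integral over t >= 1 converges for s > DIM('a).\<close>

lemma nn_integral_one_plus_norm_powr:
 fixes s :: real
 assumes s: "s > DIM('a)"
 shows "(\<integral>\<^sup>+y. ennreal ((1 + norm y) powr (- s)) \<partial>(lborel :: 'a::euclidean_space measure)) < infy"
proof -
 have s0: "s > 0" using s by (metis DIM_positive less_trans of_nat_0_less_iff)
 define V where "V = unit_ball_vol (DIM('a))"
 have V: "V >= 0" by (simp add: V_def)
 have layer: "ennreal ((1 + r) powr (- s)) = (INTR t. ennreal (s * t powr (- s - 1)) * indicator {1 + r..} t)"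
  if "r >= 0" for r
 proof -
  have "((%t. s * t powr (- s - 1)) has_integral s * (- ((1 + r) powr (- s - 1 + 1)) / (- s - 1 + 1))) {1 + r..}"
   using s0 that by (intro has_integral_mult_right has_integral_powr_to_inf) auto
  then have "((%t. s * t powr (- s - 1)) has_integral (1 + r) powr (- s)) {1 + r..}"
   using s0 by simp
  then show ?thesis
   using s0 by (intro nn_integral_has_integral_lebesgue'[symmetric]) auto
 qed
 have "(\<integral>\<^sup>+y. ennreal ((1 + norm y) powr (- s)) \<partial>(lborel :: 'a measure))
   = (\<integral>\<^sup>+y. (INTR t. ennreal (s * t powr (- s - 1)) * indicator {1 + norm y..} t) \<partial>(lborel :: 'a measure))"
  by (simp add: layer)
 also have "... = (INTR t. \<integral>\<^sup>+y. ennreal (s * t powr (- s - 1)) * indicator {1 + norm y..} t \<partial>(lborel :: 'a measure))"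
  unfolding atLeast_def by (rule lborel_pair.Fubini'[symmetric]) measurable
 also have "... <= (INTR t. ennreal (s * V) * (ennreal (t powr (real DIM('a) - s - 1)) * indicator {1..} t))"
 proof (rule nn_integral_mono)
  fix t :: real
  show "(\<integral>\<^sup>+y. ennreal (s * t powr (- s - 1)) * indicator {1 + norm y..} t \<partial>(lborel :: 'a measure))
    <= ennreal (s * V) * (ennreal (t powr (real DIM('a) - s - 1)) * indicator {1..} t)"
  proof (cases "t >= 1")
   case True
   have "(\<integral>\<^sup>+y. ennreal (s * t powr (- s - 1)) * indicator {1 + norm y..} t \<partial>(lborel :: 'a measure))
     <= (\<integral>\<^sup>+y. ennreal (s * t powr (- s - 1)) * indicator (cball 0 t) y \<partial>(lborel :: 'a measure))"
    by (intro nn_integral_mono mult_left_mono) (auto simp: indicator_def)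
   also have "... = ennreal (s * t powr (- s - 1)) * ennreal (V * t ^ DIM('a))"
    using True by (subst nn_integral_cmult_indicator) (auto simp: emeasure_cball V_def)
   also have "... = ennreal (s * V) * ennreal (t powr (real DIM('a) - s - 1))"
   proof -
    have "t powr (real DIM('a) - s - 1) = t powr (- s - 1) * t powr (real DIM('a))"
     unfolding powr_add[symmetric] by (rule arg_cong[where f = "(powr) t"]) simp
    then show ?thesis using True s0 V by (simp add: ennreal_mult[symmetric] powr_realpow mult_ac)
   qed
   finally show ?thesis using True by simp
  next
   case False
   then have "indicator {1 + norm y..} t = (0 :: ennreal)" for y :: 'a
    using norm_ge_zero[of y] by (auto simp: indicator_def simp del: norm_ge_zero)
   then show ?thesis by (simp only: mult_zero_right nn_integral_const) simp
  qed
 qed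
 also have "... = ennreal (s * V) * (INTR t. ennreal (t powr (real DIM('a) - s - 1)) * indicator {1..} t)"
  by (rule nn_integral_cmult) measurable
 also have "(INTR t. ennreal (t powr (real DIM('a) - s - 1)) * indicator {1..} t) =
   ennreal (- (1 powr (real DIM('a) - s - 1 + 1)) / (real DIM('a) - s - 1 + 1))"
  by (rule nn_integral_has_integral_lebesgue'[OF _ has_integral_powr_to_inf]) (use s in auto)
 finally show ?thesis by (auto simp: ennreal_mult_less_top intro: le_less_trans)
qed

lemma norm_unit_cell_le: "x : unit_cell ==> norm (x :: real^'d::finite) <= real CARD('d)"
proof -
 assume x: "x : unit_cell"
 have "norm x <= (\<Sum>i\<in>UNIV. norm (x $ i))" unfolding norm_vec_def by (rule L2_set_le_sum) simp
 also have "... <= (\<Sum>i\<in>(UNIV::'d set). 1)"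
 proof (rule sum_mono)
  fix i
  have "- 1/2 < x $ i" "x $ i <= 1/2" using x by (auto simp: unit_cell_def)
  then show "norm (x $ i) <= 1" by simp
 qed
 finally show "norm x <= real CARD('d)" by simp
qed

text \<open>The point is uniformity in w. Each term is compared with its average over the unit cell;
  the averages add up to an integral over the whole space, which does not depend on w.\<close>

lemma lattice_sum_norm_powr_bounded:
 fixes s d :: real
 assumes s: "s > real CARD('d::finite)" and d: "d > 0"
 shows "\<exists>K>0. \<forall>w::real^'d. (SUML l. ennreal (norm (w + l) powr (- s) * of_bool (d <= norm (w + l)))) <= ennreal K"
proof -
 interpret prob_space "tor :: (real^'d) measure" by (rule prob_space_tor)
 \<comment> \<open>If norm y >= d and x lies in the cell, then 1 + norm (x + y) <= 1 + CARD('d) +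
   norm y <= c norm y.\<close>
 define c where "c = 1 + (1 + real CARD('d)) / d"
 have c: "c > 0" using d by (simp add: c_def add_pos_nonneg)
 have s0: "s > 0" using s by (meson less_le_trans of_nat_0_le_iff not_le)
 define I where "I = (\<integral>\<^sup>+y. ennreal ((1 + norm y) powr (- s)) \<partial>(lborel :: (real^'d) measure))"
 have I: "I < infy" unfolding I_def by (rule nn_integral_one_plus_norm_powr) (use s in simp)
 have "(SUML l. ennreal (norm (w + l) powr (- s) * of_bool (d <= norm (w + l)))) <= ennreal (c powr s) * I" for w :: "real^'d"
 proof -
  have pt: "ennreal (norm y powr (- s) * of_bool (d <= norm y)) <= (INTT x. ennreal (c powr s) * ennreal ((1 + norm (x + y)) powr (- s)))" for y :: "real^'d"
  proof (cases "d <= norm y")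
   case True
   have "ennreal (norm y powr (- s)) = (\<integral>\<^sup>+x. ennreal (norm y powr (- s)) \<partial>(tor :: (real^'d) measure))"
    using emeasure_space_1 by simp
   also have "... <= (INTT x. ennreal (c powr s) * ennreal ((1 + norm (x + y)) powr (- s)))"
   proof (rule nn_integral_mono_AE)
    show "AE x in tor. ennreal (norm y powr (- s)) <= ennreal (c powr s) * ennreal ((1 + norm (x + y)) powr (- s))"
     unfolding AE_tor_iff
    proof (intro AE_I2 impI)
     fix x :: "real^'d" assume x: "x : unit_cell"
     have y: "norm y > 0" using True d by linarith
     have "1 + norm (x + y) <= 1 + real CARD('d) + norm y"
      using norm_triangle_ineq[of x y] norm_unit_cell_le[OF x] by linarith
     also have "1 + real CARD('d) <= (1 + real CARD('d)) / d * norm y"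
      using mult_left_mono[OF True, of "(1 + real CARD('d)) / d"] d by simp
     finally have le: "1 + norm (x + y) <= c * norm y" by (simp add: c_def algebra_simps)
     have "norm y powr (- s) = c powr s * (c * norm y) powr (- s)"
      using c y by (simp add: powr_mult powr_minus)
     also have "(c * norm y) powr (- s) <= (1 + norm (x + y)) powr (- s)"
      using le s0 by (intro powr_mono2') (auto simp: add_pos_nonneg)
     finally show "ennreal (norm y powr (- s)) <= ennreal (c powr s) * ennreal ((1 + norm (x + y)) powr (- s))"
      using c by (auto simp: ennreal_mult[symmetric] mult_left_mono intro!: ennreal_leI)
    qed
   qed
   finally show ?thesis using True by simp
  qed simp
  have "(SUML l. ennreal (norm (w + l) powr (- s) * of_bool (d <= norm (w + l))))
   <= (SUML l. (INTT x. ennreal (c powr s) * ennreal ((1 + norm (x + (w + l))) powr (- s))))"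
   by (intro nn_integral_mono pt)
  also have "... = (INTT x. (SUML l. ennreal (c powr s) * ennreal ((1 + norm (x + (w + l))) powr (- s))))"
   by (rule nn_integral_latm_swap[symmetric]) measurable
  also have "... = (INTR y. ennreal (c powr s) * ennreal ((1 + norm (y + w)) powr (- s)))"
   by (subst nn_integral_periodize[symmetric]) (auto simp: add_ac)
  also have "... = ennreal (c powr s) * (INTR y. ennreal ((1 + norm (y + w)) powr (- s)))"
   by (rule nn_integral_cmult) measurable
  also have "(INTR y. ennreal ((1 + norm (y + w)) powr (- s))) = I"
   unfolding I_def by (rule nn_integral_lborel_shift) measurable
  finally show ?thesis .
 qed
 note bound = this
 have "ennreal (c powr s) * I < infy" using I by (simp add: ennreal_mult_less_top)
 then obtain K where K: "ennreal (c powr s) * I = ennreal K" "K >= 0" by (cases "ennreal (c powr s) * I") auto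
 show ?thesis
 proof (intro exI[of _ "K + 1"] conjI allI)
  fix w :: "real^'d"
  show "(SUML l. ennreal (norm (w + l) powr (- s) * of_bool (d <= norm (w + l)))) <= ennreal (K + 1)"
   using bound[of w] K by (auto elim!: order_trans intro: ennreal_leI)
 qed (use K in simp)
qed

section \<open>The operator at scale 0 and its error on lattice fibres\<close>

definition inv_fourier :: "(real^'d::finite => complex) => real^'d => complex" where
 "inv_fourier g x = (LINT y|lborel. g y * character x y)"

text \<open>The pairing of \<open>g\<close> with the Fourier transform of the k-th shift at scale 0;
  every scale is later reduced to this one.\<close>

definition symbol_coeff :: "(real^'d::finite => complex) => (real^'d => complex) => real^'d => complex" where
 "symbol_coeff h g k = (LINT y|lborel. g y * cnj (h y) * cnj (character k y))"

text \<open>The operator at scale 0 as a pointwise series. Being an integral over counting measure,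
  it is 0 wherever the series does not converge absolutely; under the standing assumptions of the
  locale below this happens on a null set.\<close>

definition quasi_proj :: "(real^'d::finite => complex) => (real^'d => complex) => (real^'d => complex) => real^'d => complex" where
 "quasi_proj \<phi> h g x = (LINT k|latm. symbol_coeff h g k * \<phi> (x + k))"

text \<open>A Zak transform, normalised to be periodic in \<open>x\<close>; as a function of \<open>x\<close> it has the Fourier
 coefficients $\widehat\varphi(\eta+l)$.\<close>

definition zak :: "(real^'d::finite => complex) => real^'d => real^'d => complex" where
 "zak \<phi> x y = (LINT m|latm. \<phi> (x + m) * cnj (character (x + m) y))"

lemma borel_measurable_character_pair [measurable (raw)]:
 assumes [measurable]: "f : borel_measurable M" "g : borel_measurable M"
 shows "(%z. character (f z) (g z)) : borel_measurable M"
 unfolding character_def cis_conv_exp by measurable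

lemma borel_measurable_zak1 [measurable (raw)]:
 assumes [measurable]: "\<phi> : bm" "f : borel_measurable M" "g : borel_measurable M"
 shows "(%z. zak \<phi> (f z) (g z)) : borel_measurable M"
 unfolding zak_def by (rule borel_measurable_LINT_latm) measurable

lemma borel_measurable_inv_fourier [measurable]:
 assumes [measurable]: "g : bm"
 shows "inv_fourier g : bm"
 unfolding inv_fourier_def by measurable

lemma borel_measurable_quasi_proj [measurable]:
 assumes [measurable]: "\<phi> : bm"
 shows "quasi_proj \<phi> h g : bm"
 unfolding quasi_proj_def by (rule borel_measurable_LINT_latm) measurable

lemma norm_LINT_latm_le: "enorm (LINT k|latm. F k) <= (SUML k. enorm (F k))"
proof (cases "integrable latm F")
 case True
 then show ?thesis
  using integral_norm_bound[of latm F] by (subst nn_integral_eq_integral) (auto intro!: ennreal_leI)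
next
 case False
 then show ?thesis by (simp add: not_integrable_integral_eq)
qed

lemma integrable_latm_iff: "integrable latm F \<longleftrightarrow> (SUML k. enorm (F k)) < infy" for F :: "_ => complex"
 by (simp add: integrable_iff_bounded)

lemma fcoeff_periodize:
 assumes [measurable]: "b : bm" and b: "integrable lborel b" and k: "k : int_lattice"
 shows "fcoeff (%y. LINT l|latm. b (y + l)) k = (LINT y|lborel. b y * cnj (character k y))"
proof -
 have "integrable lborel (%y. b y * cnj (character k y))" using b by simp
 from integral_periodize(4)[OF this]
 have "(LINT y|lborel. b y * cnj (character k y)) = (LINT y|tor. LINT l|latm. b (y + l) * cnj (character k (y + l)))" ..
 also have "... = fcoeff (%y. LINT l|latm. b (y + l)) k"
  unfolding fcoeff_def
 proof (rule Bochner_Integration.integral_cong)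
  fix y :: "real^'a"
  have "(LINT l|latm. b (y + l) * cnj (character k (y + l))) = (LINT l|latm. b (y + l) * cnj (character k y))"
   using k by (intro Bochner_Integration.integral_cong) (simp_all add: character_simps)
  then show "(LINT l|latm. b (y + l) * cnj (character k (y + l))) = (LINT l|latm. b (y + l)) * cnj (character k y)"
   by simp
 qed simp
 finally show ?thesis ..
qed

lemma Lp_enorm_latm_cong:
 assumes "!!k. k : int_lattice ==> u k = v k" "1 <= p"
 shows "Lp_enorm p latm u = Lp_enorm p latm v"
 using assms by (intro Lp_enorm_AE_cong) (auto simp: AE_count_space)

lemma Hausdorff_Young_periodized:
 assumes "conj_exp p q"
 shows "\<exists>C>0. \<forall>b::real^'d::finite => complex. b : bm --> integrable lborel b -->
  Lp_enorm p latm (%k. enorm (LINT y|lborel. b y * cnj (character k y))) \<le>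
   ennreal C * Lt q (%y. SUML l. enorm (b (y + l)))"
proof -
 note f = conj_exp_facts[OF assms]
 obtain C where C: "C > 0" "!!G::real^'d => complex. G : bm ==>
  Lp_enorm p latm (%k. enorm (fcoeff G k)) <= ennreal C * Lt q (%x. enorm (G x))"
  using Hausdorff_Young_Lp[OF assms] by blast
 have "Lp_enorm p latm (%k. enorm (LINT y|lborel. b y * cnj (character k y))) \<le>
   ennreal C * Lt q (%y. SUML l. enorm (b (y + l)))"
  if [measurable]: "b : bm" and b: "integrable lborel b" for b :: "real^'d => complex"
 proof -
  define G where "G = (%y. LINT l|latm. b (y + l))"
  have [measurable]: "G : bm"
   unfolding G_def by (rule borel_measurable_LINT_latm) measurable
  have "Lp_enorm p latm (%k. enorm (LINT y|lborel. b y * cnj (character k y))) = Lp_enorm p latm (%k. enorm (fcoeff G k))"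
   using fcoeff_periodize[OF that] f by (intro Lp_enorm_latm_cong) (simp_all add: G_def)
  also have "... <= ennreal C * Lt q (%x. enorm (G x))"
   by (rule C) measurable
  also have "Lt q (%x. enorm (G x)) <= Lt q (%y. SUML l. enorm (b (y + l)))"
  proof (rule Lp_enorm_AE_mono)
   show "AE x in tor. enorm (G x) <= (SUML l. enorm (b (x + l)))"
    unfolding G_def by (rule AE_I2, rule norm_LINT_latm_le)
   show "1 <= ennreal q" by (rule f)
  qed measurable
  finally show ?thesis by (simp add: mult_left_mono)
 qed
 then show ?thesis using C(1) by blast
qed

lemma character_plus_minus: "character (x + k) y = character x y * cnj (character (- k) y)"
 by (simp add: character_simps)

text \<open>On a fibre x + k the values are, up to the sign of k, the Fourier coefficients of the
  periodization of g(y) e(xy); the resulting bound is the same for every x.\<close>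

lemma Lp_enorm_inv_fourier_le:
 assumes "conj_exp p q"
 shows "\<exists>C>0. \<forall>g::real^'d::finite => complex. g : bm --> integrable lborel g -->
  Lp_enorm p lborel (%x. enorm (inv_fourier g x)) \<le>
   ennreal C * Lt q (%y. SUML l. enorm (g (y + l)))"
proof -
 note f = conj_exp_facts[OF assms]
 obtain C where C: "C > 0" "!!b::real^'d => complex. b : bm ==> integrable lborel b ==>
  Lp_enorm p latm (%k. enorm (LINT y|lborel. b y * cnj (character k y))) \<le>
   ennreal C * Lt q (%y. SUML l. enorm (b (y + l)))"
  using Hausdorff_Young_periodized[OF assms] by blast
 have "Lp_enorm p lborel (%x. enorm (inv_fourier g x)) \<le>
   ennreal C * Lt q (%y. SUML l. enorm (g (y + l)))"
  if [measurable]: "g : bm" and g: "integrable lborel g" for g :: "real^'d => complex"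
 proof -
  define R where "R = ennreal C * Lt q (%y. SUML l. enorm (g (y + l)))"
  have fib: "Lp_enorm p latm (%k. enorm (inv_fourier g (x + k))) <= R" for x
  proof -
   have "Lp_enorm p latm (%k. enorm (inv_fourier g (x + k))) =
     Lp_enorm p latm (%k. enorm (LINT y|lborel. (g y * character x y) * cnj (character (- k) y)))"
    by (simp add: inv_fourier_def character_plus_minus mult.assoc)
   also have "... = Lp_enorm p latm (%k. enorm (LINT y|lborel. (g y * character x y) * cnj (character k y)))"
    by (rule Lp_enorm_latm_minus[OF f(1)])
   also have "... <= ennreal C * Lt q (%y. SUML l. enorm (g (y + l) * character x (y + l)))"
    by (rule C) (use g in auto)
   finally show ?thesis by (simp add: norm_mult R_def)
  qed
  have "Lp_enorm p lborel (%x. enorm (inv_fourier g x)) <= Lp_enorm p tor (%x. Lp_enorm p latm (%k. enorm (inv_fourier g (x + k))))"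
   by (rule Lp_enorm_lborel_fibers[OF f(1)]) measurable
  also have "... <= Lp_enorm p (tor :: (real^'d) measure) (%x. R)"
   by (rule Lp_enorm_AE_mono[OF f(1)]) (use fib f(1) in \<open>auto intro!: Lp_enorm_latm_measurable\<close>)
  also have "... <= R" by (rule Lp_enorm_tor_const_le[OF f(1)])
  finally show ?thesis by (simp add: R_def)
 qed
 then show ?thesis using C(1) by blast
qed

lemma Lp_enorm_symbol_coeff_le:
 assumes "conj_exp p q"
 shows "\<exists>C>0. \<forall>h g::real^'d::finite => complex. h : bm --> g : bm --> integrable lborel (%y. g y * cnj (h y)) -->
  Lp_enorm p latm (%k. enorm (symbol_coeff h g k)) \<le>
   ennreal C * Lt q (%y. SUML l. enorm (g (y + l) * h (y + l)))"
proof -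
 obtain C where C: "C > 0" "!!b::real^'d => complex. b : bm ==> integrable lborel b ==>
  Lp_enorm p latm (%k. enorm (LINT y|lborel. b y * cnj (character k y))) \<le>
   ennreal C * Lt q (%y. SUML l. enorm (b (y + l)))"
  using Hausdorff_Young_periodized[OF assms] by blast
 have "Lp_enorm p latm (%k. enorm (symbol_coeff h g k)) \<le>
   ennreal C * Lt q (%y. SUML l. enorm (g (y + l) * h (y + l)))"
  if "h : bm" "g : bm" "integrable lborel (%y. g y * cnj (h y))" for h g :: "real^'d => complex"
  using C(2)[of "%y. g y * cnj (h y)"] that by (simp add: symbol_coeff_def norm_mult)
 then show ?thesis using C(1) by blast
qed

lemma Lp_enorm_quasi_proj_le:
 assumes p: "1 <= p" and [measurable]: "\<phi> : bm"
 shows "Lp_enorm p lborel (%x. enorm (quasi_proj \<phi> h g x)) \<le>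
  Lp_enorm p latm (%k. enorm (symbol_coeff h g k)) * Lp_enorm p tor (%x. SUML k. enorm (\<phi> (x + k)))"
proof -
 have "Lp_enorm p lborel (%x. enorm (quasi_proj \<phi> h g x)) \<le>
  Lp_enorm p lborel (%x. SUML k. enorm (symbol_coeff h g k) * enorm (\<phi> (x + k)))"
 proof (rule Lp_enorm_AE_mono[OF p])
  show "AE x in lborel. enorm (quasi_proj \<phi> h g x) <= (SUML k. enorm (symbol_coeff h g k) * enorm (\<phi> (x + k)))"
   unfolding quasi_proj_def
   by (rule AE_I2, rule order_trans[OF norm_LINT_latm_le]) (simp add: norm_mult ennreal_mult)
 qed measurable
 also have "... <= Lp_enorm p latm (%k. enorm (symbol_coeff h g k)) * Lp_enorm p tor (%x. SUML k. enorm (\<phi> (x + k)))"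
  by (rule Lp_enorm_lattice_convolution[OF p, of "%x. enorm (\<phi> x)"]) measurable
 finally show ?thesis .
qed

text \<open>Jensen's inequality with weights |y+l|^(-s), s = (b-N)p, whose sum is bounded uniformly
  in y because b > N + CARD('d)/p means s > CARD('d). The exponents match: (N+s)q - s = qb, by
  q(p-1) = p. For p = infinity, q = 1 and the left side is the weighted integral itself.\<close>

lemma weighted_periodization_bound:
 fixes N b d :: real
 assumes pq: "conj_exp p q" and d: "d > 0"
  and b: "if p = infy then b = N else b > N + real CARD('d) / enn2real p"
 shows "\<exists>K>0. \<forall>u::real^'d::finite => real. u : bm --> (\<forall>y. u y >= 0) --> (\<forall>y. norm y < d --> u y = 0) -->
  Lt q (%y. SUML l. ennreal (u (y + l) * norm (y + l) powr N))
   <= ennreal K * ennpowr (INTR y. ennreal (norm y powr (q * b) * u y powr q)) (1 / q)"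
proof (cases "p = infy")
 case True
 then have q: "q = 1" and N: "b = N" using conj_exp_facts[OF pq] b by auto
 have "Lt q (%y. SUML l. ennreal (u (y + l) * norm (y + l) powr N))
   <= ennreal 1 * ennpowr (INTR y. ennreal (norm y powr (q * b) * u y powr q)) (1 / q)"
  if [measurable]: "u : bm" and "\<forall>y. u y >= 0" for u :: "real^'d => real"
  using that nn_integral_periodize[of "%y. ennreal (u y * norm y powr N)"] by (simp add: Lp_enorm_def q N mult.commute)
 then show ?thesis by (intro exI[of _ 1]) auto
next
 case False
 note f = conj_exp_facts[OF pq]
 define P where "P = enn2real p"
 have P: "P >= 2" "q * (P - 1) = P" using f False by (auto simp: P_def)
 define s where "s = (b - N) * P"
 have s: "s > real CARD('d)"
  using b False P by (simp add: s_def P_def field_simps)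
 obtain K where K: "K > 0" "!!y::real^'d. (SUML l. ennreal (norm (y + l) powr (- s) * of_bool (d <= norm (y + l)))) <= ennreal K"
  using lattice_sum_norm_powr_bounded[OF s d] by blast
 have "Lt q (%y. SUML l. ennreal (u (y + l) * norm (y + l) powr N))
   <= ennreal (K powr ((q - 1) / q)) * ennpowr (INTR y. ennreal (norm y powr (q * b) * u y powr q)) (1 / q)"
  if [measurable]: "u : bm" and u0: "\<forall>y. u y >= 0" and supp: "\<forall>y. norm y < d --> u y = 0" for u :: "real^'d => real"
 proof (rule Lp_enorm_leI)
  have pt: "ennpowr (SUML l. ennreal (u (y + l) * norm (y + l) powr N)) q \<le>
   ennpowr (ennreal K) (q - 1) * (SUML l. ennreal (norm (y + l) powr (q * b) * u (y + l) powr q))" for y :: "real^'d"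
  proof -
   define a where "a = (%l. ennreal (norm (y + l) powr (- s) * of_bool (d <= norm (y + l))))"
   define c where "c = (%l. ennreal (u (y + l) * norm (y + l) powr (N + s)))"
   have ca: "ennreal (u (y + l) * norm (y + l) powr N) = c l * a l" for l
    using supp u0 d by (cases "d <= norm (y + l)")
     (auto simp: a_def c_def ennreal_mult[symmetric] mult.assoc powr_add[symmetric])
   have ca': "ennpowr (c l) q * a l <= ennreal (norm (y + l) powr (q * b) * u (y + l) powr q)" for l
   proof (cases "d <= norm (y + l)")
    case True
    have e: "(N + s) * q + (- s) = q * b"
    proof -
     have "s * q - s = (b - N) * (q * (P - 1) + q * 1 - P)" by (simp add: s_def algebra_simps)
     also have "... = (b - N) * q" using P(2) by simp
     finally show ?thesis by (simp add: algebra_simps)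
    qed
    have "((norm (y + l)) powr (N + s)) powr q * norm (y + l) powr (- s) = norm (y + l) powr (q * b)"
     unfolding powr_powr powr_add[symmetric] e ..
    then show ?thesis using True u0
     by (simp add: a_def c_def ennpowr_ennreal powr_mult ennreal_mult[symmetric] mult_ac)
   qed (simp add: a_def)
   have "ennpowr (SUML l. ennreal (u (y + l) * norm (y + l) powr N)) q <= ennpowr (SUML l. a l) (q - 1) * (SUML l. ennpowr (c l) q * a l)"
    unfolding ca by (rule nn_integral_Jensen) (use f in auto)
   also have "... <= ennpowr (ennreal K) (q - 1) * (SUML l. ennreal (norm (y + l) powr (q * b) * u (y + l) powr q))"
    using f ca' K(2)[of y] by (intro mult_mono ennpowr_mono nn_integral_mono) (auto simp: a_def)
   finally show ?thesis .
  qed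
  have "(INTT y. ennpowr (SUML l. ennreal (u (y + l) * norm (y + l) powr N)) q) \<le>
   (INTT y. ennpowr (ennreal K) (q - 1) * (SUML l. ennreal (norm (y + l) powr (q * b) * u (y + l) powr q)))"
   by (intro nn_integral_mono pt)
  also have "... = ennpowr (ennreal K) (q - 1) * (INTT y. (SUML l. ennreal (norm (y + l) powr (q * b) * u (y + l) powr q)))"
   by (rule nn_integral_cmult, rule borel_measurable_nn_integral_latm) measurable
  also have "(INTT y. (SUML l. ennreal (norm (y + l) powr (q * b) * u (y + l) powr q))) = (INTR y. ennreal (norm y powr (q * b) * u y powr q))"
   by (rule nn_integral_periodize) measurable
  also have "ennpowr (ennreal K) (q - 1) * ... = ennpowr (ennreal (K powr ((q - 1) / q)) * ennpowr (INTR y. ennreal (norm y powr (q * b) * u y powr q)) (1 / q)) q"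
   using f K by (simp add: ennpowr_mult ennpowr_ennreal powr_powr)
  finally show "(INTT y. ennpowr (SUML l. ennreal (u (y + l) * norm (y + l) powr N)) (enn2real (ennreal q)))
   <= ennpowr (ennreal (K powr ((q - 1) / q)) * ennpowr (INTR y. ennreal (norm y powr (q * b) * u y powr q)) (1 / q)) (enn2real (ennreal q))"
   using f by simp
  show "(%y. SUML l. ennreal (u (y + l) * norm (y + l) powr N)) : borel_measurable tor"
   by (rule borel_measurable_nn_integral_latm) measurable
 qed (use f in auto)
 then show ?thesis using K(1) by (intro exI[of _ "K powr ((q - 1) / q)"]) auto
qed

definition fhat :: "(real^'d::finite => complex) => real^'d => complex" where
 "fhat \<phi> w = (LINT x|lborel. \<phi> x * cnj (character w x))"

lemma zak_periodic: "k : int_lattice ==> zak \<phi> (x + k) y = zak \<phi> x y"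
 using LINT_latm_shift[of k "%m. \<phi> (x + m) * cnj (character (x + m) y)"]
 by (simp add: zak_def add_ac)

lemma fcoeff_zak:
 assumes [measurable]: "\<phi> : bm" and "integrable lborel \<phi>" and l: "l : int_lattice"
 shows "fcoeff (%x. zak \<phi> x y) l = fhat \<phi> (y + l)"
proof -
 have [measurable]: "(%x. character x y) : bm" by measurable
 have "fcoeff (%x. LINT m|latm. \<phi> (x + m) * cnj (character (x + m) y)) l = (LINT x|lborel. \<phi> x * cnj (character x y) * cnj (character l x))"
  using assms integrable_mult_character(2)[of lborel \<phi> y]
  by (intro fcoeff_periodize[of "%x. \<phi> x * cnj (character x y)"]) (auto simp: character_commute[of _ y])
 then show ?thesis by (simp add: zak_def fhat_def character_simps character_commute[of _ y] mult.assoc)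
qed

lemma fcoeff_character_series:
 fixes c :: "real^'a::finite => complex"
 assumes K: "(SUML l. enorm (c l)) < infy" and k: "k : int_lattice"
 shows "fcoeff (%x. LINT l|latm. c l * character l x) k = c k"
proof -
 interpret t: prob_space "tor :: (real^'a) measure" by (rule prob_space_tor)
 interpret l: sigma_finite_measure "latm :: (real^'a) measure" by (rule sigma_finite_latm)
 interpret pair_sigma_finite "tor :: (real^'a) measure" "latm :: (real^'a) measure" ..
  have m: "(%(x, l). c l * character l x * cnj (character k x)) : borel_measurable (tor \<Otimes>\<^sub>M latm)"
   by (rule measurable_latm_pair) measurable
  have "integrable (tor \<Otimes>\<^sub>M latm) (%(x, l). c l * character l x * cnj (character k x))"
  proof (rule integrableI_bounded[OF m])
   have "(\<integral>\<^sup>+z. ennreal (norm (case z of (x, l) => c l * character l x * cnj (character k x))) \<partial>(tor \<Otimes>\<^sub>M latm))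
    = (\<integral>\<^sup>+x. (SUML l. enorm (c l)) \<partial>(tor :: (real^'a) measure))"
    using m by (subst l.nn_integral_fst[symmetric]) (auto simp: norm_mult)
   also have "... = (SUML l. enorm (c l))" using t.emeasure_space_1 by simp
   finally show "(\<integral>\<^sup>+z. ennreal (norm (case z of (x, l) => c l * character l x * cnj (character k x))) \<partial>(tor \<Otimes>\<^sub>M latm)) < infy"
    using K by simp
  qed
  from Fubini_integral[OF this]
  have "(LINT x|tor. LINT l|latm. c l * character l x * cnj (character k x)) = (LINT l|latm. LINT x|tor. c l * character l x * cnj (character k x))"
   by simp
  also have "... = (LINT l|latm. indicator {k} l *\<^sub>R c k)"
  proof (rule Bochner_Integration.integral_cong)
   fix l :: "real^'a" assume "l : space latm"
   then have l: "l : int_lattice" by simp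
   have "(LINT x|tor. c l * character l x * cnj (character k x)) = c l * (LINT x|tor. character (l - k) x)"
    unfolding diff_conv_add_uminus character_simps by (simp add: mult.assoc)
   also have "... = indicator {k} l *\<^sub>R c k"
    using LINT_tor_character[of "l - k"] l k t.prob_space by (cases "l = k") (auto simp: character_simps)
   finally show "(LINT x|tor. c l * character l x * cnj (character k x)) = indicator {k} l *\<^sub>R c k" .
  qed simp
  also have "... = c k"
   using k by (subst integral_scaleR_left) (auto simp: integrable_real_indicator measure_def)
  finally show ?thesis by (simp add: fcoeff_def)
qed

text \<open>The nonzero coefficients being absolutely summable, their Fourier series is bounded by
  \<open>K\<close> everywhere, and by uniqueness of coefficients it represents G minus its mean
  almost everywhere. The bound is therefore in the supremum norm.\<close>

lemma AE_fcoeff_sum_bound: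
 assumes [measurable]: "G : bm" and G: "integrable tor G"
  and K: "(SUML l. enorm (fcoeff G l) * of_bool (l ~= 0)) <= K" "K < infy"
 shows "AE x in tor. enorm (G x - fcoeff G 0) <= K"
proof -
 interpret t: prob_space "tor :: (real^'a) measure" by (rule prob_space_tor)
 define c where "c = (%l. fcoeff G l * of_bool (l ~= 0))"
 define S where "S = (%x. LINT l|latm. c l * character l x)"
 have cK: "(SUML l. enorm (c l)) <= K"
  using K(1) by (auto simp: c_def norm_mult of_bool_def if_distrib cong: if_cong)
 have [measurable]: "S : bm"
  unfolding S_def by (rule borel_measurable_LINT_latm) measurable
 have bS: "enorm (S x) <= K" for x
  unfolding S_def by (rule order_trans[OF norm_LINT_latm_le]) (simp add: norm_mult cK)
 have iS: "integrable tor S"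
 proof (rule integrableI_bounded)
  have "(INTT x. enorm (S x)) <= (\<integral>\<^sup>+x. K \<partial>(tor :: (real^'a) measure))"
   by (intro nn_integral_mono bS)
  also have "... = K" using t.emeasure_space_1 by simp
  finally show "(INTT x. ennreal (norm (S x))) < infy" using K(2) by (auto intro: le_less_trans)
 qed measurable
 have fS: "fcoeff S k = c k" if k: "k : int_lattice" for k
  unfolding S_def using cK K(2) by (intro fcoeff_character_series k) (auto intro: le_less_trans)
 define H where "H = (%x. G x - fcoeff G 0 - S x)"
 have iH: "integrable tor H" using G iS by (simp add: H_def)
 have fH: "fcoeff H k = 0" if k: "k : int_lattice" for k
 proof -
  have "fcoeff H k = fcoeff G k - (LINT x|tor. fcoeff G 0 * cnj (character k x)) - fcoeff S k"
   using G iS integrable_mult_character(2)[OF G, of k] integrable_mult_character(2)[OF iS, of k]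
   by (simp add: H_def fcoeff_def left_diff_distrib)
  also have "(LINT x|tor. fcoeff G 0 * cnj (character k x)) = fcoeff G 0 * of_bool (k = 0)"
   using LINT_tor_character[of "- k"] k t.prob_space by (cases "k = 0") (auto simp: character_simps)
  finally show ?thesis using fS[OF k] by (simp add: c_def)
 qed
 have "AE x in tor. H x = 0" by (rule fcoeff_unique[OF iH]) (rule fH)
 then show ?thesis
 proof eventually_elim
  case (elim x)
  then have "G x - fcoeff G 0 = S x" by (simp add: H_def)
  then show ?case using bS[of x] by simp
 qed
qed

lemma nn_integral_of_Lp_tor:
 assumes p: "1 <= p" and [measurable]: "u : borel_measurable (tor :: (real^'d::finite) measure)" and fin: "Lp_enorm p tor u < infy"
 shows "(INTT x. u x) < infy"
proof -
 interpret prob_space "tor :: (real^'d) measure" by (rule prob_space_tor)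
 show ?thesis
 proof (cases "p = infy")
  case True
  have "(INTT x. u x) <= (\<integral>\<^sup>+x. Lp_enorm p tor u \<partial>(tor :: (real^'d) measure))"
   by (rule nn_integral_mono_AE[OF Lp_enorm_infinity_AE[OF True]])
  then show ?thesis using fin emeasure_space_1 by (auto intro: le_less_trans)
 next
  case False
  define P where "P = enn2real p"
  have P: "P >= 1" using ennreal_ge_1_real[OF p False] by (simp add: P_def)
  have "ennpowr (INTT x. u x * 1) P <= ennpowr (\<integral>\<^sup>+x. 1 \<partial>(tor :: (real^'d) measure)) (P - 1) * (INTT x. ennpowr (u x) P * 1)"
   by (rule nn_integral_Jensen) (use P in auto)
  also have "... = ennpowr (Lp_enorm p tor u) P"
   using emeasure_space_1 ennpowr_ennreal[of 1 "P - 1"] by (simp add: P_def Lp_enorm_eq_power[OF p False])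
  also have "... < infy" using fin by (simp add: less_top[symmetric])
  finally show ?thesis by (simp add: less_top[symmetric])
 qed
qed

context
 fixes \<phi> :: "real^'d::finite => complex"
 assumes phi_meas [measurable]: "\<phi> : bm"
begin

abbreviation (input) "per \<equiv> (%x. SUML k. enorm (\<phi> (x + k)))"

lemma per_measurable [measurable]: "per : bm"
 by (rule borel_measurable_nn_integral_latm) measurable

lemma per_periodic: "k : int_lattice ==> per (x + k) = per x"
 using nn_integral_latm_shift[of k "%m. enorm (\<phi> (x + m))"] by (simp add: add_ac)

lemma integrable_of_per:
 assumes p: "1 <= p" and fin: "Lp_enorm p tor per < infy"
 shows "(INTT x. per x) < infy" "integrable lborel \<phi>" "AE x in tor. per x < infy"
proof -
 show *: "(INTT x. per x) < infy"
  by (rule nn_integral_of_Lp_tor[OF p _ fin]) measurable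
 show "integrable lborel \<phi>"
 proof (rule integrableI_bounded)
  show "(INTR x. ennreal (norm (\<phi> x))) < infy"
   using * nn_integral_periodize[of "%x. ennreal (norm (\<phi> x))"] by simp
 qed measurable
 show "AE x in tor. per x < infy"
  using * by (intro nn_integral_noteq_infinite[THEN eventually_mono]) (auto simp: less_top[symmetric])
qed

text \<open>Fubini moves the lattice sum inside the frequency integral, where it becomes
  \<open>character y w * zak \<phi> y w\<close>. As \<open>zak\<close> is periodic, the shift by k
  leaves only a character behind, and as \<open>g\<close> vanishes off the cell the integral over
  the space is already a Fourier coefficient.\<close>

lemma error_fiber:
 assumes [measurable]: "h : bm" "g : bm"
  and ig: "integrable lborel g" and igh: "integrable lborel (%w. g w * cnj (h w))"
  and supp: "!!w. w \<notin> unit_cell ==> g w = 0"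
  and x: "per x < infy" and k: "k : int_lattice"
 shows "inv_fourier g (x + k) - quasi_proj \<phi> h g (x + k) =
  fcoeff (%w. g w * (character x w * (1 - cnj (h w) * zak \<phi> x w))) (- k)"
proof -
 interpret l: sigma_finite_measure "latm :: (real^'d) measure" by (rule sigma_finite_latm)
 interpret pair_sigma_finite "lborel :: (real^'d) measure" "latm :: (real^'d) measure" ..
 define y where "y = x + k"
 have y: "per y < infy" using x per_periodic[OF k] by (simp add: y_def)
 have ily: "integrable latm (%m. \<phi> (y + m))" using y by (simp add: integrable_latm_iff)
 have bz: "cmod (zak \<phi> y w) <= enn2real (per y)" for w
 proof -
  have "enorm (zak \<phi> y w) <= per y"
   unfolding zak_def by (rule order_trans[OF norm_LINT_latm_le]) (simp add: norm_mult)
  then show ?thesis using y by (metis enn2real_ennreal enn2real_mono norm_ge_zero infinity_ennreal_def)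
 qed
 have m: "(%(w, m). g w * cnj (h w) * cnj (character m w) * \<phi> (y + m)) : borel_measurable (lborel \<Otimes>\<^sub>M latm)"
  by (rule measurable_latm_pair) measurable
 have "integrable (lborel \<Otimes>\<^sub>M latm) (%(w, m). g w * cnj (h w) * cnj (character m w) * \<phi> (y + m))"
 proof (rule integrableI_bounded[OF m])
  have "(\<integral>\<^sup>+z. ennreal (norm (case z of (w, m) => g w * cnj (h w) * cnj (character m w) * \<phi> (y + m))) \<partial>(lborel \<Otimes>\<^sub>M latm))
   = (INTR w. (SUML m. enorm (g w * cnj (h w)) * enorm (\<phi> (y + m))))"
   using m by (subst l.nn_integral_fst[symmetric]) (auto simp: norm_mult ennreal_mult)
  also have "... = (INTR w. enorm (g w * cnj (h w))) * per y"
   by (simp add: nn_integral_cmult nn_integral_multc)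
  also have "... < infy"
   using igh y by (simp add: integrable_iff_bounded ennreal_mult_less_top)
  finally show "(\<integral>\<^sup>+z. ennreal (norm (case z of (w, m) => g w * cnj (h w) * cnj (character m w) * \<phi> (y + m))) \<partial>(lborel \<Otimes>\<^sub>M latm)) < infy" .
 qed
 from Fubini_integral[OF this]
 have "quasi_proj \<phi> h g y = (LINT w|lborel. LINT m|latm. g w * cnj (h w) * cnj (character m w) * \<phi> (y + m))"
  by (simp add: quasi_proj_def symbol_coeff_def)
 also have "... = (LINT w|lborel. g w * cnj (h w) * (character y w * zak \<phi> y w))"
 proof (rule Bochner_Integration.integral_cong)
  fix w :: "real^'d"
  have *: "g w * cnj (h w) * cnj (character m w) * \<phi> (y + m) = g w * cnj (h w) * (character y w * (\<phi> (y + m) * cnj (character (y + m) w)))" for m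
  proof -
   have "character y w * cnj (character (y + m) w) = cnj (character m w) * (character y w * cnj (character y w))"
    by (simp add: character_simps mult_ac)
   then have "character y w * cnj (character (y + m) w) = cnj (character m w)" by simp
   then show ?thesis by (metis mult.assoc mult.commute)
  qed
  show "(LINT m|latm. g w * cnj (h w) * cnj (character m w) * \<phi> (y + m)) = g w * cnj (h w) * (character y w * zak \<phi> y w)"
   unfolding * by (simp add: zak_def)
 qed simp
 finally have Q: "quasi_proj \<phi> h g y = (LINT w|lborel. g w * cnj (h w) * (character y w * zak \<phi> y w))" .
 have i1: "integrable lborel (%w. g w * character y w)" using ig by simp
 have i2: "integrable lborel (%w. g w * cnj (h w) * (character y w * zak \<phi> y w))"
 proof (rule Bochner_Integration.integrable_bound)
  show "integrable lborel (%w. enn2real (per y) * cmod (g w * cnj (h w)))" using igh by (intro integrable_mult_right integrable_norm)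
  show "AE w in lborel. norm (g w * cnj (h w) * (character y w * zak \<phi> y w)) <= norm (enn2real (per y) * cmod (g w * cnj (h w)))"
  proof (rule AE_I2)
   fix w
   have "norm (g w * cnj (h w) * (character y w * zak \<phi> y w)) = cmod (g w * cnj (h w)) * cmod (zak \<phi> y w)"
    by (simp add: norm_mult)
   also have "... <= cmod (g w * cnj (h w)) * enn2real (per y)" by (rule mult_left_mono[OF bz]) simp
   also have "... = norm (enn2real (per y) * cmod (g w * cnj (h w)))" by (simp add: abs_mult norm_mult)
   finally show "norm (g w * cnj (h w) * (character y w * zak \<phi> y w)) <= norm (enn2real (per y) * cmod (g w * cnj (h w)))" .
  qed
 qed measurable
 have "inv_fourier g y - quasi_proj \<phi> h g y = (LINT w|lborel. g w * character y w - g w * cnj (h w) * (character y w * zak \<phi> y w))"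
  unfolding Q inv_fourier_def using i1 i2 by (rule Bochner_Integration.integral_diff[symmetric])
 also have "... = (LINT w|lborel. indicator unit_cell w *\<^sub>R (g w * (character x w * (1 - cnj (h w) * zak \<phi> x w)) * cnj (character (- k) w)))"
 proof (rule Bochner_Integration.integral_cong)
  fix w
  show "g w * character y w - g w * cnj (h w) * (character y w * zak \<phi> y w) =
    indicator unit_cell w *\<^sub>R (g w * (character x w * (1 - cnj (h w) * zak \<phi> x w)) * cnj (character (- k) w))"
  proof -
   have "character y w = character x w * cnj (character (- k) w)" "zak \<phi> y w = zak \<phi> x w"
    unfolding y_def by (rule character_plus_minus, rule zak_periodic[OF k])
   then show ?thesis
    using supp[of w] by (cases "w : unit_cell") (simp_all add: algebra_simps)
  qed
 qed simp
 also have "... = fcoeff (%w. g w * (character x w * (1 - cnj (h w) * zak \<phi> x w))) (- k)"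
  unfolding fcoeff_def by (rule LINT_tor[symmetric]) measurable
 finally show ?thesis by (simp add: y_def)
qed

end

section \<open>Error bounds for frequencies near and away from the origin\<close>

text \<open>Hausdorff-Young on each fibre, then the mixed norm inequality with u = w|g| and with the
  symbol error divided by \<open>w\<close> as second factor, whose norm in x is at most 1. The
  division explains w > 0 wherever g is nonzero.\<close>

lemma local_estimate:
 assumes pq: "conj_exp p q"
 shows "\<exists>C>0. \<forall>\<phi> h g (w :: real^'d::finite => real). \<phi> : bm --> h : bm --> g : bm -->
  w : bm -->
  (AE x in tor. (SUML k. enorm (\<phi> (x + k))) < infy) -->
  integrable lborel g --> integrable lborel (%y. g y * cnj (h y)) --> (\<forall>y. y \<notin> unit_cell --> g y = 0) -->
  (AE y in tor. g y ~= 0 --> w y > 0 \<and> Lp_enorm p tor (%x. enorm (1 - cnj (h y) * zak \<phi> x y)) <= ennreal (w y)) -->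
  Lp_enorm p lborel (%x. enorm (inv_fourier g x - quasi_proj \<phi> h g x))
   <= ennreal C * Lt q (%y. ennreal (w y * cmod (g y)))"
proof -
 note f = conj_exp_facts[OF pq]
 obtain C where C: "C > 0" "!!G::real^'d => complex. G : bm ==>
  Lp_enorm p latm (%k. enorm (fcoeff G k)) <= ennreal C * Lt q (%x. enorm (G x))"
  using Hausdorff_Young_Lp[OF pq] by blast
 have "Lp_enorm p lborel (%x. enorm (inv_fourier g x - quasi_proj \<phi> h g x))
   <= ennreal C * Lt q (%y. ennreal (w y * cmod (g y)))"
  if [measurable]: "\<phi> : bm" "h : bm" "g : bm" "w : bm"
   and per: "AE x in tor. (SUML k. enorm (\<phi> (x + k))) < infy"
   and ig: "integrable lborel g" "integrable lborel (%y. g y * cnj (h y))" and supp: "!!y. y \<notin> unit_cell ==> g y = 0"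
   and w: "AE y in tor. g y ~= 0 --> w y > 0 \<and> Lp_enorm p tor (%x. enorm (1 - cnj (h y) * zak \<phi> x y)) <= ennreal (w y)"
  for \<phi> h g :: "real^'d => complex" and w :: "real^'d => real"
 proof -
  define E where "E = (%x. inv_fourier g x - quasi_proj \<phi> h g x)"
  have [measurable]: "E : bm" unfolding E_def by measurable
  define F where "F = (%x y. ennreal (cmod (1 - cnj (h y) * zak \<phi> x y) / w y))"
  define u where "u = (%y. ennreal (w y * cmod (g y)))"
  have [measurable]: "u : bm" unfolding u_def by measurable
  have Fm: "(%(x, y). F x y) : borel_measurable (tor \<Otimes>\<^sub>M tor)" unfolding F_def split_beta' by measurable
  have Fm1: "(%y. F x y) : borel_measurable tor" for x unfolding F_def by measurable
  have "Lp_enorm p lborel (%x. enorm (E x)) <= Lp_enorm p tor (%x. Lp_enorm p latm (%k. enorm (E (x + k))))"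
   by (rule Lp_enorm_lborel_fibers[OF f(1)]) measurable
  also have "... <= Lp_enorm p tor (%x. ennreal C * Lt q (%y. u y * F x y))"
  proof (rule Lp_enorm_AE_mono[OF f(1)])
   show "(%x. Lp_enorm p latm (%k. enorm (E (x + k)))) : borel_measurable tor"
    by (rule Lp_enorm_latm_measurable[OF f(1)]) measurable
   show "AE x in tor. Lp_enorm p latm (%k. enorm (E (x + k))) <= ennreal C * Lt q (%y. u y * F x y)"
    using per
   proof eventually_elim
    case (elim x)
    define G where "G = (%y. g y * (character x y * (1 - cnj (h y) * zak \<phi> x y)))"
    have [measurable]: "G : bm" unfolding G_def by measurable
    have "Lp_enorm p latm (%k. enorm (E (x + k))) = Lp_enorm p latm (%k. enorm (fcoeff G (- k)))"
     using error_fiber[OF _ _ _ ig supp elim] f(1) by (intro Lp_enorm_latm_cong) (auto simp: E_def G_def)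
    also have "... = Lp_enorm p latm (%k. enorm (fcoeff G k))" by (rule Lp_enorm_latm_minus[OF f(1)])
    also have "... <= ennreal C * Lt q (%y. enorm (G y))" by (rule C) measurable
    also have "Lt q (%y. enorm (G y)) <= Lt q (%y. u y * F x y)"
    proof (rule Lp_enorm_AE_mono[OF f(5)])
     show "AE y in tor. enorm (G y) <= u y * F x y"
      using w
     proof eventually_elim
      case (elim y)
      then show ?case
       by (cases "g y = 0") (auto simp: G_def u_def F_def norm_mult ennreal_mult[symmetric])
     qed
    qed measurable
    finally show ?case by (simp add: mult_left_mono)
   qed
  qed
  also have "... <= ennreal C * Lp_enorm p tor (%x. Lt q (%y. u y * F x y))"
  proof (rule Lp_enorm_cmult_le[OF f(1)])
   interpret t: prob_space "tor :: (real^'d) measure" by (rule prob_space_tor)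
   have "(%x. INTT y. ennpowr (u y * F x y) q) : borel_measurable tor"
    unfolding F_def by measurable
   then show "(%x. Lt q (%y. u y * F x y)) : borel_measurable tor"
    using f by (simp add: Lp_enorm_def)
  qed
  also have "Lp_enorm p tor (%x. Lt q (%y. u y * F x y)) <= 1 * Lt q u"
  proof (rule Lp_enorm_mixed_le[OF pq _ Fm])
   show "AE y in tor. u y ~= 0 --> Lp_enorm p tor (%x. F x y) <= 1"
    using w
   proof eventually_elim
    case (elim y)
    show ?case
    proof
     assume "u y ~= 0"
     then have "g y ~= 0" by (auto simp: u_def)
     with elim have w: "w y > 0" "Lp_enorm p tor (%x. enorm (1 - cnj (h y) * zak \<phi> x y)) <= ennreal (w y)"
      by auto
     have "Lp_enorm p tor (%x. F x y) = Lp_enorm p tor (%x. ennreal (1 / w y) * enorm (1 - cnj (h y) * zak \<phi> x y))"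
      using w(1) by (simp add: F_def ennreal_mult[symmetric])
     also have "... <= ennreal (1 / w y) * Lp_enorm p tor (%x. enorm (1 - cnj (h y) * zak \<phi> x y))"
      by (rule Lp_enorm_cmult_le[OF f(1)]) measurable
     also have "... <= ennreal (1 / w y) * ennreal (w y)" using w(2) by (rule mult_left_mono) simp
     also have "... = 1" using w(1) by (simp add: ennreal_mult[symmetric])
     finally show "Lp_enorm p tor (%x. F x y) <= 1" .
    qed
   qed
  qed measurable
  finally show ?thesis by (simp add: E_def u_def mult_left_mono)
 qed
 then show ?thesis using C(1) by blast
qed

text \<open>No cancellation is used: f and its quasi-projection are bounded separately. On the
  support of g the weight |w|^N absorbs the growth of \<open>h\<close>, and for f itself 1 <= d^(-N)
  |w|^N holds there.\<close>

lemma tail_estimate: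
 fixes N b d Ch :: real and \<phi> h :: "real^'d::finite => complex"
 assumes pq: "conj_exp p q" and d: "d > 0" and Ch: "Ch >= 0" and N: "N >= 0"
  and b: "if p = infy then b = N else b > N + real CARD('d) / enn2real p"
  and [measurable]: "\<phi> : bm" "h : bm"
  and fin: "Lp_enorm p tor (%x. SUML k. enorm (\<phi> (x + k))) < infy"
  and h: "AE w in lborel. d <= norm w --> cmod (h w) <= Ch * norm w powr N"
 shows "\<exists>C>0. \<forall>g. g : bm --> integrable lborel g --> integrable lborel (%w. g w * cnj (h w)) -->
  (\<forall>w. norm w < d --> g w = 0) -->
  Lp_enorm p lborel (%x. enorm (inv_fourier g x - quasi_proj \<phi> h g x))
   <= ennreal C * ennpowr (INTR w. ennreal (norm w powr (q * b) * cmod (g w) powr q)) (1 / q)"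
proof -
 note f = conj_exp_facts[OF pq]
 obtain C1 where C1: "C1 > 0" "!!g::real^'d => complex. g : bm ==> integrable lborel g ==>
  Lp_enorm p lborel (%x. enorm (inv_fourier g x)) \<le>
   ennreal C1 * Lt q (%w. SUML l. enorm (g (w + l)))"
  using Lp_enorm_inv_fourier_le[OF pq] by blast
 obtain C2 where C2: "C2 > 0" "!!h g::real^'d => complex. h : bm ==> g : bm ==> integrable lborel (%w. g w * cnj (h w)) ==>
  Lp_enorm p latm (%k. enorm (symbol_coeff h g k)) \<le>
   ennreal C2 * Lt q (%w. SUML l. enorm (g (w + l) * h (w + l)))"
  using Lp_enorm_symbol_coeff_le[OF pq] by blast
 obtain K where K: "K > 0" "!!u::real^'d => real. u : bm ==> (\<forall>w. u w >= 0) ==> (\<forall>w. norm w < d --> u w = 0) ==>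
  Lt q (%w. SUML l. ennreal (u (w + l) * norm (w + l) powr N))
   <= ennreal K * ennpowr (INTR w. ennreal (norm w powr (q * b) * u w powr q)) (1 / q)"
  using weighted_periodization_bound[OF pq d b] by blast
 obtain P where P: "Lp_enorm p tor (%x. SUML k. enorm (\<phi> (x + k))) = ennreal P" "P >= 0"
  using fin by (cases "Lp_enorm p tor (%x. SUML k. enorm (\<phi> (x + k)))") auto
 define C where "C = 4 * (C1 * (d powr (- N) * K) + C2 * (Ch * K) * P)"
 have C: "C > 0" using C1 C2 K d Ch P by (simp add: C_def add_pos_nonneg)
 have "Lp_enorm p lborel (%x. enorm (inv_fourier g x - quasi_proj \<phi> h g x))
   <= ennreal C * ennpowr (INTR w. ennreal (norm w powr (q * b) * cmod (g w) powr q)) (1 / q)"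
  if [measurable]: "g : bm" and ig: "integrable lborel g" "integrable lborel (%w. g w * cnj (h w))"
   and supp: "!!w. norm w < d ==> g w = 0" for g
 proof -
  define J where "J = ennpowr (INTR w. ennreal (norm w powr (q * b) * cmod (g w) powr q)) (1 / q)"
  define W where "W = (%w. SUML l. ennreal (cmod (g (w + l)) * norm (w + l) powr N))"
  have [measurable]: "W : bm"
   unfolding W_def by (rule borel_measurable_nn_integral_latm) measurable
  have W: "Lt q W <= ennreal K * J"
   unfolding W_def J_def by (rule K(2)) (use supp in auto)
  have "Lt q (%w. SUML l. enorm (g (w + l))) <= Lt q (%w. ennreal (d powr (- N)) * W w)"
  proof (rule Lp_enorm_AE_mono[OF f(5)])
   have pt: "enorm (g y) <= ennreal (d powr (- N)) * ennreal (cmod (g y) * norm y powr N)" for y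
   proof (cases "norm y < d")
    case False
    then have "1 <= d powr (- N) * norm y powr N"
     using d N powr_mono2[of N d "norm y"] by (simp add: powr_minus field_simps)
    then have "cmod (g y) * 1 <= cmod (g y) * (d powr (- N) * norm y powr N)"
     by (rule mult_left_mono) simp
    then show ?thesis by (simp add: ennreal_mult[symmetric] mult_ac ennreal_leI)
   qed (simp add: supp)
   show "AE x in tor. (SUML l. enorm (g (x + l))) <= ennreal (d powr (- N)) * W x"
    unfolding W_def by (subst nn_integral_cmult[symmetric]) (auto intro!: AE_I2 nn_integral_mono pt)
   show "(%x. SUML l. enorm (g (x + l))) : borel_measurable tor"
    by (rule borel_measurable_nn_integral_latm) measurable
  qed
  also have "... <= ennreal (d powr (- N)) * Lt q W"
   by (rule Lp_enorm_cmult_le[OF f(5)]) measurable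
  also have "... <= ennreal (d powr (- N)) * (ennreal K * J)" using W by (rule mult_left_mono) simp
  finally have 1: "Lt q (%w. SUML l. enorm (g (w + l))) <= ennreal (d powr (- N)) * (ennreal K * J)" .
  have "Lt q (%w. SUML l. enorm (g (w + l) * h (w + l))) <= Lt q (%w. ennreal Ch * W w)"
  proof (rule Lp_enorm_AE_mono[OF f(5)])
   have "AE x in tor. \<forall>l\<in>int_lattice. d <= norm (x + l) --> cmod (h (x + l)) <= Ch * norm (x + l) powr N"
    using h by (subst (asm) AE_tor_lattice_iff)
   then show "AE x in tor. (SUML l. enorm (g (x + l) * h (x + l))) <= ennreal Ch * W x"
   proof eventually_elim
    case (elim x)
    have "enorm (g (x + l) * h (x + l)) <= ennreal Ch * ennreal (cmod (g (x + l)) * norm (x + l) powr N)" if "l : int_lattice" for l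
    proof (cases "norm (x + l) < d")
     case False
     then have "cmod (g (x + l)) * cmod (h (x + l)) <= cmod (g (x + l)) * (Ch * norm (x + l) powr N)"
      using elim that by (intro mult_left_mono) auto
     then show ?thesis using Ch by (simp add: ennreal_mult[symmetric] mult_ac norm_mult ennreal_leI)
    qed (simp add: supp)
    then show ?case
     unfolding W_def by (subst nn_integral_cmult[symmetric]) (auto intro!: nn_integral_mono)
   qed
   show "(%x. SUML l. enorm (g (x + l) * h (x + l))) : borel_measurable tor"
    by (rule borel_measurable_nn_integral_latm) measurable
  qed
  also have "... <= ennreal Ch * Lt q W"
   by (rule Lp_enorm_cmult_le[OF f(5)]) measurable
  also have "... <= ennreal Ch * (ennreal K * J)" using W by (rule mult_left_mono) simp
  finally have 2: "Lt q (%w. SUML l. enorm (g (w + l) * h (w + l))) <= ennreal Ch * (ennreal K * J)" .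
  have "Lp_enorm p lborel (%x. enorm (inv_fourier g x - quasi_proj \<phi> h g x)) \<le>
    Lp_enorm p lborel (%x. enorm (inv_fourier g x) + enorm (quasi_proj \<phi> h g x))"
   by (rule Lp_enorm_AE_mono[OF f(1)]) (auto simp: ennreal_plus[symmetric] simp del: ennreal_plus intro!: ennreal_leI norm_triangle_ineq4)
  also have "... <= 4 * (Lp_enorm p lborel (%x. enorm (inv_fourier g x)) + Lp_enorm p lborel (%x. enorm (quasi_proj \<phi> h g x)))"
   by (rule Lp_enorm_add_le[OF f(1)]) measurable
  also have "... <= 4 * (ennreal C1 * (ennreal (d powr (- N)) * (ennreal K * J)) + (ennreal C2 * (ennreal Ch * (ennreal K * J))) * ennreal P)"
  proof (intro mult_left_mono add_mono)
   show "Lp_enorm p lborel (%x. enorm (inv_fourier g x)) <= ennreal C1 * (ennreal (d powr (- N)) * (ennreal K * J))"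
    using C1(2)[OF that(1) ig(1)] mult_left_mono[OF 1, of "ennreal C1"] by (auto intro: order_trans)
   have "Lp_enorm p lborel (%x. enorm (quasi_proj \<phi> h g x)) \<le>
     Lp_enorm p latm (%k. enorm (symbol_coeff h g k)) * ennreal P"
    unfolding P(1)[symmetric] by (rule Lp_enorm_quasi_proj_le[OF f(1)]) measurable
   also have "... <= (ennreal C2 * (ennreal Ch * (ennreal K * J))) * ennreal P"
    using C2(2)[OF _ that(1) ig(2)] mult_left_mono[OF 2, of "ennreal C2"] by (intro mult_right_mono) (auto intro: order_trans)
   finally show "Lp_enorm p lborel (%x. enorm (quasi_proj \<phi> h g x)) <= (ennreal C2 * (ennreal Ch * (ennreal K * J))) * ennreal P" .
  qed simp
  also have "... = ennreal C * J"
  proof -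
   have "ennreal C = 4 * (ennreal C1 * (ennreal (d powr (- N)) * ennreal K) + ennreal C2 * (ennreal Ch * ennreal K) * ennreal P)"
    using C1 C2 K Ch P d unfolding C_def
    by (simp add: ennreal_mult[symmetric] ennreal_plus[symmetric] del: ennreal_plus distrib_left_numeral flip: ennreal_numeral)
   then show ?thesis by (simp add: distrib_left distrib_right mult_ac)
  qed
  finally show ?thesis by (simp add: J_def)
 qed
 then show ?thesis using C by blast
qed

section \<open>Continuity in the frequency and convergence of the lattice series\<close>

lemma fhat_continuous:
 assumes [measurable]: "\<phi> : bm" and "integrable lborel \<phi>"
 shows "isCont (fhat \<phi>) z"
proof (unfold isCont_def tendsto_at_iff_sequentially, intro allI impI)
 fix X :: "nat => real^'a" assume X: "\<forall>i. X i : UNIV - {z}" "X ~~> z"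
 have "(%i. LINT x|lborel. \<phi> x * cnj (character (X i) x)) ~~> (LINT x|lborel. \<phi> x * cnj (character z x))"
 proof (rule integral_dominated_convergence[where w = "%x. cmod (\<phi> x)"])
  show "AE x in lborel. (%i. \<phi> x * cnj (character (X i) x)) ~~> \<phi> x * cnj (character z x)"
   unfolding character_def cis_conv_exp by (rule AE_I2) (intro tendsto_intros X)
 qed (use assms(2) in \<open>auto simp: norm_mult\<close>)
 then show "((fhat \<phi> \<circ> X) \<longlongrightarrow> fhat \<phi> z) sequentially" by (simp add: fhat_def comp_def)
qed

text \<open>Dominated convergence twice: over the lattice for almost every fixed x, then over x with
  majorant (2A)^P, where A is the periodization of |\<phi>|. The convergence in x is only pointwise,
  which confines the argument to finite exponents.\<close>

lemma zak_continuous: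
 fixes P :: real
 assumes [measurable]: "\<phi> : bm" and P: "P >= 1"
  and fin: "(INTT x. ennpowr (SUML k. enorm (\<phi> (x + k))) P) < infy" and e: "e > 0"
 shows "\<exists>d>0. \<forall>y. norm y < d --> (INTT x. ennreal (cmod (zak \<phi> x y - zak \<phi> x 0) powr P)) <= e"
proof (rule ccontr)
 define A where "A = (%x. SUML k. enorm (\<phi> (x + k)))"
 have [measurable]: "A : bm" unfolding A_def by (rule borel_measurable_nn_integral_latm) measurable
 assume neg: "\<not> ?thesis"
 have finA': "(INTT x. ennpowr (A x) P) < infy" using fin by (simp add: A_def)
 have "\<forall>n. \<exists>y. norm y < 1 / real (Suc n) \<and> e < (INTT x. ennreal (cmod (zak \<phi> x y - zak \<phi> x 0) powr P))"
 proof (intro allI)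
  fix n
  have "0 < 1 / real (Suc n)" by simp
  with neg have "\<not> (\<forall>y. norm y < 1 / real (Suc n) --> (INTT x. ennreal (cmod (zak \<phi> x y - zak \<phi> x 0) powr P)) <= e)"
   by blast
  then show "\<exists>y. norm y < 1 / real (Suc n) \<and> e < (INTT x. ennreal (cmod (zak \<phi> x y - zak \<phi> x 0) powr P))"
   unfolding not_all not_imp not_le .
 qed
 from choice[OF this] obtain X where X: "!!n. norm (X n) < 1 / real (Suc n)" "!!n. e < (INTT x. ennreal (cmod (zak \<phi> x (X n) - zak \<phi> x 0) powr P))"
  by blast
 have X0: "X ~~> 0"
 proof (rule tendsto_norm_zero_cancel, rule tendsto_sandwich[OF _ _ tendsto_const LIMSEQ_inverse_real_of_nat])
  show "\<forall>\<^sub>F n in sequentially. norm (X n) <= inverse (real (Suc n))"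
   using X(1) by (intro always_eventually allI) (simp add: inverse_eq_divide less_imp_le)
 qed simp
 have zb: "enorm (zak \<phi> x y) <= A x" for x y
  unfolding zak_def A_def by (rule order_trans[OF norm_LINT_latm_le]) (simp add: norm_mult)
 have finA: "AE x in tor. A x < infy"
 proof -
  have "AE x in tor. ennpowr (A x) P ~= infy"
   using finA' by (intro nn_integral_noteq_infinite) auto
  then show ?thesis by eventually_elim (simp add: less_top[symmetric])
 qed
 have "(%n. INTT x. ennreal (cmod (zak \<phi> x (X n) - zak \<phi> x 0) powr P)) ~~> (\<integral>\<^sup>+x. 0 \<partial>(tor :: (real^'a) measure))"
 proof (rule nn_integral_dominated_convergence[where w = "%x. ennpowr (2 * A x) P"])
  show "AE x in tor. ennreal (cmod (zak \<phi> x (X n) - zak \<phi> x 0) powr P) <= ennpowr (2 * A x) P" for n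
  proof (rule AE_I2)
   fix x
   have "enorm (zak \<phi> x (X n) - zak \<phi> x 0) <= enorm (zak \<phi> x (X n)) + enorm (zak \<phi> x 0)"
    by (simp add: ennreal_plus[symmetric] norm_triangle_ineq4 ennreal_leI del: ennreal_plus)
   also have "... <= 2 * A x" unfolding mult_2 by (intro add_mono zb)
   finally have "ennpowr (enorm (zak \<phi> x (X n) - zak \<phi> x 0)) P <= ennpowr (2 * A x) P"
    using P by (intro ennpowr_mono) auto
   then show "ennreal (cmod (zak \<phi> x (X n) - zak \<phi> x 0) powr P) <= ennpowr (2 * A x) P"
    by (simp add: ennpowr_ennreal)
  qed
  have "(INTT x. ennpowr (2 * A x) P) = ennpowr 2 P * (INTT x. ennpowr (A x) P)"
   by (simp add: ennpowr_mult nn_integral_cmult)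
  also have "... < infy" using finA' by (auto simp: ennreal_mult_eq_top_iff less_top[symmetric])
  finally show "(INTT x. ennpowr (2 * A x) P) < infy" .
  show "AE x in tor. (%n. ennreal (cmod (zak \<phi> x (X n) - zak \<phi> x 0) powr P)) ~~> 0"
   using finA
  proof eventually_elim
   case (elim x)
   have "(%n. zak \<phi> x (X n)) ~~> zak \<phi> x 0"
    unfolding zak_def
   proof (rule integral_dominated_convergence[where w = "%m. cmod (\<phi> (x + m))"])
    show "integrable latm (%m. cmod (\<phi> (x + m)))"
     using elim by (intro integrable_norm) (simp add: integrable_latm_iff A_def)
    show "AE m in latm. (%n. \<phi> (x + m) * cnj (character (x + m) (X n))) ~~> \<phi> (x + m) * cnj (character (x + m) 0)"
     unfolding character_def cis_conv_exp by (rule AE_I2) (intro tendsto_intros X0)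
   qed (auto simp: norm_mult)
   then have "(%n. cmod (zak \<phi> x (X n) - zak \<phi> x 0) powr P) ~~> cmod (zak \<phi> x 0 - zak \<phi> x 0) powr P"
    using P by (intro tendsto_intros) auto
   then have "(%n. cmod (zak \<phi> x (X n) - zak \<phi> x 0) powr P) ~~> 0" by simp
   then show ?case by (metis tendsto_ennrealI ennreal_0)
  qed
 qed measurable
 then have "(%n. INTT x. ennreal (cmod (zak \<phi> x (X n) - zak \<phi> x 0) powr P)) ~~> 0" by simp
 then have "eventually (%n. (INTT x. ennreal (cmod (zak \<phi> x (X n) - zak \<phi> x 0) powr P)) < e) sequentially"
  using e by (rule order_tendstoD)
 then show False using X(2) by (auto simp: eventually_sequentially dest: less_asym)
qed

text \<open>For finite p this is the tail of a convergent sum. For p = infinity a bounded sequence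
  may have large tails, so it is assumed to tend to zero.\<close>

lemma Lp_enorm_latm_tail:
 assumes p: "1 <= p" and fin: "Lp_enorm p latm c < infy"
  and inf: "!!e. p = infy ==> e > 0 ==> finite {k\<in>int_lattice. e <= c k}"
 shows "((%A. Lp_enorm p latm (%k. c k * of_bool (k \<notin> A))) \<longlongrightarrow> 0) (finite_subsets_at_top int_lattice)"
proof (cases "p = infy")
 case True
 show ?thesis
 proof (rule order_tendstoI)
  fix e :: ennreal assume "e > 0"
  then obtain e' where e': "0 < e'" "e' < e" using dense by blast
  have "eventually (%A. finite A \<and> {k\<in>int_lattice. e' <= c k} \<subseteq> A \<and> A \<subseteq> int_lattice) (finite_subsets_at_top int_lattice)"
   using inf[OF True e'(1)] by (subst eventually_finite_subsets_at_top, intro exI[of _ "{k\<in>int_lattice. e' <= c k}"]) auto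
  then show "eventually (%A. Lp_enorm p latm (%k. c k * of_bool (k \<notin> A)) < e) (finite_subsets_at_top int_lattice)"
  proof eventually_elim
   case (elim A)
   have "Lp_enorm p latm (%k. c k * of_bool (k \<notin> A)) <= e'"
    by (rule Lp_enorm_leI[OF p]) (use elim True in \<open>auto simp: AE_count_space not_le less_imp_le of_bool_def\<close>)
   then show ?case using e' by simp
  qed
 qed simp
next
 case False
 define P where "P = enn2real p"
 have P: "P >= 1" using ennreal_ge_1_real[OF p False] by (simp add: P_def)
 define F where "F = (%k. ennpowr (c k) P)"
 define T where "T = (SUML k. F k)"
 have T: "T < infy" using fin by (auto simp: T_def F_def P_def less_top[symmetric] simp flip: Lp_enorm_eq_power[OF p False])
 have "(sum F \<longlongrightarrow> T) (finite_subsets_at_top int_lattice)"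
  unfolding T_def nn_integral_latm_eq_infsum 
 proof -
  have "F summable_on int_lattice" by (rule nonneg_summable_on_complete) simp
  from has_sum_infsum[OF this] show "(sum F \<longlongrightarrow> infsum F int_lattice) (finite_subsets_at_top int_lattice)"
   by (simp add: has_sum_def)
 qed
 have tail: "(SUML k. F k * of_bool (k \<notin> A)) + sum F A = T" if "finite A" "A \<subseteq> int_lattice" for A
 proof -
  have "sum F A = (SUML k. F k * indicator A k)"
   using that by (subst nn_integral_indicator_finite) (auto intro!: sum.cong simp: subset_eq)
  then have "(SUML k. F k * of_bool (k \<notin> A)) + sum F A = (SUML k. F k * of_bool (k \<notin> A) + F k * indicator A k)"
   by (simp add: nn_integral_add)
  also have "... = T" unfolding T_def by (intro nn_integral_cong) (simp add: indicator_def)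
  finally show ?thesis .
 qed
 have "((%A. SUML k. F k * of_bool (k \<notin> A)) \<longlongrightarrow> 0) (finite_subsets_at_top int_lattice)"
 proof (rule order_tendstoI)
  fix e :: ennreal assume e: "e > 0"
  have "eventually (%A. T < sum F A + e) (finite_subsets_at_top int_lattice)"
  proof -
   have "T < T + e" using T e by (cases T; cases e) (auto simp: ennreal_plus[symmetric] ennreal_less_iff simp del: ennreal_plus)
   moreover have "((%A. sum F A + e) \<longlongrightarrow> T + e) (finite_subsets_at_top int_lattice)"
    using \<open>(sum F \<longlongrightarrow> T) _\<close> by (intro tendsto_add tendsto_const)
   ultimately show ?thesis by (rule order_tendstoD(1)[rotated])
  qed
  moreover have "eventually (%A. finite A \<and> A \<subseteq> int_lattice) (finite_subsets_at_top (int_lattice :: (real^'a) set))"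
   by (rule eventually_finite_subsets_at_top_weakI) simp
  ultimately show "eventually (%A. (SUML k. F k * of_bool (k \<notin> A)) < e) (finite_subsets_at_top int_lattice)"
  proof eventually_elim
   case (elim A)
   then have *: "sum F A + (SUML k. F k * of_bool (k \<notin> A)) < sum F A + e"
    using tail[of A] by (simp add: add.commute)
   show ?case
   proof (rule ccontr)
    assume "\<not> ?case"
    then have "sum F A + e <= sum F A + (SUML k. F k * of_bool (k \<notin> A))" by (intro add_left_mono) simp
    then show False using * by (meson leD)
   qed
  qed
 qed simp
 then have "((%A. ennpowr (SUML k. F k * of_bool (k \<notin> A)) (1 / P)) \<longlongrightarrow> 0) (finite_subsets_at_top int_lattice)"
  using P by (intro tendsto_ennpowr_0) auto
 moreover have "ennpowr (SUML k. F k * of_bool (k \<notin> A)) (1 / P) = Lp_enorm p latm (%k. c k * of_bool (k \<notin> A))" for A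
 proof -
  have "F k * of_bool (k \<notin> A) = ennpowr (c k * of_bool (k \<notin> A)) P" for k by (simp add: F_def of_bool_def)
  then show ?thesis using False by (simp add: Lp_enorm_def P_def)
 qed
 ultimately show ?thesis by simp
qed

text \<open>The remainder after a finite set A is dominated by a lattice convolution with the
  coefficients outside A; the convolution bound reduces the claim to the tail of the coefficient
  sequence.\<close>

lemma lattice_series_converges:
 fixes \<phi> :: "real^'d::finite => complex"
 assumes p: "1 <= p" and [measurable]: "\<phi> : bm"
  and fin: "Lp_enorm p tor (%x. SUML k. enorm (\<phi> (x + k))) < infy"
  and c: "Lp_enorm p latm (%k. enorm (c k)) < infy"
  and inf: "!!e. p = infy ==> e > 0 ==> finite {k\<in>int_lattice. e <= cmod (c k)}"
 shows "((%A. Lp_enorm p lborel (%x. enorm ((LINT k|latm. c k * \<phi> (x + k)) - (\<Sum>k\<in>A. c k * \<phi> (x + k))))) \<longlongrightarrow> 0) (finite_subsets_at_top int_lattice)"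
proof -
 define L where "L = Lp_enorm p tor (%x. SUML k. enorm (\<phi> (x + k)))"
 define cA where "cA = (%A k. enorm (c k) * of_bool (k \<notin> A))"
 have [measurable]: "(%x. LINT k|latm. c k * \<phi> (x + k)) : bm"
  by (rule borel_measurable_LINT_latm) measurable
 have "((%A. Lp_enorm p latm (cA A)) \<longlongrightarrow> 0) (finite_subsets_at_top int_lattice)"
  unfolding cA_def
 proof (rule Lp_enorm_latm_tail[OF p c])
  fix e :: ennreal assume "p = infy" "e > 0"
  show "finite {k : int_lattice. e <= enorm (c k)}"
  proof (cases e)
   case (real r)
   then have "r > 0" using \<open>e > 0\<close> by simp
   then show ?thesis using inf[OF \<open>p = infy\<close>, of r] real by simp
  qed (simp add: top_unique)
 qed
 then have "((%A. Lp_enorm p latm (cA A) * L) \<longlongrightarrow> 0 * L) (finite_subsets_at_top int_lattice)"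
  using fin by (intro tendsto_mult_ennreal) (auto simp: L_def)
 then have lim: "((%A. Lp_enorm p latm (cA A) * L) \<longlongrightarrow> 0) (finite_subsets_at_top int_lattice)" by simp
 have le: "Lp_enorm p lborel (%x. enorm ((LINT k|latm. c k * \<phi> (x + k)) - (\<Sum>k\<in>A. c k * \<phi> (x + k)))) <= Lp_enorm p latm (cA A) * L"
  if A: "finite A" "A \<subseteq> int_lattice" for A
 proof -
  obtain B where B: "Lp_enorm p latm (%k. enorm (c k)) = ennreal B" "B >= 0"
   using c by (cases "Lp_enorm p latm (%k. enorm (c k))") auto
  have cB: "cmod (c k) <= B" if "k : int_lattice" for k
   using Lp_enorm_latm_ge[OF p that, of "%k. enorm (c k)"] B by simp
  have "AE x in tor. \<forall>k\<in>int_lattice. (SUML m. enorm (\<phi> (x + k + m))) < infy"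
   using integrable_of_per(3)[OF assms(2) p fin] by eventually_elim (simp add: per_periodic)
  then have "AE x in lborel. (SUML m. enorm (\<phi> (x + m))) < infy"
   by (subst AE_tor_lattice_iff)
  then have "AE x in lborel. enorm ((LINT k|latm. c k * \<phi> (x + k)) - (\<Sum>k\<in>A. c k * \<phi> (x + k))) <= (SUML k. cA A k * enorm (\<phi> (x + k)))"
  proof eventually_elim
   case (elim x)
   then have i: "integrable latm (%k. \<phi> (x + k))" by (simp add: integrable_latm_iff)
   have i1: "integrable latm (%k. c k * \<phi> (x + k))"
   proof (rule Bochner_Integration.integrable_bound)
    show "integrable latm (%k. B * cmod (\<phi> (x + k)))" using i by (intro integrable_mult_right integrable_norm)
    show "AE k in latm. norm (c k * \<phi> (x + k)) <= norm (B * cmod (\<phi> (x + k)))"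
     using cB B by (auto simp: AE_count_space norm_mult abs_mult intro!: mult_right_mono)
   qed simp
   have "(\<Sum>k\<in>A. c k * \<phi> (x + k)) = (LINT k|count_space A. c k * \<phi> (x + k))"
    using A by (simp add: lebesgue_integral_count_space_finite)
   also have "... = (LINT k|latm. indicator A k *\<^sub>R (c k * \<phi> (x + k)))"
   proof -
    have "count_space A = restrict_space latm A" using A by (simp add: restrict_count_space Int_absorb1 Int_absorb2)
    then show ?thesis using A by (simp add: integral_restrict_space)
   qed
   finally have sumA: "(\<Sum>k\<in>A. c k * \<phi> (x + k)) = (LINT k|latm. indicator A k *\<^sub>R (c k * \<phi> (x + k)))" .
   have i2: "integrable latm (%k. indicator A k *\<^sub>R (c k * \<phi> (x + k)))"
    by (rule Bochner_Integration.integrable_bound[OF i1]) (auto simp: indicator_def)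
   have "(LINT k|latm. c k * \<phi> (x + k)) - (\<Sum>k\<in>A. c k * \<phi> (x + k)) = (LINT k|latm. c k * \<phi> (x + k) - indicator A k *\<^sub>R (c k * \<phi> (x + k)))"
    unfolding sumA using i1 i2 by (rule Bochner_Integration.integral_diff[symmetric])
   then have "enorm ((LINT k|latm. c k * \<phi> (x + k)) - (\<Sum>k\<in>A. c k * \<phi> (x + k))) <= (SUML k. enorm (c k * \<phi> (x + k) - indicator A k *\<^sub>R (c k * \<phi> (x + k))))"
    by (simp only: norm_LINT_latm_le)
   also have "... = (SUML k. cA A k * enorm (\<phi> (x + k)))"
    by (intro nn_integral_cong) (simp add: cA_def indicator_def norm_mult ennreal_mult)
   finally show ?case .
  qed
  then have "Lp_enorm p lborel (%x. enorm ((LINT k|latm. c k * \<phi> (x + k)) - (\<Sum>k\<in>A. c k * \<phi> (x + k)))) \<le>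
    Lp_enorm p lborel (%x. SUML k. cA A k * enorm (\<phi> (x + k)))"
   by (intro Lp_enorm_AE_mono[OF p]) measurable
  also have "... <= Lp_enorm p latm (cA A) * L"
   unfolding L_def by (rule Lp_enorm_lattice_convolution[OF p, of "%x. enorm (\<phi> x)"]) measurable
  finally show ?thesis .
 qed
 show ?thesis
  by (rule tendsto_sandwich[OF _ _ tendsto_const lim])
    (auto intro!: eventually_finite_subsets_at_top_weakI le)
qed

section \<open>Iterated partial derivatives, their symmetry, and Taylor's bound\<close>

declare n_times_differentiable.simps(2) [simp del]

lemma n_times_differentiable_SucD:
 assumes "n_times_differentiable (Suc n) f S"
 shows "x : S ==> f differentiable (at x)" "n_times_differentiable n (partial i f) S"
 using assms by (auto simp: n_times_differentiable.simps(2))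

lemma partial_eq_derivative:
 fixes f :: "real^'d::finite => complex"
 assumes "(f has_derivative f') (at x)"
 shows "partial i f x = f' (axis i 1)"
proof -
 have "((%t. f (x + t *\<^sub>R axis i 1)) has_derivative (%t. f' (t *\<^sub>R axis i 1))) (at 0)"
  by (rule has_derivative_compose[of "%t. x + t *\<^sub>R axis i 1" _ 0 UNIV f f'])
    (auto intro!: derivative_eq_intros assms)
 moreover have "f' (t *\<^sub>R axis i 1) = t *\<^sub>R f' (axis i 1)" for t
  using assms by (simp add: has_derivative_def bounded_linear.linear linear_scale)
 ultimately have "((%t. f (x + t *\<^sub>R axis i 1)) has_vector_derivative f' (axis i 1)) (at 0)"
  by (simp add: has_vector_derivative_def)
 then show ?thesis unfolding partial_def by (rule vector_derivative_at)
qed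

lemma derivative_eq_partials:
 fixes f :: "real^'d::finite => complex"
 assumes "(f has_derivative f') (at x)"
 shows "f' v = (\<Sum>i\<in>UNIV. (v $ i) *\<^sub>R partial i f x)"
proof -
 have lin: "linear f'" using assms by (simp add: has_derivative_def bounded_linear.linear)
 have "v = (\<Sum>i\<in>UNIV. (v $ i) *\<^sub>R axis i 1)"
  by (simp add: vec_eq_iff axis_def if_distrib[where f = "(*) _"] cong: if_cong)
 then have "f' v = f' (\<Sum>i\<in>UNIV. (v $ i) *\<^sub>R axis i 1)" by simp
 also have "... = (\<Sum>i\<in>UNIV. (v $ i) *\<^sub>R f' (axis i 1))"
  using lin by (simp add: linear_sum linear_scale)
 finally show ?thesis by (simp add: partial_eq_derivative[OF assms])
qed

lemma partial_cong:
 fixes f g :: "real^'d::finite => complex"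
 assumes "open S" "x : S" "!!y. y : S ==> f y = g y"
 shows "partial i f x = partial i g x"
proof -
 define T where "T = (%t. x + t *\<^sub>R axis i (1::real)) -` S"
 have T: "open T" unfolding T_def by (intro open_vimage assms continuous_intros)
 have 0: "0 : T" using assms by (simp add: T_def)
 have "((%t. f (x + t *\<^sub>R axis i 1)) has_vector_derivative D) (at 0) \<longleftrightarrow> ((%t. g (x + t *\<^sub>R axis i 1)) has_vector_derivative D) (at 0)" for D
  using has_vector_derivative_transform_within_open[OF _ T 0, of "%t. f (x + t *\<^sub>R axis i 1)" D "%t. g (x + t *\<^sub>R axis i 1)"]
   has_vector_derivative_transform_within_open[OF _ T 0, of "%t. g (x + t *\<^sub>R axis i 1)" D "%t. f (x + t *\<^sub>R axis i 1)"]
  using assms(3) by (auto simp: T_def)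
 then show ?thesis unfolding partial_def vector_derivative_def by simp
qed

lemma partial_shift: "partial i (%x. f (x + l)) x = partial i f (x + l)"
 by (simp add: partial_def add_ac)

lemma partial_sum:
 fixes f :: "'j => real^'d::finite => complex"
 assumes "!!j. j : J ==> f j differentiable (at x)"
 shows "partial i (%x. \<Sum>j\<in>J. c j * f j x) x = (\<Sum>j\<in>J. c j * partial i (f j) x)"
proof -
 obtain f' where f': "!!j. j : J ==> (f j has_derivative f' j) (at x)"
  using assms unfolding differentiable_def by metis
 have "((%x. \<Sum>j\<in>J. c j * f j x) has_derivative (%v. \<Sum>j\<in>J. c j * f' j v)) (at x)"
  using f' by (intro has_derivative_sum has_derivative_mult_right) auto
 from partial_eq_derivative[OF this] show ?thesis
  using partial_eq_derivative[OF f'] by simp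
qed

lemma n_times_differentiable_cong:
 fixes f g :: "real^'d::finite => complex"
 assumes "open S" "!!y. y : S ==> f y = g y" "n_times_differentiable n f S"
 shows "n_times_differentiable n g S"
 using assms(2,3)
proof (induction n arbitrary: f g)
 case (Suc n)
 have "g differentiable (at x)" if x: "x : S" for x
 proof -
  obtain f' where "(f has_derivative f') (at x)"
   using n_times_differentiable_SucD(1)[OF Suc.prems(2) x] by (auto simp: differentiable_def)
  then have "(g has_derivative f') (at x)"
   by (rule has_derivative_transform_within_open[OF _ assms(1) x]) (rule Suc.prems(1))
  then show ?thesis by (auto simp: differentiable_def)
 qed
 moreover have "n_times_differentiable n (partial i g) S" for i
 proof (rule Suc.IH)
  show "partial i f y = partial i g y" if "y : S" for y
   by (rule partial_cong[OF assms(1) that]) (rule Suc.prems(1))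
  show "n_times_differentiable n (partial i f) S" by (rule n_times_differentiable_SucD(2)[OF Suc.prems(2)])
 qed
 ultimately show ?case by (simp add: n_times_differentiable.simps(2))
qed simp

lemma n_times_differentiable_mono:
 "n_times_differentiable n f S ==> m <= n ==> T \<subseteq> S ==> n_times_differentiable m f T"
proof (induction n arbitrary: f m)
 case (Suc n)
 then show ?case by (cases m) (auto simp: n_times_differentiable.simps(2))
qed simp

lemma n_times_differentiable_sum:
 fixes f :: "'j => real^'d::finite => complex"
 assumes "open S" "!!j. j : J ==> n_times_differentiable n (f j) S"
 shows "n_times_differentiable n (%x. \<Sum>j\<in>J. c j * f j x) S"
 using assms(2)
proof (induction n arbitrary: f)
 case (Suc n)
 have d: "f j differentiable (at x)" if "j : J" "x : S" for j x
  using n_times_differentiable_SucD(1)[OF Suc.prems] that by blast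
 show ?case
  unfolding n_times_differentiable.simps
 proof (intro conjI ballI allI)
  fix x assume x: "x : S"
  obtain f' where f': "!!j. j : J ==> (f j has_derivative f' j) (at x)"
   using d[OF _ x] unfolding differentiable_def by metis
  have "((%x. \<Sum>j\<in>J. c j * f j x) has_derivative (%v. \<Sum>j\<in>J. c j * f' j v)) (at x)"
   using f' by (intro has_derivative_sum has_derivative_mult_right) auto
  then show "(%x. \<Sum>j\<in>J. c j * f j x) differentiable (at x)" by (auto simp: differentiable_def)
 next
  fix i
  have "n_times_differentiable n (%x. \<Sum>j\<in>J. c j * partial i (f j) x) S"
   using n_times_differentiable_SucD(2)[OF Suc.prems] by (intro Suc.IH) auto
  then show "n_times_differentiable n (partial i (%x. \<Sum>j\<in>J. c j * f j x)) S"
   by (rule n_times_differentiable_cong[OF assms(1), rotated]) (simp add: partial_sum d)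
 qed
qed simp

lemma n_times_differentiable_shift:
 fixes f :: "real^'d::finite => complex"
 assumes "n_times_differentiable n f T" "!!x. x : S ==> x + l : T"
 shows "n_times_differentiable n (%x. f (x + l)) S"
 using assms(1)
proof (induction n arbitrary: f)
 case (Suc n)
 have "(%x. f (x + l)) differentiable (at x)" if "x : S" for x
 proof -
  have "f differentiable (at (x + l))" using n_times_differentiable_SucD(1)[OF Suc.prems assms(2)[OF that]] .
  then have "(f \<circ> (%x. x + l)) differentiable (at x)"
   by (intro differentiable_chain_at) (auto intro!: derivative_intros)
  then show ?thesis by (simp add: comp_def)
 qed
 moreover have "n_times_differentiable n (partial i (%x. f (x + l))) S" for i
 proof -
  have "partial i (%x. f (x + l)) = (%x. partial i f (x + l))" by (simp add: partial_shift fun_eq_iff)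
  then show ?thesis using Suc.IH[of "partial i f"] n_times_differentiable_SucD(2)[OF Suc.prems] by simp
 qed
 ultimately show ?case by (simp add: n_times_differentiable.simps(2))
qed simp

text \<open>Derivatives along words instead of multi-indices: inductions add or remove one letter,
  and symmetry makes the result depend only on the multiset of letters, that is, on a
  multi-index.\<close>

definition partials :: "'d list => (real^'d => complex) => real^'d => complex" where
 "partials is f = foldr partial is f"

lemma partials_simps [simp]:
 "partials [] f = f" "partials (i # is) f = partial i (partials is f)" "partials (is @ js) f = partials is (partials js f)"
 by (simp_all add: partials_def)

lemma partials_shift: "partials is (%x. f (x + l)) x = partials is f (x + l)"
proof (induction "is" arbitrary: x)
 case (Cons i "is")
 have "partials is (%x. f (x + l)) = (%x. partials is f (x + l))" using Cons by (simp add: fun_eq_iff)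
 then show ?case by (simp add: partial_shift)
qed simp

lemma n_times_differentiable_partials:
 "n_times_differentiable (n + length is) f S ==> n_times_differentiable n (partials is f) S"
proof (induction "is" arbitrary: n)
 case (Cons i "is")
 then have "n_times_differentiable (Suc n) (partials is f) S" by simp
 then show ?case by (simp add: n_times_differentiable_SucD(2))
qed simp

lemma partials_sum:
 fixes f :: "'j => real^'d::finite => complex"
 assumes "open S" "x : S" "!!j. j : J ==> n_times_differentiable (length is) (f j) S"
 shows "partials is (%x. \<Sum>j\<in>J. c j * f j x) x = (\<Sum>j\<in>J. c j * partials is (f j) x)"
 using assms(2,3)
proof (induction "is" arbitrary: x)
 case (Cons i "is")
 have n: "n_times_differentiable (length is) (f j) S" "n_times_differentiable 1 (partials is (f j)) S" if "j : J" for j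
  using Cons.prems(2)[OF that] n_times_differentiable_partials[of 1 "is" "f j" S]
  by (auto intro: n_times_differentiable_mono)
 have "partials (i # is) (%x. \<Sum>j\<in>J. c j * f j x) x = partial i (%x. \<Sum>j\<in>J. c j * partials is (f j) x) x"
  unfolding partials_simps by (rule partial_cong[OF assms(1) Cons.prems(1)]) (use Cons.IH n in auto)
 also have "... = (\<Sum>j\<in>J. c j * partial i (partials is (f j)) x)"
  using n_times_differentiable_SucD(1)[OF n(2)[unfolded One_nat_def]] Cons.prems(1) by (intro partial_sum) auto
 finally show ?case by simp
qed simp

text \<open>The mean value inequality along direction i reduces the second difference to a
  difference of values of \<open>partial i f\<close>, which is linearised by the differentiability
  of \<open>partial i f\<close> at the single point x. Continuity of second derivatives is not
  involved.\<close>

lemma second_difference_bound: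
 fixes f :: "real^'d::finite => complex"
 assumes S: "open S" "x : S" and d: "!!y. y : S ==> f differentiable (at y)"
  and d2: "partial i f differentiable (at x)" and e: "e > 0"
 shows "\<exists>\<delta>>0. \<forall>t. 0 < t \<and> t < \<delta> -->
  cmod (f (x + t *\<^sub>R axis i 1 + t *\<^sub>R axis j 1) - f (x + t *\<^sub>R axis i 1) - f (x + t *\<^sub>R axis j 1) + f x - (t * t) *\<^sub>R partial j (partial i f) x) <= e * (t * t)"
proof -
 obtain L where L: "(partial i f has_derivative L) (at x)" using d2 by (auto simp: differentiable_def)
 have linL: "linear L" using L by (simp add: has_derivative_def bounded_linear.linear)
 have Lj: "L (axis j 1) = partial j (partial i f) x" using partial_eq_derivative[OF L] by simp
 have e3: "e / 3 > 0" using e by simp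
 obtain d1 where d1: "d1 > 0" "!!y. norm (y - x) < d1 ==> norm (partial i f y - partial i f x - L (y - x)) <= e / 3 * norm (y - x)"
  using L e3 unfolding has_derivative_at_alt by blast
 obtain d0 where d0: "d0 > 0" "ball x d0 \<subseteq> S" using S open_contains_ball by blast
 define \<delta> where "\<delta> = min d0 d1 / 2"
 have \<delta>: "\<delta> > 0" "2 * \<delta> <= d0" "2 * \<delta> <= d1" using d0 d1 by (auto simp: \<delta>_def)
 show ?thesis
 proof (intro exI[of _ \<delta>] conjI allI impI)
  show "\<delta> > 0" by (rule \<delta>)
  fix t :: real assume t: "0 < t \<and> t < \<delta>"
  define a where "a = (axis i 1 :: real^'d)"
  define b where "b = (axis j 1 :: real^'d)"
  have nab: "norm a = 1" "norm b = 1" by (simp_all add: a_def b_def)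
  \<comment> \<open>\<open>w t - w 0\<close> is the second difference minus its expected value. The
    derivative of w is at most e t: the two linearisations cost e/3 times 2t and e/3 times
    t.\<close>
  define w where "w = (%s. f (x + t *\<^sub>R b + s *\<^sub>R a) - f (x + s *\<^sub>R a) - (s * t) *\<^sub>R L b)"
  have near: "norm (s *\<^sub>R a) <= t" "norm (t *\<^sub>R b + s *\<^sub>R a) <= 2 * t" if "s : {0..t}" for s
  proof -
   show "norm (s *\<^sub>R a) <= t" using that nab by simp
   then show "norm (t *\<^sub>R b + s *\<^sub>R a) <= 2 * t"
    using norm_triangle_ineq[of "t *\<^sub>R b" "s *\<^sub>R a"] nab t by simp
  qed
  have inS: "x + s *\<^sub>R a : S" "x + t *\<^sub>R b + s *\<^sub>R a : S" if "s : {0..t}" for s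
  proof -
   have "dist x (x + s *\<^sub>R a) < d0" "dist x (x + t *\<^sub>R b + s *\<^sub>R a) < d0"
   proof -
    have *: "dist x (x + v) = norm v" for v by (simp add: dist_norm)
    show "dist x (x + s *\<^sub>R a) < d0" unfolding * using near(1)[OF that] t \<delta> by linarith
    show "dist x (x + t *\<^sub>R b + s *\<^sub>R a) < d0" unfolding add.assoc * using near(2)[OF that] t \<delta> by linarith
   qed
   then show "x + s *\<^sub>R a : S" "x + t *\<^sub>R b + s *\<^sub>R a : S" using d0(2) by auto
  qed
  have dir: "((%s. f (y + s *\<^sub>R a)) has_derivative (%h. h *\<^sub>R partial i f (y + s *\<^sub>R a))) (at s within {0..t})"
   if yS: "y + s *\<^sub>R a : S" for y s
  proof -
   obtain f' where f': "(f has_derivative f') (at (y + s *\<^sub>R a))" using d[OF yS] unfolding differentiable_def by blast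
   have "((%s. f (y + s *\<^sub>R a)) has_derivative (%h. f' (h *\<^sub>R a))) (at s within {0..t})"
    by (rule has_derivative_compose[of "%s. y + s *\<^sub>R a" _ s "{0..t}" f f'])
      (auto intro!: derivative_eq_intros f')
   moreover have "f' (h *\<^sub>R a) = h *\<^sub>R partial i f (y + s *\<^sub>R a)" for h
    using f' partial_eq_derivative[OF f', of i] by (simp add: a_def has_derivative_def bounded_linear.linear linear_scale)
   ultimately show ?thesis by simp
  qed
  have "norm (w t - w 0) <= e * t * norm (t - 0)"
  proof (rule differentiable_bound[of "{0..t}"])
   fix s assume s: "s : {0..t}"
   let ?c = "partial i f (x + t *\<^sub>R b + s *\<^sub>R a) - partial i f (x + s *\<^sub>R a) - t *\<^sub>R L b"
   show "(w has_derivative (%h. h *\<^sub>R ?c)) (at s within {0..t})"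
   proof -
    have "((%s. (s * t) *\<^sub>R L b) has_derivative (%h. (h * t) *\<^sub>R L b)) (at s within {0..t})"
     by (auto intro!: derivative_eq_intros)
    with dir[OF inS(1)[OF s]] dir[OF inS(2)[OF s]]
    have "(w has_derivative (%h. h *\<^sub>R partial i f (x + t *\<^sub>R b + s *\<^sub>R a) - h *\<^sub>R partial i f (x + s *\<^sub>R a) - (h * t) *\<^sub>R L b)) (at s within {0..t})"
     unfolding w_def by (intro has_derivative_diff)
    then show ?thesis by (simp add: scaleR_diff_right)
   qed
   have 1: "norm (partial i f (x + t *\<^sub>R b + s *\<^sub>R a) - partial i f x - L (t *\<^sub>R b + s *\<^sub>R a)) <= e / 3 * (2 * t)"
   proof -
    have eq: "x + t *\<^sub>R b + s *\<^sub>R a - x = t *\<^sub>R b + s *\<^sub>R a" by simp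
    have "norm (x + t *\<^sub>R b + s *\<^sub>R a - x) < d1" unfolding eq using near(2)[OF s] t \<delta> by linarith
    from d1(2)[OF this] have "norm (partial i f (x + t *\<^sub>R b + s *\<^sub>R a) - partial i f x - L (t *\<^sub>R b + s *\<^sub>R a)) <= e / 3 * norm (t *\<^sub>R b + s *\<^sub>R a)"
     unfolding eq .
    also have "... <= e / 3 * (2 * t)" using mult_left_mono[OF near(2)[OF s], of "e/3"] e by simp
    finally show ?thesis .
   qed
   have 2: "norm (partial i f (x + s *\<^sub>R a) - partial i f x - L (s *\<^sub>R a)) <= e / 3 * t"
   proof -
    have eq: "x + s *\<^sub>R a - x = s *\<^sub>R a" by simp
    have "norm (x + s *\<^sub>R a - x) < d1" unfolding eq using near(1)[OF s] t \<delta> by linarith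
    from d1(2)[OF this] have "norm (partial i f (x + s *\<^sub>R a) - partial i f x - L (s *\<^sub>R a)) <= e / 3 * norm (s *\<^sub>R a)"
     unfolding eq .
    also have "... <= e / 3 * t" using mult_left_mono[OF near(1)[OF s], of "e/3"] e by simp
    finally show ?thesis .
   qed
   have "?c = (partial i f (x + t *\<^sub>R b + s *\<^sub>R a) - partial i f x - L (t *\<^sub>R b + s *\<^sub>R a)) - (partial i f (x + s *\<^sub>R a) - partial i f x - L (s *\<^sub>R a))"
    using linL by (simp add: linear_add linear_scale)
   then have "norm ?c <= e / 3 * (2 * t) + e / 3 * t"
    by (simp only:) (rule order_trans[OF norm_triangle_ineq4 add_mono[OF 1 2]])
   then have c: "norm ?c <= e * t" by simp
   show "onorm (%h. h *\<^sub>R ?c) <= e * t"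
    using c by (intro onorm_le) (simp add: mult.commute mult_left_mono)
  qed (use t in auto)
  then show "cmod (f (x + t *\<^sub>R axis i 1 + t *\<^sub>R axis j 1) - f (x + t *\<^sub>R axis i 1) - f (x + t *\<^sub>R axis j 1) + f x - (t * t) *\<^sub>R partial j (partial i f) x) <= e * (t * t)"
   using t by (simp add: w_def a_def[symmetric] b_def[symmetric] Lj[folded b_def, symmetric] algebra_simps)
 qed
qed

text \<open>The second difference is symmetric in i and j, so both mixed derivatives, multiplied by
  t^2, lie within e t^2 of it. If they differed by 3e, then 3e t^2 <= 2e t^2 would follow.\<close>

lemma partial_commute:
 fixes f :: "real^'d::finite => complex"
 assumes S: "open S" "x : S" and f: "n_times_differentiable 2 f S"
 shows "partial i (partial j f) x = partial j (partial i f) x"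
proof (rule ccontr)
 assume ne: "partial i (partial j f) x ~= partial j (partial i f) x"
 define e where "e = cmod (partial i (partial j f) x - partial j (partial i f) x) / 3"
 have e: "e > 0" using ne by (simp add: e_def)
 have d: "!!y. y : S ==> f differentiable (at y)" "!!i. partial i f differentiable (at x)"
  using f S by (auto simp: numeral_2_eq_2 n_times_differentiable.simps(2))
 obtain \<delta>1 where 1: "\<delta>1 > 0" "!!t. 0 < t ==> t < \<delta>1 ==>
  cmod (f (x + t *\<^sub>R axis i 1 + t *\<^sub>R axis j 1) - f (x + t *\<^sub>R axis i 1) - f (x + t *\<^sub>R axis j 1) + f x - (t * t) *\<^sub>R partial j (partial i f) x) <= e * (t * t)"
  using second_difference_bound[OF S d(1) d(2) e, of i j] by blast
 obtain \<delta>2 where 2: "\<delta>2 > 0" "!!t. 0 < t ==> t < \<delta>2 ==>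
  cmod (f (x + t *\<^sub>R axis j 1 + t *\<^sub>R axis i 1) - f (x + t *\<^sub>R axis j 1) - f (x + t *\<^sub>R axis i 1) + f x - (t * t) *\<^sub>R partial i (partial j f) x) <= e * (t * t)"
  using second_difference_bound[OF S d(1) d(2) e, of j i] by blast
 define t where "t = min \<delta>1 \<delta>2 / 2"
 have t: "0 < t" "t < \<delta>1" "t < \<delta>2" using 1 2 by (auto simp: t_def)
 define \<Delta> where "\<Delta> = f (x + t *\<^sub>R axis i 1 + t *\<^sub>R axis j 1) - f (x + t *\<^sub>R axis i 1) - f (x + t *\<^sub>R axis j 1) + f x"
 have a: "cmod (\<Delta> - (t * t) *\<^sub>R partial j (partial i f) x) <= e * (t * t)"
  using 1(2)[OF t(1,2)] by (simp add: \<Delta>_def)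
 have "\<Delta> = f (x + t *\<^sub>R axis j 1 + t *\<^sub>R axis i 1) - f (x + t *\<^sub>R axis j 1) - f (x + t *\<^sub>R axis i 1) + f x"
  by (simp add: \<Delta>_def algebra_simps)
 then have b: "cmod (\<Delta> - (t * t) *\<^sub>R partial i (partial j f) x) <= e * (t * t)"
  using 2(2)[OF t(1,3)] by simp
 have "(t * t) * (3 * e) = cmod ((t * t) *\<^sub>R (partial i (partial j f) x - partial j (partial i f) x))"
  by (simp add: e_def)
 also have "... = cmod ((\<Delta> - (t * t) *\<^sub>R partial j (partial i f) x) - (\<Delta> - (t * t) *\<^sub>R partial i (partial j f) x))"
  by (simp add: algebra_simps)
 also have "... <= e * (t * t) + e * (t * t)"
  by (rule order_trans[OF norm_triangle_ineq4 add_mono[OF a b]])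
 finally show False using e t by (simp add: algebra_simps)
qed

lemma partials_move:
 fixes f :: "real^'d::finite => complex"
 assumes S: "open S" "x : S" and f: "n_times_differentiable (Suc (length xs + length ys)) f S"
 shows "partials (xs @ i # ys) f x = partials (i # xs @ ys) f x"
 using S(2) f
proof (induction xs arbitrary: x)
 case (Cons a xs)
 have n: "n_times_differentiable (Suc (length xs + length ys)) f S" "n_times_differentiable 2 (partials (xs @ ys) f) S"
  using Cons.prems(2) n_times_differentiable_partials[of 2 "xs @ ys" f S] by (auto intro: n_times_differentiable_mono)
 have "partials ((a # xs) @ i # ys) f x = partial a (partials (xs @ i # ys) f) x" by simp
 also have "... = partial a (partials (i # xs @ ys) f) x"
  by (rule partial_cong[OF S(1) Cons.prems(1)]) (use Cons.IH n in blast)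
 also have "... = partial i (partial a (partials (xs @ ys) f)) x"
  using partial_commute[OF S(1) Cons.prems(1) n(2), of a i] by simp
 finally show ?case by simp
qed simp

lemma partials_perm:
 fixes f :: "real^'d::finite => complex"
 assumes S: "open S" "x : S" and f: "n_times_differentiable (length is) f S" and m: "mset is = mset js"
 shows "partials is f x = partials js f x"
 using S(2) f m
proof (induction "is" arbitrary: js x)
 case (Cons i "is")
 then have "i : set js" by (metis list.set_intros(1) mset_eq_setD)
 then obtain xs ys where js: "js = xs @ i # ys" by (meson split_list)
 then have m: "mset is = mset (xs @ ys)" using Cons.prems by simp
 then have len: "length is = length xs + length ys" by (metis length_append mset_eq_length)
 have n: "n_times_differentiable (length is) f S" using Cons.prems(2) by (auto intro: n_times_differentiable_mono)
 have "partials js f x = partials (i # xs @ ys) f x"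
  unfolding js using Cons.prems len by (intro partials_move[OF S(1)]) auto
 also have "... = partial i (partials is f) x"
  unfolding partials_simps(2) by (rule partial_cong[OF S(1) Cons.prems(1), symmetric]) (use Cons.IH n m in blast)
 finally show ?case by simp
qed simp

definition mi_list :: "('d::finite => nat) => 'd list" where
 "mi_list b = concat (map (%i. replicate (b i) i) coords)"

lemma coords: "distinct (coords :: 'd::finite list)" "set (coords :: 'd list) = UNIV"
proof -
 have "\<exists>is :: 'd list. distinct is \<and> set is = UNIV"
  using finite_distinct_list[of "UNIV :: 'd set"] by auto
 from someI_ex[OF this] show "distinct (coords :: 'd list)" "set (coords :: 'd list) = UNIV"
  by (auto simp: coords_def)
qed

lemma D_eq_partials: "D b f = partials (mi_list b) f"
proof -
 have *: "(partial i ^^ n) h = partials (replicate n i) h" for i n h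
  by (induction n) (auto simp: partials_def)
 have "foldr (%i h. (partial i ^^ b i) h) is f = partials (concat (map (%i. replicate (b i) i) is)) f" for "is"
  by (induction "is") (simp_all add: *)
 then show ?thesis by (simp add: D_def mi_list_def)
qed

lemma count_mi_list: "count (mset (mi_list b)) i = b i"
proof -
 have "count (mset (concat (map (%i. replicate (b i) i) is))) i = (if i : set is then b i else 0)" if "distinct is" for "is"
  using that by (induction "is") auto
 from this[OF coords(1)] show ?thesis by (simp add: mi_list_def coords(2))
qed

lemma length_mi_list: "length (mi_list b) = mi_order b"
proof -
 have "length (mi_list b) = sum_list (map b coords)"
  by (simp add: mi_list_def length_concat comp_def)
 also have "... = mi_order b"
  using sum_list_distinct_conv_sum_set[OF coords(1), of b] by (simp add: mi_order_def coords(2))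
 finally show ?thesis .
qed

lemma mset_mi_list_count: "mset (mi_list (count (mset is))) = mset is"
 by (rule multiset_eqI) (simp add: count_mi_list)

lemma mi_order_count: "mi_order (count (mset is)) = length is"
 by (metis length_mi_list mset_eq_length mset_mi_list_count)

lemma partials_eq_D:
 fixes f :: "real^'d::finite => complex"
 assumes "open S" "x : S" "n_times_differentiable (length is) f S"
 shows "partials is f x = D (count (mset is)) f x"
 unfolding D_eq_partials by (rule partials_perm[OF assms]) (simp add: mset_mi_list_count)

text \<open>Induction on n: the first partials satisfy the bound of order n - 1, and the mean value
  inequality on the segment from 0 gains one factor norm x. Each step sums over CARD('d)
  coordinates, whence that factor in the power.\<close>

lemma Taylor_vanishing:
 fixes f :: "real^'d::finite => complex"
 assumes "n_times_differentiable n f (ball 0 d)"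
  and "!!is. length is < n ==> partials is f 0 = 0"
  and "!!is x. length is = n ==> x : ball 0 d ==> cmod (partials is f x) <= B"
  and "x : ball 0 d"
 shows "cmod (f x) <= (real CARD('d) * norm x) ^ n * B"
 using assms
proof (induction n arbitrary: f x)
 case 0
 then show ?case using "0.prems"(3)[of "[]" x] by simp
next
 case (Suc n)
 have IH: "cmod (partial i f y) <= (real CARD('d) * norm y) ^ n * B" if "y : ball 0 d" for i y
 proof (rule Suc.IH[OF _ _ _ that])
  show "n_times_differentiable n (partial i f) (ball 0 d)" using Suc.prems(1) by (rule n_times_differentiable_SucD(2))
  show "partials is (partial i f) 0 = 0" if "length is < n" for "is"
   using Suc.prems(2)[of "is @ [i]"] that by simp
  show "cmod (partials is (partial i f) y) <= B" if "length is = n" "y : ball 0 d" for "is" y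
   using Suc.prems(3)[of "is @ [i]" y] that by simp
 qed
 define R where "R = (real CARD('d) * norm x) ^ n * B"
 have seg: "y : ball 0 d \<and> norm y <= norm x" if ys: "y : closed_segment 0 x" for y
 proof -
  obtain u where "0 <= u" "u <= 1" "y = u *\<^sub>R x" using ys by (auto simp: closed_segment_def)
  then have "norm y <= norm x" by (simp add: mult_left_le_one_le)
  then show ?thesis using Suc.prems(4) by simp
 qed
 have B: "B >= 0" using Suc.prems(3)[of "replicate (Suc n) undefined" x] Suc.prems(4) norm_ge_zero order_trans by (metis length_replicate)
 obtain f' where f': "!!y. y : ball 0 d ==> (f has_derivative f' y) (at y)"
  using Suc.prems(1) unfolding n_times_differentiable.simps differentiable_def by metis
 have "cmod (f x - f 0) <= (real CARD('d) * R) * norm (x - 0)"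
 proof (rule differentiable_bound[of "closed_segment 0 x" f f'])
  fix y assume y: "y : closed_segment 0 x"
  show "(f has_derivative f' y) (at y within closed_segment 0 x)"
   using f' seg[OF y] by (blast intro: has_derivative_at_withinI)
  show "onorm (f' y) <= real CARD('d) * R"
  proof (rule onorm_le)
   fix v
   have "norm (f' y v) = norm (\<Sum>i\<in>UNIV. (v $ i) *\<^sub>R partial i f y)"
    using derivative_eq_partials[OF f'] seg[OF y] by simp
   also have "... <= (\<Sum>i\<in>(UNIV::'d set). norm v * R)"
   proof (rule sum_norm_le)
    fix i
    have "cmod (partial i f y) <= (real CARD('d) * norm y) ^ n * B" using IH seg[OF y] by blast
    also have "... <= R" unfolding R_def using seg[OF y] B by (intro mult_right_mono power_mono mult_left_mono) auto
    finally show "norm ((v $ i) *\<^sub>R partial i f y) <= norm v * R"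
     using component_le_norm_cart[of v i] by (auto intro!: mult_mono)
   qed
   finally show "norm (f' y v) <= real CARD('d) * R * norm v" by (simp add: mult_ac)
  qed
 qed auto
 moreover have "f 0 = 0" using Suc.prems(2)[of "[]"] by simp
 ultimately show ?case by (simp add: R_def mult_ac)
qed

section \<open>Schwartz functions\<close>

definition rapidly_decreasing :: "(real^'d => complex) => bool" where
 "rapidly_decreasing g \<longleftrightarrow> (\<forall>m. \<exists>B. \<forall>x. (1 + norm x) ^ m * cmod (g x) <= B)"

lemma norm_schwartz_term: "norm (schwartz_term \<alpha> b f x) = \<bar>\<Prod>i\<in>UNIV. (x $ i) ^ \<alpha> i\<bar> * cmod (D b f x)"
 by (simp only: schwartz_term_def norm_mult norm_of_real)

text \<open>Membership by closure: in a class stable under partial derivatives it is enough to check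
  differentiability and rapid decrease of each member. No formula for higher derivatives of sums or
  compositions is then required.\<close>

lemma schwartz_classI:
 fixes f :: "real^'d::finite => complex"
 assumes f: "f : X" and d: "!!g x. g : X ==> g differentiable (at x)"
  and p: "!!g i. g : X ==> partial i g : X" and r: "!!g. g : X ==> rapidly_decreasing g"
 shows "f : schwartz"
proof -
 have n: "n_times_differentiable n g UNIV" if "g : X" for n g
  using that by (induction n arbitrary: g) (auto simp: n_times_differentiable.simps(2) d p)
 have ps: "partials is f : X" for "is"
  by (induction "is") (auto simp: f p)
 have "bounded (range (schwartz_term \<alpha> b f))" for \<alpha> b
 proof -
  obtain B where B: "!!x. (1 + norm x) ^ (\<Sum>i\<in>UNIV. \<alpha> i) * cmod (D b f x) <= B"
   using r[OF ps] unfolding D_eq_partials rapidly_decreasing_def by meson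
  show ?thesis
  proof (rule boundedI, clarify)
   fix x :: "real^'d"
   have "\<bar>\<Prod>i\<in>UNIV. (x $ i) ^ \<alpha> i\<bar> = (\<Prod>i\<in>UNIV. \<bar>x $ i\<bar> ^ \<alpha> i)" by (simp add: abs_prod power_abs)
   also have "... <= (\<Prod>i\<in>UNIV. (1 + norm x) ^ \<alpha> i)"
    using component_le_norm_cart[of x] by (intro prod_mono conjI power_mono) (auto intro: add_increasing)
   also have "... = (1 + norm x) ^ (\<Sum>i\<in>UNIV. \<alpha> i)" by (simp add: power_sum)
   finally have "\<bar>\<Prod>i\<in>UNIV. (x $ i) ^ \<alpha> i\<bar> * cmod (D b f x) <= (1 + norm x) ^ (\<Sum>i\<in>UNIV. \<alpha> i) * cmod (D b f x)"
    by (rule mult_right_mono) simp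
   also have "... <= B" by (rule B)
   finally show "norm (schwartz_term \<alpha> b f x) <= B" by (simp only: norm_schwartz_term)
  qed
 qed
 then show ?thesis using n[OF f] by (simp add: schwartz_def)
qed

lemma schwartz_differentiable:
 "f : schwartz ==> n_times_differentiable n f UNIV" "f : schwartz ==> f differentiable (at x)"
 using n_times_differentiable_SucD(1)[of 0 f UNIV x] by (auto simp: schwartz_def)

lemma schwartz_partial:
 fixes f :: "real^'d::finite => complex"
 assumes f: "f : schwartz"
 shows "partial i f : schwartz"
proof -
 have "n_times_differentiable n (partial i f) UNIV" for n
  by (rule n_times_differentiable_SucD(2)[OF schwartz_differentiable(1)[OF f]])
 moreover have "bounded (range (schwartz_term \<alpha> b (partial i f)))" for \<alpha> b
 proof -
  have "D b (partial i f) x = D (count (mset (mi_list b @ [i]))) f x" for x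
   using partials_eq_D[of UNIV x "mi_list b @ [i]" f] schwartz_differentiable(1)[OF f]
   by (simp add: D_eq_partials)
  then have "schwartz_term \<alpha> b (partial i f) = schwartz_term \<alpha> (count (mset (mi_list b @ [i]))) f"
   by (simp add: schwartz_term_def fun_eq_iff)
  then show ?thesis using f by (simp add: schwartz_def)
 qed
 ultimately show ?thesis by (simp add: schwartz_def)
qed

text \<open>Bounds for powers of single coordinates yield decay in the norm: the largest coordinate
  t satisfies norm x <= CARD('d) t, and t^m is one of the summands.\<close>

lemma one_plus_norm_power_le:
 fixes x :: "real^'d::finite"
 shows "(1 + norm x) ^ m <= (1 + real CARD('d)) ^ m * (1 + (\<Sum>i\<in>UNIV. \<bar>x $ i\<bar> ^ m))"
proof -
 define t where "t = Max (range (%i. \<bar>x $ i\<bar>))"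
 have "t : range (%i. \<bar>x $ i\<bar>)" unfolding t_def by (rule Max_in) auto
 then obtain i where i: "t = \<bar>x $ i\<bar>" by blast
 have t: "\<bar>x $ j\<bar> <= t" for j unfolding t_def by (intro Max_ge) auto
 have "norm x <= (\<Sum>j\<in>UNIV. \<bar>x $ j\<bar>)" by (rule norm_le_l1_cart)
 also have "... <= real CARD('d) * t" using sum_mono[of UNIV "%j. \<bar>x $ j\<bar>" "%_. t"] t by simp
 finally have n: "norm x <= real CARD('d) * t" .
 have ti: "t ^ m <= (\<Sum>i\<in>UNIV. \<bar>x $ i\<bar> ^ m)"
  unfolding i by (rule member_le_sum) auto
 show ?thesis
 proof (cases "t <= 1")
  case True
  then have "1 + norm x <= 1 + real CARD('d)" using n mult_left_mono[OF True, of "real CARD('d)"] by linarith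
  then have "(1 + norm x) ^ m <= (1 + real CARD('d)) ^ m * 1" by (simp add: power_mono)
  also have "... <= (1 + real CARD('d)) ^ m * (1 + (\<Sum>i\<in>UNIV. \<bar>x $ i\<bar> ^ m))"
   by (intro mult_left_mono) (auto intro!: sum_nonneg)
  finally show ?thesis .
 next
  case False
  then have "1 + norm x <= (1 + real CARD('d)) * t" using n by (simp add: algebra_simps)
  then have "(1 + norm x) ^ m <= (1 + real CARD('d)) ^ m * t ^ m"
   using power_mono[of "1 + norm x" "(1 + real CARD('d)) * t" m] by (simp only: power_mult_distrib) simp
  also have "... <= (1 + real CARD('d)) ^ m * (1 + (\<Sum>i\<in>UNIV. \<bar>x $ i\<bar> ^ m))"
   using ti by (intro mult_left_mono) auto
  finally show ?thesis .
 qed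
qed

lemma schwartz_rapidly_decreasing:
 fixes f :: "real^'d::finite => complex"
 assumes f: "f : schwartz"
 shows "rapidly_decreasing f"
 unfolding rapidly_decreasing_def
proof
 fix m
 have "mi_list (%_::'d. 0) = []" using length_mi_list[of "%_::'d. 0"] by (simp add: mi_order_def)
 then have D0: "D (%_. 0) f = f" by (simp add: D_eq_partials)
 have bd: "\<exists>B. \<forall>x. \<bar>\<Prod>i\<in>UNIV. (x $ i) ^ \<alpha> i\<bar> * cmod (f x) <= B" for \<alpha> :: "'d => nat"
 proof -
  have "bounded (range (schwartz_term \<alpha> (%_. 0) f))" using f by (simp add: schwartz_def)
  then show ?thesis by (auto simp: bounded_iff norm_schwartz_term D0)
 qed
 obtain B0 where B0: "!!x. cmod (f x) <= B0" using bd[of "%_. 0"] by auto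
 have "\<exists>B. \<forall>x. \<bar>x $ i\<bar> ^ m * cmod (f x) <= B" for i
 proof -
  have "(\<Prod>j\<in>UNIV. (x $ j) ^ (if j = i then m else 0)) = (x $ i) ^ m" for x :: "real^'d"
   by (subst prod.remove[of _ i]) auto
  then show ?thesis using bd[of "%j. if j = i then m else 0"] by (simp add: power_abs)
 qed
 then obtain B where B: "!!i x. \<bar>x $ i\<bar> ^ m * cmod (f x) <= B i" by metis
 show "\<exists>B. \<forall>x. (1 + norm x) ^ m * cmod (f x) <= B"
 proof (intro exI allI)
  fix x
  have "(1 + norm x) ^ m * cmod (f x) <= (1 + real CARD('d)) ^ m * (1 + (\<Sum>i\<in>UNIV. \<bar>x $ i\<bar> ^ m)) * cmod (f x)"
   by (intro mult_right_mono one_plus_norm_power_le) simp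
  also have "... = (1 + real CARD('d)) ^ m * (cmod (f x) + (\<Sum>i\<in>UNIV. \<bar>x $ i\<bar> ^ m * cmod (f x)))"
   by (simp add: distrib_left distrib_right sum_distrib_right)
  also have "... <= (1 + real CARD('d)) ^ m * (B0 + (\<Sum>i\<in>UNIV. B i))"
   by (intro mult_left_mono add_mono sum_mono B B0) auto
  finally show "(1 + norm x) ^ m * cmod (f x) <= (1 + real CARD('d)) ^ m * (B0 + (\<Sum>i\<in>UNIV. B i))" .
 qed
qed

lemma schwartz_sum:
 fixes f :: "'j::finite => real^'d::finite => complex"
 assumes f: "!!j. f j : schwartz"
 shows "(%x. \<Sum>j\<in>UNIV. c j * f j x) : schwartz"
proof (rule schwartz_classI)
 define X where "X = {g. \<exists>f::'j => real^'d => complex. (\<forall>j. f j : schwartz) \<and> g = (%x. \<Sum>j\<in>UNIV. c j * f j x)}"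
 show "(%x. \<Sum>j\<in>UNIV. c j * f j x) : X" using f by (auto simp: X_def)
 fix g assume "g : X"
 then obtain f :: "'j => real^'d => complex" where f: "!!j. f j : schwartz" and g: "g = (%x. \<Sum>j\<in>UNIV. c j * f j x)"
  by (auto simp: X_def)
 show "g differentiable (at x)" for x
  using n_times_differentiable_sum[of UNIV UNIV 1 f c] n_times_differentiable_SucD(1)[of 0 g UNIV x] schwartz_differentiable(1)[OF f]
  by (simp add: g)
 have "partial i g = (%x. \<Sum>j\<in>UNIV. c j * partial i (f j) x)" for i
  unfolding g by (rule ext, rule partial_sum) (rule schwartz_differentiable(2)[OF f])
 then show "partial i g : X" for i
  unfolding X_def by (intro CollectI exI[of _ "%j. partial i (f j)"]) (simp add: schwartz_partial[OF f])
 show "rapidly_decreasing g"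
  unfolding rapidly_decreasing_def
 proof
  fix m
  have "\<exists>B. \<forall>x. (1 + norm x) ^ m * cmod (f j x) <= B" for j
   using schwartz_rapidly_decreasing[OF f] by (simp add: rapidly_decreasing_def)
  then obtain B where B: "!!j x. (1 + norm x) ^ m * cmod (f j x) <= B j" by metis
  show "\<exists>B. \<forall>x. (1 + norm x) ^ m * cmod (g x) <= B"
  proof (intro exI allI)
   fix x
   have "(1 + norm x) ^ m * cmod (g x) <= (1 + norm x) ^ m * (\<Sum>j\<in>UNIV. cmod (c j) * cmod (f j x))"
    unfolding g by (intro mult_left_mono order_trans[OF norm_sum]) (auto simp: norm_mult)
   also have "... = (\<Sum>j\<in>UNIV. cmod (c j) * ((1 + norm x) ^ m * cmod (f j x)))"
    by (simp add: sum_distrib_left mult_ac)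
   also have "... <= (\<Sum>j\<in>UNIV. cmod (c j) * B j)"
    by (intro sum_mono mult_left_mono B) auto
   finally show "(1 + norm x) ^ m * cmod (g x) <= (\<Sum>j\<in>UNIV. cmod (c j) * B j)" .
  qed
 qed
qed

lemma schwartz_cmult: "f : schwartz ==> (%x. c * f x) : schwartz"
 using schwartz_sum[of "%_::unit. f" "%_. c"] by simp

lemma schwartz_affine:
 fixes f :: "real^'d::finite => complex" and A :: "real^'d^'d"
 assumes f: "f : schwartz" and A: "invertible A"
 shows "(%x. f (A *v x + b)) : schwartz"
proof (rule schwartz_classI)
 define X where "X = {g. \<exists>f\<in>schwartz. g = (%x. f (A *v x + b))}"
 show "(%x. f (A *v x + b)) : X" using f by (auto simp: X_def)
 obtain B where BA: "B ** A = mat 1" using A by (auto simp: invertible_def)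
 fix g assume "g : X"
 then obtain f where f: "f : schwartz" and g: "g = (%x. f (A *v x + b))" by (auto simp: X_def)
 have gd: "(g has_derivative (%v. f' (A *v v))) (at x)" if "(f has_derivative f') (at (A *v x + b))" for f' x
  unfolding g
  by (rule has_derivative_compose[of "%x. A *v x + b" _ x UNIV f f'])
    (auto intro!: derivative_eq_intros that bounded_linear.has_derivative[OF matrix_vector_mul_bounded_linear])
 show "g differentiable (at x)" for x
  using schwartz_differentiable(2)[OF f, of "A *v x + b"] gd by (auto simp: differentiable_def)
 have "partial i g = (%x. (\<Sum>j\<in>UNIV. of_real (A $ j $ i) * partial j f (A *v x + b)))" for i
 proof
  fix x
  obtain f' where f': "(f has_derivative f') (at (A *v x + b))"
   using schwartz_differentiable(2)[OF f] by (auto simp: differentiable_def)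
  have "partial i g x = f' (A *v axis i 1)" by (rule partial_eq_derivative[OF gd[OF f']])
  also have "... = (\<Sum>j\<in>UNIV. ((A *v axis i 1) $ j) *\<^sub>R partial j f (A *v x + b))"
   by (rule derivative_eq_partials[OF f'])
  also have "... = (\<Sum>j\<in>UNIV. (A $ j $ i) *\<^sub>R partial j f (A *v x + b))"
   by (simp add: matrix_vector_mult_def axis_def if_distrib[where f = "(*) _"] cong: if_cong)
  finally show "partial i g x = (\<Sum>j\<in>UNIV. of_real (A $ j $ i) * partial j f (A *v x + b))"
   by (simp add: scaleR_conv_of_real)
 qed
 moreover have "(%x. \<Sum>j\<in>UNIV. of_real (A $ j $ i) * partial j f x) : schwartz" for i
  by (rule schwartz_sum) (rule schwartz_partial[OF f])
 ultimately show "partial i g : X" for i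
  unfolding X_def by (intro CollectI bexI[of _ "%x. \<Sum>j\<in>UNIV. of_real (A $ j $ i) * partial j f x"]) auto
 show "rapidly_decreasing g"
  unfolding rapidly_decreasing_def
 proof
  fix m
  obtain R where R: "!!x. (1 + norm x) ^ m * cmod (f x) <= R"
   using schwartz_rapidly_decreasing[OF f] unfolding rapidly_decreasing_def by meson
  define K where "K = 1 + onorm ((*v) B) * (1 + norm b)"
  have o: "onorm ((*v) B) >= 0" by (rule onorm_pos_le[OF matrix_vector_mul_bounded_linear])
  have K: "1 + norm x <= K * (1 + norm (A *v x + b))" for x
  proof -
   have "x = B *v ((A *v x + b) - b)" using BA by (simp add: matrix_vector_mul_assoc)
   then have "norm x <= onorm ((*v) B) * norm ((A *v x + b) - b)"
    using onorm[OF matrix_vector_mul_bounded_linear, of B "(A *v x + b) - b"] by simp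
   also have "... <= onorm ((*v) B) * (norm (A *v x + b) + norm b)"
    by (intro mult_left_mono norm_triangle_ineq4 o)
   also have "... <= onorm ((*v) B) * ((1 + norm b) * (1 + norm (A *v x + b)))"
    by (intro mult_left_mono o) (simp add: algebra_simps)
   finally have "norm x <= onorm ((*v) B) * ((1 + norm b) * (1 + norm (A *v x + b)))" .
   moreover have "K * (1 + norm (A *v x + b)) = 1 + norm (A *v x + b) + onorm ((*v) B) * ((1 + norm b) * (1 + norm (A *v x + b)))"
    unfolding K_def by (simp only: distrib_right mult_1_left mult.assoc)
   ultimately show ?thesis using norm_ge_zero[of "A *v x + b"] by linarith
  qed
  show "\<exists>R. \<forall>x. (1 + norm x) ^ m * cmod (g x) <= R"
  proof (intro exI allI)
   fix x
   have "(1 + norm x) ^ m * cmod (g x) <= (K * (1 + norm (A *v x + b))) ^ m * cmod (f (A *v x + b))"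
    unfolding g by (intro mult_right_mono power_mono K) auto
   also have "... = K ^ m * ((1 + norm (A *v x + b)) ^ m * cmod (f (A *v x + b)))"
    by (simp add: power_mult_distrib)
   also have "... <= K ^ m * R"
    using o by (intro mult_left_mono R) (simp add: K_def)
   finally show "(1 + norm x) ^ m * cmod (g x) <= K ^ m * R" .
  qed
 qed
qed

text \<open>Polynomials times the Gaussian: the smallest linear class that contains it and is stable
  under multiplication by coordinates. Partial derivatives stay inside, so
  \<open>schwartz_classI\<close> applies.\<close>

inductive gauss_poly :: "(real^'d::finite => complex) => bool" where
 base: "gauss_poly (%x. of_real (exp (- (x \<bullet> x))))"
| coord: "gauss_poly f ==> gauss_poly (%x. of_real (x $ i) * f x)"
| lin: "gauss_poly f ==> gauss_poly g ==> gauss_poly (%x. c * f x + g x)"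

lemma gauss_poly_cmult: "gauss_poly f ==> gauss_poly (%x. c * f x)"
 using gauss_poly.lin[of f f "c - 1"] by (simp add: algebra_simps)

lemma gauss_poly_closed:
 "gauss_poly f ==> (\<forall>x. f differentiable (at x)) \<and> (\<forall>i. gauss_poly (partial i f)) \<and> rapidly_decreasing f"
proof (induction rule: gauss_poly.induct)
 case base
 have der: "((%x::real^'d. of_real (exp (- (x \<bullet> x)))) has_derivative (%v. (of_real (exp (- (x \<bullet> x)) * (- (2 * (x \<bullet> v)))) :: complex))) (at x)" for x
  by (auto intro!: derivative_eq_intros simp: inner_commute algebra_simps)
 have peq: "partial i (%x::real^'d. of_real (exp (- (x \<bullet> x)))) = (%x. (- 2) * (of_real (x $ i) * of_real (exp (- (x \<bullet> x)))))" for i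
  by (rule ext, subst partial_eq_derivative[OF der]) (simp add: inner_axis)
 have "gauss_poly (partial i (%x::real^'d. of_real (exp (- (x \<bullet> x)))))" for i
  unfolding peq by (rule gauss_poly_cmult[OF gauss_poly.coord[OF gauss_poly.base]])
 moreover have "rapidly_decreasing (%x::real^'d. of_real (exp (- (x \<bullet> x))))"
  unfolding rapidly_decreasing_def
 proof (intro allI exI)
  fix m and x :: "real^'d"
  define r where "r = norm x"
  have r: "r >= 0" by (simp add: r_def)
  have "(1 + r) ^ m / fact m <= exp (1 + r)"
  proof -
   have "(%n. (1 + r) ^ n /\<^sub>R fact n) sums exp (1 + r)" by (rule exp_converges)
   then have "(\<Sum>n\<in>{m}. (1 + r) ^ n /\<^sub>R fact n) <= exp (1 + r)"
    by (rule sum_le_suminf[OF sums_summable, THEN order_trans]) (use r \<open>_ sums _\<close> in \<open>auto simp: sums_iff\<close>)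
   then show ?thesis by (simp add: divide_inverse mult.commute)
  qed
  then have "(1 + r) ^ m <= fact m * exp (1 + r)" by (simp add: field_simps)
  \<comment> \<open>From (r - 1)^2 >= 0. Exponential decay at rate 2 beats exp (1 + r), which
    dominates the power of 1 + r through one term of its series.\<close>
  moreover have "exp (- (x \<bullet> x)) <= exp (1 - 2 * r)"
  proof -
   have "0 <= (r - 1)\<^sup>2" by simp
   then have "- r\<^sup>2 <= 1 - 2 * r" by (simp add: power2_eq_square algebra_simps)
   then show ?thesis by (simp add: r_def dot_square_norm)
  qed
  ultimately have "(1 + r) ^ m * exp (- (x \<bullet> x)) <= (fact m * exp (1 + r)) * exp (1 - 2 * r)"
   using r by (intro mult_mono) auto
  also have "... = fact m * exp (2 - r)" by (simp add: mult.assoc exp_add[symmetric])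
  also have "... <= fact m * exp 2" using r by simp
  finally show "(1 + norm x) ^ m * cmod (of_real (exp (- (x \<bullet> x)))) <= fact m * exp 2"
   by (simp add: r_def)
 qed
 ultimately show ?case using der unfolding differentiable_def by blast
next
 case (coord f i)
 have der: "((%x. of_real (x $ i) * f x) has_derivative (%v. of_real (x $ i) * f' v + of_real (v $ i) * f x)) (at x)"
  if "(f has_derivative f') (at x)" for f' x
  by (auto intro!: derivative_eq_intros that bounded_linear.has_derivative[OF bounded_linear_vec_nth])
 have "partial j (%x. of_real (x $ i) * f x) = (%x. of_bool (j = i) * f x + of_real (x $ i) * partial j f x)" for j
 proof
  fix x
  obtain f' where f': "(f has_derivative f') (at x)" using coord.IH by (auto simp: differentiable_def)
  show "partial j (%x. of_real (x $ i) * f x) x = of_bool (j = i) * f x + of_real (x $ i) * partial j f x"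
   unfolding partial_eq_derivative[OF der[OF f']] partial_eq_derivative[OF f'] by (simp add: axis_def)
 qed
 then have "gauss_poly (partial j (%x. of_real (x $ i) * f x))" for j
  using gauss_poly.lin[OF coord.hyps gauss_poly.coord, of "partial j f" "of_bool (j = i)" i] coord.IH by simp
 moreover have "rapidly_decreasing (%x. of_real (x $ i) * f x)"
  unfolding rapidly_decreasing_def
 proof
  fix m
  obtain B where B: "!!x. (1 + norm x) ^ Suc m * cmod (f x) <= B"
   using coord.IH unfolding rapidly_decreasing_def by meson
  have "(1 + norm x) ^ m * cmod (of_real (x $ i) * f x) <= B" for x
  proof -
   have "(1 + norm x) ^ m * cmod (of_real (x $ i) * f x) = (1 + norm x) ^ m * cmod (f x) * \<bar>x $ i\<bar>" by (simp add: norm_mult)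
   also have "... <= (1 + norm x) ^ m * cmod (f x) * (1 + norm x)"
    using component_le_norm_cart[of x i] by (intro mult_left_mono) auto
   also have "... <= B" using B[of x] by (simp add: mult_ac)
   finally show ?thesis .
  qed
  then show "\<exists>B. \<forall>x. (1 + norm x) ^ m * cmod (of_real (x $ i) * f x) <= B" by blast
 qed
 ultimately show ?case using der coord.IH unfolding differentiable_def by blast
next
 case (lin f g c)
 have der: "((%x. c * f x + g x) has_derivative (%v. c * f' v + g' v)) (at x)"
  if "(f has_derivative f') (at x)" "(g has_derivative g') (at x)" for f' g' x
  by (auto intro!: derivative_eq_intros that)
 have "partial j (%x. c * f x + g x) = (%x. c * partial j f x + partial j g x)" for j
 proof
  fix x
  obtain f' g' where f': "(f has_derivative f') (at x)" and g': "(g has_derivative g') (at x)"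
   using lin.IH unfolding differentiable_def by meson
  show "partial j (%x. c * f x + g x) x = c * partial j f x + partial j g x"
   unfolding partial_eq_derivative[OF der[OF f' g']] partial_eq_derivative[OF f'] partial_eq_derivative[OF g'] ..
 qed
 then have "gauss_poly (partial j (%x. c * f x + g x))" for j
  using gauss_poly.lin[of "partial j f" "partial j g" c] lin.IH by auto
 moreover have "rapidly_decreasing (%x. c * f x + g x)"
  unfolding rapidly_decreasing_def
 proof
  fix m
  obtain A B where A: "!!x. (1 + norm x) ^ m * cmod (f x) <= A" and B: "!!x. (1 + norm x) ^ m * cmod (g x) <= B"
   using lin.IH unfolding rapidly_decreasing_def by meson
  have "(1 + norm x) ^ m * cmod (c * f x + g x) <= cmod c * A + B" for x
  proof -
   have "(1 + norm x) ^ m * cmod (c * f x + g x) <= (1 + norm x) ^ m * (cmod c * cmod (f x) + cmod (g x))"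
    by (intro mult_left_mono order_trans[OF norm_triangle_ineq]) (auto simp: norm_mult)
   also have "... = cmod c * ((1 + norm x) ^ m * cmod (f x)) + (1 + norm x) ^ m * cmod (g x)" by (simp add: algebra_simps)
   also have "... <= cmod c * A + B" by (intro add_mono mult_left_mono A B) auto
   finally show ?thesis .
  qed
  then show "\<exists>B. \<forall>x. (1 + norm x) ^ m * cmod (c * f x + g x) <= B" by blast
 qed
 ultimately show ?case using der lin.IH unfolding differentiable_def by blast
qed

lemma gaussian_schwartz: "(%x::real^'d::finite. of_real (exp (- (x \<bullet> x)))) : schwartz"
 by (rule schwartz_classI[where X = "Collect gauss_poly"]) (use gauss_poly_closed gauss_poly.base in auto)

section \<open>Matrix powers and the decay of the inverse powers of a dilation matrix\<close>

lemma mat_pow_simps [simp]: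
 "mat_pow A 0 = mat 1" "mat_pow A (Suc n) = A ** mat_pow A n"
 by (simp_all add: mat_pow_def)

lemma mat_pow_Suc_right: "mat_pow A (Suc n) = mat_pow A n ** (A :: real^'d::finite^'d)"
proof (induction n)
 case (Suc n)
 have "mat_pow A (Suc (Suc n)) = A ** (mat_pow A n ** A)"
  unfolding mat_pow_simps(2)[of A "Suc n"] Suc ..
 then show ?case by (simp only: matrix_mul_assoc mat_pow_simps)
qed simp

lemma transpose_mat_pow: "transpose (mat_pow (A :: real^'d::finite^'d) n) = mat_pow (transpose A) n"
proof (induction n)
 case (Suc n)
 have "transpose (mat_pow A (Suc n)) = mat_pow (transpose A) n ** transpose A"
  by (simp add: matrix_transpose_mul Suc)
 then show ?case by (simp only: mat_pow_Suc_right)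
qed (simp add: transpose_mat)

lemma mat_pow_inverse:
 fixes A B :: "real^'d::finite^'d"
 assumes "A ** B = mat 1"
 shows "mat_pow A n ** mat_pow B n = mat 1"
proof (induction n)
 case (Suc n)
 have "mat_pow A (Suc n) ** mat_pow B (Suc n) = mat_pow A n ** (A ** B) ** mat_pow B n"
  unfolding mat_pow_Suc_right[of A] mat_pow_simps(2)[of B] by (simp only: matrix_mul_assoc)
 then show ?case using Suc assms by simp
qed simp

lemma matrix_inv_unique_right:
 fixes A B :: "real^'d::finite^'d"
 assumes "A ** B = mat 1"
 shows "matrix_inv A = B"
proof -
 have BA: "B ** A = mat 1" using assms matrix_left_right_inverse by blast
 then have "\<exists>B. A ** B = mat 1 \<and> B ** A = mat 1" using assms by blast
 from someI_ex[OF this] have inv: "matrix_inv A ** A = mat 1" by (simp add: matrix_inv_def)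
 have "matrix_inv A = matrix_inv A ** (A ** B)" by (simp add: assms)
 also have "... = B" by (simp only: matrix_mul_assoc inv matrix_mul_lid)
 finally show ?thesis .
qed

definition mpow :: "complex^'d::finite^'d => nat => complex^'d => complex^'d" where
 "mpow A n v = (((*v) A) ^^ n) v"

definition poly_apply :: "complex^'d::finite^'d => complex poly => complex^'d => complex^'d" where
 "poly_apply A p v = (\<Sum>i\<le>degree p. coeff p i *s mpow A i v)"

lemma mpow_simps: "mpow A 0 v = v" "mpow A (Suc n) v = A *v mpow A n v" "mpow A n (A *v v) = A *v mpow A n v"
 by (simp_all add: mpow_def funpow_swap1)

lemma mpow_linear: "mpow A n (u - c *s v) = mpow A n u - c *s mpow A n v"
 by (induction n) (simp_all add: mpow_simps matrix_vector_mult_diff_distrib vector_scalar_commute)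

lemma poly_apply_extend:
 assumes "degree p <= n"
 shows "poly_apply A p v = (\<Sum>i\<le>n. coeff p i *s mpow A i v)"
 unfolding poly_apply_def using assms
 by (intro sum.mono_neutral_left) (auto simp: coeff_eq_0)

lemma poly_apply_factor:
 "poly_apply A ([:- z, 1:] * q) v = poly_apply A q (A *v v - z *s v)"
proof -
 define n where "n = degree q"
 have factor: "[:- z, 1:] * q = pCons 0 q - smult z q" by simp
 have "degree ([:- z, 1:] * q) <= Suc n"
  using degree_mult_le[of "[:- z, 1:]" q] by (simp add: n_def)
 then have "poly_apply A ([:- z, 1:] * q) v = (\<Sum>i\<le>Suc n. coeff ([:- z, 1:] * q) i *s mpow A i v)"
  by (rule poly_apply_extend)
 also have "... = (\<Sum>i\<le>Suc n. (case i of 0 => 0 | Suc j => coeff q j) *s mpow A i v) - (\<Sum>i\<le>Suc n. (z * coeff q i) *s mpow A i v)"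
  unfolding sum_subtractf[symmetric] factor
  by (intro sum.cong refl) (simp only: coeff_diff coeff_smult coeff_pCons vector_sub_rdistrib)
 also have "(\<Sum>i\<le>Suc n. (z * coeff q i) *s mpow A i v) = (\<Sum>i\<le>n. (z * coeff q i) *s mpow A i v)"
  by (simp add: n_def coeff_eq_0)
 also have "(\<Sum>i\<le>Suc n. (case i of 0 => 0 | Suc j => coeff q j) *s mpow A i v) = (\<Sum>i\<le>n. coeff q i *s mpow A (Suc i) v)"
  by (subst sum.atMost_Suc_shift) simp
 also have "(\<Sum>i\<le>n. coeff q i *s mpow A (Suc i) v) - (\<Sum>i\<le>n. (z * coeff q i) *s mpow A i v) = (\<Sum>i\<le>n. coeff q i *s mpow A i (A *v v - z *s v))"
  unfolding sum_subtractf[symmetric]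
  by (intro sum.cong refl) (simp add: mpow_linear mpow_simps vector_ssub_ldistrib vector_smult_assoc mult.commute)
 also have "... = poly_apply A q (A *v v - z *s v)" by (simp add: poly_apply_def n_def)
 finally show ?thesis .
qed

lemma matrix_vector_mult_sum: "A *v (\<Sum>i\<in>I. f i) = (\<Sum>i\<in>I. (A :: complex^'d::finite^'d) *v f i)"
 by (induction I rule: infinite_finite_induct) (simp_all add: matrix_vector_right_distrib)

lemma of_real_vector_scalar_mult: "complex_of_real r *s w = r *\<^sub>R w"
 unfolding vec_eq_iff vector_scaleR_component vector_smult_component by (simp add: scaleR_conv_of_real)

lemma poly_apply_commute:
 "poly_apply A q (A *v v - z *s v) = A *v poly_apply A q v - z *s poly_apply A q v"
proof -
 have "poly_apply A q (A *v v - z *s v) = (\<Sum>i\<le>degree q. A *v (coeff q i *s mpow A i v) - z *s (coeff q i *s mpow A i v))"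
  unfolding poly_apply_def
  by (intro sum.cong refl) (simp add: mpow_linear mpow_simps vector_ssub_ldistrib vector_smult_assoc mult.commute vector_scalar_commute)
 also have "... = A *v poly_apply A q v - z *s poly_apply A q v"
  unfolding poly_apply_def sum_subtractf by (simp add: matrix_vector_mult_sum vec.scale_sum_right)
 finally show ?thesis .
qed

text \<open>Each step contracts by |c| and adds a small error. Once the error is below (1 - |c|)
  e/2, the level e/2 is stationary and the excess over it decays geometrically.\<close>

lemma linear_recurrence_tendsto_0:
 fixes x w :: "nat => complex^'d::finite"
 assumes c: "cmod c < 1" and rec: "!!n. x (Suc n) = c *s x n + w n" and w: "w ~~> 0"
 shows "x ~~> 0"
proof -
 define b where "b = (%n. norm (x n))"
 have nc: "norm (c *s y) = cmod c * norm y" for y :: "complex^'d"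
  by (simp add: norm_vec_def L2_set_def norm_mult power_mult_distrib sum_distrib_left[symmetric] real_sqrt_mult)
 have b: "b (Suc n) <= cmod c * b n + norm (w n)" for n
  unfolding b_def rec using norm_triangle_ineq[of "c *s x n" "w n"] by (simp add: nc)
 have w0: "(%n. norm (w n)) ~~> 0" using w by (rule tendsto_norm_zero)
 have "b ~~> 0"
 proof (rule LIMSEQ_I)
  fix e :: real assume e: "e > 0"
  define e' where "e' = (1 - cmod c) * (e / 2)"
  have e': "e' > 0" using e c by (simp add: e'_def)
  obtain N where N: "!!n. n >= N ==> norm (w n) < e'"
   using order_tendstoD(2)[OF w0 e'] by (auto simp: eventually_sequentially)
  have distrib: "cmod c * (X + h) + (1 - cmod c) * h = cmod c * X + h" for X h :: real
   by (simp add: algebra_simps)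
  have bd: "b (N + k) <= cmod c ^ k * b N + e / 2" for k
  proof (induction k)
   case (Suc k)
   have "b (N + Suc k) <= cmod c * b (N + k) + e'" using b[of "N + k"] N[of "N + k"] by simp
   also have "... <= cmod c * (cmod c ^ k * b N + e / 2) + e'" using Suc by (intro add_right_mono mult_left_mono) auto
   also have "... = cmod c ^ Suc k * b N + e / 2"
    using distrib[of "cmod c ^ k * b N" "e / 2"] by (simp add: e'_def mult.assoc)
   finally show ?case .
  qed (use e in simp)
  have "(%k. cmod c ^ k * b N) ~~> 0 * b N" using c by (intro tendsto_mult LIMSEQ_power_zero tendsto_const) simp
  then have "(%k. cmod c ^ k * b N) ~~> 0" by simp
  then obtain K where K: "!!k. k >= K ==> cmod c ^ k * b N < e / 2"
   using order_tendstoD(2)[of _ 0 sequentially "e / 2"] e by (auto simp: eventually_sequentially)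
  show "\<exists>no. \<forall>n\<ge>no. norm (b n - 0) < e"
  proof (intro exI allI impI)
   fix n assume "n >= N + K"
   then have "b n <= cmod c ^ (n - N) * b N + e / 2" "n - N >= K" using bd[of "n - N"] by auto
   then show "norm (b n - 0) < e" using K[of "n - N"] by (simp add: b_def)
  qed
 qed
 then show ?thesis unfolding b_def by (rule tendsto_norm_zero_cancel)
qed

text \<open>Convergence of the powers of a matrix with spectral radius less than 1, applied to one vector \<open>v\<close>: \<open>v\<close> is
 annihilated by a polynomial in the matrix, whose linear factors are removed one at a time.\<close>

context
 fixes A :: "complex^'d::finite^'d"
 assumes eig: "!!c v. v ~= 0 ==> A *v v = c *s v ==> cmod c < 1"
begin

lemma mpow_tendsto_0_of_poly:
 "degree p = n ==> p ~= 0 ==> poly_apply A p v = 0 ==> (%j. mpow A j v) ~~> 0"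
proof (induction n arbitrary: p v)
 case 0
 then have "coeff p 0 ~= 0" by (metis leading_coeff_0_iff)
 moreover have "coeff p 0 *s v = 0" using 0 by (simp add: poly_apply_def mpow_simps)
 ultimately have v: "v = 0" by (simp add: vector_mul_eq_0)
 have "mpow A j v = 0" for j by (induction j) (simp_all add: mpow_simps v)
 then show ?case by simp
next
 case (Suc n)
 then have "\<not> constant (poly p)" by (simp add: constant_degree)
 then obtain z where "poly p z = 0" using fundamental_theorem_of_algebra by blast
 then obtain q where p: "p = [:- z, 1:] * q" by (auto simp: poly_eq_0_iff_dvd elim: dvdE)
 then have q: "q ~= 0" "degree q = n" using Suc.prems by (auto simp: degree_mult_eq simp del: mult_pCons_left)
 define w where "w = A *v v - z *s v"
 have pw: "poly_apply A q w = 0" using Suc.prems(3) unfolding p poly_apply_factor w_def .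
 \<comment> \<open>If |z| < 1, the orbit of v obeys a contracting recurrence driven by the orbit of
   w = (A - z) v, which the induction hypothesis covers. Otherwise z is not an eigenvalue, so q(A)
   v, being killed by A - z, is 0 and q already annihilates v.\<close>
 show ?case
 proof (cases "cmod z < 1")
  case True
  have "(%j. mpow A j w) ~~> 0" by (rule Suc.IH[OF q(2,1) pw])
  then show ?thesis
   by (rule linear_recurrence_tendsto_0[OF True, rotated]) (simp add: w_def mpow_linear mpow_simps)
 next
  case False
  have "A *v poly_apply A q v = z *s poly_apply A q v"
   using pw unfolding w_def poly_apply_commute by simp
  then have "poly_apply A q v = 0" using eig False by blast
  then show ?thesis by (rule Suc.IH[OF q(2,1)])
 qed
qed

lemma mpow_tendsto_0: "(%j. mpow A j v) ~~> 0"
proof -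
 define m where "m = DIM(complex^'d)"
 \<comment> \<open>m is the real dimension, so the m + 1 vectors A^i v with i <= m are linearly
   dependent; if two of them coincide, their difference is the relation.\<close>
 have "\<exists>a::nat => real. (\<exists>i\<le>m. a i ~= 0) \<and> (\<Sum>i\<le>m. a i *\<^sub>R mpow A i v) = 0"
 proof (cases "inj_on (%i. mpow A i v) {..m}")
  case True
  define S where "S = (%i. mpow A i v) ` {..m}"
  have "card S = Suc m" using True by (simp add: S_def card_image)
  then have "dependent S" using dependent_biggerset[of S] by (simp add: m_def S_def)
  then obtain u where u: "(\<Sum>x\<in>S. u x *\<^sub>R x) = 0" "\<exists>x\<in>S. u x ~= 0"
   using dependent_finite[of S] by (auto simp: S_def)
  have "(\<Sum>i\<le>m. u (mpow A i v) *\<^sub>R mpow A i v) = 0"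
   using u(1) True by (simp add: S_def sum.reindex)
  then show ?thesis using u(2) by (intro exI[of _ "%i. u (mpow A i v)"]) (auto simp: S_def)
 next
  case False
  then obtain i k where ik: "i <= m" "k <= m" "i ~= k" "mpow A i v = mpow A k v" by (auto simp: inj_on_def)
  define a where "a = (%l. if l = i then 1 else if l = k then - 1 else (0::real))"
  have "(\<Sum>l\<le>m. a l *\<^sub>R mpow A l v) = (\<Sum>l\<in>{i, k}. a l *\<^sub>R mpow A l v)"
   using ik by (intro sum.mono_neutral_right) (auto simp: a_def)
  also have "... = 0" using ik by (simp add: a_def)
  finally show ?thesis using ik(1) by (intro exI[of _ a]) (auto simp: a_def)
 qed
 then obtain a :: "nat => real" and i where a: "i <= m" "a i ~= 0" "(\<Sum>i\<le>m. a i *\<^sub>R mpow A i v) = 0" by blast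
 define p where "p = (\<Sum>i\<le>m. monom (complex_of_real (a i)) i)"
 have c: "coeff p i = (if i <= m then of_real (a i) else 0)" for i
  by (simp add: p_def coeff_sum)
 have "coeff p i ~= 0" using a by (simp add: c)
 then have "p ~= 0" by auto
 have "degree p <= m" by (rule degree_le) (simp add: c)
 then have "poly_apply A p v = (\<Sum>i\<le>m. a i *\<^sub>R mpow A i v)"
  by (subst poly_apply_extend) (auto intro!: sum.cong simp: c of_real_vector_scalar_mult)
 then have "poly_apply A p v = 0" using a by simp
 then show ?thesis using mpow_tendsto_0_of_poly \<open>p ~= 0\<close> by blast
qed

end

definition cvec :: "real^'d => complex^'d" where "cvec x = (\<chi> i. complex_of_real (x $ i))"
definition cmat :: "real^'d^'d => complex^'d^'d" where "cmat A = (\<chi> i j. complex_of_real (A $ i $ j))"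

lemma cmat_mult_cvec: "cmat (A :: real^'d::finite^'d) *v cvec x = cvec (A *v x)"
 by (simp add: cmat_def cvec_def matrix_vector_mult_def vec_eq_iff)

lemma cmat_mult: "cmat (A :: real^'d::finite^'d) ** cmat B = cmat (A ** B)"
 by (simp add: cmat_def matrix_matrix_mult_def vec_eq_iff)

lemma cmat_mat_1: "cmat (mat 1) = mat 1"
 by (simp add: cmat_def mat_def vec_eq_iff)

lemma onorm_matrix_tendsto_0:
 fixes X :: "nat => real^'d::finite^'d"
 assumes "!!i k. (%n. X n $ i $ k) ~~> 0"
 shows "(%n. onorm ((*v) (X n))) ~~> 0"
proof (rule tendsto_sandwich[OF _ _ tendsto_const])
 have "(%n. \<Sum>i\<in>UNIV. \<Sum>k\<in>UNIV. \<bar>X n $ i $ k\<bar>) ~~> (\<Sum>i\<in>(UNIV::'d set). \<Sum>k\<in>(UNIV::'d set). \<bar>0\<bar>)"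
  by (intro tendsto_intros assms)
 then show "(%n. \<Sum>i\<in>UNIV. \<Sum>k\<in>UNIV. \<bar>X n $ i $ k\<bar>) ~~> 0" by simp
 show "\<forall>\<^sub>F n in sequentially. onorm ((*v) (X n)) <= (\<Sum>i\<in>UNIV. \<Sum>k\<in>UNIV. \<bar>X n $ i $ k\<bar>)"
  by (intro always_eventually allI onorm_le_matrix_component_sum)
qed (auto intro!: always_eventually onorm_pos_le matrix_vector_mul_bounded_linear)

context
 fixes M :: "real^'d::finite^'d"
 assumes M: "dilation_matrix M"
begin

lemma dilation_matrix_invertible: "invertible M"
proof (rule ccontr)
 assume "\<not> invertible M"
 then obtain x where x: "x ~= 0" "M *v x = 0"
  using invertible_left_inverse[of M] matrix_left_invertible_ker[of M] by auto
 have "cvec x ~= 0" using x(1) by (auto simp: cvec_def vec_eq_iff)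
 moreover have "cmat M *v cvec x = 0 *s cvec x"
  unfolding cmat_mult_cvec x(2) by (simp add: cvec_def vec_eq_iff)
 ultimately have "cmod 0 > 1" using M unfolding dilation_matrix_def cmat_def by blast
 then show False by simp
qed

lemma dilation_inverse: "M ** matrix_inv M = mat 1" "matrix_inv M ** M = mat 1"
proof -
 obtain B where B: "M ** B = mat 1" "B ** M = mat 1" using dilation_matrix_invertible by (auto simp: invertible_def)
 then have "matrix_inv M = B" by (intro matrix_inv_unique_right)
 then show "M ** matrix_inv M = mat 1" "matrix_inv M ** M = mat 1" using B by auto
qed

abbreviation (input) "Mp \<equiv> mat_pow M"
abbreviation (input) "Bp \<equiv> mat_pow (matrix_inv M)"

lemma mat_powi_dilation: "mat_powi M (int j) = Mp j" "mat_powi M (- int j) = Bp j"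
 "mat_powi (transpose M) (- int j) = transpose (Bp j)"
proof -
 have "transpose M ** transpose (matrix_inv M) = mat 1"
  using dilation_inverse(2) by (metis matrix_transpose_mul transpose_mat)
 then have "matrix_inv (transpose M) = transpose (matrix_inv M)" by (rule matrix_inv_unique_right)
 then show "mat_powi M (int j) = Mp j" "mat_powi M (- int j) = Bp j" "mat_powi (transpose M) (- int j) = transpose (Bp j)"
  by (auto simp: mat_powi_def transpose_mat_pow transpose_mat)
qed

lemma dilation_powers_inverse: "Mp j ** Bp j = mat 1" "Bp j ** Mp j = mat 1"
 by (rule mat_pow_inverse, rule dilation_inverse)+

lemma dilation_powers_transpose_inverse:
 "transpose (Mp j) ** transpose (Bp j) = mat 1" "transpose (Bp j) ** transpose (Mp j) = mat 1"
 using dilation_powers_inverse[of j] by (metis matrix_transpose_mul transpose_mat)+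

text \<open>The eigenvalues of the complexified inverse are reciprocals of eigenvalues of M, hence
  of modulus below 1. Entries of the powers are coordinates of orbits of basis vectors.\<close>

lemma dilation_inverse_power_entry: "(%j. Bp j $ i $ k) ~~> 0"
proof -
 define B where "B = matrix_inv M"
 have MB: "cmat M ** cmat B = mat 1" using dilation_inverse by (simp add: cmat_mult B_def cmat_mat_1)
 have eig: "cmod c < 1" if "v ~= 0" "cmat B *v v = c *s v" for c v
 proof -
  have v: "v = c *s (cmat M *v v)"
   using arg_cong[OF that(2), of "(*v) (cmat M)"] MB by (simp add: matrix_vector_mul_assoc vector_scalar_commute)
  then have c: "c ~= 0" using that(1) by auto
  have "cmat M *v v = inverse c *s v"
   by (subst (2) v) (simp add: vector_smult_assoc c)
  then have "cmod (inverse c) > 1" using M that(1) unfolding dilation_matrix_def cmat_def by blast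
  then show ?thesis using c by (simp add: norm_inverse one_less_inverse_iff)
 qed
 have eq: "mpow (cmat B) j (cvec x) = cvec (mat_pow B j *v x)" for j x
  by (induction j) (simp_all add: mpow_simps cmat_mult_cvec matrix_vector_mul_assoc)
 have "(%j. mpow (cmat B) j (cvec (axis k 1))) ~~> 0" by (rule mpow_tendsto_0[OF eig])
 then have "(%j. cvec (mat_pow B j *v axis k 1) $ i) ~~> 0 $ i" unfolding eq by (rule tendsto_vec_nth)
 then have "(%j. cmod (cvec (mat_pow B j *v axis k 1) $ i)) ~~> 0" by (simp add: tendsto_norm_zero)
 then have "(%j. \<bar>(mat_pow B j *v axis k 1) $ i\<bar>) ~~> 0" by (simp add: cvec_def)
 then have "(%j. (mat_pow B j *v axis k 1) $ i) ~~> 0" by (rule tendsto_rabs_zero_cancel)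
 moreover have "(X *v axis k 1) $ i = X $ i $ k" for X :: "real^'d^'d"
  by (simp add: matrix_vector_mult_def axis_def if_distrib[where f = "(*) _"] cong: if_cong)
 ultimately show ?thesis by (simp add: B_def)
qed

lemma onorm_dilation_inverse_tendsto_0:
 "(%j. onorm ((*v) (Bp j))) ~~> 0" "(%j. onorm ((*v) (transpose (Bp j)))) ~~> 0"
 by (rule onorm_matrix_tendsto_0; use dilation_inverse_power_entry in \<open>simp add: transpose_def\<close>)+

lemma onorm_dilation_inverse_pos: "onorm ((*v) (transpose (Bp j))) > 0"
proof (rule ccontr)
 assume "\<not> ?thesis"
 then have "onorm ((*v) (transpose (Bp j))) = 0"
  using onorm_pos_le[OF matrix_vector_mul_bounded_linear, of "transpose (Bp j)"] by simp
 then have 0: "transpose (Bp j) *v x = 0" for x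
  using onorm_eq_0[OF matrix_vector_mul_bounded_linear, of "transpose (Bp j)"] by (auto simp: fun_eq_iff)
 have "axis undefined 1 = transpose (Mp j) *v (transpose (Bp j) *v axis undefined 1)"
  by (simp only: matrix_vector_mul_assoc dilation_powers_transpose_inverse matrix_vector_mul_lid)
 then have "axis undefined (1::real) = (0 :: real^'d)" unfolding 0 by simp
 then show False by (simp add: axis_eq_0_iff)
qed

end

section \<open>Borel representatives and injectivity of the Fourier transform\<close>

lemma lebesgue_ex_borel:
 fixes f :: "'a::euclidean_space => complex"
 assumes "f : borel_measurable lebesgue"
 shows "\<exists>f'\<in>bm. AE x in lborel. f x = f' x"
proof -
 have "(%x. Re (f x)) : borel_measurable lebesgue" "(%x. Im (f x)) : borel_measurable lebesgue"
  using assms by simp_all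
 then obtain a b where ab: "a : borel_measurable lborel" "AE x in lborel. Re (f x) = a x" "b : borel_measurable lborel" "AE x in lborel. Im (f x) = b x"
  using completion_ex_borel_measurable_real by metis
 show ?thesis
 proof (rule bexI[of _ "%x. Complex (a x) (b x)"])
  show "AE x in lborel. f x = Complex (a x) (b x)" using ab(2,4) by eventually_elim (simp add: complex_eq_iff)
  have [measurable]: "a : bm" "b : bm" using ab by simp_all
  show "(%x. Complex (a x) (b x)) : bm" unfolding Complex_eq by measurable
 qed
qed

lemma LINT_lebesgue_cong:
 fixes F F' :: "'a::euclidean_space => complex"
 assumes [measurable]: "F' : bm" and AE: "AE x in lborel. F x = F' x"
 shows "(LINT x|lebesgue. F x) = (LINT x|lborel. F' x)" "integrable lebesgue F \<longleftrightarrow> integrable lborel F'"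
proof -
 have m': "F' : borel_measurable lebesgue" by (rule measurable_completion) simp
 have AE': "AE x in lebesgue. F x = F' x" using AE by (rule AE_completion)
 then have AE'': "AE x in lebesgue. F' x = F x" by eventually_elim simp
 have m: "F : borel_measurable lebesgue"
  using borel_measurable_AE[OF m' AE''] .
 show "(LINT x|lebesgue. F x) = (LINT x|lborel. F' x)"
  using integral_cong_AE[OF m m' AE'] integral_completion[of F' lborel] by simp
 show "integrable lebesgue F \<longleftrightarrow> integrable lborel F'"
  using integrable_cong_AE[OF m m' AE'] integrable_completion[of F' lborel] by simp
qed

lemma fourier_eq_fhat:
 fixes f f' :: "real^'d::finite => complex"
 assumes [measurable]: "f' : bm" and AE: "AE x in lborel. f x = f' x"
 shows "fourier f = fhat f'"
proof
 fix w
 have "AE x in lborel. f x * cis (- 2 * pi * (x \<bullet> w)) = f' x * cnj (character w x)"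
  using AE by eventually_elim (simp add: character_def cis_cnj inner_commute)
 then show "fourier f w = fhat f' w"
  unfolding fourier_def fhat_def by (intro LINT_lebesgue_cong) measurable
qed

lemma borel_measurable_fhat [measurable]:
 assumes [measurable]: "f : bm"
 shows "fhat f : bm"
 unfolding fhat_def by measurable

text \<open>Uniqueness on the torus is used twice. For each x the periodization of H(y) e(xy) has
  vanishing coefficients, so the sum \<open>G x y\<close> of H(y+l) e(lx) is 0 for almost every y.
  After exchanging the order of the quantifiers, for almost every y it is 0 for almost every x, and
  its coefficients as a function of x are the values H(y+k).\<close>

lemma fourier_unique:
 fixes H :: "real^'d::finite => complex"
 assumes [measurable]: "H : bm" and H: "integrable lborel H"
  and 0: "!!t. (LINT w|lborel. H w * cnj (character t w)) = 0"
 shows "AE w in lborel. H w = 0"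
proof -
 interpret t: prob_space "tor :: (real^'d) measure" by (rule prob_space_tor)
 interpret pair_sigma_finite "tor :: (real^'d) measure" "tor :: (real^'d) measure" ..
 define G where "G = (%x y. LINT l|latm. H (y + l) * character l x)"
 have Gm: "(%z. G (fst z) (snd z)) : borel_measurable (borel \<Otimes>\<^sub>M borel)"
  unfolding G_def by (rule borel_measurable_LINT_latm) measurable
 then have Gm': "(%z. G (fst z) (snd z)) : borel_measurable (tor \<Otimes>\<^sub>M tor)"
  by (simp cong: measurable_cong_sets sets_pair_measure_cong)
 have "AE y in tor. G x y = 0" for x
 proof -
  define b where "b = (%y. H y * character x y)"
  have [measurable]: "b : bm" unfolding b_def by measurable
  have ib: "integrable lborel b" using H by (simp add: b_def)
  have "AE y in tor. (LINT l|latm. b (y + l)) = 0"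
  proof (rule fcoeff_unique)
   show "integrable tor (%y. LINT l|latm. b (y + l))" by (rule integral_periodize(3)[OF ib])
   fix k :: "real^'d" assume k: "k : int_lattice"
   have "fcoeff (%y. LINT l|latm. b (y + l)) k = (LINT y|lborel. b y * cnj (character k y))"
    by (rule fcoeff_periodize[OF _ ib k]) measurable
   also have "... = (LINT y|lborel. H y * cnj (character (k - x) y))"
    unfolding diff_conv_add_uminus character_simps b_def by (simp add: mult_ac)
   finally show "fcoeff (%y. LINT l|latm. b (y + l)) k = 0" by (simp add: 0)
  qed
  then show ?thesis
  proof eventually_elim
   case (elim y)
   have "(LINT l|latm. b (y + l)) = character x y * G x y"
   proof -
    have *: "b (y + l) = character x y * (H (y + l) * character l x)" for l
     by (simp add: b_def character_simps character_commute[of l x] mult_ac)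
    show ?thesis unfolding * G_def by simp
   qed
   with elim show ?case by simp
  qed
 qed
 then have "AE x in tor. AE y in tor. G x y = 0" by simp
 moreover have "{z : space (tor \<Otimes>\<^sub>M tor). G (fst z) (snd z) = 0} : sets (tor \<Otimes>\<^sub>M tor)"
  using Gm' by measurable
 ultimately have "AE y in tor. AE x in tor. G x y = 0"
  using AE_commute[of "%x y. G x y = 0"] by blast
 moreover have "AE y in tor. integrable latm (%k. H (y + k))" by (rule integral_periodize(2)[OF H])
 ultimately have "AE y in tor. \<forall>k\<in>int_lattice. H (y + k) = 0"
 proof eventually_elim
  case (elim y)
  show ?case
  proof
   fix k :: "real^'d" assume k: "k : int_lattice"
   have "H (y + k) = fcoeff (%x. LINT l|latm. H (y + l) * character l x) k"
    using elim(2) k by (intro fcoeff_character_series[symmetric]) (auto simp: integrable_latm_iff)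
   also have "... = (LINT x|tor. G x y * cnj (character k x))" by (simp add: fcoeff_def G_def)
   also have "... = 0"
    using elim(1) by (intro integral_eq_zero_AE) (auto elim: eventually_mono)
   finally show "H (y + k) = 0" .
  qed
 qed
 then show ?thesis by (subst AE_tor_lattice_iff)
qed

lemma schwartz_borel: "f : schwartz ==> f : bm"
 using schwartz_differentiable(2)[of f]
 by (intro borel_measurable_continuous_onI continuous_at_imp_continuous_on ballI differentiable_imp_continuous_within) auto

lemma schwartz_integrable:
 fixes f :: "real^'d::finite => complex"
 assumes f: "f : schwartz"
 shows "integrable lborel f"
proof -
 have [measurable]: "f : bm" by (rule schwartz_borel[OF f])
 define s where "s = CARD('d) + 1"
 obtain B where B: "!!x. (1 + norm x) ^ s * cmod (f x) <= B"
  using schwartz_rapidly_decreasing[OF f] unfolding rapidly_decreasing_def by meson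
 have B0: "B >= 0" using order_trans[OF norm_ge_zero[of "f 0"]] B[of 0] by simp
 show ?thesis
 proof (rule integrableI_bounded)
  have "(INTR x. ennreal (norm (f x))) <= (\<integral>\<^sup>+x. ennreal B * ennreal ((1 + norm x) powr (- real s)) \<partial>(lborel :: (real^'d) measure))"
  proof (rule nn_integral_mono)
   fix x :: "real^'d"
   have p: "1 + norm x > 0" by (simp add: add_pos_nonneg)
   have "cmod (f x) <= B * (1 + norm x) powr (- real s)"
    using B[of x] p by (simp add: powr_minus powr_realpow field_simps)
   then show "ennreal (norm (f x)) <= ennreal B * ennreal ((1 + norm x) powr (- real s))"
    using B0 by (simp add: ennreal_mult[symmetric] ennreal_leI)
  qed
  also have "... = ennreal B * (\<integral>\<^sup>+x. ennreal ((1 + norm x) powr (- real s)) \<partial>(lborel :: (real^'d) measure))"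
   by (rule nn_integral_cmult) measurable
  also have "... < infy"
   using nn_integral_one_plus_norm_powr[where 'a = "real^'d", of "real s"] by (simp add: ennreal_mult_less_top s_def)
  finally show "(INTR x. ennreal (norm (f x))) < infy" .
 qed measurable
qed

lemma linear_change_of_variables:
 fixes A :: "real^'d::finite^'d"
 assumes d: "lborel = density (distr lborel borel ((*v) A)) (%_. ennreal c)" and c: "c > 0"
 shows "f : bm ==> (INTR x. f x) = ennreal c * (INTR x. f (A *v x))"
  and "F : bm ==> integrable lborel F \<longleftrightarrow> integrable lborel (%x. F (A *v x))"
  and "F : bm ==> (LINT x|lborel. F x) = of_real c * (LINT x|lborel. (F (A *v x) :: complex))"
  and "(AE x in lborel. P x) ==> (AE x in lborel. P (A *v x))"
proof -
 have [measurable]: "(*v) A : bm" by (intro borel_measurable_continuous_onI continuous_intros)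
 show "(INTR x. f x) = ennreal c * (INTR x. f (A *v x))" if [measurable]: "f : bm" for f
  by (subst d) (simp add: nn_integral_density nn_integral_distr nn_integral_cmult)
 show "integrable lborel F \<longleftrightarrow> integrable lborel (%x. F (A *v x))" if [measurable]: "F : bm" for F :: "_ => complex"
 proof -
  have "integrable lborel F \<longleftrightarrow> integrable (density (distr lborel borel ((*v) A)) (%_. ennreal c)) F" using d by simp
  also have "... \<longleftrightarrow> integrable (distr lborel borel ((*v) A)) (%x. c *\<^sub>R F x)"
   using c by (subst integrable_density) auto
  also have "... \<longleftrightarrow> integrable lborel (%x. c *\<^sub>R F (A *v x))" by (subst integrable_distr_eq) auto
  also have "... \<longleftrightarrow> integrable lborel (%x. F (A *v x))"
  proof
   assume "integrable lborel (%x. c *\<^sub>R F (A *v x))"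
   then have "integrable lborel (%x. (1 / c) *\<^sub>R (c *\<^sub>R F (A *v x)))" 
    using integrable_scaleR_right[of "1 / c" lborel "%x. c *\<^sub>R F (A *v x)"] by blast
   moreover have "1 / c * c = 1" using c by simp
   ultimately show "integrable lborel (%x. F (A *v x))" unfolding scaleR_scaleR by (simp only: scaleR_one)
  qed simp
  finally show ?thesis .
 qed
 show "(LINT x|lborel. F x) = of_real c * (LINT x|lborel. (F (A *v x) :: complex))" if [measurable]: "F : bm" for F
 proof -
  have "(LINT x|lborel. F x) = (LINT x|density (distr lborel borel ((*v) A)) (%_. ennreal c). F x)" using d by simp
  also have "... = (LINT x|distr lborel borel ((*v) A). c *\<^sub>R F x)"
   using c by (subst integral_density) auto
  also have "... = (LINT x|lborel. c *\<^sub>R F (A *v x))" by (subst integral_distr) auto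
  finally show ?thesis by (simp add: scaleR_conv_of_real)
 qed
 assume "AE x in lborel. P x"
 then have "AE x in density (distr lborel borel ((*v) A)) (%_. ennreal c). P x" unfolding d[symmetric] .
 then have "AE x in distr lborel borel ((*v) A). P x" using c by (subst (asm) AE_density) auto
 then show "AE x in lborel. P (A *v x)" by (rule AE_distrD[rotated]) measurable
qed

text \<open>The transform of the Gaussian is nonzero at 0, its integral being positive, hence on a
  ball by continuity. A dilation enlarges the ball to radius R, so the transform is never
  computed.\<close>

lemma schwartz_fourier_nonzero:
 "\<exists>f\<in>schwartz. \<forall>w :: real^'d::finite. norm w < R --> fhat f w ~= 0"
proof -
 define f0 where "f0 = (%x::real^'d. complex_of_real (exp (- (x \<bullet> x))))"
 have f0: "f0 : schwartz" unfolding f0_def by (rule gaussian_schwartz)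
 have i0: "integrable lborel f0" and [measurable]: "f0 : bm"
  using schwartz_integrable[OF f0] schwartz_borel[OF f0] by auto
 have "fhat f0 0 = of_real (LINT x|lborel. exp (- (x \<bullet> (x :: real^'d))))"
  by (simp add: fhat_def character_simps f0_def)
 moreover have "(LINT x|lborel. exp (- (x \<bullet> (x :: real^'d)))) ~= 0"
 proof
  assume "(LINT x|lborel. exp (- (x \<bullet> (x :: real^'d)))) = 0"
  moreover have "integrable lborel (%x::real^'d. exp (- (x \<bullet> x)))"
   using integrable_norm[OF i0] by (simp add: f0_def)
  ultimately have "AE x in (lborel :: (real^'d) measure). False"
   by (subst (asm) integral_nonneg_eq_0_iff_AE) auto
  then have "emeasure (lborel :: (real^'d) measure) UNIV = 0"
   using AE_iff_measurable[of UNIV lborel "%x::real^'d. False"] by simp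
  then show False using emeasure_mono[of unit_cell UNIV "lborel :: (real^'d) measure"] emeasure_unit_cell[where 'd = 'd] by simp
 qed
 ultimately have "fhat f0 0 ~= 0" by simp
 then obtain d where d: "d > 0" "!!z. norm z < d ==> fhat f0 z ~= 0"
  using continuous_at_avoid[OF fhat_continuous[OF _ i0, of 0], of 0] by auto
 define a where "a = (\<bar>R\<bar> + 1) / d"
 have a: "a > 0" using d by (simp add: a_def add_nonneg_pos)
 define A where "A = a *\<^sub>R (mat 1 :: real^'d^'d)"
 have Av: "A *v x = a *\<^sub>R x" for x by (simp add: A_def scaleR_matrix_vector_assoc[symmetric])
 have inv: "invertible A"
  unfolding invertible_left_inverse matrix_left_invertible_injective using a by (auto simp: inj_on_def Av)
 obtain c where c: "c > 0" "lborel = density (distr lborel borel ((*v) A)) (%_. ennreal c)"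
  using lborel_density_linear[OF inv] by blast
 define f where "f = (%x. f0 (A *v x + 0))"
 have f: "f : schwartz" unfolding f_def by (rule schwartz_affine[OF f0 inv])
 have "fhat f w ~= 0" if w: "norm w < R" for w
 proof -
  have "norm w < \<bar>R\<bar> + 1" using w by linarith
  then have "norm (w /\<^sub>R a) < d" 
   using mult_strict_left_mono[of "norm w" "\<bar>R\<bar> + 1" d] d(1) a by (simp add: a_def field_simps)
  have "a * (inverse a * t) = t" for t :: real using a by simp
  then have "character (w /\<^sub>R a) (a *\<^sub>R x) = character w x" for x
   unfolding character_def inner_scaleR_left inner_scaleR_right by (simp only:)
  moreover have "fhat f0 (w /\<^sub>R a) = of_real c * (LINT x|lborel. f0 (A *v x) * cnj (character (w /\<^sub>R a) (A *v x)))"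
   unfolding fhat_def by (rule linear_change_of_variables(3)[OF c(2,1)]) measurable
  ultimately have "fhat f0 (w /\<^sub>R a) = of_real c * fhat f w"
   by (simp add: fhat_def f_def Av)
  then show ?thesis using d(2)[OF \<open>norm (w /\<^sub>R a) < d\<close>] by auto
 qed
 then show ?thesis using f by blast
qed

lemma cis_character: "cis (- 2 * pi * (x \<bullet> w)) = cnj (character w x)"
 by (simp add: character_def cis_cnj inner_commute)

lemma fourier_schwartz: "f : schwartz ==> fourier f = fhat f"
 by (rule fourier_eq_fhat[OF schwartz_borel]) auto

lemma has_fourier_function_AE_cong:
 assumes h: "has_fourier_function T h" and [measurable]: "h' : bm" and AE: "AE w in lborel. h w = h' w"
 shows "has_fourier_function T h'"
  and "!!f. f : schwartz ==> integrable lborel (%w. fhat f w * cnj (h' w)) \<and> (LINT w|lborel. fhat f w * cnj (h' w)) = T f"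
proof -
 have *: "integrable lborel (%w. fhat f w * cnj (h' w)) \<and> (LINT w|lborel. fhat f w * cnj (h' w)) = T f"
  if f: "f : schwartz" for f
 proof -
  have [measurable]: "f : bm" by (rule schwartz_borel[OF f])
  have "AE w in lborel. fourier f w * cnj (h w) = fhat f w * cnj (h' w)"
   using AE by eventually_elim (simp add: fourier_schwartz[OF f])
  from LINT_lebesgue_cong[OF _ this] h f show ?thesis
   by (auto simp: has_fourier_function_def pairing_def)
 qed
 show "!!f. f : schwartz ==> integrable lborel (%w. fhat f w * cnj (h' w)) \<and> (LINT w|lborel. fhat f w * cnj (h' w)) = T f"
  by (rule *)
 show "has_fourier_function T h'"
  unfolding has_fourier_function_def
 proof (intro conjI ballI)
  show "h' : borel_measurable lebesgue" by (rule measurable_completion) simp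
  fix f :: "real^'a => complex" assume f: "f : schwartz"
  have [measurable]: "f : bm" by (rule schwartz_borel[OF f])
  have m: "(%w. fhat f w * cnj (h' w)) : bm" by measurable
  have r: "AE w in lborel. fourier f w * cnj (h' w) = fhat f w * cnj (h' w)"
   by (simp add: fourier_schwartz[OF f])
  show "integrable lebesgue (%w. fourier f w * cnj (h' w))" "pairing (fourier f) h' = T f"
   using LINT_lebesgue_cong[OF m r] *[OF f] by (auto simp: pairing_def)
 qed
qed

lemma has_fourier_function_borel:
 assumes "has_fourier_function T h"
 shows "\<exists>h'\<in>bm. AE w in lborel. h w = h' w"
 using assms lebesgue_ex_borel[of h] by (simp add: has_fourier_function_def)

text \<open>Testing with the translates of a Schwartz function \<open>f\<close> shows that
 $\widehat f\,\overline{(h_1-h_2)}$ has vanishing Fourier transform.\<close>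

lemma has_fourier_function_unique:
 fixes h1 h2 :: "real^'d::finite => complex"
 assumes 1: "has_fourier_function T h1" and 2: "has_fourier_function T h2"
 shows "AE w in lborel. h1 w = h2 w"
proof -
 obtain k1 where [measurable]: "k1 : bm" and k1: "AE w in lborel. h1 w = k1 w"
  using has_fourier_function_borel[OF 1] by blast
 obtain k2 where [measurable]: "k2 : bm" and k2: "AE w in lborel. h2 w = k2 w"
  using has_fourier_function_borel[OF 2] by blast
 note K1 = has_fourier_function_AE_cong(2)[OF 1 \<open>k1 : _\<close> k1]
 note K2 = has_fourier_function_AE_cong(2)[OF 2 \<open>k2 : _\<close> k2]
 have zero: "AE w in lborel. fhat f w * cnj (k1 w - k2 w) = 0" if f: "f : schwartz" for f
 proof -
  have [measurable]: "f : bm" by (rule schwartz_borel[OF f])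
  define H where "H = (%w. fhat f w * cnj (k1 w - k2 w))"
  have H: "H = (%w. fhat f w * cnj (k1 w) - fhat f w * cnj (k2 w))" by (simp add: H_def fun_eq_iff algebra_simps)
  have iH: "integrable lborel H" unfolding H using K1[OF f] K2[OF f] by simp
  have "(LINT w|lborel. H w * cnj (character t w)) = 0" for t
  proof -
   define ft where "ft = (%x. f (mat 1 *v x + (- t)))"
   have ft: "ft : schwartz" unfolding ft_def by (rule schwartz_affine[OF f]) (auto simp: invertible_def)
   have fh: "fhat ft w = fhat f w * cnj (character t w)" for w
   proof -
    have "(LINT x|lborel. f (x + (- t)) * cnj (character w (x + (- t) + t))) = (LINT x|lborel. f x * cnj (character w (x + t)))"
     by (rule LINT_lborel_shift[of "%x. f x * cnj (character w (x + t))" "- t"]) measurable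
    then show ?thesis
     by (simp add: fhat_def ft_def character_simps character_commute[of w t] mult.assoc[symmetric])
   qed
   have "(LINT w|lborel. H w * cnj (character t w)) = (LINT w|lborel. fhat ft w * cnj (k1 w) - fhat ft w * cnj (k2 w))"
    by (intro Bochner_Integration.integral_cong) (simp_all add: H_def fh algebra_simps)
   also have "... = T ft - T ft"
    using K1[OF ft] K2[OF ft] by (subst Bochner_Integration.integral_diff) auto
   finally show ?thesis by simp
  qed
  then have "AE w in lborel. H w = 0"
   by (intro fourier_unique[OF _ iH]) (auto simp: H_def)
  then show ?thesis by (simp add: H_def)
 qed
 have "AE w in lborel. k1 w = k2 w"
 proof -
  \<comment> \<open>Countably many Schwartz functions whose transforms have no common zero, so that
    the exceptional null sets can be united.\<close>
  obtain F :: "nat => real^'d => complex" where F: "!!n. F n : schwartz" "!!w. \<exists>n. fhat (F n) w ~= 0"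
  proof -
   have "\<forall>n::nat. \<exists>f\<in>schwartz. \<forall>w::real^'d. norm w < real n --> fhat f w ~= 0"
    using schwartz_fourier_nonzero by blast
   then obtain F :: "nat => real^'d => complex" where "!!n. F n : schwartz" "!!n w. norm w < real n ==> fhat (F n) w ~= 0" by metis
   moreover have "\<exists>n::nat. norm w < real n" for w :: "real^'d" by (rule reals_Archimedean2)
   ultimately show ?thesis using that by meson
  qed
  have "AE w in lborel. \<forall>n. fhat (F n) w * cnj (k1 w - k2 w) = 0"
   unfolding AE_all_countable using zero[OF F(1)] by blast
  then show ?thesis
  proof eventually_elim
   case (elim w)
   obtain n where "fhat (F n) w ~= 0" using F(2) by blast
   then have "cnj (k1 w - k2 w) = 0" using elim mult_eq_0_iff by blast
   then show ?case by simp
  qed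
 qed
 then show ?thesis using k1 k2 by eventually_elim simp
qed

section \<open>Uniqueness of L_p sums and the Fourier transform of dilated functionals\<close>

lemma has_Lp_sum_unique:
 fixes u :: "'k => real^'d::finite => complex"
 assumes p: "1 <= p" and F: "has_Lp_sum p u K F" and G: "has_Lp_sum p u K G"
  and u: "!!k. k : K ==> u k : borel_measurable lebesgue"
 shows "AE x in lborel. F x = G x"
proof -
 have m: "F : borel_measurable lebesgue" "G : borel_measurable lebesgue"
  using F G by (auto simp: has_Lp_sum_def Lp_space_def)
 define a where "a = (%A. Lp_norm p (%x. F x - (\<Sum>k\<in>A. u k x)))"
 define b where "b = (%A. Lp_norm p (%x. G x - (\<Sum>k\<in>A. u k x)))"
 have "((%A. 4 * (a A + b A)) \<longlongrightarrow> 4 * (0 + 0)) (finite_subsets_at_top K)"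
  using F G unfolding has_Lp_sum_def a_def b_def
  by (intro tendsto_mult_ennreal tendsto_add tendsto_const) auto
 then have lim: "((%A. 4 * (a A + b A)) \<longlongrightarrow> 0) (finite_subsets_at_top K)" by simp
 have "Lp_norm p (%x. F x - G x) <= 4 * (a A + b A)" if A: "A \<subseteq> K" for A
 proof -
  have s[measurable]: "(%x. \<Sum>k\<in>A. u k x) : borel_measurable lebesgue" using A u by (intro borel_measurable_sum) auto
  note m[measurable]
  have "Lp_norm p (%x. F x - G x) <= Lp_enorm p lebesgue (%x. enorm (F x - (\<Sum>k\<in>A. u k x)) + enorm (G x - (\<Sum>k\<in>A. u k x)))"
  proof (rule Lp_enorm_AE_mono[OF p])
   have "cmod (F x - G x) <= cmod (F x - (\<Sum>k\<in>A. u k x)) + cmod (G x - (\<Sum>k\<in>A. u k x))" for x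
    using norm_triangle_ineq4[of "F x - (\<Sum>k\<in>A. u k x)" "G x - (\<Sum>k\<in>A. u k x)"] by simp
   then show "AE x in lebesgue. enorm (F x - G x) <= enorm (F x - (\<Sum>k\<in>A. u k x)) + enorm (G x - (\<Sum>k\<in>A. u k x))"
    by (simp add: ennreal_plus[symmetric] ennreal_leI del: ennreal_plus)
  qed measurable
  also have "... <= 4 * (a A + b A)"
   unfolding a_def b_def by (rule Lp_enorm_add_le[OF p]) measurable
  finally show ?thesis .
 qed
 then have "Lp_norm p (%x. F x - G x) <= 0"
  by (intro tendsto_lowerbound[OF lim] eventually_finite_subsets_at_top_weakI) auto
 then have "AE x in lebesgue. enorm (F x - G x) = 0"
  using m by (intro Lp_enorm_eq_0_AE[OF p]) auto
 then have "AE x in lebesgue. F x = G x" by eventually_elim simp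
 then show ?thesis by (simp add: AE_completion_iff)
qed

lemma Lp_enorm_linear_le:
 fixes A :: "real^'d::finite^'d"
 assumes p: "1 <= p" and d: "lborel = density (distr lborel borel ((*v) A)) (%_. ennreal c)" "c > 0"
  and [measurable]: "u : bm"
 shows "Lp_enorm p lborel (%x. u (A *v x)) <= ennreal (if p = infy then 1 else c powr (- 1 / enn2real p)) * Lp_enorm p lborel u"
proof (rule Lp_enorm_leI[OF p])
 have [measurable]: "(*v) A : bm" by (intro borel_measurable_continuous_onI continuous_intros)
 show "(%x. u (A *v x)) : borel_measurable lborel" by measurable
 show "AE x in lborel. u (A *v x) <= ennreal (if p = infy then 1 else c powr (- 1 / enn2real p)) * Lp_enorm p lborel u" if "p = infy"
  using linear_change_of_variables(4)[OF d Lp_enorm_infinity_AE[OF that]] that by simp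
 assume pt: "p ~= infy"
 define P where "P = enn2real p"
 have P: "P >= 1" using ennreal_ge_1_real[OF p pt] by (simp add: P_def)
 have "ennpowr (Lp_enorm p lborel u) P = ennreal c * (INTR x. ennpowr (u (A *v x)) P)"
  unfolding P_def Lp_enorm_eq_power[OF p pt] by (rule linear_change_of_variables(1)[OF d]) measurable
 then have "ennreal (1 / c) * ennpowr (Lp_enorm p lborel u) P = ennreal (1 / c) * ennreal c * (INTR x. ennpowr (u (A *v x)) P)"
  by (simp add: mult.assoc)
 also have "ennreal (1 / c) * ennreal c = 1" using d(2) by (simp add: ennreal_mult[symmetric])
 finally have "(INTR x. ennpowr (u (A *v x)) P) = ennreal (1 / c) * ennpowr (Lp_enorm p lborel u) P" by simp
 also have "... = ennpowr (ennreal (c powr (- 1 / P)) * Lp_enorm p lborel u) P"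
 proof -
  have "- 1 / P * P = - 1" using P by simp
  then have "(c powr (- 1 / P)) powr P = 1 / c" using d(2) by (simp only: powr_powr) (simp add: powr_minus divide_inverse)
  then show ?thesis unfolding ennpowr_mult by (simp add: ennpowr_ennreal)
 qed
 finally show "(INTR x. ennpowr (u (A *v x)) (enn2real p)) <= ennpowr (ennreal (if p = infy then 1 else c powr (- 1 / enn2real p)) * Lp_enorm p lborel u) (enn2real p)"
  using pt by (simp add: P_def)
qed

lemma dilate_dilation_matrix:
 assumes M: "dilation_matrix M"
 shows "dilate M (int j) k \<phi> x = of_real (\<bar>det M\<bar> powr (real j / 2)) * \<phi> (mat_pow M j *v x + k)"
  and "dilate M (- int j) (- (mat_powi M (- int j) *v k)) f x = of_real (\<bar>det M\<bar> powr (- (real j / 2))) * f (mat_pow (matrix_inv M) j *v (x - k))"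
 by (simp_all add: dilate_def mat_powi_dilation[OF M] matrix_vector_mult_diff_distrib)

lemma transpose_character: "character (transpose A *v w) x = character w (A *v x)"
 by (simp add: character_def dot_lmul_matrix transpose_matrix_vector)

text \<open>The dilation acts on the test function, whose transform is a modulated
  \<open>fhat f\<close> at \<open>transpose A *v w\<close> with a factor m. Substituting by
  \<open>transpose A\<close> in the pairing absorbs m, since \<open>A\<close> and its transpose
  share the constant.\<close>

lemma has_fourier_function_dist_dilate:
 fixes M :: "real^'d::finite^'d" and j :: nat
 assumes M: "dilation_matrix M" and T: "has_fourier_function T h" and h[measurable]: "h : bm"
 defines "N \<equiv> transpose (mat_pow (matrix_inv M) j)"
 shows "has_fourier_function (dist_dilate M (int j) k T)
  (%z. of_real (\<bar>det M\<bar> powr (- (real j / 2))) * (h (N *v z) * character k (N *v z)))" (is "has_fourier_function _ ?h")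
proof -
 define A where "A = mat_pow M j"
 define B where "B = mat_pow (matrix_inv M) j"
 define D where "D = \<bar>det M\<bar> powr (- (real j / 2))"
 have AB: "A ** B = mat 1" "B ** A = mat 1" "transpose A ** N = mat 1" "N ** transpose A = mat 1"
  unfolding A_def B_def N_def using dilation_powers_inverse[OF M] dilation_powers_transpose_inverse[OF M] by auto
 have inv: "invertible A" "invertible B" using AB by (auto simp: invertible_def)
 obtain m where m: "m > 0" "lborel = density (distr lborel borel ((*v) A)) (%_. ennreal m)"
  "lborel = density (distr lborel borel ((*v) (transpose A))) (%_. ennreal m)"
  using lborel_density_linear[OF inv(1)] by blast
 have [measurable]: "(*v) A : bm" "(*v) N : bm" "(*v) (transpose A) : bm" "(*v) B : bm"
  by (intro borel_measurable_continuous_onI continuous_intros)+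
 have hm[measurable]: "?h : bm" by measurable
 note T' = has_fourier_function_AE_cong(2)[OF T h AE_I2]
 show ?thesis
  unfolding has_fourier_function_def
 proof (intro conjI ballI)
  show "?h : borel_measurable lebesgue" by (rule measurable_completion) simp
  fix f :: "real^'d => complex" assume f: "f : schwartz"
  have [measurable]: "f : bm" by (rule schwartz_borel[OF f])
  define F where "F = dilate M (- int j) (- (mat_powi M (- int j) *v k)) f"
  have F: "F = (%x. of_real D * f (B *v x + (- (B *v k))))"
   unfolding F_def using dilate_dilation_matrix(2)[OF M] by (simp add: fun_eq_iff D_def B_def matrix_vector_mult_diff_distrib)
  have Fs: "F : schwartz" unfolding F by (intro schwartz_cmult schwartz_affine f inv)
  have fF: "fhat F w = of_real (D * m) * cnj (character w k) * fhat f (transpose A *v w)" for w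
  proof -
   have "fhat F w = (LINT x|lborel. of_real D * f (B *v (x + (- k))) * cnj (character w (x + (- k) + k)))"
    by (simp add: fhat_def F matrix_vector_mult_diff_distrib)
   also have "... = (LINT x|lborel. of_real D * f (B *v x) * cnj (character w (x + k)))"
    by (rule LINT_lborel_shift[of "%x. of_real D * f (B *v x) * cnj (character w (x + k))" "- k"]) measurable
   also have "... = of_real m * (LINT x|lborel. of_real D * f (B *v (A *v x)) * cnj (character w (A *v x + k)))"
    by (rule linear_change_of_variables(3)[OF m(2,1)]) measurable
   also have "... = of_real m * (LINT x|lborel. (of_real D * cnj (character w k)) * (f x * cnj (character (transpose A *v w) x)))"
   proof -
    have eq: "of_real D * f (B *v (A *v x)) * cnj (character w (A *v x + k)) =
      (of_real D * cnj (character w k)) * (f x * cnj (character (transpose A *v w) x))" for x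
     unfolding transpose_character character_simps by (simp add: matrix_vector_mul_assoc AB mult_ac)
    show ?thesis by (simp only: eq)
   qed
   also have "... = of_real m * ((of_real D * cnj (character w k)) * fhat f (transpose A *v w))"
    unfolding fhat_def by (subst integral_mult_right_zero) simp
   also have "... = of_real (D * m) * cnj (character w k) * fhat f (transpose A *v w)"
    by (simp add: mult_ac)
   finally show ?thesis .
  qed
  define G where "G = (%z. fhat f z * cnj (?h z))"
  have [measurable]: "G : bm" unfolding G_def by measurable
  have GF: "of_real m * G (transpose A *v w) = fhat F w * cnj (h w)" for w
  proof -
   have "N *v (transpose A *v w) = w" by (simp only: matrix_vector_mul_assoc AB matrix_vector_mul_lid)
   then have "G (transpose A *v w) = fhat f (transpose A *v w) * cnj (of_real D * (h w * character k w))"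
    by (simp only: G_def D_def)
   then show ?thesis unfolding fF by (simp add: character_commute[of k w] mult_ac)
  qed
  have i: "integrable lborel G" and v: "(LINT z|lborel. G z) = T F"
  proof -
   have "integrable lborel (%w. of_real m * G (transpose A *v w))" unfolding GF using T'[OF _ Fs] by simp
   then have "integrable lborel (%w. of_real (1 / m) * (of_real m * G (transpose A *v w)))" by (rule integrable_mult_right)
   then have "integrable lborel (%w. G (transpose A *v w))" using m(1) by (simp add: mult.assoc[symmetric] del: of_real_divide flip: of_real_mult)
   then show "integrable lborel G" using linear_change_of_variables(2)[OF m(3,1), of G] by simp
   have "(LINT z|lborel. G z) = (LINT w|lborel. of_real m * G (transpose A *v w))"
    using linear_change_of_variables(3)[OF m(3,1), of G] by simp
   also have "... = T F" unfolding GF using T'[OF _ Fs] by simp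
   finally show "(LINT z|lborel. G z) = T F" .
  qed
  have "AE z in lborel. fourier f z * cnj (?h z) = G z" by (simp add: G_def fourier_schwartz[OF f])
  from LINT_lebesgue_cong[OF _ this] i v
  show "integrable lebesgue (%z. fourier f z * cnj (?h z))" "pairing (fourier f) ?h = dist_dilate M (int j) k T f"
   by (auto simp: pairing_def dist_dilate_def F_def)
 qed
qed

section \<open>Integrability from weighted L_q bounds\<close>

lemma small_ball_unit_cell:
 assumes "norm (x :: real^'d::finite) < 1/2"
 shows "x : unit_cell"
 unfolding unit_cell_def
proof (intro CollectI allI)
 fix i
 have "\<bar>x $ i\<bar> < 1/2" using component_le_norm_cart[of x i] assms by linarith
 then show "- 1/2 < x $ i \<and> x $ i <= 1/2" by (intro conjI; linarith)
qed

text \<open>For y in the cell, norm (y + l) < 1/2 forces l = 0, because that ball lies in the cell.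
  The region where \<open>h\<close> is merely bounded thus contributes the single term g(y), and the
  other terms form a weighted periodization. A finite L_q norm on the cell, a probability space,
  then yields integrability.\<close>

lemma periodized_symbol_finite:
 fixes N b C :: real and g h :: "real^'d::finite => complex"
 assumes pq: "conj_exp p q" and C: "C >= 0"
  and b: "if p = infy then b = N else b > N + real CARD('d) / enn2real p"
  and [measurable]: "h : bm" "g : bm"
  and h1: "AE y in lborel. norm y < 1/2 --> cmod (h y) <= C"
  and h2: "AE y in lborel. 1/2 <= norm y --> cmod (h y) <= C * norm y powr N"
  and I1: "(INTR y. ennreal (cmod (g y) powr q)) < infy"
  and I2: "(INTR y. ennreal (norm y powr (q * b) * cmod (g y) powr q)) < infy"
 shows "Lt q (%y. SUML l. enorm (g (y + l) * h (y + l))) < infy" (is "?L < _")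
  and "integrable lborel (%y. g y * cnj (h y))"
proof -
 note f = conj_exp_facts[OF pq]
 obtain K where K: "K > 0" "!!u::real^'d => real. u : bm ==> (\<forall>y. u y >= 0) ==> (\<forall>y. norm y < 1/2 --> u y = 0) ==>
  Lt q (%y. SUML l. ennreal (u (y + l) * norm (y + l) powr N))
   <= ennreal K * ennpowr (INTR y. ennreal (norm y powr (q * b) * u y powr q)) (1 / q)"
  using weighted_periodization_bound[OF pq _ b, of "1/2"] by auto
 define u where "u = (%y. cmod (g y) * of_bool (1/2 <= norm y))"
 have [measurable]: "u : bm" unfolding u_def by measurable
 define V where "V = (%y. SUML l. ennreal (u (y + l) * norm (y + l) powr N))"
 have [measurable]: "V : bm"
  unfolding V_def by (rule borel_measurable_nn_integral_latm) measurable
 have "Lt q V <= ennreal K * ennpowr (INTR y. ennreal (norm y powr (q * b) * u y powr q)) (1 / q)"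
  unfolding V_def by (rule K(2)) (auto simp: u_def)
 also have "(INTR y. ennreal (norm y powr (q * b) * u y powr q)) <= (INTR y. ennreal (norm y powr (q * b) * cmod (g y) powr q))"
  by (intro nn_integral_mono ennreal_leI mult_left_mono) (auto simp: u_def of_bool_def)
 finally have V: "Lt q V < infy"
  using I2 f by (auto simp: ennpowr_mono mult_left_mono ennreal_mult_less_top less_top[symmetric] top_unique ennreal_mult_eq_top_iff)
 have G: "Lt q (%y. enorm (g y)) < infy"
 proof -
  have "ennpowr (Lt q (%y. enorm (g y))) q = (INTT y. ennreal (cmod (g y) powr q))"
   by (simp add: Lp_enorm_eq_power_q[OF pq] ennpowr_ennreal)
  also have "... <= (INTR y. ennreal (cmod (g y) powr q))"
   by (subst nn_integral_tor) (auto intro!: nn_integral_mono simp: indicator_def)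
  also have "... < infy" by (rule I1)
  finally show ?thesis by (simp add: less_top[symmetric])
 qed
 define W where "W = (%y. SUML l. enorm (g (y + l) * h (y + l)))"
 have [measurable]: "W : bm"
  unfolding W_def by (rule borel_measurable_nn_integral_latm) measurable
 have "Lt q W <= Lt q (%y. ennreal C * (enorm (g y) + V y))"
 proof (rule Lp_enorm_AE_mono[OF f(5)])
  have h12: "AE y in lborel. (norm y < 1/2 --> cmod (h y) <= C) \<and> (1/2 <= norm y --> cmod (h y) <= C * norm y powr N)"
   using h1 h2 by eventually_elim auto
  have "AE x in tor. \<forall>l\<in>int_lattice. (norm (x + l) < 1/2 --> cmod (h (x + l)) <= C) \<and> (1/2 <= norm (x + l) --> cmod (h (x + l)) <= C * norm (x + l) powr N)"
   using h12 by (subst (asm) AE_tor_lattice_iff)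
  moreover have "AE x in tor. x : (unit_cell :: (real^'d) set)" by (simp add: AE_tor_iff)
  ultimately show "AE y in tor. W y <= ennreal C * (enorm (g y) + V y)"
  proof eventually_elim
   case (elim y)
   have "enorm (g (y + l) * h (y + l)) <= ennreal C * (enorm (g y) * indicator {0} l + ennreal (u (y + l) * norm (y + l) powr N))"
    if l: "l : int_lattice" for l
   proof (cases "norm (y + l) < 1/2")
    case True
    have "l = 0"
    proof -
     have "y + l : unit_cell" using small_ball_unit_cell[OF True] .
     moreover have "\<exists>!k. k : int_lattice \<and> y - k : unit_cell" by (rule ex1_lattice_unit_cell)
     moreover have "- l : int_lattice" "y - (- l) = y + l" "y - 0 = y" "0 : int_lattice" using l by auto
     ultimately have "- l = 0" using elim(2) by metis
     then show ?thesis by simp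
    qed
    moreover have "cmod (h y) <= C" using bspec[OF elim(1) l] True \<open>l = 0\<close> by simp
    then have "cmod (g y) * cmod (h y) <= C * cmod (g y)"
     by (subst mult.commute) (rule mult_right_mono, auto)
    ultimately show ?thesis using C True by (simp add: u_def norm_mult ennreal_mult[symmetric] ennreal_leI)
   next
    case False
    have "cmod (g (y + l)) * cmod (h (y + l)) <= cmod (g (y + l)) * (C * norm (y + l) powr N)"
     using elim(1) l False by (intro mult_left_mono) auto
    then have "enorm (g (y + l) * h (y + l)) <= ennreal C * ennreal (u (y + l) * norm (y + l) powr N)"
     using False C by (simp add: u_def norm_mult ennreal_mult[symmetric] mult_ac ennreal_leI)
    also have "... <= ennreal C * (enorm (g y) * indicator {0} l + ennreal (u (y + l) * norm (y + l) powr N))"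
     by (intro mult_left_mono) auto
    finally show ?thesis .
   qed
   then have "W y <= (SUML l. ennreal C * (enorm (g y) * indicator {0} l + ennreal (u (y + l) * norm (y + l) powr N)))"
    unfolding W_def by (intro nn_integral_mono) auto
   also have "... = ennreal C * ((SUML l. enorm (g y) * indicator {0} l) + V y)"
    by (simp add: nn_integral_cmult nn_integral_add V_def)
   also have "(SUML l. enorm (g y) * indicator {0} l) = enorm (g y)"
    by (subst nn_integral_indicator_finite) auto
   finally show ?case .
  qed
 qed measurable
 also have "... <= ennreal C * Lt q (%y. enorm (g y) + V y)"
  by (rule Lp_enorm_cmult_le[OF f(5)]) measurable
 also have "... <= ennreal C * (4 * (Lt q (%y. enorm (g y)) + Lt q V))"
  by (intro mult_left_mono Lp_enorm_add_le[OF f(5)]) auto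
 also have "... < infy" using V G by (simp add: ennreal_mult_less_top del: distrib_left_numeral)
 finally have W: "Lt q W < infy" .
 then show "?L < infy" by (simp add: W_def)
 show "integrable lborel (%y. g y * cnj (h y))"
 proof (rule integrableI_bounded)
  have "(INTR y. ennreal (norm (g y * cnj (h y)))) = (INTT y. W y)"
   unfolding W_def by (subst nn_integral_periodize[symmetric]) (auto simp: norm_mult)
  also have "... < infy" by (rule nn_integral_of_Lp_tor[OF f(5) _ W]) measurable
  finally show "(INTR y. ennreal (norm (g y * cnj (h y)))) < infy" .
 qed measurable
qed

text \<open>The preceding lemma for the symbol 1; the constant 2^N makes 1 <= 2^N |y|^N valid for
  |y| >= 1/2.\<close>

lemma weighted_integrable:
 fixes N b :: real and g :: "real^'d::finite => complex"
 assumes pq: "conj_exp p q" and N: "N >= 0"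
  and b: "if p = infy then b = N else b > N + real CARD('d) / enn2real p"
  and [measurable]: "g : bm"
  and I1: "(INTR y. ennreal (cmod (g y) powr q)) < infy"
  and I2: "(INTR y. ennreal (norm y powr (q * b) * cmod (g y) powr q)) < infy"
 shows "integrable lborel g"
proof -
 have "1 <= 2 powr N" using N by (simp add: ge_one_powr_ge_zero)
 moreover have "1 <= 2 powr N * norm y powr N" if "1/2 <= norm y" for y :: "real^'d"
  using that N by (simp add: powr_mult[symmetric] ge_one_powr_ge_zero)
 ultimately have "integrable lborel (%y. g y * cnj 1)"
  by (intro periodized_symbol_finite(2)[OF pq _ b _ _ _ _ I1 I2, of "2 powr N" "%_. 1"]) auto
 then show ?thesis by simp
qed

text \<open>Far out the integrand decays with exponent s' = q(N + CARD('d) + \<epsilon> - \<gamma>).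
  By q(1 - 1/p) = 1 this is CARD('d) + q \<epsilon>/2 for finite p, and CARD('d) + \<epsilon> for p
  = infinity; giving away only half of \<epsilon> keeps it above the dimension.\<close>

lemma Lq_decay_weighted:
 fixes g0 g :: "real^'d::finite => complex"
 assumes pq: "conj_exp p q" and \<epsilon>: "\<epsilon> > 0" and N: "N >= 0"
  and \<gamma>: "\<gamma> = (if p = infy then N else N + real CARD('d) / enn2real p + \<epsilon> / 2)"
  and g0: "Lq_decay q (N + real CARD('d) + \<epsilon>) g0" and [measurable]: "g : bm" and AE: "AE x in lborel. g0 x = g x"
 shows "(INTR y. ennreal (cmod (g y) powr q)) < infy"
  and "(INTR y. ennreal (norm y powr (q * \<gamma>) * cmod (g y) powr q)) < infy"
proof -
 note f = conj_exp_facts[OF pq]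
 define s where "s = N + real CARD('d) + \<epsilon>"
 have g0m: "g0 : borel_measurable lebesgue" and g0n: "Lp_norm (ennreal q) g0 < infy"
  using g0 by (auto simp: Lq_decay_def Lp_space_def)
 have "Lp_norm (ennreal q) g0 = Lp_norm (ennreal q) g"
  using g0m AE_completion[OF AE] by (intro Lp_enorm_AE_cong[OF f(5)]) (auto simp: measurable_completion elim: eventually_mono)
 also have "... = Lp_enorm (ennreal q) lborel (%x. enorm (g x))"
  by (rule Lp_enorm_completion[OF f(5)]) measurable
 finally have "Lp_enorm (ennreal q) lborel (%x. enorm (g x)) < infy" using g0n by simp
 then have "ennpowr (Lp_enorm (ennreal q) lborel (%x. enorm (g x))) q < infy" by (simp add: less_top[symmetric])
 then show I1: "(INTR y. ennreal (cmod (g y) powr q)) < infy"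
  by (simp add: Lp_enorm_eq_power_q[OF pq] ennpowr_ennreal)
 obtain C R where "AE w in lebesgue. norm w >= R --> cmod (g0 w) <= C * norm w powr (- s)"
  using g0 by (auto simp: Lq_decay_def s_def)
 then have "AE w in lborel. norm w >= R --> cmod (g0 w) <= C * norm w powr (- s)" by (simp add: AE_completion_iff)
 then have dec: "AE w in lborel. norm w >= R --> cmod (g w) <= \<bar>C\<bar> * norm w powr (- s)"
  using AE by eventually_elim (auto intro: order_trans[OF _ mult_right_mono[OF abs_ge_self]])
 define R' where "R' = max R 1"
 have \<gamma>0: "\<gamma> >= 0" using N \<epsilon> f(9) by (auto simp: \<gamma>)
 define s' where "s' = q * (s - \<gamma>)"
 have s': "s' > real CARD('d)"
 proof (cases "p = infy")
  case True
  then show ?thesis using f(12) \<epsilon> by (simp add: s'_def s_def \<gamma>)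
 next
  case False
  define P where "P = enn2real p"
  have P: "P > 0" "q * (P - 1) = P" using f(9,10) False by (auto simp: P_def)
  have "s' = real CARD('d) * (q * (P - 1)) / P + q * \<epsilon> / 2"
   using P(1) False by (simp add: s'_def s_def \<gamma> P_def field_simps)
  also have "... = real CARD('d) + q * \<epsilon> / 2" using P by simp
  finally show ?thesis using f(4) \<epsilon> by simp
 qed
 have s'0: "s' > 0" using s' by (meson less_le_trans of_nat_0_le_iff not_le)
 \<comment> \<open>The factor 2 powr s' comes from norm y >= (1 + norm y)/2 for norm y >= 1.\<close>
 define c where "c = \<bar>C\<bar> powr q * 2 powr s'"
 have "(INTR y. ennreal (norm y powr (q * \<gamma>) * cmod (g y) powr q)) \<le>
   (INTR y. ennreal (R' powr (q * \<gamma>)) * ennreal (cmod (g y) powr q) + ennreal c * ennreal ((1 + norm y) powr (- s')))"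
 proof (rule nn_integral_mono_AE)
  show "AE y in lborel. ennreal (norm y powr (q * \<gamma>) * cmod (g y) powr q) <= ennreal (R' powr (q * \<gamma>)) * ennreal (cmod (g y) powr q) + ennreal c * ennreal ((1 + norm y) powr (- s'))"
   using dec
  proof eventually_elim
   case (elim y)
   show ?case
   proof (cases "norm y <= R'")
    case True
    then have "norm y powr (q * \<gamma>) * cmod (g y) powr q <= R' powr (q * \<gamma>) * cmod (g y) powr q"
     using f(4) \<gamma>0 by (intro mult_right_mono powr_mono2) auto
    then have "ennreal (norm y powr (q * \<gamma>) * cmod (g y) powr q) <= ennreal (R' powr (q * \<gamma>)) * ennreal (cmod (g y) powr q)"
     by (simp add: ennreal_mult[symmetric] ennreal_leI)
    then show ?thesis by (rule order_trans) simp
   next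
    case False
    then have n: "norm y >= 1" "norm y >= R" by (auto simp: R'_def)
    have "norm y powr (q * \<gamma>) * cmod (g y) powr q <= norm y powr (q * \<gamma>) * (\<bar>C\<bar> * norm y powr (- s)) powr q"
     using elim n f(4) by (intro mult_left_mono powr_mono2) auto
    also have "... = \<bar>C\<bar> powr q * (norm y powr (q * \<gamma>) * norm y powr (- s * q))"
     by (simp add: powr_mult powr_powr mult_ac)
    also have "norm y powr (q * \<gamma>) * norm y powr (- s * q) = norm y powr (- s')"
     unfolding powr_add[symmetric] by (rule arg_cong[where f = "%t. norm y powr t"]) (simp add: s'_def algebra_simps)
    also have "norm y powr (- s') <= ((1 + norm y) / 2) powr (- s')"
     using n s'0 by (intro powr_mono2') auto
    also have "((1 + norm y) / 2) powr (- s') = 2 powr s' * (1 + norm y) powr (- s')"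
     by (simp add: powr_divide powr_minus field_simps)
    finally have "norm y powr (q * \<gamma>) * cmod (g y) powr q <= c * (1 + norm y) powr (- s')"
     by (simp add: c_def mult_left_mono mult.assoc)
    then have "ennreal (norm y powr (q * \<gamma>) * cmod (g y) powr q) <= ennreal c * ennreal ((1 + norm y) powr (- s'))"
     by (simp add: c_def ennreal_mult[symmetric] ennreal_leI)
    then show ?thesis by (rule order_trans) simp
   qed
  qed
 qed
 also have "... = ennreal (R' powr (q * \<gamma>)) * (INTR y. ennreal (cmod (g y) powr q)) + ennreal c * (\<integral>\<^sup>+y. ennreal ((1 + norm y) powr (- s')) \<partial>(lborel :: (real^'d) measure))"
  by (simp add: nn_integral_add nn_integral_cmult)
 also have "... < infy"
  using I1 nn_integral_one_plus_norm_powr[where 'a = "real^'d", of s'] s' by (simp add: ennreal_mult_less_top)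
 finally show "(INTR y. ennreal (norm y powr (q * \<gamma>) * cmod (g y) powr q)) < infy" .
qed

section \<open>Identification of the operator at scale j\<close>

text \<open>\<open>dist_fourier\<close> is an arbitrary choice, but any two Fourier functions of the
  dilated functional agree almost everywhere. The pairing may therefore be computed with the
  explicit one, followed by the substitution by the transposed power.\<close>

lemma pairing_dist_dilate:
 fixes M :: "real^'d::finite^'d" and j :: nat
 assumes M: "dilation_matrix M" and T: "has_fourier_function T h" and [measurable]: "h : bm"
  and m: "m > 0" "lborel = density (distr lborel borel ((*v) (transpose (mat_pow M j)))) (%_. ennreal m)"
  and [measurable]: "g : bm" and AE: "AE x in lborel. g0 x = g x"
 shows "pairing g0 (dist_fourier (dist_dilate M (int j) k T)) =
  of_real (\<bar>det M\<bar> powr (- (real j / 2))) * symbol_coeff h (%y. of_real m * g (transpose (mat_pow M j) *v y)) k"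
proof -
 define D where "D = \<bar>det M\<bar> powr (- (real j / 2))"
 define N where "N = transpose (mat_pow (matrix_inv M) j)"
 define A where "A = transpose (mat_pow M j)"
 have NA: "N *v (A *v x) = x" for x
  unfolding N_def A_def by (simp only: matrix_vector_mul_assoc dilation_powers_transpose_inverse[OF M] matrix_vector_mul_lid)
 have [measurable]: "(*v) N : bm"
  by (intro borel_measurable_continuous_onI continuous_intros)
 define hk where "hk = (%z. complex_of_real D * (h (N *v z) * character k (N *v z)))"
 have [measurable]: "hk : bm" unfolding hk_def by measurable
 have 1: "has_fourier_function (dist_dilate M (int j) k T) hk"
  unfolding hk_def D_def N_def by (rule has_fourier_function_dist_dilate[OF M T]) measurable
 then have "has_fourier_function (dist_dilate M (int j) k T) (dist_fourier (dist_dilate M (int j) k T))"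
  using someI[of "has_fourier_function (dist_dilate M (int j) k T)", OF 1] by (simp add: dist_fourier_def)
 from has_fourier_function_unique[OF this 1]
 have "AE w in lborel. g0 w * cnj (dist_fourier (dist_dilate M (int j) k T) w) = g w * cnj (hk w)"
  using AE by eventually_elim simp
 then have "pairing g0 (dist_fourier (dist_dilate M (int j) k T)) = (LINT w|lborel. g w * cnj (hk w))"
  unfolding pairing_def by (intro LINT_lebesgue_cong) measurable
 also have "... = of_real m * (LINT y|lborel. g (A *v y) * cnj (hk (A *v y)))"
  unfolding A_def by (rule linear_change_of_variables(3)[OF m(2,1)]) measurable
 also have "... = of_real m * (LINT y|lborel. of_real D * (g (A *v y) * cnj (h y) * cnj (character k y)))"
  unfolding hk_def NA by (simp add: mult_ac)
 also have "... = of_real D * symbol_coeff h (%y. of_real m * g (A *v y)) k"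
  by (simp add: symbol_coeff_def mult_ac flip: integral_mult_right_zero)
 finally show ?thesis by (simp add: D_def A_def)
qed

text \<open>The factor |det M|^(-j/2) of the coefficients cancels |det M|^(j/2) of the dilated
  \<phi>, so the terms are those of the scale-0 series at M^j x. That series converges
  unconditionally in L_p, and uniqueness of L_p sums identifies the chosen \<open>Q\<close> with its
  sum almost everywhere.\<close>

lemma Q_eq_quasi_proj:
 fixes M :: "real^'d::finite^'d" and j :: nat
 assumes pq: "conj_exp p q" and M: "dilation_matrix M" and T: "has_fourier_function T h" and [measurable]: "h : bm"
  and m: "m > 0" "lborel = density (distr lborel borel ((*v) (mat_pow M j))) (%_. ennreal m)"
   "lborel = density (distr lborel borel ((*v) (transpose (mat_pow M j)))) (%_. ennreal m)"
  and [measurable]: "g : bm" and AE: "AE x in lborel. g0 x = g x"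
  and \<phi>0: "\<phi>0 : borel_measurable lebesgue" and [measurable]: "\<phi> : bm" and AE\<phi>: "AE x in lborel. \<phi>0 x = \<phi> x"
  and fin: "Lp_enorm p tor (%x. SUML k. enorm (\<phi> (x + k))) < infy"
 defines "gj \<equiv> %y. of_real m * g (transpose (mat_pow M j) *v y)"
 assumes i: "integrable lborel (%y. gj y * cnj (h y))"
  and c: "Lt q (%y. SUML l. enorm (gj (y + l) * h (y + l))) < infy"
 shows "AE x in lborel. Q p M \<phi>0 T g0 j x = quasi_proj \<phi> h gj (mat_pow M j *v x)"
  and "Q p M \<phi>0 T g0 j : borel_measurable lebesgue"
proof -
 note f = conj_exp_facts[OF pq]
 define A where "A = mat_pow M j"
 have [measurable]: "(*v) A : bm" "(*v) (transpose (mat_pow M j)) : bm"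
  by (intro borel_measurable_continuous_onI continuous_intros)+
 have [measurable]: "gj : bm" unfolding gj_def by measurable
 define a where "a = symbol_coeff h gj"
 define u where "u = (%k x. pairing g0 (dist_fourier (dist_dilate M (int j) k T)) * dilate M (int j) k \<phi>0 x)"
 define L where "L = quasi_proj \<phi> h gj"
 define s where "s = ennreal (if p = infy then 1 else m powr (- 1 / enn2real p))"
 have det: "\<bar>det M\<bar> > 0" using dilation_matrix_invertible[OF M] by (simp add: invertible_det_nz)
 have u: "u k x = a k * \<phi>0 (A *v x + k)" for k x
 proof -
  have "\<bar>det M\<bar> powr (- (real j / 2)) * \<bar>det M\<bar> powr (real j / 2) = 1"
   using det by (simp add: powr_add[symmetric])
  then have "complex_of_real (\<bar>det M\<bar> powr (- (real j / 2))) * of_real (\<bar>det M\<bar> powr (real j / 2)) = 1"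
   by (metis of_real_1 of_real_mult)
  then show ?thesis
   unfolding u_def pairing_dist_dilate[OF M T \<open>h : _\<close> m(1,3) \<open>g : _\<close> AE] dilate_dilation_matrix(1)[OF M] a_def gj_def A_def
   by (simp add: mult_ac)
 qed
 have aAE: "AE x in lborel. \<forall>k\<in>int_lattice. u k x = a k * \<phi> (A *v x + k)"
 proof (subst AE_ball_countable[OF countable_int_lattice], intro ballI)
  fix k :: "real^'d"
  have "AE x in lborel. \<phi>0 (x + k) = \<phi> (x + k)" by (rule AE_lborel_shift[OF AE\<phi>])
  then have "AE x in lborel. \<phi>0 (A *v x + k) = \<phi> (A *v x + k)"
   unfolding A_def by (rule linear_change_of_variables(4)[OF m(2,1)])
  then show "AE x in lborel. u k x = a k * \<phi> (A *v x + k)" by eventually_elim (simp add: u)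
 qed
 have ac: "Lp_enorm p latm (%k. enorm (a k)) < infy"
 proof -
  obtain C where "C > 0" "Lp_enorm p latm (%k. enorm (symbol_coeff h gj k)) \<le>
   ennreal C * Lt q (%y. SUML l. enorm (gj (y + l) * h (y + l)))"
   using Lp_enorm_symbol_coeff_le[OF pq] i \<open>h : _\<close> \<open>gj : _\<close> by blast
  then show ?thesis using c by (auto simp: a_def ennreal_mult_less_top intro: le_less_trans)
 qed
 \<comment> \<open>The coefficients tend to zero, as the case p = infinity of the convergence lemma
   demands.\<close>
 have ainf: "finite {k\<in>int_lattice. e <= cmod (a k)}" if "e > 0" for e
 proof -
  define b where "b = (%y. gj y * cnj (h y))"
  have [measurable]: "b : bm" unfolding b_def by measurable
  have ib: "integrable lborel b" using i by (simp add: b_def)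
  have "finite {k\<in>int_lattice. e <= cmod (fcoeff (%y. LINT l|latm. b (y + l)) k)}"
   using \<open>e > 0\<close> integral_periodize(3)[OF ib]
   by (intro Riemann_Lebesgue_tor) (auto intro!: borel_measurable_LINT_latm)
  moreover have "fcoeff (%y. LINT l|latm. b (y + l)) k = a k" if "k : int_lattice" for k
   using fcoeff_periodize[OF _ ib that] by (simp add: a_def symbol_coeff_def b_def)
  ultimately show ?thesis by (simp cong: conj_cong)
 qed
 have Lm[measurable]: "L : bm" unfolding L_def by measurable
 have LA: "(%x. L (A *v x)) : borel_measurable lebesgue" by (rule measurable_completion) measurable
 have um: "u k : borel_measurable lebesgue" if "k : int_lattice" for k
 proof -
  have 1: "AE x in lebesgue. a k * \<phi> (A *v x + k) = u k x"
   using AE_completion[OF aAE] by eventually_elim (use that in simp)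
  have 2: "(%x. a k * \<phi> (A *v x + k)) : borel_measurable lebesgue" by (rule measurable_completion) measurable
  show ?thesis by (rule borel_measurable_AE[OF 2 1])
 qed
 have "has_Lp_sum p u int_lattice (%x. L (A *v x))"
  unfolding has_Lp_sum_def
 proof
  have "Lp_norm p (%x. L (A *v x)) = Lp_enorm p lborel (%x. enorm (L (A *v x)))"
   by (rule Lp_enorm_completion[OF f(1)]) measurable
  also have "... <= s * Lp_enorm p lborel (%x. enorm (L x))"
   unfolding s_def A_def by (rule Lp_enorm_linear_le[OF f(1) m(2,1)]) measurable
  also have "... <= s * (Lp_enorm p latm (%k. enorm (a k)) * Lp_enorm p tor (%x. SUML k. enorm (\<phi> (x + k))))"
   unfolding L_def a_def by (intro mult_left_mono Lp_enorm_quasi_proj_le[OF f(1)]) auto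
  also have "... < infy" using ac fin by (simp add: ennreal_mult_less_top s_def)
  finally show "(%x. L (A *v x)) : Lp_space p" using LA by (simp add: Lp_space_def)
  define R where "R = (%X. Lp_enorm p lborel (%x. enorm (L x - (\<Sum>k\<in>X. a k * \<phi> (x + k)))))"
  have "(R \<longlongrightarrow> 0) (finite_subsets_at_top int_lattice)"
   unfolding R_def L_def quasi_proj_def a_def[symmetric]
   by (rule lattice_series_converges[OF f(1) _ fin ac]) (use ainf in auto)
  then have "((%X. s * R X) \<longlongrightarrow> s * 0) (finite_subsets_at_top int_lattice)"
   by (intro tendsto_mult_ennreal tendsto_const) (auto simp: s_def)
  then have lim: "((%X. s * R X) \<longlongrightarrow> 0) (finite_subsets_at_top int_lattice)" by simp
  have le: "Lp_norm p (%x. L (A *v x) - (\<Sum>k\<in>X. u k x)) <= s * R X" if X: "finite X" "X \<subseteq> int_lattice" for X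
  proof -
   have um': "(%x. \<Sum>k\<in>X. u k x) : borel_measurable lebesgue" using um X by (intro borel_measurable_sum) auto
   have "Lp_norm p (%x. L (A *v x) - (\<Sum>k\<in>X. u k x)) = Lp_norm p (%x. L (A *v x) - (\<Sum>k\<in>X. a k * \<phi> (A *v x + k)))"
   proof (rule Lp_enorm_AE_cong[OF f(1)])
    show "(%x. enorm (L (A *v x) - (\<Sum>k\<in>X. u k x))) : borel_measurable lebesgue"
     using LA um' by measurable
    show "(%x. enorm (L (A *v x) - (\<Sum>k\<in>X. a k * \<phi> (A *v x + k)))) : borel_measurable lebesgue"
     by (rule measurable_completion) measurable
    show "AE x in lebesgue. enorm (L (A *v x) - (\<Sum>k\<in>X. u k x)) = enorm (L (A *v x) - (\<Sum>k\<in>X. a k * \<phi> (A *v x + k)))"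
     using AE_completion[OF aAE]
    proof eventually_elim
     case (elim x)
     then have "(\<Sum>k\<in>X. u k x) = (\<Sum>k\<in>X. a k * \<phi> (A *v x + k))" using X by (intro sum.cong) auto
     then show ?case by simp
    qed
   qed
   also have "... = Lp_enorm p lborel (%x. enorm (L (A *v x) - (\<Sum>k\<in>X. a k * \<phi> (A *v x + k))))"
    by (rule Lp_enorm_completion[OF f(1)]) measurable
   also have "... <= s * R X"
    unfolding s_def A_def R_def
    by (rule Lp_enorm_linear_le[OF f(1) m(2,1), of "%x. enorm (L x - (\<Sum>k\<in>X. a k * \<phi> (x + k)))"]) measurable
   finally show ?thesis .
  qed
  show "((%X. Lp_norm p (%x. L (A *v x) - (\<Sum>k\<in>X. u k x))) \<longlongrightarrow> 0) (finite_subsets_at_top int_lattice)"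
   by (rule tendsto_sandwich[OF _ _ tendsto_const lim]) (auto intro!: eventually_finite_subsets_at_top_weakI le)
 qed
 note sum1 = this
 then have sum2: "has_Lp_sum p u int_lattice (Q p M \<phi>0 T g0 j)"
  using someI[of "has_Lp_sum p u int_lattice", OF sum1] by (simp add: Q_def u_def)
 show "AE x in lborel. Q p M \<phi>0 T g0 j x = quasi_proj \<phi> h gj (mat_pow M j *v x)"
  using has_Lp_sum_unique[OF f(1) sum2 sum1 um] by (simp add: L_def A_def)
 show "Q p M \<phi>0 T g0 j : borel_measurable lebesgue"
  using sum2 by (simp add: has_Lp_sum_def Lp_space_def)
qed

section \<open>Scaling\<close>

lemma inv_fourier_dilate:
 fixes A :: "real^'d::finite^'d"
 assumes m: "m > 0" "lborel = density (distr lborel borel ((*v) (transpose A))) (%_. ennreal m)"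
  and [measurable]: "g : bm"
 shows "inv_fourier (%y. of_real m * g (transpose A *v y)) (A *v x) = inv_fourier g x"
proof -
 have "inv_fourier g x = of_real m * (LINT y|lborel. g (transpose A *v y) * character x (transpose A *v y))"
  unfolding inv_fourier_def by (rule linear_change_of_variables(3)[OF m(2,1)]) measurable
 also have "... = inv_fourier (%y. of_real m * g (transpose A *v y)) (A *v x)"
  using transpose_character[of A _ x] by (simp add: inv_fourier_def character_commute[of x] character_commute[of "A *v x"] mult.assoc)
 finally show ?thesis ..
qed

text \<open>The number |det M|^j, taken as the common constant of the two changes of variables
  instead of being computed from determinants.\<close>

definition jacobian :: "real^'d::finite^'d => nat => real" where
 "jacobian M j = (SOME m. m > 0 \<and> lborel = density (distr lborel borel ((*v) (mat_pow M j))) (%_. ennreal m) \<and>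
   lborel = density (distr lborel borel ((*v) (transpose (mat_pow M j)))) (%_. ennreal m))"

text \<open>Chosen so that its inverse Fourier transform at M^j x is that of g at x.\<close>

definition scaled :: "real^'d::finite^'d => nat => (real^'d => complex) => real^'d => complex" where
 "scaled M j g = (%y. of_real (jacobian M j) * g (transpose (mat_pow M j) *v y))"

definition proj_error :: "(real^'d::finite => complex) => (real^'d => complex) => (real^'d => complex) => real^'d => complex" where
 "proj_error \<phi> h g x = inv_fourier g x - quasi_proj \<phi> h g x"

lemma proj_error_measurable [measurable]:
 assumes [measurable]: "g : bm" "\<phi> : bm"
 shows "proj_error \<phi> h g : bm"
 unfolding proj_error_def by measurable

lemma borel_measurable_matrix_mult [measurable]: "(*v) (A :: real^'d::finite^'e::finite) : bm"
 by (intro borel_measurable_continuous_onI continuous_intros)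

lemma jacobian:
 assumes "dilation_matrix M"
 shows "jacobian M j > 0"
  "lborel = density (distr lborel borel ((*v) (mat_pow M j))) (%_. ennreal (jacobian M j))"
  "lborel = density (distr lborel borel ((*v) (transpose (mat_pow M j)))) (%_. ennreal (jacobian M j))"
proof -
 have "invertible (mat_pow M j)"
  using dilation_powers_inverse[OF assms, of j] unfolding invertible_def by blast
 from someI_ex[OF lborel_density_linear[OF this]]
 show "jacobian M j > 0"
  "lborel = density (distr lborel borel ((*v) (mat_pow M j))) (%_. ennreal (jacobian M j))"
  "lborel = density (distr lborel borel ((*v) (transpose (mat_pow M j)))) (%_. ennreal (jacobian M j))"
  unfolding jacobian_def by blast+
qed

lemma scaled_measurable [measurable]:
 assumes [measurable]: "g : bm"
 shows "scaled M j g : bm"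
 unfolding scaled_def by measurable

text \<open>Of the factor m^q, with m the Jacobian, one power is consumed by the substitution; the
  remaining m^(q-1) cancels later against the scaling of the L_p norm. The weight |B w|^(qs) is
  estimated through the operator norm of \<open>B\<close>.\<close>

lemma scaled_integral:
 fixes M :: "real^'d::finite^'d" and j :: nat
 assumes M: "dilation_matrix M" and [measurable]: "g : bm" and P[measurable]: "Measurable.pred borel P" and q: "q >= 1" and s: "s >= 0"
 defines "B \<equiv> transpose (mat_pow (matrix_inv M) j)"
 shows "(INTR y. ennreal (norm y powr (q * s) * cmod (scaled M j g y * of_bool (P y)) powr q)) \<le>
  ennreal (jacobian M j powr (q - 1)) * (ennreal (onorm ((*v) B) powr (s * q)) *
   (INTR w. ennreal (norm w powr (q * s) * cmod (g w) powr q) * indicator {w. P (B *v w)} w))"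
proof -
 note J = jacobian[OF M, of j]
 define m where "m = jacobian M j"
 define AT where "AT = transpose (mat_pow M j)"
 have BA: "B *v (AT *v y) = y" for y
  by (simp only: matrix_vector_mul_assoc AT_def B_def dilation_powers_transpose_inverse[OF M] matrix_vector_mul_lid)
 define G where "G = (%w. ennreal (norm (B *v w) powr (q * s) * cmod (g w * of_bool (P (B *v w))) powr q))"
 have PB[measurable]: "Measurable.pred borel (%w. P (B *v w))" by measurable
 have [measurable]: "G : bm" unfolding G_def by measurable
 have m: "m > 0" using J(1) by (simp add: m_def)
 have "(INTR y. ennreal (norm y powr (q * s) * cmod (scaled M j g y * of_bool (P y)) powr q)) = (INTR y. ennreal (m powr q) * G (AT *v y))"
 proof (rule nn_integral_cong)
  fix y :: "real^'d"
  show "ennreal (norm y powr (q * s) * cmod (scaled M j g y * of_bool (P y)) powr q) = ennreal (m powr q) * G (AT *v y)"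
   using m by (simp add: G_def BA scaled_def m_def[symmetric] AT_def[symmetric] norm_mult powr_mult ennreal_mult[symmetric] mult_ac)
 qed
 also have "... = ennreal (m powr q) * (INTR y. G (AT *v y))"
  unfolding AT_def by (rule nn_integral_cmult) measurable
 also have "ennreal (m powr q) = ennreal (m powr (q - 1)) * ennreal m"
  using m powr_add[of m "q - 1" 1] by (simp add: ennreal_mult[symmetric])
 also have "ennreal (m powr (q - 1)) * ennreal m * (INTR y. G (AT *v y)) = ennreal (m powr (q - 1)) * (INTR w. G w)"
  unfolding AT_def m_def by (subst linear_change_of_variables(1)[OF J(3,1), of G]) (auto simp: mult.assoc)
 also have "(INTR w. G w) <= (INTR w. ennreal (onorm ((*v) B) powr (s * q)) * (ennreal (norm w powr (q * s) * cmod (g w) powr q) * indicator {w. P (B *v w)} w))"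
 proof (rule nn_integral_mono)
  fix w :: "real^'d"
  have o: "0 <= onorm ((*v) B)" by (rule onorm_pos_le) (rule matrix_vector_mul_bounded_linear)
  have "norm (B *v w) powr (q * s) <= (onorm ((*v) B) * norm w) powr (q * s)"
   using q s by (intro powr_mono2 onorm matrix_vector_mul_bounded_linear) auto
  also have "... = onorm ((*v) B) powr (s * q) * norm w powr (q * s)" using o by (simp add: powr_mult mult_ac)
  finally have "norm (B *v w) powr (q * s) * cmod (g w) powr q <= onorm ((*v) B) powr (s * q) * norm w powr (q * s) * cmod (g w) powr q"
   by (rule mult_right_mono) simp
  then show "G w <= ennreal (onorm ((*v) B) powr (s * q)) * (ennreal (norm w powr (q * s) * cmod (g w) powr q) * indicator {w. P (B *v w)} w)"
   by (cases "P (B *v w)") (simp_all add: G_def ennreal_mult[symmetric] mult_ac ennreal_leI)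
 qed
 also have "... = ennreal (onorm ((*v) B) powr (s * q)) * (INTR w. ennreal (norm w powr (q * s) * cmod (g w) powr q) * indicator {w. P (B *v w)} w)"
  by (rule nn_integral_cmult) measurable
 finally show ?thesis by (simp add: m_def mult_left_mono)
qed

text \<open>Composition with M^j contributes m^(-1/p), and the q-th root of m^(q-1) is m^(1/p): the
  estimate takes the same form at all scales.\<close>

lemma Lp_enorm_scaled_le:
 fixes M :: "real^'d::finite^'d"
 assumes pq: "conj_exp p q" and M: "dilation_matrix M" and [measurable]: "u : bm" and C: "C >= 0"
  and le: "Lp_enorm p lborel u <= ennreal C * ennpowr I (1 / q)" and I: "I <= ennreal (jacobian M j powr (q - 1)) * X"
 shows "Lp_enorm p lborel (%x. u (mat_pow M j *v x)) <= ennreal C * ennpowr X (1 / q)"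
proof -
 note f = conj_exp_facts[OF pq]
 note J = jacobian[OF M, of j]
 define m where "m = jacobian M j"
 define s where "s = (if p = infy then 1 else m powr (- 1 / enn2real p))"
 have m: "m > 0" using J(1) by (simp add: m_def)
 have e: "s * (m powr (q - 1)) powr (1 / q) = 1"
 proof (cases "p = infy")
  case True
  then show ?thesis using f(12) m by (simp add: s_def)
 next
  case False
  define P where "P = enn2real p"
  have P: "P >= 2" "q = P / (P - 1)" using f(8,13) False by (auto simp: P_def)
  have "(q - 1) / q = 1 / P" using P(1) unfolding P(2) by (simp add: field_simps)
  then show ?thesis using m False by (simp add: s_def P_def[symmetric] powr_powr powr_add[symmetric])
 qed
 have "Lp_enorm p lborel (%x. u (mat_pow M j *v x)) <= ennreal s * Lp_enorm p lborel u"
  unfolding s_def m_def by (rule Lp_enorm_linear_le[OF f(1) J(2,1)]) measurable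
 also have "... <= ennreal s * (ennreal C * ennpowr (ennreal (m powr (q - 1)) * X) (1 / q))"
  using f(4) by (intro mult_left_mono order_trans[OF le] ennpowr_mono) (auto simp: I m_def)
 also have "... = ennreal s * ennreal ((m powr (q - 1)) powr (1 / q)) * (ennreal C * ennpowr X (1 / q))"
  by (simp add: ennpowr_mult ennpowr_ennreal mult_ac)
 also have "ennreal s * ennreal ((m powr (q - 1)) powr (1 / q)) = 1"
  using e by (metis ennreal_1 ennreal_mult' ennreal_mult'' powr_ge_zero)
 finally show ?thesis by simp
qed

lemma inv_fourier_add:
 assumes "integrable lborel g1" "integrable lborel g2"
 shows "inv_fourier (%y. g1 y + g2 y) x = inv_fourier g1 x + inv_fourier g2 x"
 using integrable_mult_character(1)[OF assms(1), of x] integrable_mult_character(1)[OF assms(2), of x]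
 by (simp add: inv_fourier_def distrib_right)

lemma symbol_coeff_add:
 assumes "integrable lborel (%y. g1 y * cnj (h y))" "integrable lborel (%y. g2 y * cnj (h y))"
 shows "symbol_coeff h (%y. g1 y + g2 y) k = symbol_coeff h g1 k + symbol_coeff h g2 k"
 using integrable_mult_character(2)[OF assms(1), of k] integrable_mult_character(2)[OF assms(2), of k]
 by (simp add: symbol_coeff_def distrib_right)

lemma proj_error_add:
 fixes \<phi> :: "real^'d::finite => complex"
 assumes i: "integrable lborel g1" "integrable lborel g2" "integrable lborel (%y. g1 y * cnj (h y))" "integrable lborel (%y. g2 y * cnj (h y))"
  and x: "(SUML k. enorm (\<phi> (x + k))) < infy"
 shows "proj_error \<phi> h (%y. g1 y + g2 y) x = proj_error \<phi> h g1 x + proj_error \<phi> h g2 x"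
proof -
 have I: "integrable latm (%k. symbol_coeff h g k * \<phi> (x + k))" if g: "integrable lborel (%y. g y * cnj (h y))" for g
 proof -
  define c where "c = (LINT y|lborel. cmod (g y * cnj (h y)))"
  have c: "cmod (symbol_coeff h g k) <= c" for k
   unfolding symbol_coeff_def c_def by (rule order_trans[OF integral_norm_bound]) (simp add: norm_mult)
  have "c >= 0" using order_trans[OF norm_ge_zero c[of 0]] .
  have "(SUML k. enorm (symbol_coeff h g k * \<phi> (x + k))) <= (SUML k. ennreal c * enorm (\<phi> (x + k)))"
   using c \<open>c >= 0\<close> by (intro nn_integral_mono) (auto simp: norm_mult ennreal_mult[symmetric] intro!: ennreal_leI mult_right_mono)
  also have "... < infy" using x by (simp add: nn_integral_cmult ennreal_mult_less_top)
  finally show ?thesis unfolding integrable_latm_iff .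
 qed
 show ?thesis
  using I[OF i(3)] I[OF i(4)] unfolding proj_error_def quasi_proj_def
  by (simp add: inv_fourier_add[OF i(1,2)] symbol_coeff_add[OF i(3,4)] distrib_right)
qed

section \<open>Splitting the error into high and low frequencies\<close>

text \<open>\<open>\<phi>0\<close> is the given function and \<open>\<phi>\<close> a Borel
  representative; \<open>h\<close> is a Borel Fourier function of \<open>T\<close>. The bounds on
  \<open>h\<close> are separated by the ball of radius 1/2 instead of the cube, because the
  frequency cut-offs are radial.\<close>

locale quasi_projection =
 fixes M :: "real^'d::finite^'d" and p :: ennreal and q N Ch :: real
  and \<phi>0 \<phi> h :: "real^'d => complex" and T :: "(real^'d => complex) => complex"
 assumes pq: "conj_exp p q" and M: "dilation_matrix M" and N: "N >= 0" and Ch: "Ch >= 0"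
  and \<phi>0: "\<phi>0 : borel_measurable lebesgue" and \<phi>m [measurable]: "\<phi> : bm" and AE\<phi>: "AE x in lborel. \<phi>0 x = \<phi> x"
  and hm [measurable]: "h : bm" and T: "has_fourier_function T h"
  and fin: "Lp_enorm p tor (%x. SUML k. enorm (\<phi> (x + k))) < infy"
  and h1: "AE y in lborel. norm y < 1/2 --> cmod (h y) <= Ch"
  and h2: "AE y in lborel. 1/2 <= norm y --> cmod (h y) <= Ch * norm y powr N"
begin

lemmas f = conj_exp_facts[OF pq]

definition admissible :: "real => bool" where
 "admissible b \<longleftrightarrow> (if p = infy then b = N else b > N + real CARD('d) / enn2real p)"

text \<open>What the decay of g is used for, in a form stable under scaling and restriction. The
  exponent b is existential: it secures integrability and may differ from the exponent of a
  particular estimate.\<close>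

definition good :: "(real^'d => complex) => bool" where
 "good g \<longleftrightarrow> g : bm \<and> (INTR y. ennreal (cmod (g y) powr q)) < infy \<and>
  (\<exists>b. admissible b \<and> (INTR y. ennreal (norm y powr (q * b) * cmod (g y) powr q)) < infy)"

abbreviation r where "r j \<equiv> onorm ((*v) (transpose (mat_pow (matrix_inv M) j)))"
abbreviation BT where "BT j \<equiv> transpose (mat_pow (matrix_inv M) j)"

lemma admissible_nonneg: "admissible b ==> b >= 0"
proof -
 assume "admissible b"
 moreover have "0 <= real CARD('d) / enn2real p" by simp
 ultimately show "b >= 0" using N unfolding admissible_def by (smt (verit))
qed

lemma good_measurable: "good g ==> g : bm" by (simp add: good_def)

lemma good_integrable:
 assumes "good g"
 shows "integrable lborel g" "integrable lborel (%y. g y * cnj (h y))"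
  "Lt q (%y. SUML l. enorm (g (y + l) * h (y + l))) < infy"
proof -
 obtain \<gamma> where \<gamma>: "admissible \<gamma>" "(INTR y. ennreal (norm y powr (q * \<gamma>) * cmod (g y) powr q)) < infy"
  using assms by (auto simp: good_def)
 have g: "g : bm" "(INTR y. ennreal (cmod (g y) powr q)) < infy"
  using assms by (auto simp: good_def)
 note \<gamma>1 = \<gamma>(1)[unfolded admissible_def]
 show "integrable lborel g" by (rule weighted_integrable[OF pq N \<gamma>1 g \<gamma>(2)])
 show "integrable lborel (%y. g y * cnj (h y))" by (rule periodized_symbol_finite(2)[OF pq Ch \<gamma>1 hm g(1) h1 h2 g(2) \<gamma>(2)])
 show "Lt q (%y. SUML l. enorm (g (y + l) * h (y + l))) < infy"
  by (rule periodized_symbol_finite(1)[OF pq Ch \<gamma>1 hm g(1) h1 h2 g(2) \<gamma>(2)])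
qed

lemma good_restrict:
 assumes g: "good g" and [measurable]: "Measurable.pred borel P"
 shows "good (%y. g y * of_bool (P y))"
proof -
 have le: "ennreal (a * cmod (g y * of_bool (P y)) powr q) <= ennreal (a * cmod (g y) powr q)" if "a >= 0" for a y
  using that by (auto simp: of_bool_def intro!: ennreal_leI)
 obtain b where b: "admissible b" "(INTR y. ennreal (norm y powr (q * b) * cmod (g y) powr q)) < infy"
  using g by (auto simp: good_def)
 have [measurable]: "g : bm" using g by (rule good_measurable)
 show ?thesis
  unfolding good_def
 proof (intro conjI exI)
  show "admissible b" by fact
  show "(%y. g y * of_bool (P y)) : bm" by measurable
  show "(INTR y. ennreal (norm y powr (q * b) * cmod (g y * of_bool (P y)) powr q)) < infy"
   by (rule le_less_trans[OF nn_integral_mono b(2)]) (rule le, simp)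
  have le1: "ennreal (cmod (g y * of_bool (P y)) powr q) <= ennreal (cmod (g y) powr q)" for y
   using le[of 1 y] by simp
  have I: "(INTR y. ennreal (cmod (g y) powr q)) < infy" using g by (simp add: good_def)
  show "(INTR y. ennreal (cmod (g y * of_bool (P y)) powr q)) < infy"
   by (rule le_less_trans[OF nn_integral_mono I]) (rule le1)
 qed
qed

lemma good_scaled:
 assumes g: "good g"
 shows "good (scaled M j g)"
proof -
 obtain b where b: "admissible b" "(INTR y. ennreal (norm y powr (q * b) * cmod (g y) powr q)) < infy"
  using g by (auto simp: good_def)
 have gm[measurable]: "g : bm" using g by (rule good_measurable)
 have I: "(INTR y. ennreal (cmod (g y) powr q)) < infy" using g by (simp add: good_def)
 \<comment> \<open>\<open>0 powr 0\<close> is 0, so the weight of exponent 0 is 1 only off the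
   origin.\<close>
 have x0: "norm y powr (q * 0) = of_bool (y ~= 0)" for y :: "real^'d" by simp
 have AE0: "AE y in (lborel :: (real^'d) measure). y ~= 0" by (rule AE_lborel_singleton)
 show ?thesis
  unfolding good_def
 proof (intro conjI exI)
  show "admissible b" by fact
  show "scaled M j g : bm" by measurable
  have "(INTR y. ennreal (norm y powr (q * b) * cmod (scaled M j g y) powr q)) \<le>
   ennreal (jacobian M j powr (q - 1)) * (ennreal (r j powr (b * q)) * (INTR w. ennreal (norm w powr (q * b) * cmod (g w) powr q)))"
   using scaled_integral[OF M gm _ f(3) admissible_nonneg[OF b(1)], of "%_. True" j] by simp
  also have "... < infy" using b(2) by (simp add: ennreal_mult_less_top)
  finally show "(INTR y. ennreal (norm y powr (q * b) * cmod (scaled M j g y) powr q)) < infy" .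
  have "(INTR y. ennreal (cmod (scaled M j g y) powr q)) = (INTR y. ennreal (norm y powr (q * 0) * cmod (scaled M j g y * of_bool True) powr q))"
   by (rule nn_integral_cong_AE, use AE0 in eventually_elim) simp
  also have "... <= ennreal (jacobian M j powr (q - 1)) * (ennreal (r j powr (0 * q)) * (INTR w. ennreal (norm w powr (q * 0) * cmod (g w) powr q) * indicator {w. True} w))"
   by (rule scaled_integral[OF M gm _ f(3)]) auto
  also have "(INTR w. ennreal (norm w powr (q * 0) * cmod (g w) powr q) * indicator {w. True} w) = (INTR y. ennreal (cmod (g y) powr q))"
   by (rule nn_integral_cong_AE, use AE0 in eventually_elim) simp
  finally show "(INTR y. ennreal (cmod (scaled M j g y) powr q)) < infy"
   using I by (auto simp: ennreal_mult_less_top intro: le_less_trans)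
 qed
qed

lemma per_facts:
 "(INTT x. (SUML k. enorm (\<phi> (x + k)))) < infy" "integrable lborel \<phi>"
 "AE x in tor. (SUML k. enorm (\<phi> (x + k))) < infy" "AE x in lborel. (SUML k. enorm (\<phi> (x + k))) < infy"
proof -
 note i = integrable_of_per[OF \<phi>m f(1) fin]
 show "(INTT x. (SUML k. enorm (\<phi> (x + k)))) < infy" "integrable lborel \<phi>"
  "AE x in tor. (SUML k. enorm (\<phi> (x + k))) < infy" by (rule i)+
 from i(3) show "AE x in lborel. (SUML k. enorm (\<phi> (x + k))) < infy"
  by (subst AE_tor_lattice_iff) (simp add: per_periodic[OF \<phi>m])
qed

lemma error_representation:
 assumes g: "good g" and AE: "AE x in lborel. g0 x = g x"
 shows "Lp_norm p (%x. fourier g0 (- x) - Q p M \<phi>0 T g0 j x) =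
  Lp_enorm p lborel (%x. enorm (proj_error \<phi> h (scaled M j g) (mat_pow M j *v x)))"
proof -
 note J = jacobian[OF M, of j]
 have gm[measurable]: "g : bm" using g by (rule good_measurable)
 note i = good_integrable[OF good_scaled[OF g, of j]]
 note Q = Q_eq_quasi_proj[OF pq M T hm J gm AE \<phi>0 \<phi>m AE\<phi> fin i(2,3)[unfolded scaled_def], folded scaled_def]
 have F: "fourier g0 (- x) = inv_fourier (scaled M j g) (mat_pow M j *v x)" for x
 proof -
  have "fourier g0 (- x) = inv_fourier g x"
   unfolding fourier_eq_fhat[OF gm AE] by (simp add: fhat_def inv_fourier_def character_simps)
  also have "... = inv_fourier (scaled M j g) (mat_pow M j *v x)"
   unfolding scaled_def by (rule inv_fourier_dilate[OF J(1,3) gm, symmetric])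
  finally show ?thesis .
 qed
 have m1: "(%x. inv_fourier (scaled M j g) (mat_pow M j *v x)) : borel_measurable lebesgue"
  by (rule measurable_completion) measurable
 have "Lp_norm p (%x. fourier g0 (- x) - Q p M \<phi>0 T g0 j x) = Lp_norm p (%x. proj_error \<phi> h (scaled M j g) (mat_pow M j *v x))"
 proof (rule Lp_enorm_AE_cong[OF f(1)])
  show "(%x. enorm (fourier g0 (- x) - Q p M \<phi>0 T g0 j x)) : borel_measurable lebesgue"
   using m1 Q(2) unfolding F by measurable
  show "(%x. enorm (proj_error \<phi> h (scaled M j g) (mat_pow M j *v x))) : borel_measurable lebesgue"
   by (rule measurable_completion) measurable
  show "AE x in lebesgue. enorm (fourier g0 (- x) - Q p M \<phi>0 T g0 j x) = enorm (proj_error \<phi> h (scaled M j g) (mat_pow M j *v x))"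
   using AE_completion[OF Q(1)] by eventually_elim (simp add: F proj_error_def)
 qed
 also have "... = Lp_enorm p lborel (%x. enorm (proj_error \<phi> h (scaled M j g) (mat_pow M j *v x)))"
  by (rule Lp_enorm_completion[OF f(1)]) measurable
 finally show ?thesis .
qed

definition high :: "real => nat => (real^'d => complex) => real^'d => complex" where
 "high d j g = (%y. scaled M j g y * of_bool (d <= norm y))"

definition low :: "real => nat => (real^'d => complex) => real^'d => complex" where
 "low d j g = (%y. scaled M j g y * of_bool (norm y < d))"

abbreviation (input) "high_err d j g \<equiv> Lp_enorm p lborel (%x. enorm (proj_error \<phi> h (high d j g) (mat_pow M j *v x)))"
abbreviation (input) "low_err d j g \<equiv> Lp_enorm p lborel (%x. enorm (proj_error \<phi> h (low d j g) (mat_pow M j *v x)))"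
abbreviation (input) "Q_err g0 j \<equiv> Lp_norm p (%x. fourier g0 (- x) - Q p M \<phi>0 T g0 j x)"
abbreviation (input) "symbol_err y \<equiv> Lp_enorm p tor (%x. enorm (1 - cnj (h y) * zak \<phi> x y))"
abbreviation (input) "outer_int s d j g \<equiv>
 INTR w. ennreal (norm w powr (q * s) * cmod (g w) powr q) * indicator {w. d <= norm (BT j *v w)} w"
abbreviation (input) "inner_int s d j g \<equiv>
 INTR w. ennreal (norm w powr (q * s) * cmod (g w) powr q) * indicator {w. norm (BT j *v w) < d} w"

lemma good_high_low: "good g ==> good (high d j g)" "good g ==> good (low d j g)"
 unfolding high_def low_def by (rule good_restrict[OF good_scaled]; simp)+

lemma high_low_split:
 assumes g: "good g"
 shows "AE x in lborel. proj_error \<phi> h (scaled M j g) (mat_pow M j *v x) =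
  proj_error \<phi> h (high d j g) (mat_pow M j *v x) + proj_error \<phi> h (low d j g) (mat_pow M j *v x)"
proof -
 note J = jacobian[OF M, of j]
 have s: "scaled M j g = (%y. high d j g y + low d j g y)"
  by (auto simp: fun_eq_iff high_def low_def of_bool_def)
 have "AE x in lborel. (SUML k. enorm (\<phi> (mat_pow M j *v x + k))) < infy"
  by (rule linear_change_of_variables(4)[OF J(2,1) per_facts(4)])
 then show ?thesis
 proof eventually_elim
  case (elim x)
  show ?case
   unfolding s
   by (rule proj_error_add[OF _ _ _ _ elim]) (auto intro!: good_integrable good_high_low g)
 qed
qed

lemma high_estimate:
 assumes d: "0 < d" and b: "admissible b"
 shows "\<exists>C>0. \<forall>g j. good g -->
  high_err d j g \<le>
  ennreal C * ennpowr (ennreal (r j powr (b * q)) *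
   (outer_int (b) d j g)) (1 / q)"
proof -
 \<comment> \<open>On the shell d <= norm w < 1/2, where \<open>h\<close> is only known to be
   bounded, \<open>Ch * d powr (- N)\<close> supplies the power bound.\<close>
 define c where "c = max Ch (Ch * d powr (- N))"
 have hc: "AE w in lborel. d <= norm w --> cmod (h w) <= c * norm w powr N"
  using h1 h2
 proof eventually_elim
  case (elim w)
  show ?case
  proof
   assume n: "d <= norm w"
   show "cmod (h w) <= c * norm w powr N"
   proof (cases "norm w < 1/2")
    case True
    have "d powr N <= norm w powr N" using n d N by (intro powr_mono2) auto
    then have "1 <= d powr (- N) * norm w powr N" using d by (simp add: powr_minus field_simps)
    then have "Ch * 1 <= Ch * (d powr (- N) * norm w powr N)" using Ch by (rule mult_left_mono)
    also have "... = (Ch * d powr (- N)) * norm w powr N" by simp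
    also have "... <= c * norm w powr N" by (rule mult_right_mono) (auto simp: c_def)
    finally show ?thesis using elim True by simp
   next
    case False
    then have "cmod (h w) <= Ch * norm w powr N" using elim by simp
    also have "... <= c * norm w powr N" by (rule mult_right_mono) (auto simp: c_def)
    finally show ?thesis .
   qed
  qed
 qed
 have c0: "c >= 0" using Ch by (simp add: c_def)
 obtain C where C: "C > 0" "!!g. g : bm ==> integrable lborel g ==> integrable lborel (%w. g w * cnj (h w)) ==>
  (\<forall>w. norm w < d --> g w = 0) ==>
  Lp_enorm p lborel (%x. enorm (inv_fourier g x - quasi_proj \<phi> h g x))
   <= ennreal C * ennpowr (INTR w. ennreal (norm w powr (q * b) * cmod (g w) powr q)) (1 / q)"
  using tail_estimate[OF pq d c0 N b[unfolded admissible_def] \<phi>m hm fin hc] by blast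
 have "high_err d j g \<le>
  ennreal C * ennpowr (ennreal (r j powr (b * q)) *
   (outer_int (b) d j g)) (1 / q)"
  if g: "good g" for g j
 proof -
  have gm[measurable]: "g : bm" using g by (rule good_measurable)
  note gh = good_high_low(1)[OF g, of d j]
  have hgm[measurable]: "high d j g : bm" using gh by (rule good_measurable)
  show ?thesis
  proof (rule Lp_enorm_scaled_le[OF pq M, of "%y. enorm (proj_error \<phi> h (high d j g) y)"])
   show "Lp_enorm p lborel (%y. enorm (proj_error \<phi> h (high d j g) y)) \<le>
    ennreal C * ennpowr (INTR w. ennreal (norm w powr (q * b) * cmod (high d j g w) powr q)) (1 / q)"
    unfolding proj_error_def
    by (rule C(2)[OF hgm good_integrable(1,2)[OF gh]]) (simp add: high_def)
   show "(INTR w. ennreal (norm w powr (q * b) * cmod (high d j g w) powr q)) \<le>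
    ennreal (jacobian M j powr (q - 1)) * (ennreal (r j powr (b * q)) *
     (outer_int (b) d j g))"
    unfolding high_def by (rule scaled_integral[OF M gm _ f(3) admissible_nonneg[OF b]]) measurable
  qed (use C(1) in \<open>auto\<close>)
 qed
 then show ?thesis using C(1) by blast
qed

text \<open>The symbol error is measured against K |z|^s: s = n gives the rate, s = 0 mere
  convergence. The radius is at most 1/2 so that the ball lies in the cell; the origin, where the
  weight vanishes, is a null set.\<close>

lemma low_estimate:
 "\<exists>C>0. \<forall>g j d K s. good g --> 0 < d --> d <= 1/2 --> K > 0 --> s >= 0 -->
  (AE z in lborel. norm z < d --> symbol_err z <= ennreal (K * norm z powr s)) -->
  low_err d j g \<le>
  ennreal (C * K) * ennpowr (ennreal (r j powr (s * q)) *
   (inner_int (s) d j g)) (1 / q)"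
proof -
 obtain C where C: "C > 0" "!!g (w :: real^'d => real). g : bm ==> w : bm ==>
  integrable lborel g ==> integrable lborel (%z. g z * cnj (h z)) ==> (\<forall>z. z \<notin> unit_cell --> g z = 0) ==>
  (AE z in tor. g z ~= 0 --> w z > 0 \<and> symbol_err z <= ennreal (w z)) ==>
  Lp_enorm p lborel (%x. enorm (inv_fourier g x - quasi_proj \<phi> h g x))
   <= ennreal C * Lt q (%z. ennreal (w z * cmod (g z)))"
  using local_estimate[OF pq, where 'd = 'd] \<phi>m hm per_facts(3) by blast
 have "low_err d j g \<le>
  ennreal (C * K) * ennpowr (ennreal (r j powr (s * q)) *
   (inner_int (s) d j g)) (1 / q)"
  if g: "good g" and d: "0 < d" "d <= 1/2" and K: "K > 0" and s: "s >= 0"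
   and w: "AE z in lborel. norm z < d --> symbol_err z <= ennreal (K * norm z powr s)"
  for g j d K s
 proof -
  have gm[measurable]: "g : bm" using g by (rule good_measurable)
  note gl = good_high_low(2)[OF g, of d j]
  have lgm[measurable]: "low d j g : bm" using gl by (rule good_measurable)
  define I where "I = (INTR z. ennreal (norm z powr (q * s) * cmod (low d j g z) powr q))"
  show ?thesis
  proof (rule Lp_enorm_scaled_le[OF pq M, of "%y. enorm (proj_error \<phi> h (low d j g) y)"])
   have "Lp_enorm p lborel (%y. enorm (proj_error \<phi> h (low d j g) y)) \<le>
    ennreal C * Lt q (%z. ennreal ((K * norm z powr s) * cmod (low d j g z)))"
    unfolding proj_error_def
   proof (rule C(2)[OF lgm _ good_integrable(1,2)[OF gl]])
    show "\<forall>z. z \<notin> unit_cell --> low d j g z = 0"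
    proof (intro allI impI)
     fix z :: "real^'d" assume "z \<notin> unit_cell"
     then have "\<not> norm z < d" using small_ball_unit_cell[of z] d by linarith
     then show "low d j g z = 0" by (simp add: low_def)
    qed
    have "AE z in (lborel :: (real^'d) measure). z ~= 0" by (rule AE_lborel_singleton)
    with w have "AE z in lborel. low d j g z ~= 0 --> K * norm z powr s > 0 \<and> symbol_err z <= ennreal (K * norm z powr s)"
     by eventually_elim (use K in \<open>auto simp: low_def of_bool_def split: if_splits\<close>)
    then show "AE z in tor. low d j g z ~= 0 --> K * norm z powr s > 0 \<and> symbol_err z <= ennreal (K * norm z powr s)"
     by (rule AE_tor)
   qed measurable
   also have "Lt q (%z. ennreal ((K * norm z powr s) * cmod (low d j g z))) <= ennreal K * ennpowr I (1 / q)"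
   proof -
    have "ennpowr (Lt q (%z. ennreal ((K * norm z powr s) * cmod (low d j g z)))) q =
     (INTT z. ennpowr (ennreal ((K * norm z powr s) * cmod (low d j g z))) q)"
     by (rule Lp_enorm_eq_power_q[OF pq])
    also have "... <= (INTR z. ennpowr (ennreal ((K * norm z powr s) * cmod (low d j g z))) q)"
     by (subst nn_integral_tor) (auto intro!: nn_integral_mono simp: indicator_def)
    also have "... = (INTR z. ennreal (K powr q) * ennreal (norm z powr (q * s) * cmod (low d j g z) powr q))"
     using K by (intro nn_integral_cong) (simp add: ennpowr_ennreal max_def powr_mult powr_powr ennreal_mult[symmetric] mult_ac)
    also have "... = ennreal (K powr q) * I" unfolding I_def by (rule nn_integral_cmult) measurable
    also have "... = ennpowr (ennreal K * ennpowr I (1 / q)) q"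
     using K f(4) by (simp add: ennpowr_mult ennpowr_ennreal)
    finally show ?thesis using f(4) by (simp add: ennpowr_le_iff)
   qed
   finally show "Lp_enorm p lborel (%y. enorm (proj_error \<phi> h (low d j g) y)) <= ennreal (C * K) * ennpowr I (1 / q)"
    using C(1) K by (simp add: ennreal_mult mult.assoc mult_left_mono)
   show "I <= ennreal (jacobian M j powr (q - 1)) * (ennreal (r j powr (s * q)) *
     (inner_int (s) d j g))"
    unfolding I_def low_def by (rule scaled_integral[OF M gm _ f(3) s]) measurable
  qed (use C(1) K in \<open>auto\<close>)
 qed
 then show ?thesis using C(1) by blast
qed

lemma error_split:
 assumes g: "good g" and AE: "AE x in lborel. g0 x = g x"
 shows "Q_err g0 j \<le>
  4 * (high_err d j g +
     low_err d j g)"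
proof -
 have [measurable]: "g : bm" "high d j g : bm" "low d j g : bm"
  using g good_high_low[OF g] by (auto intro: good_measurable)
 show ?thesis
  unfolding error_representation[OF g AE]
 proof (rule order_trans[OF Lp_enorm_AE_mono[OF f(1)] Lp_enorm_add_le[OF f(1)]])
  show "AE x in lborel. enorm (proj_error \<phi> h (scaled M j g) (mat_pow M j *v x)) \<le>
   enorm (proj_error \<phi> h (high d j g) (mat_pow M j *v x)) + enorm (proj_error \<phi> h (low d j g) (mat_pow M j *v x))"
   using high_low_split[OF g, of j d]
   by eventually_elim (simp add: ennreal_plus[symmetric] ennreal_leI norm_triangle_ineq del: ennreal_plus)
 qed measurable
qed

end

section \<open>Order of approximation from the Strang-Fix condition\<close>

declare transpose_matrix_vector [simp del]

lemma n_times_differentiable_const: "n_times_differentiable n (%_. c) S"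
proof (induction n arbitrary: c)
 case (Suc n)
 have "partial i (%_ :: real^'a. c) = (%_. 0)" for i by (simp add: partial_def fun_eq_iff)
 then show ?case using Suc by (simp add: n_times_differentiable.simps(2))
qed simp

lemma partials_const: "is ~= [] ==> partials is (%_ :: real^'d::finite. c) = (%_. 0)"
proof (induction "is")
 case (Cons i "is")
 then show ?case by (cases "is = []") (simp_all add: partial_def fun_eq_iff)
qed simp

text \<open>There are finitely many words of length n, so their individual bounds can be added.
  Values in \<open>ennreal\<close> cover a single derivative and a lattice sum of derivatives
  alike.\<close>

lemma uniform_partials_bound:
 fixes F :: "('d::finite => nat) => real^'d => ennreal"
 assumes "!!b. mi_order b = n ==> \<exists>B. \<forall>x\<in>S. F b x <= ennreal B"
 shows "\<exists>B\<ge>0. \<forall>is. length is = n --> (\<forall>x\<in>S. F (count (mset is)) x <= ennreal B)"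
proof -
 define X where "X = {is :: 'd list. length is = n}"
 have X: "finite X" using finite_lists_length_eq[of "UNIV :: 'd set" n] by (simp add: X_def)
 have "\<forall>is. \<exists>B. length is = n --> (\<forall>x\<in>S. F (count (mset is)) x <= ennreal B)"
  using assms mi_order_count by blast
 then obtain B where B: "!!is x. length is = n ==> x : S ==> F (count (mset is)) x <= ennreal (B is)" by metis
 have "F (count (mset is)) x <= ennreal (\<Sum>is\<in>X. \<bar>B is\<bar>)" if "length is = n" "x : S" for "is" x
 proof -
  have "B is <= \<bar>B is\<bar>" by simp
  also have "... <= (\<Sum>is\<in>X. \<bar>B is\<bar>)" by (rule member_le_sum) (use that X in \<open>auto simp: X_def\<close>)
  finally show ?thesis using B[OF that] by (auto intro: order_trans ennreal_leI)
 qed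
 then show ?thesis by (intro exI[of _ "\<Sum>is\<in>X. \<bar>B is\<bar>"]) (auto intro: sum_nonneg)
qed

lemma one_minus_bound:
 fixes F :: "real^'d::finite => complex"
 assumes n: "n >= 1" and F: "boundedly_differentiable n F {w. norm w < d}"
  and 0: "!!k. mi_order k < n ==> D k (%w. 1 - F w) 0 = 0" and d: "d > 0"
 shows "\<exists>B\<ge>0. \<forall>x. norm x < d --> cmod (1 - F x) <= B * norm x ^ n"
proof -
 define S where "S = ball (0::real^'d) d"
 have S: "S = {w. norm w < d}" "open S" "0 : S" using d by (auto simp: S_def)
 have Fn: "n_times_differentiable n F S" using F by (simp add: boundedly_differentiable_def S)
 \<comment> \<open>1 - F is written as a two-term sum indexed by the booleans, so that the results
   on linear combinations apply.\<close>
 define c :: "bool => complex" where "c = (%b. if b then 1 else - 1)"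
 define G where "G = (%b (x::real^'d). if b then 1 else F x)"
 have eq: "(%x. 1 - F x) = (%x. \<Sum>b\<in>UNIV. c b * G b x)"
  by (simp add: fun_eq_iff c_def G_def UNIV_bool)
 have Gn: "n_times_differentiable m (G b) S" if "m <= n" for m b
  using n_times_differentiable_const[of m 1 S] n_times_differentiable_mono[OF Fn that] by (cases b) (auto simp: G_def)
 have nd: "n_times_differentiable m (%x. 1 - F x) S" if "m <= n" for m
  unfolding eq by (rule n_times_differentiable_sum[OF S(2) Gn[OF that]])
 obtain B where B: "B >= 0" "!!is x. length is = n ==> x : S ==> enorm (D (count (mset is)) F x) <= ennreal B"
 proof -
  have "\<exists>B. \<forall>x\<in>S. enorm (D k F x) <= ennreal B" if "mi_order k = n" for k
  proof -
   have "bounded (D k F ` S)" using F that by (simp add: boundedly_differentiable_def S)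
   then obtain B where "\<forall>x\<in>S. cmod (D k F x) <= B" by (auto simp: bounded_iff)
   then show ?thesis by (intro exI[of _ B]) (auto intro: ennreal_leI)
  qed
  from uniform_partials_bound[of n S "%k x. enorm (D k F x)", OF this] that show ?thesis by blast
 qed
 have "cmod (1 - F x) <= (real CARD('d) * norm x) ^ n * B" if "norm x < d" for x
 proof (rule Taylor_vanishing[of n "%x. 1 - F x" d])
  show "n_times_differentiable n (%x. 1 - F x) (ball 0 d)" using nd[of n] by (simp add: S_def)
  show "partials is (%x. 1 - F x) 0 = 0" if "length is < n" for "is"
   using that 0 by (subst partials_eq_D[OF S(2,3) nd]) (auto simp: mi_order_count)
  show "cmod (partials is (%x. 1 - F x) x) <= B" if "length is = n" "x : ball 0 d" for "is" x
  proof -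
   have x: "x : S" using that by (simp add: S_def)
   have "partials is (%x. 1 - F x) x = (\<Sum>b\<in>UNIV. c b * partials is (G b) x)"
    unfolding eq by (rule partials_sum[OF S(2) x]) (use Gn that(1) in simp)
   also have "... = - partials is F x"
   proof -
    have "is ~= []" using that n by auto
    then have "partials is (%x::real^'d. 1) x = 0" by (simp add: partials_const)
    then show ?thesis by (simp add: UNIV_bool c_def G_def)
   qed
   also have "partials is F x = D (count (mset is)) F x"
    using that Fn by (intro partials_eq_D[OF S(2) x]) simp
   finally show ?thesis using B(2)[OF that(1) x] B(1) by simp
  qed
 qed (use that in simp)
 then have "\<forall>x. norm x < d --> cmod (1 - F x) <= real CARD('d) ^ n * B * norm x ^ n"
  by (simp add: power_mult_distrib mult_ac)
 then show ?thesis using B(1) by (intro exI[of _ "real CARD('d) ^ n * B"]) simp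
qed

text \<open>Taylor's bound for each l separately need not be summable, since the n-th derivatives
  are controlled only through their sum at each point. For fixed y and finite L, unimodular factors
  turn the F(y+l) into their moduli, and Taylor is applied once to the combination \<open>G\<close>
  of the translates, whose n-th derivatives are bounded by that sum, independently of L and
  y.\<close>

lemma strang_fix_sum_bound:
 fixes F :: "real^'d::finite => complex"
 assumes d: "d > 0"
  and bd: "!!l. l : int_lattice - {0} ==> boundedly_differentiable n F {w. norm (w + l) < d}"
  and sum: "!!b. mi_order b = n ==> \<exists>B. \<forall>w. norm w < d --> (\<Sum>\<^sub>\<infinity>l\<in>int_lattice - {0}. enorm (D b F (w + l))) <= ennreal B"
  and 0: "!!l b. l : int_lattice - {0} ==> mi_order b < n ==> D b F l = 0"
 shows "\<exists>B\<ge>0. \<forall>y. norm y < d --> (\<Sum>\<^sub>\<infinity>l\<in>int_lattice - {0}. enorm (F (y + l))) <= ennreal (B * norm y ^ n)"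
proof -
 define S where "S = ball (0::real^'d) d"
 have S: "open S" "0 : S" using d by (auto simp: S_def)
 \<comment> \<open>The hypothesis for l describes the ball around -l; the lattice is
   symmetric.\<close>
 have Fb: "n_times_differentiable n F (ball l d)" if "l : int_lattice - {0}" for l
 proof -
  have "{w. norm (w + - l) < d} = ball l d" by (auto simp: dist_norm norm_minus_commute)
  then show ?thesis using bd[of "- l"] that by (simp add: boundedly_differentiable_def)
 qed
 have sum': "\<exists>B. \<forall>w\<in>S. (\<Sum>\<^sub>\<infinity>l\<in>int_lattice - {0}. enorm (D b F (w + l))) <= ennreal B" if mi: "mi_order b = n" for b
 proof -
  obtain B where "\<forall>w. norm w < d --> (\<Sum>\<^sub>\<infinity>l\<in>int_lattice - {0}. enorm (D b F (w + l))) <= ennreal B"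
   using sum[OF mi] by blast
  then show ?thesis unfolding S_def by (intro exI[of _ B]) simp
 qed
 have "\<exists>B\<ge>0. \<forall>is. length is = n --> (\<forall>w\<in>S. (\<Sum>\<^sub>\<infinity>l\<in>int_lattice - {0}. enorm (D (count (mset is)) F (w + l))) <= ennreal B)"
  by (rule uniform_partials_bound[of n S "%b w. \<Sum>\<^sub>\<infinity>l\<in>int_lattice - {0}. enorm (D b F (w + l))"]) (rule sum')
 then obtain B where B0: "B >= 0" "\<forall>is. length is = n --> (\<forall>w\<in>S. (\<Sum>\<^sub>\<infinity>l\<in>int_lattice - {0}. enorm (D (count (mset is)) F (w + l))) <= ennreal B)"
  by (elim exE conjE)
 note B = B0(1) B0(2)[rule_format]
 have main: "(\<Sum>l\<in>L. enorm (F (y + l))) <= ennreal ((real CARD('d) * norm y) ^ n * B)"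
  if L: "finite L" "L \<subseteq> int_lattice - {0}" and y: "norm y < d" for L y
 proof -
  define s where "s = (%l. if F (y + l) = 0 then 1 else cnj (F (y + l)) / of_real (cmod (F (y + l))))"
  have s1: "cmod (s l) = 1" for l by (simp add: s_def norm_divide)
  have s2: "s l * F (y + l) = of_real (cmod (F (y + l)))" for l
  proof (cases "F (y + l) = 0")
   case False
   have "cnj (F (y + l)) * F (y + l) = of_real (cmod (F (y + l))) * of_real (cmod (F (y + l)))"
    using complex_norm_square[of "F (y + l)"] by (simp add: power2_eq_square mult.commute)
   then show ?thesis using False by (simp add: s_def)
  qed (simp add: s_def)
  define G where "G = (%w. \<Sum>l\<in>L. s l * F (w + l))"
  have nd: "n_times_differentiable m (%w. F (w + l)) S" if "l : L" "m <= n" for l m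
  proof (rule n_times_differentiable_shift)
   show "n_times_differentiable m F (ball l d)"
    using Fb[of l] L that by (auto intro: n_times_differentiable_mono)
  qed (auto simp: S_def dist_norm norm_minus_commute)
  have p: "partials is G x = (\<Sum>l\<in>L. s l * D (count (mset is)) F (x + l))" if "length is <= n" "x : S" for "is" x
  proof -
   have "partials is G x = (\<Sum>l\<in>L. s l * partials is (%w. F (w + l)) x)"
    unfolding G_def by (rule partials_sum[OF S(1) that(2)]) (rule nd[OF _ that(1)])
   also have "... = (\<Sum>l\<in>L. s l * D (count (mset is)) F (x + l))"
   proof (intro sum.cong refl)
    fix l assume l: "l : L"
    have "partials is F (x + l) = D (count (mset is)) F (x + l)"
    proof (rule partials_eq_D[of "ball l d"])
     show "n_times_differentiable (length is) F (ball l d)"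
      using Fb[of l] L l that(1) by (auto intro: n_times_differentiable_mono)
    qed (use that(2) in \<open>auto simp: S_def dist_norm norm_minus_commute\<close>)
    then show "s l * partials is (%w. F (w + l)) x = s l * D (count (mset is)) F (x + l)"
     by (simp add: partials_shift)
   qed
   finally show ?thesis .
  qed
  have "cmod (G y) <= (real CARD('d) * norm y) ^ n * B"
  proof (rule Taylor_vanishing[of n G d])
   show "n_times_differentiable n G (ball 0 d)"
    unfolding G_def S_def[symmetric] by (rule n_times_differentiable_sum[OF S(1)]) (rule nd, auto)
   show "partials is G 0 = 0" if "length is < n" for "is"
   proof -
    have "D (count (mset is)) F l = 0" if "l : L" for l
     by (rule 0) (use that L(2) \<open>length is < n\<close> in \<open>auto simp: mi_order_count\<close>)
    then show ?thesis using p[of "is" 0] S(2) that by simp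
   qed
   show "cmod (partials is G x) <= B" if "length is = n" "x : ball 0 d" for "is" x
   proof -
    have x: "x : S" using that by (simp add: S_def)
    have "cmod (partials is G x) <= (\<Sum>l\<in>L. cmod (D (count (mset is)) F (x + l)))"
     using p[of "is" x] that x by (simp add: sum_norm_le norm_mult s1)
    moreover have "ennreal (\<Sum>l\<in>L. cmod (D (count (mset is)) F (x + l))) <= ennreal B"
    proof -
     have "(\<Sum>l\<in>L. enorm (D (count (mset is)) F (x + l))) <= (\<Sum>\<^sub>\<infinity>l\<in>int_lattice - {0}. enorm (D (count (mset is)) F (x + l)))"
      using L by (subst nonneg_infsum_complete) (auto intro!: SUP_upper)
     also have "... <= ennreal B" by (rule B(2)[OF that(1) x])
     finally show ?thesis by (simp add: sum_ennreal)
    qed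
    ultimately show ?thesis using B(1) by (simp add: ennreal_le_iff)
   qed
  qed (use y in simp)
  moreover have "G y = of_real (\<Sum>l\<in>L. cmod (F (y + l)))" by (simp add: G_def s2)
  then have "cmod (G y) = (\<Sum>l\<in>L. cmod (F (y + l)))" by (simp only: norm_of_real) (simp add: sum_nonneg)
  ultimately show ?thesis by (simp add: sum_ennreal ennreal_leI)
 qed
 have "\<forall>y. norm y < d --> (\<Sum>\<^sub>\<infinity>l\<in>int_lattice - {0}. enorm (F (y + l))) <= ennreal ((real CARD('d) ^ n * B) * norm y ^ n)"
  using main by (subst nonneg_infsum_complete) (auto intro!: SUP_least simp: power_mult_distrib mult_ac)
 then show ?thesis using B(1) by (intro exI[of _ "real CARD('d) ^ n * B"]) simp
qed

lemma nn_integral_latm_nonzero: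
 "(SUML l. F l * of_bool (l ~= 0)) = (\<Sum>\<^sub>\<infinity>l\<in>int_lattice - {0}. F l)" for F :: "real^'d::finite => ennreal"
 unfolding nn_integral_latm_eq_infsum by (rule infsum_cong_neutral) auto

context quasi_projection
begin

lemma zak_integrable: "integrable tor (%x. zak \<phi> x y)"
proof (rule integrableI_bounded)
 have "(INTT x. ennreal (norm (zak \<phi> x y))) <= (INTT x. (SUML k. enorm (\<phi> (x + k))))"
  unfolding zak_def by (intro nn_integral_mono order_trans[OF norm_LINT_latm_le]) (simp add: norm_mult)
 then show "(INTT x. ennreal (norm (zak \<phi> x y))) < infy" using per_facts(1) by (rule le_less_trans)
qed measurable

lemma zak_minus_fhat_bound:
 assumes "(\<Sum>\<^sub>\<infinity>l\<in>int_lattice - {0}. enorm (fhat \<phi> (y + l))) <= K" "K < infy"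
 shows "AE x in tor. enorm (zak \<phi> x y - fhat \<phi> y) <= K"
proof -
 have "(SUML l. enorm (fcoeff (%x. zak \<phi> x y) l) * of_bool (l ~= 0)) = (SUML l. enorm (fhat \<phi> (y + l)) * of_bool (l ~= 0))"
  using fcoeff_zak[OF \<phi>m per_facts(2)] by (intro nn_integral_cong) simp
 then have "(SUML l. enorm (fcoeff (%x. zak \<phi> x y) l) * of_bool (l ~= 0)) <= K"
  using assms(1) by (simp add: nn_integral_latm_nonzero)
 from AE_fcoeff_sum_bound[OF _ zak_integrable this assms(2)]
 show ?thesis using fcoeff_zak[OF \<phi>m per_facts(2), of 0 y] by simp
qed

text \<open>The zeroth coefficient of \<open>zak \<phi> x y\<close> in x is
  \<open>fhat \<phi> y\<close>, and the others are summed absolutely. Splitting off the zeroth gives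
  a bound in the supremum norm, which serves all p at once.\<close>

lemma symbol_error_bound:
 assumes "(\<Sum>\<^sub>\<infinity>l\<in>int_lattice - {0}. enorm (fhat \<phi> (y + l))) <= ennreal K" "cmod (h y) <= Ch" "K >= 0"
 shows "symbol_err y <= ennreal (cmod (1 - fhat \<phi> y * cnj (h y)) + Ch * K)"
proof (rule order_trans[OF Lp_enorm_AE_mono[OF f(1)] Lp_enorm_tor_const_le[OF f(1)]])
 show "AE x in tor. enorm (1 - cnj (h y) * zak \<phi> x y) <= ennreal (cmod (1 - fhat \<phi> y * cnj (h y)) + Ch * K)"
  using zak_minus_fhat_bound[OF assms(1) ennreal_less_top[folded infinity_ennreal_def]]
 proof eventually_elim
  case (elim x)
  then have "cmod (zak \<phi> x y - fhat \<phi> y) <= K" using assms(3) by (simp add: ennreal_le_iff)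
  then have "cmod (h y) * cmod (zak \<phi> x y - fhat \<phi> y) <= Ch * K" using assms(2) Ch by (intro mult_mono) auto
  moreover have "1 - cnj (h y) * zak \<phi> x y = (1 - fhat \<phi> y * cnj (h y)) - cnj (h y) * (zak \<phi> x y - fhat \<phi> y)"
   by (simp add: algebra_simps)
  then have "cmod (1 - cnj (h y) * zak \<phi> x y) <= cmod (1 - fhat \<phi> y * cnj (h y)) + cmod (cnj (h y) * (zak \<phi> x y - fhat \<phi> y))"
   by (metis norm_triangle_ineq4)
  ultimately show ?case by (intro ennreal_leI) (simp add: norm_mult)
 qed
qed measurable

text \<open>\<open>h0\<close> is the function whose derivatives at points are prescribed,
  \<open>h\<close> its Borel version. They agree only almost everywhere, so the pointwise bound on
  the symbol is carried over off a null set.\<close>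

lemma approximation_order:
 assumes h0: "AE y in lborel. h0 y = h y" and n: "n >= 1" and d: "0 < d" "d < 1/2" and \<gamma>: "admissible \<gamma>"
  and F: "boundedly_differentiable n (%w. fhat \<phi> w * cnj (h0 w)) {w. norm w < d}"
  and F0: "!!k. mi_order k < n ==> D k (%w. 1 - fhat \<phi> w * cnj (h0 w)) 0 = 0"
  and bd: "!!l. l : int_lattice - {0} ==> boundedly_differentiable n (fhat \<phi>) {w. norm (w + l) < d}"
  and sum: "!!k. mi_order k = n ==> \<exists>B. \<forall>w. norm w < d --> (\<Sum>\<^sub>\<infinity>l\<in>int_lattice - {0}. enorm (D k (fhat \<phi>) (w + l))) <= ennreal B"
  and SF: "!!l k. l : int_lattice - {0} ==> mi_order k < n ==> D k (fhat \<phi>) l = 0"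
 shows "\<exists>C1 C2. \<forall>g0 g j. good g --> (AE x in lborel. g0 x = g x) -->
  ennpowr (Q_err g0 j) q \<le>
   ennreal (C1 * r j powr (\<gamma> * q)) * (outer_int (\<gamma>) d j g) +
   ennreal (C2 * r j powr (real n * q)) * (inner_int (real n) d j g)"
proof -
 obtain B1 where B1: "B1 >= 0" "!!x. norm x < d ==> cmod (1 - fhat \<phi> x * cnj (h0 x)) <= B1 * norm x ^ n"
  using one_minus_bound[OF n F F0 d(1)] by blast
 obtain B2 where B2: "B2 >= 0" "!!y. norm y < d ==> (\<Sum>\<^sub>\<infinity>l\<in>int_lattice - {0}. enorm (fhat \<phi> (y + l))) <= ennreal (B2 * norm y ^ n)"
  using strang_fix_sum_bound[OF d(1) bd sum SF] by blast
 \<comment> \<open>The summand 1 ensures K > 0.\<close>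
 define K where "K = B1 + Ch * B2 + 1"
 have K: "K > 0" using B1(1) B2(1) Ch by (simp add: K_def add_nonneg_pos)
 have AE0: "AE y in (lborel :: (real^'d) measure). y ~= 0" by (rule AE_lborel_singleton)
 have loc: "AE y in lborel. norm y < d --> symbol_err y <= ennreal (K * norm y powr real n)"
  using h1 h0 AE0
 proof eventually_elim
  case (elim y)
  show ?case
  proof
   assume y: "norm y < d"
   have "symbol_err y <= ennreal (cmod (1 - fhat \<phi> y * cnj (h y)) + Ch * (B2 * norm y ^ n))"
    using elim y d(2) B2 by (intro symbol_error_bound) auto
   also have "... <= ennreal (K * norm y powr real n)"
   proof (rule ennreal_leI)
    have "cmod (1 - fhat \<phi> y * cnj (h y)) + Ch * (B2 * norm y ^ n) <= B1 * norm y ^ n + Ch * B2 * norm y ^ n + 1 * norm y ^ n"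
     using elim B1(2)[OF y] by (simp add: mult.assoc add_increasing2)
    also have "... = K * norm y powr real n"
     using elim by (simp only: K_def distrib_right powr_realpow zero_less_norm_iff not_False_eq_True)
    finally show "cmod (1 - fhat \<phi> y * cnj (h y)) + Ch * (B2 * norm y ^ n) <= K * norm y powr real n" .
   qed
   finally show "symbol_err y <= ennreal (K * norm y powr real n)" .
  qed
 qed
 obtain c1 where c1: "c1 > 0" "!!g j. good g ==>
  high_err d j g \<le>
  ennreal c1 * ennpowr (ennreal (r j powr (\<gamma> * q)) *
   (outer_int (\<gamma>) d j g)) (1 / q)"
  using high_estimate[OF d(1) \<gamma>] by blast
 obtain c2 where c2: "c2 > 0" "!!g j. good g ==>
  low_err d j g \<le>
  ennreal (c2 * K) * ennpowr (ennreal (r j powr (real n * q)) *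
   (inner_int (real n) d j g)) (1 / q)"
 proof -
  obtain C where "C > 0" "\<forall>g j d K s. good g --> 0 < d --> d <= 1/2 --> K > 0 --> s >= 0 -->
  (AE y in lborel. norm y < d --> symbol_err y <= ennreal (K * norm y powr s)) -->
  low_err d j g \<le>
  ennreal (C * K) * ennpowr (ennreal (r j powr (s * q)) *
   (inner_int (s) d j g)) (1 / q)"
   using low_estimate by blast
  then show ?thesis using loc d K by (intro that[of C]) auto
 qed
 \<comment> \<open>4 comes from the triangle inequality in L_p, 2 powr q from splitting the q-th
   power of a sum.\<close>
 define c where "c = 4 powr q * 2 powr q"
 define C1 where "C1 = c * c1 powr q"
 define C2 where "C2 = c * (c2 * K) powr q"
 have "ennpowr (Q_err g0 j) q \<le>
   ennreal (C1 * r j powr (\<gamma> * q)) * (outer_int (\<gamma>) d j g) +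
   ennreal (C2 * r j powr (real n * q)) * (inner_int (real n) d j g)"
  if g: "good g" and AE: "AE x in lborel. g0 x = g x" for g0 g j
 proof -
  define I1 where "I1 = (outer_int (\<gamma>) d j g)"
  define I2 where "I2 = (inner_int (real n) d j g)"
  define a where "a = ennreal c1 * ennpowr (ennreal (r j powr (\<gamma> * q)) * I1) (1 / q)"
  define b where "b = ennreal (c2 * K) * ennpowr (ennreal (r j powr (real n * q)) * I2) (1 / q)"
  have q0: "q > 0" "q >= 0" using f(4) by auto
  have "Q_err g0 j <= ennreal 4 * (a + b)"
   using c1(2)[OF g, of j] c2(2)[OF g, of j]
   by (intro order_trans[OF error_split[OF g AE, of j d]]) (simp add: a_def b_def I1_def I2_def add_mono mult_left_mono del: distrib_left_numeral)
  then have "ennpowr (Q_err g0 j) q <= ennpowr (ennreal 4) q * ennpowr (a + b) q"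
   using q0 unfolding ennpowr_mult[symmetric] by (intro ennpowr_mono) auto
  also have "... <= ennpowr (ennreal 4) q * (ennreal (2 powr q) * (ennpowr a q + ennpowr b q))"
   using q0 by (intro mult_left_mono ennpowr_sum_le) auto
  also have "... = ennreal c * (ennpowr a q + ennpowr b q)"
   unfolding ennpowr_ennreal by (simp add: c_def ennreal_mult mult.assoc)
  also have "ennpowr a q = ennreal (c1 powr q) * (ennreal (r j powr (\<gamma> * q)) * I1)"
   using q0 c1(1) unfolding a_def ennpowr_mult[of "ennreal c1"] ennpowr_ennpowr by (simp add: ennpowr_ennreal)
  also have "ennpowr b q = ennreal ((c2 * K) powr q) * (ennreal (r j powr (real n * q)) * I2)"
   using q0 c2(1) K unfolding b_def ennpowr_mult[of "ennreal (c2 * K)"] ennpowr_ennpowr by (simp add: ennpowr_ennreal)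
  finally show ?thesis
   unfolding I1_def[symmetric] I2_def[symmetric]
   by (simp add: C1_def C2_def c_def ennreal_mult distrib_left mult.assoc)
 qed
 then show ?thesis by blast
qed

end

section \<open>Sufficiency of the Strang-Fix condition for convergence\<close>

lemma ennreal_tendsto_0I:
 fixes X :: "'a => ennreal"
 assumes "!!e::real. e > 0 ==> \<forall>\<^sub>F x in F. X x <= ennreal e"
 shows "(X \<longlongrightarrow> 0) F"
proof (rule order_tendstoI)
 fix a :: ennreal assume "0 < a"
 then obtain b where b: "0 < b" "b < a" using dense by blast
 then obtain e where e: "e > 0" "b = ennreal e" by (cases b) (auto simp: top_unique)
 show "\<forall>\<^sub>F x in F. X x < a"
  using assms[OF e(1)] by eventually_elim (use b(2) e(2) in auto)
qed simp

context quasi_projection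
begin

abbreviation \<open>periodized x \<equiv> (SUML k. enorm (\<phi> (x + k)))\<close>

lemma zak_le_per: "enorm (zak \<phi> x y) <= periodized x"
 unfolding zak_def by (rule order_trans[OF norm_LINT_latm_le]) (simp add: norm_mult)

text \<open>The exponent p' is free: it is p in the sufficiency proof for finite p, and 1 in the
  necessity proof, where p may be infinite. The difference splits into the variation of
  \<open>zak\<close> in y and that of the symbol, small by continuity at 0.\<close>

lemma symbol_continuous:
 fixes e :: real
 assumes p': "1 <= p'" "p' ~= infy" and fin': "Lp_enorm p' tor periodized < infy"
  and h0: "AE y in lborel. h0 y = h y" "isCont h0 0" and e: "e > 0"
 shows "\<exists>\<delta>>0. \<delta> < 1/2 \<and> (AE y in lborel. norm y < \<delta> -->
  Lp_enorm p' tor (%x. enorm (cnj (h0 0) * zak \<phi> x 0 - cnj (h y) * zak \<phi> x y)) <= ennreal e)"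
proof -
 define P where "P = enn2real p'"
 have P: "P >= 1" using ennreal_ge_1_real[OF p'] by (simp add: P_def)
 obtain b where b: "b >= 0" "Lp_enorm p' tor periodized = ennreal b"
  using fin' by (cases "Lp_enorm p' tor periodized") auto
 have [measurable]: "periodized : bm" by (rule per_measurable[OF \<phi>m])
 define a where "a = h0 0"
 define c where "c = cmod a"
 \<comment> \<open>Two contributions of size e/8, times the 4 of the triangle inequality; adding 1
   avoids a division by zero.\<close>
 define e1 where "e1 = e / 8 / (c + 1)"
 define e2 where "e2 = e / 8 / (b + 1)"
 have c: "c >= 0" by (simp add: c_def)
 have e12: "e1 > 0" "e2 > 0" "c * e1 <= e / 8" "e2 * b <= e / 8"
  using e b c by (auto simp: e1_def e2_def field_simps)
 have "(INTT x. ennpowr (periodized x) P) = ennpowr (Lp_enorm p' tor periodized) P"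
  unfolding P_def by (rule Lp_enorm_eq_power[OF p', symmetric])
 also have "... < infy" using fin' by (simp add: less_top[symmetric])
 finally have F: "(INTT x. ennpowr (periodized x) P) < infy" .
 have "ennpowr (ennreal e1) P > 0" using e12 by (simp add: zero_less_iff_neq_zero)
 from zak_continuous[OF \<phi>m P F this]
 obtain \<delta>1 where \<delta>1: "\<delta>1 > 0" "!!y. norm y < \<delta>1 ==> (INTT x. ennreal (cmod (zak \<phi> x y - zak \<phi> x 0) powr P)) <= ennpowr (ennreal e1) P"
  by blast
 obtain \<delta>2 where \<delta>2: "\<delta>2 > 0" "!!y. norm y < \<delta>2 ==> cmod (h0 y - a) < e2"
  using h0(2) e12(2) unfolding continuous_at_eps_delta a_def by (metis dist_norm diff_zero)
 define \<delta> where "\<delta> = min (min \<delta>1 \<delta>2) (1/4)"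
 have \<delta>: "\<delta> > 0" "\<delta> < 1/2" "\<delta> <= \<delta>1" "\<delta> <= \<delta>2" using \<delta>1 \<delta>2 by (auto simp: \<delta>_def)
 have "AE y in lborel. norm y < \<delta> -->
  Lp_enorm p' tor (%x. enorm (cnj (h0 0) * zak \<phi> x 0 - cnj (h y) * zak \<phi> x y)) <= ennreal e"
  using h0(1)
 proof eventually_elim
  case (elim y)
  show ?case
  proof
   assume y: "norm y < \<delta>"
   define Z where "Z = (%x. enorm (zak \<phi> x y - zak \<phi> x 0))"
   have [measurable]: "Z : bm" unfolding Z_def by measurable
   have hh: "cmod (h y - a) <= e2" using \<delta>2(2)[of y] y \<delta>(4) elim by simp
   have "Lp_enorm p' tor (%x. enorm (cnj (h0 0) * zak \<phi> x 0 - cnj (h y) * zak \<phi> x y)) \<le>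
    Lp_enorm p' tor (%x. ennreal c * Z x + ennreal e2 * periodized x)"
   proof (rule Lp_enorm_AE_mono[OF p'(1)])
    show "AE x in tor. enorm (cnj (h0 0) * zak \<phi> x 0 - cnj (h y) * zak \<phi> x y) <= ennreal c * Z x + ennreal e2 * periodized x"
    proof (rule AE_I2)
     fix x
     have "cnj a * zak \<phi> x 0 - cnj (h y) * zak \<phi> x y = - (cnj a * (zak \<phi> x y - zak \<phi> x 0)) - cnj (h y - a) * zak \<phi> x y"
      by (simp add: algebra_simps)
     then have "cmod (cnj a * zak \<phi> x 0 - cnj (h y) * zak \<phi> x y) <= c * cmod (zak \<phi> x y - zak \<phi> x 0) + cmod (h y - a) * cmod (zak \<phi> x y)"
      using norm_triangle_ineq4[of "- (cnj a * (zak \<phi> x y - zak \<phi> x 0))" "cnj (h y - a) * zak \<phi> x y"]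
      by (simp add: norm_mult c_def del: complex_cnj_diff)
     also have "... <= c * cmod (zak \<phi> x y - zak \<phi> x 0) + e2 * cmod (zak \<phi> x y)"
      using hh by (intro add_left_mono mult_right_mono) auto
     finally have "enorm (cnj a * zak \<phi> x 0 - cnj (h y) * zak \<phi> x y) <= ennreal c * Z x + ennreal e2 * enorm (zak \<phi> x y)"
      using c e12 by (simp add: Z_def ennreal_mult[symmetric] ennreal_plus[symmetric] ennreal_leI del: ennreal_plus)
     also have "... <= ennreal c * Z x + ennreal e2 * periodized x"
      by (intro add_left_mono mult_left_mono zak_le_per) auto
     finally show "enorm (cnj (h0 0) * zak \<phi> x 0 - cnj (h y) * zak \<phi> x y) <= ennreal c * Z x + ennreal e2 * periodized x"
      by (simp add: a_def)
    qed
   qed measurable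
   also have "... <= 4 * (Lp_enorm p' tor (%x. ennreal c * Z x) + Lp_enorm p' tor (%x. ennreal e2 * periodized x))"
    by (rule Lp_enorm_add_le[OF p'(1)]) measurable
   also have "... <= 4 * (ennreal c * ennreal e1 + ennreal e2 * ennreal b)"
   proof (intro mult_left_mono add_mono)
    have "Lp_enorm p' tor Z <= ennreal e1"
    proof (rule Lp_enorm_leI[OF p'(1)])
     show "(INTT x. ennpowr (Z x) (enn2real p')) <= ennpowr (ennreal e1) (enn2real p')"
      using \<delta>1(2)[of y] y \<delta>(3) by (simp add: Z_def ennpowr_ennreal P_def)
    qed (use p' in auto)
    then show "Lp_enorm p' tor (%x. ennreal c * Z x) <= ennreal c * ennreal e1"
     by (intro order_trans[OF Lp_enorm_cmult_le[OF p'(1)]] mult_left_mono) auto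
    show "Lp_enorm p' tor (%x. ennreal e2 * periodized x) <= ennreal e2 * ennreal b"
     unfolding b(2)[symmetric] by (rule Lp_enorm_cmult_le[OF p'(1)]) measurable
   qed simp
   also have "... = ennreal (4 * (c * e1 + e2 * b))"
    using c e12 b by (simp add: ennreal_mult ennreal_plus[symmetric] del: ennreal_plus distrib_left_numeral flip: ennreal_mult ennreal_numeral)
   also have "... <= ennreal e" using add_mono[OF e12(3,4)] e by (intro ennreal_leI) simp
   finally show "Lp_enorm p' tor (%x. enorm (cnj (h0 0) * zak \<phi> x 0 - cnj (h y) * zak \<phi> x y)) <= ennreal e" .
  qed
 qed
 then show ?thesis using \<delta> by blast
qed

lemma r_tendsto_0: "(%j. r j) ~~> 0"
 by (rule onorm_dilation_inverse_tendsto_0(2)[OF M])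

lemma outer_integral_tendsto_0:
 assumes [measurable]: "F : bm" and F: "(INTR z. F z) < infy" and d: "d > 0"
 shows "(%j. INTR z. F z * indicator {z. d <= norm (BT j *v z)} z) ~~> 0"
proof -
 have "(%j. INTR z. F z * indicator {z. d <= norm (BT j *v z)} z) ~~> (\<integral>\<^sup>+z. (0::ennreal) \<partial>(lborel :: (real^'d) measure))"
 proof (rule nn_integral_dominated_convergence[where w = F])
  show "AE z in lborel. (%j. F z * indicator {z. d <= norm (BT j *v z)} z) ~~> 0"
  proof (rule AE_I2)
   fix z :: "real^'d"
   have "(%j. r j * norm z) ~~> 0 * norm z" by (intro tendsto_intros r_tendsto_0)
   then have "\<forall>\<^sub>F j in sequentially. r j * norm z < d" using d by (intro order_tendstoD(2)[of _ "0 * norm z"]) auto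
   then have "\<forall>\<^sub>F j in sequentially. F z * indicator {z. d <= norm (BT j *v z)} z = 0"
   proof eventually_elim
    case (elim j)
    have "norm (BT j *v z) <= r j * norm z" by (intro onorm matrix_vector_mul_bounded_linear)
    then show ?case using elim by (simp add: indicator_def)
   qed
   then show "(%j. F z * indicator {z. d <= norm (BT j *v z)} z) ~~> 0" by (rule tendsto_eventually)
  qed
  show "AE z in lborel. F z * indicator {z. d <= norm (BT j *v z)} z <= F z" for j
   by (auto simp: indicator_def)
 qed (use F in measurable)
 then show ?thesis by simp
qed

lemma high_tendsto_0:
 assumes g: "good g" and d: "d > 0"
 shows "(%j. high_err d j g) ~~> 0"
proof -
 obtain b where b: "admissible b" "(INTR y. ennreal (norm y powr (q * b) * cmod (g y) powr q)) < infy"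
  using g by (auto simp: good_def)
 have [measurable]: "g : bm" using g by (rule good_measurable)
 define I where "I = (%j. INTR w. ennreal (norm w powr (q * b) * cmod (g w) powr q) * indicator {w. d <= norm (BT j *v w)} w)"
 obtain C where C: "C > 0" "!!j. high_err d j g \<le>
  ennreal C * ennpowr (ennreal (r j powr (b * q)) * I j) (1 / q)"
  using high_estimate[OF d b(1)] g unfolding I_def by blast
 have I: "I ~~> 0" unfolding I_def by (rule outer_integral_tendsto_0[OF _ b(2) d]) measurable
 have "(%j. ennreal C * ennpowr (I j) (1 / q)) ~~> ennreal C * 0"
  using f(4) I by (intro tendsto_mult_ennreal tendsto_const tendsto_ennpowr_0) auto
 then have lim: "(%j. ennreal C * ennpowr (I j) (1 / q)) ~~> 0" by simp
 have "\<forall>\<^sub>F j in sequentially. r j < 1" using r_tendsto_0 by (rule order_tendstoD) simp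
 then have "\<forall>\<^sub>F j in sequentially. high_err d j g <= ennreal C * ennpowr (I j) (1 / q)"
 proof eventually_elim
  case (elim j)
  have "0 <= b * q" using admissible_nonneg[OF b(1)] f(4) by simp
  then have "r j powr (b * q) <= 1" using elim onorm_dilation_inverse_pos[OF M, of j] by (intro powr_le1) auto
  then have "ennreal (r j powr (b * q)) * I j <= 1 * I j" by (intro mult_right_mono) (auto simp: ennreal_le_1)
  then have "ennpowr (ennreal (r j powr (b * q)) * I j) (1 / q) <= ennpowr (I j) (1 / q)"
   using f(4) by (intro ennpowr_mono) auto
  then show ?case by (intro order_trans[OF C(2)] mult_left_mono) auto
 qed
 then show ?thesis by (intro tendsto_sandwich[OF _ _ tendsto_const lim]) auto
qed

text \<open>For finite p the vanishing coefficients make \<open>zak \<phi> x 0\<close> equal to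
  \<open>fhat \<phi> 0\<close> for almost every x, and continuity in L_p does the rest. For p =
  infinity the full absolute sum is continuous at 0 and equals its term at l = 0 there; that term is
  continuous too, so the sum over the other l is small near 0.\<close>

lemma symbol_small:
 fixes e :: real
 assumes h0: "AE y in lborel. h0 y = h y" "isCont h0 0" and a: "fhat \<phi> 0 * cnj (h0 0) = 1" and e: "e > 0"
  and SF: "!!l. l : int_lattice - {0} ==> fhat \<phi> l = 0"
  and S: "p = infy ==> isCont (%w. \<Sum>\<^sub>\<infinity>k\<in>int_lattice. enorm (fhat \<phi> (w + k))) 0"
 shows "\<exists>\<delta>>0. \<delta> < 1/2 \<and> (AE y in lborel. norm y < \<delta> -->
  symbol_err y <= ennreal e)"
proof (cases "p = infy")
 case False
 have s0: "(\<Sum>\<^sub>\<infinity>l\<in>int_lattice - {0}. enorm (fhat \<phi> (0 + l))) = 0"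
  using SF by (intro infsum_0) auto
 have "AE x in tor. enorm (zak \<phi> x 0 - fhat \<phi> 0) <= 0"
  by (rule zak_minus_fhat_bound) (use s0 in auto)
 then have Z: "AE x in tor. 1 = cnj (h0 0) * zak \<phi> x 0"
  by eventually_elim (use a in \<open>simp add: mult.commute\<close>)
 from symbol_continuous[OF f(1) False fin h0 e] obtain \<delta> where \<delta>: "\<delta> > 0" "\<delta> < 1/2"
  "AE y in lborel. norm y < \<delta> --> Lp_enorm p tor (%x. enorm (cnj (h0 0) * zak \<phi> x 0 - cnj (h y) * zak \<phi> x y)) <= ennreal e"
  by blast
 have "symbol_err y = Lp_enorm p tor (%x. enorm (cnj (h0 0) * zak \<phi> x 0 - cnj (h y) * zak \<phi> x y))" for y
  by (rule Lp_enorm_AE_cong[OF f(1)]) (use Z in \<open>auto elim: eventually_mono\<close>)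
 then show ?thesis using \<delta> by auto
next
 case True
 define S where "S = (%w. \<Sum>\<^sub>\<infinity>k\<in>int_lattice. enorm (fhat \<phi> (w + k)))"
 define S0 where "S0 = (%w. \<Sum>\<^sub>\<infinity>k\<in>int_lattice - {0}. enorm (fhat \<phi> (w + k)))"
 have split: "S w = enorm (fhat \<phi> w) + S0 w" for w
 proof -
  have "S w = (SUML l. enorm (fhat \<phi> (w + l)) * indicator {0} l + enorm (fhat \<phi> (w + l)) * of_bool (l ~= 0))"
   unfolding S_def nn_integral_latm_eq_infsum[symmetric] by (intro nn_integral_cong) (simp add: indicator_def)
  also have "... = (SUML l. enorm (fhat \<phi> (w + l)) * indicator {0} l) + (SUML l. enorm (fhat \<phi> (w + l)) * of_bool (l ~= 0))"
   by (rule nn_integral_add) auto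
  also have "(SUML l. enorm (fhat \<phi> (w + l)) * indicator {0} l) = enorm (fhat \<phi> w)"
   by (subst nn_integral_indicator_finite) auto
  finally show ?thesis by (simp add: nn_integral_latm_nonzero S0_def)
 qed
 have "S0 0 = 0" unfolding S0_def using SF by (intro infsum_0) auto
 then have S0: "S 0 = enorm (fhat \<phi> 0)" using split[of 0] by simp
 define e1 where "e1 = e / (4 * (Ch + 1))"
 have e1: "e1 > 0" "Ch * (2 * e1) <= e / 2" using e Ch by (auto simp: e1_def field_simps)
 have "(S \<longlongrightarrow> S 0) (at 0)" using S[OF True] by (simp add: S_def isCont_def)
 moreover have "S 0 < ennreal (cmod (fhat \<phi> 0) + e1)" using e1 by (simp add: S0 ennreal_lessI)
 ultimately have "\<forall>\<^sub>F w in at 0. S w < ennreal (cmod (fhat \<phi> 0) + e1)" by (rule order_tendstoD)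
 then obtain \<delta>1 where \<delta>1: "\<delta>1 > 0" "!!w. w ~= 0 ==> norm w < \<delta>1 ==> S w < ennreal (cmod (fhat \<phi> 0) + e1)"
  unfolding eventually_at by (auto simp: dist_norm)
 have fc: "isCont (fhat \<phi>) 0" by (rule fhat_continuous[OF \<phi>m per_facts(2)])
 then obtain \<delta>2 where \<delta>2: "\<delta>2 > 0" "!!w. norm w < \<delta>2 ==> cmod (fhat \<phi> w - fhat \<phi> 0) < e1"
  using e1(1) unfolding continuous_at_eps_delta by (metis dist_norm diff_zero)
 have "isCont (%w. fhat \<phi> w * cnj (h0 w)) 0" using fc h0(2) by (intro continuous_intros)
 moreover have "e / 2 > 0" using e by simp
 ultimately obtain \<delta>3 where \<delta>3: "\<delta>3 > 0" "!!w. norm w < \<delta>3 ==> cmod (fhat \<phi> w * cnj (h0 w) - 1) < e / 2"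
  unfolding continuous_at_eps_delta a by (metis dist_norm diff_zero)
 define \<delta> where "\<delta> = Min {\<delta>1, \<delta>2, \<delta>3, 1/4}"
 have \<delta>: "\<delta> > 0" "\<delta> < 1/2" "\<delta> <= \<delta>1" "\<delta> <= \<delta>2" "\<delta> <= \<delta>3" using \<delta>1 \<delta>2 \<delta>3 by (auto simp: \<delta>_def)
 have AE0: "AE y in (lborel :: (real^'d) measure). y ~= 0" by (rule AE_lborel_singleton)
 have "AE y in lborel. norm y < \<delta> --> symbol_err y <= ennreal e"
  using h1 h0(1) AE0
 proof eventually_elim
  case (elim y)
  show ?case
  proof
   assume y: "norm y < \<delta>"
   have "S y < ennreal (cmod (fhat \<phi> 0) + e1)" using \<delta>1(2) elim y \<delta> by auto
   moreover have "cmod (fhat \<phi> 0) <= cmod (fhat \<phi> y) + e1"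
    using \<delta>2(2)[of y] y \<delta> norm_triangle_sub[of "fhat \<phi> 0" "fhat \<phi> y"] by (simp add: norm_minus_commute)
   then have "ennreal (cmod (fhat \<phi> 0) + e1) <= enorm (fhat \<phi> y) + ennreal (2 * e1)"
    using e1 by (simp add: ennreal_plus[symmetric] ennreal_leI del: ennreal_plus)
   ultimately have "enorm (fhat \<phi> y) + S0 y <= enorm (fhat \<phi> y) + ennreal (2 * e1)"
    unfolding split by (meson less_imp_le order_trans)
   then have S0': "S0 y <= ennreal (2 * e1)" by (simp add: ennreal_add_left_cancel_le)
   have "symbol_err y <= ennreal (cmod (1 - fhat \<phi> y * cnj (h y)) + Ch * (2 * e1))"
    using S0' elim y \<delta> e1 by (intro symbol_error_bound) (auto simp: S0_def)
   also have "... <= ennreal e"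
    using \<delta>3(2)[of y] y \<delta> elim e1(2) by (intro ennreal_leI) (simp add: norm_minus_commute)
   finally show "symbol_err y <= ennreal e" .
  qed
 qed
 then show ?thesis using \<delta> by blast
qed

lemma convergence_sufficient:
 assumes h0: "AE y in lborel. h0 y = h y" "isCont h0 0" and a: "fhat \<phi> 0 * cnj (h0 0) = 1"
  and SF: "!!l. l : int_lattice - {0} ==> fhat \<phi> l = 0"
  and S: "p = infy ==> isCont (%w. \<Sum>\<^sub>\<infinity>k\<in>int_lattice. enorm (fhat \<phi> (w + k))) 0"
  and g: "good g" and AE: "AE x in lborel. g0 x = g x"
 shows "(%j. Q_err g0 j) ~~> 0"
proof (rule ennreal_tendsto_0I)
 fix e :: real assume e: "e > 0"
 have [measurable]: "g : bm" using g by (rule good_measurable)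
 define I where "I = ennpowr (INTR y. ennreal (cmod (g y) powr q)) (1 / q)"
 have "I < infy" using g by (simp add: I_def good_def less_top[symmetric])
 then obtain G where G: "G >= 0" "I = ennreal G" by (cases I) auto
 obtain C where C: "C > 0" "\<forall>g j d K s. good g --> 0 < d --> d <= 1/2 --> K > 0 --> s >= 0 -->
  (AE y in lborel. norm y < d --> symbol_err y <= ennreal (K * norm y powr s)) -->
  low_err d j g \<le>
  ennreal (C * K) * ennpowr (ennreal (r j powr (s * q)) *
   (inner_int (s) d j g)) (1 / q)"
  using low_estimate by blast
 \<comment> \<open>Makes the low-frequency error at most C K G <= e/8 for every j: weight exponent 0
   leaves no dependence on the scaling.\<close>
 define K where "K = e / (8 * C * (G + 1))"
 have "K > 0" "C * K * G = e / 8 * (G / (G + 1))" using e C(1) G(1) by (auto simp: K_def add_nonneg_pos)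
 moreover have "e / 8 * (G / (G + 1)) <= e / 8 * 1" using e G(1) by (intro mult_left_mono) auto
 ultimately have K: "K > 0" "C * K * G <= e / 8" by auto
 obtain d where d: "d > 0" "d < 1/2" "AE y in lborel. norm y < d -->
  symbol_err y <= ennreal K"
  using symbol_small[OF h0 a K(1) SF S] by blast
 have AE0: "AE y in (lborel :: (real^'d) measure). y ~= 0" by (rule AE_lborel_singleton)
 have loc: "AE y in lborel. norm y < d -->
  symbol_err y <= ennreal (K * norm y powr 0)"
  using d(3) AE0 by eventually_elim simp
 have low: "low_err d j g <= ennreal (e / 8)" for j
 proof -
  have "low_err d j g \<le>
   ennreal (C * K) * ennpowr (ennreal (r j powr (0 * q)) *
   (inner_int (0) d j g)) (1 / q)"
   using C(2)[rule_format, OF g d(1) _ K(1) _ loc, of j] d(2) by simp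
  also have "... <= ennreal (C * K) * I"
  proof -
   have "ennreal (r j powr (0 * q)) * (inner_int (0) d j g)
    <= 1 * (INTR y. ennreal (cmod (g y) powr q))"
    by (intro mult_mono nn_integral_mono) (auto simp: indicator_def)
   then show ?thesis unfolding I_def using f(4) by (intro mult_left_mono ennpowr_mono) auto
  qed
  also have "... = ennreal (C * K * G)" using C(1) K G by (simp add: ennreal_mult)
  also have "... <= ennreal (e / 8)" using K(2) by (rule ennreal_leI)
  finally show ?thesis .
 qed
 have "\<forall>\<^sub>F j in sequentially. high_err d j g < ennreal (e / 8)"
  using high_tendsto_0[OF g d(1)] by (rule order_tendstoD) (use e in simp)
 then show "\<forall>\<^sub>F j in sequentially. Q_err g0 j <= ennreal e"
 proof eventually_elim
  case (elim j)
  have "Q_err g0 j <= ennreal 4 * (ennreal (e / 8) + ennreal (e / 8))"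
   using error_split[OF g AE, of j d] elim low[of j]
   by (simp del: distrib_left_numeral) (meson add_mono less_imp_le mult_left_mono order_trans zero_le)
  also have "... = ennreal e" using e by (simp add: ennreal_plus[symmetric] ennreal_mult[symmetric] del: ennreal_plus distrib_left_numeral ennreal_numeral)
  finally show ?case .
 qed
qed

end

section \<open>Necessity of the Strang-Fix condition for convergence\<close>

lemma pred_ball [measurable (raw)]:
 fixes x0 :: "real^'d::finite"
 assumes [measurable]: "u : borel_measurable N"
 shows "Measurable.pred N (%z. u z : ball x0 R)"
 unfolding mem_ball by measurable

text \<open>Translating by \<open>B *v t\<close> and averaging over \<open>t\<close> in the unit cell replaces counting the
 lattice cells that meet the ball.\<close>

lemma periodic_average:
 fixes A B :: "real^'d::finite^'d" and w :: "real^'d => ennreal"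
 assumes [measurable]: "w : bm" and per: "!!x k. k : int_lattice ==> w (x + k) = w x"
  and AB: "A ** B = mat 1" and s: "onorm ((*v) B) * real CARD('d) <= s"
 shows "emeasure lborel (ball x0 e) * (INTT t. w t) <= (INTR x. w (A *v x) * indicator (ball x0 (e + s)) x)"
  and "(INTR x. w (A *v x) * indicator (ball x0 e) x) <= emeasure lborel (ball x0 (e + s)) * (INTT t. w t)"
proof -
 interpret t: prob_space "tor :: (real^'d) measure" by (rule prob_space_tor)
 interpret pair_sigma_finite "lborel :: (real^'d) measure" "tor :: (real^'d) measure" ..
 have Bt: "norm (B *v t) <= s" if "t : unit_cell" for t
 proof -
  have "norm (B *v t) <= onorm ((*v) B) * norm t" by (intro onorm matrix_vector_mul_bounded_linear)
  also have "... <= onorm ((*v) B) * real CARD('d)"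
   by (intro mult_left_mono norm_unit_cell_le that onorm_pos_le matrix_vector_mul_bounded_linear)
  finally show ?thesis using s by simp
 qed
 have shift: "(INTR x. w (A *v x + t) * indicator (ball x0 R) x) = (INTR x. w (A *v x) * indicator (ball x0 R) (x - B *v t))" for t R
 proof -
  have AB': "A *v (x + B *v t) = A *v x + t" for x
   by (simp add: matrix_vector_right_distrib matrix_vector_mul_assoc AB)
  have "(%x. w (A *v x) * indicator (ball x0 R) (x - B *v t)) : bm" by measurable
  from nn_integral_lborel_shift[OF this, of "B *v t"] show ?thesis by (simp add: AB')
 qed
 have avg: "(INTT t. (INTR x. w (A *v x + t) * indicator (ball x0 R) x)) = emeasure lborel (ball x0 R) * (INTT t. w t)" for R
 proof -
  have "(INTT t. (INTR x. w (A *v x + t) * indicator (ball x0 R) x)) = (INTR x. (INTT t. w (A *v x + t) * indicator (ball x0 R) x))"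
   by (rule Fubini') measurable
  also have "... = (INTR x. (INTT t. w t) * indicator (ball x0 R) x)"
  proof (rule nn_integral_cong)
   fix x :: "real^'d"
   have "(INTT t. w (A *v x + t)) = (INTT t. w t)"
    using nn_integral_tor_shift[of w "A *v x", OF _ per] by (simp add: add.commute)
   then show "(INTT t. w (A *v x + t) * indicator (ball x0 R) x) = (INTT t. w t) * indicator (ball x0 R) x"
    by (simp add: nn_integral_multc)
  qed
  also have "... = emeasure lborel (ball x0 R) * (INTT t. w t)"
   by (subst nn_integral_cmult) (auto simp: mult.commute)
  finally show ?thesis .
 qed
 have cell: "AE t in tor. t : (unit_cell :: (real^'d) set)" by (simp add: AE_tor_iff)
 have const: "(\<integral>\<^sup>+t. c \<partial>(tor :: (real^'d) measure)) = c" for c using t.emeasure_space_1 by simp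
 have ind: "indicator (ball x0 R) (x - B *v t) <= (indicator (ball x0 (R + s)) x :: ennreal)" "(indicator (ball x0 R) x :: ennreal) <= indicator (ball x0 (R + s)) (x - B *v t)"
  if "t : unit_cell" for x t R
 proof -
  have "norm (x - x0) <= norm (x - B *v t - x0) + norm (B *v t)" "norm (x - B *v t - x0) <= norm (x - x0) + norm (B *v t)"
   using norm_triangle_ineq[of "x - B *v t - x0" "B *v t"] norm_triangle_ineq4[of "x - x0" "B *v t"] by (simp_all add: algebra_simps)
  then have "norm (x - x0) <= norm (x - B *v t - x0) + s" "norm (x - B *v t - x0) <= norm (x - x0) + s"
   using Bt[OF that] by linarith+
  then show "indicator (ball x0 R) (x - B *v t) <= (indicator (ball x0 (R + s)) x :: ennreal)" "(indicator (ball x0 R) x :: ennreal) <= indicator (ball x0 (R + s)) (x - B *v t)"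
   by (auto simp: indicator_def dist_norm norm_minus_commute)
 qed
 have "(INTT t. (INTR x. w (A *v x + t) * indicator (ball x0 e) x)) <= (\<integral>\<^sup>+t. (INTR x. w (A *v x) * indicator (ball x0 (e + s)) x) \<partial>(tor :: (real^'d) measure))"
  unfolding shift by (rule nn_integral_mono_AE, use cell in eventually_elim) (intro nn_integral_mono mult_left_mono ind, auto)
 then show "emeasure lborel (ball x0 e) * (INTT t. w t) <= (INTR x. w (A *v x) * indicator (ball x0 (e + s)) x)"
  unfolding avg const .
 have "(\<integral>\<^sup>+t. (INTR x. w (A *v x) * indicator (ball x0 e) x) \<partial>(tor :: (real^'d) measure)) <= (INTT t. (INTR x. w (A *v x + t) * indicator (ball x0 (e + s)) x))"
  unfolding shift by (rule nn_integral_mono_AE, use cell in eventually_elim) (intro nn_integral_mono mult_left_mono ind, auto)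
 then show "(INTR x. w (A *v x) * indicator (ball x0 e) x) <= emeasure lborel (ball x0 (e + s)) * (INTT t. w t)"
  unfolding avg const .
qed

lemma nn_integral_ball_le_Lp:
 fixes x0 :: "real^'d::finite"
 assumes p: "1 <= p"
 shows "\<exists>C::real. C >= 0 \<and> (\<forall>u. u : bm --> (INTR x. u x * indicator (ball x0 R) x) <= ennreal C * Lp_enorm p lborel u)"
proof -
 have fin: "emeasure lborel (ball x0 R) < infy" using emeasure_bounded_finite[of "ball x0 R"] by simp
 then obtain v where v: "v >= 0" "emeasure lborel (ball x0 R) = ennreal v" by (cases "emeasure lborel (ball x0 R)") auto
 show ?thesis
 proof (cases "p = infy")
  case True
  have "(INTR x. u x * indicator (ball x0 R) x) <= ennreal v * Lp_enorm p lborel u" for u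
  proof -
   have "(INTR x. u x * indicator (ball x0 R) x) <= (INTR x. Lp_enorm p lborel u * indicator (ball x0 R) x)"
    by (rule nn_integral_mono_AE, use Lp_enorm_infinity_AE[OF True, of u lborel] in eventually_elim) (auto intro: mult_right_mono)
   also have "... = ennreal v * Lp_enorm p lborel u" by (subst nn_integral_cmult) (auto simp: v(2) mult.commute)
   finally show ?thesis .
  qed
  then show ?thesis using v(1) by blast
 next
  case False
  define P where "P = enn2real p"
  have P: "P >= 1" using ennreal_ge_1_real[OF p False] by (simp add: P_def)
  define C where "C = v powr ((P - 1) / P)"
  have "(INTR x. u x * indicator (ball x0 R) x) <= ennreal C * Lp_enorm p lborel u" if [measurable]: "u : bm" for u
  proof -
   have "ennpowr (INTR x. u x * indicator (ball x0 R) x) P \<le>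
    ennpowr (INTR x. indicator (ball x0 R) x) (P - 1) * (INTR x. ennpowr (u x) P * indicator (ball x0 R) x)"
    by (rule nn_integral_Jensen[OF _ _ P]) measurable
   also have "... <= ennpowr (ennreal v) (P - 1) * (INTR x. ennpowr (u x) P)"
   proof -
    have "(INTR x. indicator (ball x0 R) x) = ennreal v"
     by (subst nn_integral_indicator) (auto simp: v(2))
    then show ?thesis by (simp only:) (intro mult_left_mono nn_integral_mono, auto simp: indicator_def)
   qed
   also have "... = ennpowr (ennreal C * Lp_enorm p lborel u) P"
    using P v(1) unfolding ennpowr_mult P_def Lp_enorm_eq_power[OF p False] by (simp add: ennpowr_ennreal C_def powr_powr P_def)
   finally show ?thesis using P by (simp add: ennpowr_le_iff)
  qed
  then show ?thesis using v(1) by (intro exI[of _ C]) (simp add: C_def)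
 qed
qed

context quasi_projection
begin

text \<open>In the frequency integral for the error, \<open>cnj (h w) * zak \<phi> y w\<close> is
  frozen to the value \<open>a * zak \<phi> y 0\<close>, constant in w; the last integral is the
  cost of the replacement.\<close>

lemma low_error_pointwise:
 assumes g: "good g" and supp: "!!w. w \<notin> unit_cell ==> g w = 0" and y: "periodized y < infy"
 shows "enorm ((1 - a * zak \<phi> y 0) * inv_fourier g y) <= enorm (proj_error \<phi> h g y) +
  (INTR w. enorm (g w) * enorm (a * zak \<phi> y 0 - cnj (h w) * zak \<phi> y w))"
proof -
 have gm[measurable]: "g : bm" using g by (rule good_measurable)
 note ig = good_integrable(1,2)[OF g]
 have tor_int: "integrable tor u" if [measurable]: "u : bm" and "(INTR w. enorm (u w)) < infy" for u :: "real^'d => complex"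
 proof (rule integrableI_bounded)
  have "(INTT w. enorm (u w)) <= (INTR w. enorm (u w))"
   by (subst nn_integral_tor) (auto intro!: nn_integral_mono simp: indicator_def)
  then show "(INTT w. ennreal (norm (u w))) < infy" using that(2) by (auto intro: le_less_trans)
 qed measurable
 have fg: "(INTR w. enorm (g w)) < infy" "(INTR w. enorm (g w * cnj (h w))) < infy"
  using ig by (auto simp: integrable_iff_bounded)
 define u1 where "u1 = (%w. g w * character y w)"
 define u2 where "u2 = (%w. g w * cnj (h w) * (character y w * zak \<phi> y w))"
 have [measurable]: "u1 : bm" "u2 : bm" unfolding u1_def u2_def by measurable
 have i1: "integrable tor u1"
  by (rule tor_int) (use fg in \<open>simp_all add: u1_def norm_mult\<close>)
 have i2: "integrable tor u2"
 proof (rule tor_int)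
  have "(INTR w. enorm (u2 w)) <= (INTR w. enorm (g w * cnj (h w)) * periodized y)"
  proof (rule nn_integral_mono)
   fix w
   have "enorm (u2 w) = enorm (g w * cnj (h w)) * enorm (zak \<phi> y w)"
    by (simp add: u2_def norm_mult ennreal_mult)
   also have "... <= enorm (g w * cnj (h w)) * periodized y" by (intro mult_left_mono zak_le_per) simp
   finally show "enorm (u2 w) <= enorm (g w * cnj (h w)) * periodized y" .
  qed
  also have "... < infy" using fg(2) y by (simp add: nn_integral_multc ennreal_mult_less_top)
  finally show "(INTR w. enorm (u2 w)) < infy" .
 qed measurable
 have E: "proj_error \<phi> h g y = (LINT w|tor. u1 w - u2 w)"
 proof -
  have "proj_error \<phi> h g y = fcoeff (%w. g w * (character y w * (1 - cnj (h w) * zak \<phi> y w))) 0"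
   using error_fiber[OF \<phi>m hm gm ig supp y, of 0] by (simp add: proj_error_def)
  also have "... = (LINT w|tor. u1 w - u2 w)"
   unfolding fcoeff_def by (intro Bochner_Integration.integral_cong) (simp_all add: u1_def u2_def character_simps algebra_simps)
  finally show ?thesis .
 qed
 have I: "inv_fourier g y = (LINT w|tor. u1 w)"
  unfolding inv_fourier_def u1_def
  by (subst LINT_tor) (auto intro!: Bochner_Integration.integral_cong simp: supp indicator_def)
 define W where "W = (%w. a * zak \<phi> y 0 * u1 w - u2 w)"
 have iW: "integrable tor W" unfolding W_def using i1 i2 by simp
 have "(1 - a * zak \<phi> y 0) * inv_fourier g y = proj_error \<phi> h g y - (LINT w|tor. W w)"
  unfolding E I W_def using i1 i2 by (simp add: algebra_simps)
 then have "cmod ((1 - a * zak \<phi> y 0) * inv_fourier g y) <= cmod (proj_error \<phi> h g y) + cmod (LINT w|tor. W w)"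
  by (metis norm_triangle_ineq4)
 then have "enorm ((1 - a * zak \<phi> y 0) * inv_fourier g y) <= enorm (proj_error \<phi> h g y) + enorm (LINT w|tor. W w)"
  by (simp add: ennreal_plus[symmetric] ennreal_leI del: ennreal_plus)
 also have "enorm (LINT w|tor. W w) <= (INTT w. enorm (W w))"
  by (rule integral_norm_bound_ennreal[OF iW])
 also have "... <= (INTR w. enorm (W w))"
  by (subst nn_integral_tor) (auto intro!: nn_integral_mono simp: indicator_def W_def)
 also have "... = (INTR w. enorm (g w) * enorm (a * zak \<phi> y 0 - cnj (h w) * zak \<phi> y w))"
 proof (rule nn_integral_cong)
  fix w
  have "W w = g w * (character y w * (a * zak \<phi> y 0 - cnj (h w) * zak \<phi> y w))"
   by (simp add: W_def u1_def u2_def algebra_simps)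
  then show "enorm (W w) = enorm (g w) * enorm (a * zak \<phi> y 0 - cnj (h w) * zak \<phi> y w)"
   by (simp add: norm_mult ennreal_mult)
 qed
 finally show ?thesis by (simp add: add_left_mono)
qed

lemma scaled_L1:
 assumes [measurable]: "g : bm" "Measurable.pred borel P"
 shows "(INTR y. enorm (scaled M j g y * of_bool (P y))) <= (INTR w. enorm (g w) * indicator {w. P (BT j *v w)} w)"
proof -
 have AE0: "AE y in (lborel :: (real^'d) measure). y ~= 0" by (rule AE_lborel_singleton)
 have "(INTR y. enorm (scaled M j g y * of_bool (P y))) =
  (INTR y. ennreal (norm y powr (1 * 0) * cmod (scaled M j g y * of_bool (P y)) powr 1))"
  by (rule nn_integral_cong_AE, use AE0 in eventually_elim) simp
 also have "... <= ennreal (jacobian M j powr (1 - 1)) * (ennreal (r j powr (0 * 1)) *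
   (INTR w. ennreal (norm w powr (1 * 0) * cmod (g w) powr 1) * indicator {w. P (BT j *v w)} w))"
  by (rule scaled_integral[OF M]) auto
 also have "... <= 1 * (1 * (INTR w. enorm (g w) * indicator {w. P (BT j *v w)} w))"
  by (intro mult_mono nn_integral_mono) (auto simp: indicator_def)
 finally show ?thesis by simp
qed

lemma low_tendsto_0:
 assumes g: "good g" and d: "d > 0" and AE: "AE x in lborel. g0 x = g x"
  and lim: "(%j. Q_err g0 j) ~~> 0"
 shows "(%j. low_err d j g) ~~> 0"
proof (rule tendsto_sandwich[OF _ _ tendsto_const])
 have [measurable]: "g : bm" "!!j. high d j g : bm" "!!j. low d j g : bm"
  using g good_high_low[OF g] by (auto intro: good_measurable)
 let ?s = "%j. Lp_enorm p lborel (%x. enorm (proj_error \<phi> h (scaled M j g) (mat_pow M j *v x)))"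
 let ?h = "%j. high_err d j g"
 have "?s ~~> 0" using lim unfolding error_representation[OF g AE] .
 then have "(%j. 4 * (?s j + ?h j)) ~~> 4 * (0 + 0)"
  by (intro tendsto_mult_ennreal tendsto_const tendsto_add high_tendsto_0[OF g d]) auto
 then show "(%j. 4 * (?s j + ?h j)) ~~> 0" by simp
 show "\<forall>\<^sub>F j in sequentially. low_err d j g <= 4 * (?s j + ?h j)"
 proof (rule always_eventually, rule allI, rule order_trans[OF Lp_enorm_AE_mono[OF f(1)] Lp_enorm_add_le[OF f(1)]])
  fix j
  show "AE x in lborel. enorm (proj_error \<phi> h (low d j g) (mat_pow M j *v x)) \<le>
   enorm (proj_error \<phi> h (scaled M j g) (mat_pow M j *v x)) + enorm (proj_error \<phi> h (high d j g) (mat_pow M j *v x))"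
   using high_low_split[OF g, of j d]
  proof eventually_elim
   case (elim x)
   then have "proj_error \<phi> h (low d j g) (mat_pow M j *v x) = proj_error \<phi> h (scaled M j g) (mat_pow M j *v x) - proj_error \<phi> h (high d j g) (mat_pow M j *v x)"
    by simp
   then show ?case by (simp add: ennreal_plus[symmetric] ennreal_leI norm_triangle_ineq4 del: ennreal_plus)
  qed
 qed measurable
qed simp

text \<open>On a ball the L1 norm is controlled by every L_p norm, so p = infinity needs no separate
  treatment, and the cost of freezing the symbol is measured in L1 as well, where \<open>zak\<close>
  is continuous in the frequency. Both this cost and \<open>\<Psi>\<close> are periodic, so after
  dilation their integrals over the ball are compared with their means over the cell.\<close>

lemma convergence_necessary:
 assumes h0: "AE w in lborel. h0 w = h w" "isCont h0 0" and a: "fhat \<phi> 0 * cnj (h0 0) = 1"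
  and g: "good g" and AE: "AE x in lborel. g0 x = g x" and nz: "inv_fourier g x0 ~= 0"
  and lim: "(%j. Q_err g0 j) ~~> 0"
  and l: "l : int_lattice - {0}"
 shows "fhat \<phi> l = 0"
proof -
 have gm[measurable]: "g : bm" using g by (rule good_measurable)
 have [measurable]: "!!d j. high d j g : bm" "!!d j. low d j g : bm"
  using good_high_low[OF g] by (auto intro: good_measurable)
 note ig = good_integrable(1)[OF g]
 define F where "F = inv_fourier g"
 have "F = (%x. fhat g (- x))" by (simp add: F_def fun_eq_iff fhat_def inv_fourier_def character_simps)
 then have "isCont F x0" using isCont_o2[OF _ fhat_continuous[OF gm ig], of x0 uminus] by (simp add: continuous_minus)
 \<comment> \<open>|f| is at least 2c near x0; the high frequencies take away at most c and leave c
   for the low ones.\<close>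
 define c where "c = cmod (F x0) / 3"
 have c: "c > 0" using nz by (simp add: c_def F_def)
 obtain \<rho>0 where \<rho>0: "\<rho>0 > 0" "!!x. dist x x0 < \<rho>0 ==> dist (F x) (F x0) < c"
  using \<open>isCont F x0\<close> c unfolding continuous_at_eps_delta by blast
 \<comment> \<open>\<open>K\<close> has radius 2 \<rho>; averaging compares it with the ball of
   radius \<rho> from below and that of radius 3 \<rho> from above.\<close>
 define \<rho> where "\<rho> = \<rho>0 / 2"
 have \<rho>: "\<rho> > 0" "\<rho>0 = \<rho> + \<rho>" using \<rho>0(1) by (auto simp: \<rho>_def)
 define K where "K = ball x0 (\<rho> + \<rho>)"
 have [measurable]: "K : sets borel" by (simp add: K_def)
 have F2: "2 * c <= cmod (F x)" if "x : K" for x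
 proof -
  have "cmod (F x0 - F x) < c" using \<rho>0(2)[of x] that \<rho>(2) by (simp add: K_def dist_norm norm_minus_commute)
  then show ?thesis using norm_triangle_sub[of "F x0" "F x"] by (simp add: c_def)
 qed
 define b where "b = cnj (h0 0)"
 define \<Psi> where "\<Psi> = (%y. enorm (1 - b * zak \<phi> y 0))"
 define W where "W = (%w y. enorm (b * zak \<phi> y 0 - cnj (h w) * zak \<phi> y w))"
 have [measurable]: "\<Psi> : bm" "!!w. W w : bm" unfolding \<Psi>_def W_def by measurable
 have Wm[measurable]: "(%z. W (fst z) (snd z)) : borel_measurable (borel \<Otimes>\<^sub>M borel)" unfolding W_def by measurable
 have per: "\<Psi> (y + k) = \<Psi> y" "W w (y + k) = W w y" if "k : int_lattice" for y k w
  by (simp_all add: \<Psi>_def W_def zak_periodic[OF that])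
 define I where "I = (INTT t. \<Psi> t)"
 obtain C where C: "C >= 0" "!!u. u : bm ==> (INTR x. u x * indicator K x) <= ennreal C * Lp_enorm p lborel u"
  using nn_integral_ball_le_Lp[OF f(1), of x0 "\<rho> + \<rho>"] unfolding K_def by blast
 obtain v where v: "v >= 0" "emeasure lborel (ball x0 (\<rho> + \<rho> + \<rho>)) = ennreal v"
  using emeasure_bounded_finite[of "ball x0 (\<rho> + \<rho> + \<rho>)"] by (cases "emeasure lborel (ball x0 (\<rho> + \<rho> + \<rho>))") auto
 have "(INTR w. enorm (g w)) < infy" using ig by (simp add: integrable_iff_bounded)
 note fg = this
 then obtain G where G: "G >= 0" "(INTR w. enorm (g w)) = ennreal G"
  by (cases "INTR w. enorm (g w)") auto
 define y where "y = 1 + G * v"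
 have y: "y > 0" using G v by (simp add: y_def add_pos_nonneg)
 have main: "ennreal c * (emeasure lborel (ball x0 \<rho>) * I) <= ennreal (e * y)" if e: "e > 0" for e
 proof -
  obtain d where d: "d > 0" "d < 1/2" "AE w in lborel. norm w < d --> (INTT t. W w t) <= ennreal e"
  proof -
   have "Lp_enorm 1 tor periodized < infy" using per_facts(1) by (simp add: Lp_enorm_def)
   from symbol_continuous[OF _ _ this h0 e] show ?thesis
    using that by (auto simp: Lp_enorm_def W_def b_def)
  qed
  have t1: "(%j. onorm ((*v) (mat_pow (matrix_inv M) j)) * real CARD('d)) ~~> 0 * real CARD('d)"
   by (intro tendsto_intros onorm_dilation_inverse_tendsto_0(1)[OF M])
  have e1: "\<forall>\<^sub>F j in sequentially. onorm ((*v) (mat_pow (matrix_inv M) j)) * real CARD('d) < \<rho>"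
   using t1 by (rule order_tendstoD) (use \<rho> in simp)
  have e2: "\<forall>\<^sub>F j in sequentially. (INTR \<xi>. enorm (g \<xi>) * indicator {\<xi>. d <= norm (BT j *v \<xi>)} \<xi>) < ennreal c"
   by (rule order_tendstoD(2)[OF outer_integral_tendsto_0[OF _ fg d(1)]]) (use c in auto)
  have "(%j. ennreal C * low_err d j g) ~~> ennreal C * 0"
   by (intro tendsto_mult_ennreal tendsto_const low_tendsto_0[OF g d(1) AE lim]) auto
  then have e3: "\<forall>\<^sub>F j in sequentially. ennreal C * low_err d j g < ennreal e"
   by (rule order_tendstoD) (use e in simp)
  obtain j where j: "onorm ((*v) (mat_pow (matrix_inv M) j)) * real CARD('d) < \<rho>"
   "(INTR \<xi>. enorm (g \<xi>) * indicator {\<xi>. d <= norm (BT j *v \<xi>)} \<xi>) < ennreal c"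
   "ennreal C * low_err d j g < ennreal e"
   using eventually_happens[OF eventually_conj[OF e1 eventually_conj[OF e2 e3]]] by auto
  define A where "A = mat_pow M j"
  note J = jacobian[OF M, of j]
  note avg = periodic_average[OF _ _ dilation_powers_inverse(1)[OF M, of j] less_imp_le[OF j(1)], folded A_def]
  have low_supp: "low d j g w = 0" if "w \<notin> unit_cell" for w
  proof -
   have "\<not> norm w < d" using small_ball_unit_cell[of w] d(2) that by linarith
   then show ?thesis by (simp add: low_def)
  qed
  have lowF: "c <= cmod (inv_fourier (low d j g) (A *v x))" if x: "x : K" for x
  proof -
   note i = good_integrable(1)[OF good_high_low(1)[OF g, of d j]] good_integrable(1)[OF good_high_low(2)[OF g, of d j]]
   have s: "scaled M j g = (%w. high d j g w + low d j g w)"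
    by (auto simp: fun_eq_iff high_def low_def of_bool_def)
   have "F x = inv_fourier (scaled M j g) (A *v x)"
    unfolding F_def scaled_def A_def by (rule inv_fourier_dilate[OF J(1,3) gm, symmetric])
   also have "... = inv_fourier (high d j g) (A *v x) + inv_fourier (low d j g) (A *v x)"
    unfolding s by (rule inv_fourier_add[OF i])
   finally have eq: "F x = inv_fourier (high d j g) (A *v x) + inv_fourier (low d j g) (A *v x)" .
   have "enorm (inv_fourier (high d j g) (A *v x)) <= (INTR w. ennreal (norm (high d j g w * character (A *v x) w)))"
    unfolding inv_fourier_def by (rule integral_norm_bound_ennreal) (use i(1) in simp)
   also have "... <= (INTR \<xi>. enorm (g \<xi>) * indicator {\<xi>. d <= norm (BT j *v \<xi>)} \<xi>)"
    using scaled_L1[of g "%w. d <= norm w" j] by (simp add: high_def norm_mult)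
   also note j(2)
   finally have "cmod (inv_fourier (high d j g) (A *v x)) < c" by (simp add: ennreal_less_iff)
   then show ?thesis
    using F2[OF x] eq norm_triangle_ineq[of "inv_fourier (high d j g) (A *v x)" "inv_fourier (low d j g) (A *v x)"] by simp
  qed
  have AEper: "AE x in lborel. periodized (A *v x) < infy"
   unfolding A_def by (rule linear_change_of_variables(4)[OF J(2,1) per_facts(4)])
  have "ennreal c * (emeasure lborel (ball x0 \<rho>) * I) <= ennreal c * (INTR x. \<Psi> (A *v x) * indicator K x)"
   unfolding I_def K_def by (intro mult_left_mono avg(1)) (auto simp: per)
  also have "... = (INTR x. ennreal c * (\<Psi> (A *v x) * indicator K x))"
   by (rule nn_integral_cmult[symmetric]) measurable
  also have "... <= (INTR x. enorm (proj_error \<phi> h (low d j g) (A *v x)) * indicator K x +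
    (INTR w. enorm (low d j g w) * W w (A *v x) * indicator K x))"
  proof (rule nn_integral_mono_AE, use AEper in eventually_elim)
   case (elim x)
   show ?case
   proof (cases "x : K")
    case True
    have "ennreal c * \<Psi> (A *v x) <= enorm ((1 - b * zak \<phi> (A *v x) 0) * inv_fourier (low d j g) (A *v x))"
     using mult_right_mono[OF lowF[OF True], of "cmod (1 - b * zak \<phi> (A *v x) 0)"] c
     by (simp add: \<Psi>_def norm_mult ennreal_mult[symmetric] mult.commute ennreal_leI)
    also have "... <= enorm (proj_error \<phi> h (low d j g) (A *v x)) + (INTR w. enorm (low d j g w) * W w (A *v x))"
     unfolding W_def by (rule low_error_pointwise[OF good_high_low(2)[OF g] low_supp elim])
    finally show ?thesis using True by simp
   qed simp
  qed
  also have "... = (INTR x. enorm (proj_error \<phi> h (low d j g) (A *v x)) * indicator K x) +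
    (INTR x. (INTR w. enorm (low d j g w) * W w (A *v x) * indicator K x))"
   unfolding W_def by (rule nn_integral_add) measurable
  also have "... <= ennreal e + ennreal G * (ennreal v * ennreal e)"
  proof (rule add_mono)
   have "(INTR x. enorm (proj_error \<phi> h (low d j g) (A *v x)) * indicator K x) \<le>
    ennreal C * Lp_enorm p lborel (%x. enorm (proj_error \<phi> h (low d j g) (A *v x)))"
    by (rule C(2)) measurable
   then show "(INTR x. enorm (proj_error \<phi> h (low d j g) (A *v x)) * indicator K x) <= ennreal e"
    using j(3) unfolding A_def by (meson less_imp_le order_trans)
   have "(INTR x. (INTR w. enorm (low d j g w) * W w (A *v x) * indicator K x)) =
    (INTR w. (INTR x. enorm (low d j g w) * W w (A *v x) * indicator K x))"
    unfolding W_def by (rule lborel_pair.Fubini') measurable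
   also have "... <= (INTR w. enorm (low d j g w) * (ennreal v * ennreal e))"
   proof (rule nn_integral_mono_AE, use d(3) in eventually_elim)
    case (elim w)
    show ?case
    proof (cases "norm w < d")
     case True
     have "(INTR x. enorm (low d j g w) * W w (A *v x) * indicator K x) =
      enorm (low d j g w) * (INTR x. W w (A *v x) * indicator K x)"
      unfolding mult.assoc by (rule nn_integral_cmult) measurable
     also have "(INTR x. W w (A *v x) * indicator K x) <= ennreal v * (INTT t. W w t)"
      unfolding K_def v(2)[symmetric] by (rule avg(2)) (auto simp: per)
     also have "... <= ennreal v * ennreal e" using elim True by (intro mult_left_mono) auto
     finally show ?thesis by (simp add: mult_left_mono)
    qed (simp add: low_def)
   qed
   also have "... = (INTR w. enorm (low d j g w)) * (ennreal v * ennreal e)"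
    by (rule nn_integral_multc) measurable
   also have "(INTR w. enorm (low d j g w)) <= (INTR \<xi>. enorm (g \<xi>) * indicator {\<xi>. norm (BT j *v \<xi>) < d} \<xi>)"
    unfolding low_def by (rule scaled_L1) measurable
   also have "... <= ennreal G"
    unfolding G(2)[symmetric] by (intro nn_integral_mono) (auto simp: indicator_def)
   finally show "(INTR x. (INTR w. enorm (low d j g w) * W w (A *v x) * indicator K x)) <= ennreal G * (ennreal v * ennreal e)"
    by (simp add: mult_right_mono)
  qed
  also have "... = ennreal (e * y)"
   using e G(1) v(1) by (simp add: y_def ennreal_mult[symmetric] ennreal_plus[symmetric] algebra_simps del: ennreal_plus)
  finally show ?thesis .
 qed
 have "ennreal c * (emeasure lborel (ball x0 \<rho>) * I) <= 0 + ennreal e" if "e > 0" for e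
  using main[of "e / y"] that y by simp
 then have "ennreal c * (emeasure lborel (ball x0 \<rho>) * I) <= 0" by (rule ennreal_le_epsilon)
 moreover have "emeasure lborel (ball x0 \<rho>) ~= 0"
 proof
  assume "emeasure lborel (ball x0 \<rho>) = 0"
  then have "ball x0 \<rho> : null_sets lborel" by (simp add: null_sets_def)
  then have "negligible (ball x0 \<rho>)" by (simp add: negligible_iff_null_sets null_sets_completionI)
  then show False using open_not_negligible[of "ball x0 \<rho>"] \<rho>(1) by simp
 qed
 ultimately have "I = 0" using c by (simp add: ennreal_eq_0_iff)
 then have "AE t in tor. \<Psi> t = 0" unfolding I_def by (subst (asm) nn_integral_0_iff_AE) auto
 then have Z: "AE t in tor. b * zak \<phi> t 0 = 1" by eventually_elim (simp add: \<Psi>_def)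
 interpret t: prob_space "tor :: (real^'d) measure" by (rule prob_space_tor)
 have "b * fhat \<phi> l = b * fcoeff (%x. zak \<phi> x 0) l"
  using fcoeff_zak[OF \<phi>m per_facts(2), of l 0] l by simp
 also have "... = (LINT t|tor. b * zak \<phi> t 0 * cnj (character l t))"
  by (simp add: fcoeff_def mult.assoc)
 also have "... = (LINT t|tor. character (- l) t)"
  by (rule integral_cong_AE) (use Z in \<open>auto simp: character_simps elim: eventually_mono\<close>)
 also have "... = 0" using LINT_tor_character[of "- l"] l by simp
 finally show ?thesis using a by (auto simp: b_def)
qed

end

section \<open>Reduction to Borel representatives, and the theorem\<close>

lemma unit_cell_subset_torus: "unit_cell \<subseteq> (torus :: (real^'d::finite) set)"
 by (auto simp: unit_cell_def torus_def mem_box_cart less_imp_le)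

lemma torus_borel: "(torus :: (real^'d::finite) set) : sets borel"
 by (simp add: torus_def)

lemma calLp_periodized:
 fixes \<phi> \<phi>' :: "real^'d::finite => complex"
 assumes p: "1 <= p" and \<phi>: "\<phi> : calLp p" and [measurable]: "\<phi>' : bm" and AE: "AE x in lborel. \<phi> x = \<phi>' x"
 shows "Lp_enorm p tor (%x. SUML k. enorm (\<phi>' (x + k))) < infy"
proof -
 define w where "w = (%x. SUML k. enorm (\<phi>' (x + k)))"
 have [measurable]: "w : bm"
  unfolding w_def by (rule borel_measurable_nn_integral_latm) measurable
 have t: "(torus :: (real^'d) set) : sets lebesgue" using torus_borel by (intro sets_completionI_sets) simp
 have wl: "w : borel_measurable lebesgue" by (rule measurable_completion) simp
 have wm: "w : borel_measurable (lebesgue_on torus)" by (rule measurable_restrict_space1[OF wl])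
 define C where "C = Lp_enorm p (lebesgue_on torus) w"
 have "AE x in lborel. \<forall>k\<in>int_lattice. \<phi> (x + k) = \<phi>' (x + k)"
  by (subst AE_ball_countable[OF countable_int_lattice]) (intro ballI AE_lborel_shift AE)
 then have "AE x in lborel. w x = (\<Sum>\<^sub>\<infinity>k\<in>int_lattice. enorm (\<phi> (x + k)))"
  unfolding w_def nn_integral_latm_eq_infsum by eventually_elim (simp cong: infsum_cong)
 then have "AE x in lebesgue. x : torus --> w x = (\<Sum>\<^sub>\<infinity>k\<in>int_lattice. enorm (\<phi> (x + k)))"
  by (intro AE_completion) (auto elim: eventually_mono)
 then have "AE x in lebesgue_on torus. w x = (\<Sum>\<^sub>\<infinity>k\<in>int_lattice. enorm (\<phi> (x + k)))"
  using t by (subst AE_restrict_space_iff) auto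
 then have "C <= Lp_enorm p (lebesgue_on torus) (%x. \<Sum>\<^sub>\<infinity>k\<in>int_lattice. enorm (\<phi> (x + k)))"
  unfolding C_def by (intro Lp_enorm_AE_mono[OF p wm]) (auto elim: eventually_mono)
 also have "... < infy" using \<phi> by (simp add: calLp_def)
 finally have C: "C < infy" .
 have "Lp_enorm p tor w <= C"
 proof (rule Lp_enorm_leI[OF p])
  assume "p = infy"
  then have "AE x in lebesgue_on torus. w x <= C" unfolding C_def by (rule Lp_enorm_infinity_AE)
  then have "AE x in lebesgue. x : torus --> w x <= C" using t by (subst (asm) AE_restrict_space_iff) auto
  then have "AE x in lborel. x : torus --> w x <= C" by (simp add: AE_completion_iff)
  then show "AE x in tor. w x <= C"
   unfolding AE_tor_iff by eventually_elim (use unit_cell_subset_torus in auto)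
 next
  assume p': "p ~= infy"
  have "(INTT x. ennpowr (w x) (enn2real p)) = (INTR x. ennpowr (w x) (enn2real p) * indicator unit_cell x)"
   by (rule nn_integral_tor) measurable
  also have "... <= (INTR x. ennpowr (w x) (enn2real p) * indicator torus x)"
   using unit_cell_subset_torus by (intro nn_integral_mono mult_left_mono) (auto simp: indicator_def)
  also have "... = (\<integral>\<^sup>+x. ennpowr (w x) (enn2real p) * indicator torus x \<partial>lebesgue)"
   by (rule nn_integral_completion[symmetric]) 
  also have "... = (\<integral>\<^sup>+x. ennpowr (w x) (enn2real p) \<partial>lebesgue_on torus)"
   using t by (intro nn_integral_restrict_space[symmetric]) simp
  also have "... = ennpowr C (enn2real p)" unfolding C_def by (rule Lp_enorm_eq_power[OF p p', symmetric])
  finally show "(INTT x. ennpowr (w x) (enn2real p)) <= ennpowr C (enn2real p)" .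
 qed measurable
 then show ?thesis using C by (auto simp: w_def intro: le_less_trans)
qed

lemma D_order_0: "mi_order b < 1 ==> D b F = F"
 using length_mi_list[of b] by (simp add: D_eq_partials)

text \<open>The ball of radius 1/2 lies in the cube. Points of the cube outside the ball satisfy 1
  <= (2|y|)^N, which turns the constant bound into a power bound and explains 2^N.\<close>

lemma symbol_bounds:
 fixes h h' :: "real^'d::finite => complex"
 assumes N: "N >= 0" and AE: "AE x in lborel. h x = h' x"
  and o: "AE w in lebesgue. w \<notin> torus --> cmod (h w) <= C1 * norm w powr N"
  and i: "AE w in lebesgue. w : torus --> cmod (h w) <= C2"
 shows "AE y in lborel. norm y < 1/2 --> cmod (h' y) <= \<bar>C1\<bar> + \<bar>C2\<bar> * 2 powr N"
  and "AE y in lborel. 1/2 <= norm y --> cmod (h' y) <= (\<bar>C1\<bar> + \<bar>C2\<bar> * 2 powr N) * norm y powr N"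
proof -
 have oi: "AE w in lborel. w \<notin> torus --> cmod (h w) <= C1 * norm w powr N" "AE w in lborel. w : torus --> cmod (h w) <= C2"
  using o i by (simp_all add: AE_completion_iff)
 have c2: "\<bar>C2\<bar> * 1 <= \<bar>C2\<bar> * 2 powr N" using N by (intro mult_left_mono) (auto simp: ge_one_powr_ge_zero)
 show "AE y in lborel. norm y < 1/2 --> cmod (h' y) <= \<bar>C1\<bar> + \<bar>C2\<bar> * 2 powr N"
  using oi(2) AE
 proof eventually_elim
  case (elim y)
  show ?case
  proof
   assume "norm y < 1/2"
   then have "y : torus" using small_ball_unit_cell unit_cell_subset_torus by blast
   then show "cmod (h' y) <= \<bar>C1\<bar> + \<bar>C2\<bar> * 2 powr N" using elim c2 by simp
  qed
 qed
 show "AE y in lborel. 1/2 <= norm y --> cmod (h' y) <= (\<bar>C1\<bar> + \<bar>C2\<bar> * 2 powr N) * norm y powr N"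
  using oi AE
 proof eventually_elim
  case (elim y)
  show ?case
  proof
   assume y: "1/2 <= norm y"
   have "1 <= (2 * norm y) powr N" using y N by (intro ge_one_powr_ge_zero) auto
   then have "\<bar>C2\<bar> * 1 <= \<bar>C2\<bar> * (2 * norm y) powr N" by (intro mult_left_mono) auto
   then have "\<bar>C2\<bar> <= \<bar>C2\<bar> * 2 powr N * norm y powr N" by (simp add: powr_mult)
   moreover have "C1 * norm y powr N <= \<bar>C1\<bar> * norm y powr N" by (rule mult_right_mono) auto
   moreover have "0 <= \<bar>C1\<bar> * norm y powr N" "0 <= \<bar>C2\<bar> * 2 powr N * norm y powr N" by auto
   moreover have "cmod (h' y) <= C1 * norm y powr N \<or> cmod (h' y) <= \<bar>C2\<bar>"
    using elim by (cases "y : torus") auto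
   ultimately show "cmod (h' y) <= (\<bar>C1\<bar> + \<bar>C2\<bar> * 2 powr N) * norm y powr N"
    unfolding distrib_right by linarith
  qed
 qed
qed

lemma set_nn_integral_lebesgue_cong:
 fixes g g' :: "real^'d::finite => complex"
 assumes [measurable]: "g' : bm" "A : sets borel" and AE: "AE x in lborel. g x = g' x"
 shows "(\<integral>\<^sup>+w\<in>A. ennreal (norm w powr s * cmod (g w) powr q) \<partial>lebesgue) =
  (INTR w. ennreal (norm w powr s * cmod (g' w) powr q) * indicator A w)"
proof -
 have "(\<integral>\<^sup>+w\<in>A. ennreal (norm w powr s * cmod (g w) powr q) \<partial>lebesgue) = (\<integral>\<^sup>+w\<in>A. ennreal (norm w powr s * cmod (g' w) powr q) \<partial>lebesgue)"
  by (rule nn_integral_cong_AE, use AE_completion[OF AE] in eventually_elim) simp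
 also have "... = (INTR w. ennreal (norm w powr s * cmod (g' w) powr q) * indicator A w)"
  by (rule nn_integral_completion)
 finally show ?thesis .
qed

text \<open>The function f = 0 is reproduced whatever \<phi> is, so necessity is stated for f with a
  nonzero value. For p = infinity sufficiency assumes continuity of \<open>S\<close> at 0, because
  the continuity of \<open>zak\<close> in L_p rests on dominated convergence, which does not reach
  the supremum norm.\<close>

theorem theorem4:
  fixes M :: "real^'d::finite^'d"
    and p :: ennreal and q N \<epsilon> :: real
    and \<phi> h :: "real^'d \<Rightarrow> complex"
    and T :: "(real^'d \<Rightarrow> complex) \<Rightarrow> complex"
  defines "d \<equiv> real CARD('d)"
    and "f \<equiv> (\<lambda>g :: real^'d \<Rightarrow> complex. \<lambda>x. fourier g (- x))"
    and "err \<equiv> (\<lambda>g j. Lp_norm p (\<lambda>x. fourier g (- x) - Q p M \<phi> T g j x))"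
    and "r \<equiv> (\<lambda>j. onorm (\<lambda>x. mat_powi (transpose M) (- int j) *v x))"
    and "S \<equiv> (\<lambda>\<xi>. \<Sum>\<^sub>\<infinity>k\<in>int_lattice. ennreal (cmod (fourier \<phi> (\<xi> + k)) powr q))"
  assumes p: "2 \<le> p" and q: "1 / p + 1 / ennreal q = 1"
    and M: "dilation_matrix M"
    and \<phi>: "\<phi> \<in> calLp p" "\<exists>B>0. \<forall>\<xi>. S \<xi> < ennreal B"
    and T: "tempered_distribution T" "has_fourier_function T h"
    and N: "N \<ge> 0"
    and h_out: "\<exists>C. AE \<xi> in lebesgue. \<xi> \<notin> torus \<longrightarrow> cmod (h \<xi>) \<le> C * norm \<xi> powr N"
    and h_in: "\<exists>C. AE \<xi> in lebesgue. \<xi> \<in> torus \<longrightarrow> cmod (h \<xi>) \<le> C"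
    and \<epsilon>: "\<epsilon> > 0"
  shows
    "(isCont h 0 \<and> fourier \<phi> 0 * cnj (h 0) = 1 \<longrightarrow>
        (\<forall>g. Lq_decay q (N + d + \<epsilon>) g \<longrightarrow>
           ((\<exists>x. f g x \<noteq> 0) \<and> err g \<longlonglongrightarrow> 0 \<longrightarrow> strang_fix 1 \<phi>) \<and>
           (strang_fix 1 \<phi> \<and> (p = \<infinity> \<longrightarrow> isCont S 0) \<longrightarrow> err g \<longlonglongrightarrow> 0)))
     \<and>
     (\<forall>n \<delta> \<gamma>.
        n \<ge> 1 \<and> 0 < \<delta> \<and> \<delta> < 1/2 \<and>
        boundedly_differentiable n (\<lambda>\<xi>. fourier \<phi> \<xi> * cnj (h \<xi>)) {\<xi>. norm \<xi> < \<delta>} \<and>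
        (\<forall>l\<in>int_lattice - {0}. boundedly_differentiable n (fourier \<phi>) {\<xi>. norm (\<xi> + l) < \<delta>}) \<and>
        (\<forall>\<beta>. mi_order \<beta> = n \<longrightarrow>
           (\<exists>B. \<forall>\<xi>. norm \<xi> < \<delta> \<longrightarrow>
              (\<Sum>\<^sub>\<infinity>l\<in>int_lattice - {0}. ennreal (cmod (D \<beta> (fourier \<phi>) (\<xi> + l)))) \<le> ennreal B)) \<and>
        (\<forall>\<beta>. mi_order \<beta> < n \<longrightarrow> D \<beta> (\<lambda>\<xi>. 1 - fourier \<phi> \<xi> * cnj (h \<xi>)) 0 = 0) \<and>
        strang_fix n \<phi> \<and>
        (if p = \<infinity> then \<gamma> = N
         else N + d / enn2real p < \<gamma> \<and> \<gamma> < N + d / enn2real p + \<epsilon>)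
        \<longrightarrow>
        (\<exists>C1 C2. \<forall>g. Lq_decay q (N + d + \<epsilon>) g \<longrightarrow> (\<forall>j.
           ennpowr (err g j) q
           \<le> ennreal (C1 * r j powr (\<gamma> * q)) *
               (\<integral>\<^sup>+ \<xi> \<in> {\<xi>. norm (mat_powi (transpose M) (- int j) *v \<xi>) \<ge> \<delta>}.
                  ennreal (norm \<xi> powr (q * \<gamma>) * cmod (g \<xi>) powr q) \<partial>lebesgue)
             + ennreal (C2 * r j powr (real n * q)) *
               (\<integral>\<^sup>+ \<xi> \<in> {\<xi>. norm (mat_powi (transpose M) (- int j) *v \<xi>) < \<delta>}.
                  ennreal (norm \<xi> powr (q * real n) * cmod (g \<xi>) powr q) \<partial>lebesgue))))"
proof -
 note pq = conj_expI[OF p q]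
 note f = conj_exp_facts[OF pq]
 have \<phi>l: "\<phi> : borel_measurable lebesgue" using \<phi>(1) by (simp add: calLp_def Lp_space_def)
 obtain \<phi>' where \<phi>': "\<phi>' : bm" "AE x in lborel. \<phi> x = \<phi>' x"
  using lebesgue_ex_borel[OF \<phi>l] by blast
 obtain h' where h': "h' : bm" "AE x in lborel. h x = h' x"
  using has_fourier_function_borel[OF T(2)] by blast
 obtain C1 C2 where C: "AE \<xi> in lebesgue. \<xi> \<notin> torus --> cmod (h \<xi>) <= C1 * norm \<xi> powr N"
  "AE \<xi> in lebesgue. \<xi> : torus --> cmod (h \<xi>) <= C2"
  using h_out h_in by blast
 define Ch where "Ch = \<bar>C1\<bar> + \<bar>C2\<bar> * 2 powr N"
 interpret P: quasi_projection M p q N Ch \<phi> \<phi>' h' T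
 proof
  show "has_fourier_function T h'" by (rule has_fourier_function_AE_cong(1)[OF T(2) h'])
  show "Lp_enorm p tor (%x. SUML k. enorm (\<phi>' (x + k))) < infy"
   by (rule calLp_periodized[OF f(1) \<phi>(1) \<phi>'])
 qed (use pq M N \<phi>l \<phi>' h' symbol_bounds[OF N h'(2) C] in \<open>simp_all add: Ch_def\<close>)
 have F: "fourier \<phi> = fhat \<phi>'" by (rule fourier_eq_fhat[OF \<phi>'])
 have good: "\<exists>g'. P.good g' \<and> (AE x in lborel. g x = g' x)" if g: "Lq_decay q (N + d + \<epsilon>) g" for g
 proof -
  have "g : borel_measurable lebesgue" using g by (simp add: Lq_decay_def Lp_space_def)
  then obtain g' where g': "g' : bm" "AE x in lborel. g x = g' x"
   using lebesgue_ex_borel by blast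
  \<comment> \<open>For finite p the midpoint of the allowed interval. It serves to show that g is
    \<open>good\<close>; the \<gamma> of the second part is fixed independently.\<close>
  define \<gamma> where "\<gamma> = (if p = infy then N else N + real CARD('d) / enn2real p + \<epsilon> / 2)"
  have "P.admissible \<gamma>" using \<epsilon> by (simp add: P.admissible_def \<gamma>_def)
  moreover note Lq_decay_weighted[OF pq \<epsilon> N \<gamma>_def g[unfolded d_def] g']
  ultimately show ?thesis using g' unfolding P.good_def by blast
 qed
 have SF: "strang_fix 1 \<phi> \<longleftrightarrow> (\<forall>l\<in>int_lattice - {0}. fhat \<phi>' l = 0)"
 proof
  assume s: "strang_fix 1 \<phi>"
  have "mi_order (%_ :: 'd. 0) < 1" by (simp add: mi_order_def)
  then show "\<forall>l\<in>int_lattice - {0}. fhat \<phi>' l = 0"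
   using s D_order_0[of "%_. 0" "fhat \<phi>'"] unfolding strang_fix_def F by metis
 qed (simp add: strang_fix_def F D_order_0)
 show ?thesis
 proof (intro conjI impI allI)
  fix g :: "real^'d => complex"
  assume h0: "isCont h 0 \<and> fourier \<phi> 0 * cnj (h 0) = 1" and g: "Lq_decay q (N + d + \<epsilon>) g"
  obtain g' where g': "P.good g'" "AE x in lborel. g x = g' x" using good[OF g] by blast
  have a: "fhat \<phi>' 0 * cnj (h 0) = 1" "isCont h 0" using h0 F by auto
  have g'm: "g' : bm" using g'(1) by (rule P.good_measurable)
  show "strang_fix 1 \<phi>" if lim: "(\<exists>x. f g x ~= 0) \<and> err g ~~> 0"
  proof -
   obtain x where "f g x ~= 0" using lim by blast
   then have "inv_fourier g' x ~= 0"
    unfolding f_def fourier_eq_fhat[OF g'm g'(2)] by (simp add: fhat_def inv_fourier_def character_simps)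
   then show ?thesis
    unfolding SF using P.convergence_necessary[OF h'(2) a(2,1) g' _ conjunct2[OF lim, unfolded err_def]] by blast
  qed
  show "err g ~~> 0" if s: "strang_fix 1 \<phi> \<and> (p = infy --> isCont S 0)"
   unfolding err_def
  proof (rule P.convergence_sufficient[OF h'(2) a(2,1) _ _ g'])
   show "fhat \<phi>' l = 0" if "l : int_lattice - {0}" for l using s that unfolding SF by blast
   assume pinf: "p = infy"
   then have "S = (%\<xi>. \<Sum>\<^sub>\<infinity>k\<in>int_lattice. enorm (fhat \<phi>' (\<xi> + k)))"
    using f(12) by (simp add: S_def F)
   then show "isCont (%\<xi>. \<Sum>\<^sub>\<infinity>k\<in>int_lattice. enorm (fhat \<phi>' (\<xi> + k))) 0"
    using s pinf by simp
  qed
 next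
  fix n :: nat and \<delta> \<gamma> :: real
  assume A: "n >= 1 \<and> 0 < \<delta> \<and> \<delta> < 1/2 \<and>
    boundedly_differentiable n (%\<xi>. fourier \<phi> \<xi> * cnj (h \<xi>)) {\<xi>. norm \<xi> < \<delta>} \<and>
    (\<forall>l\<in>int_lattice - {0}. boundedly_differentiable n (fourier \<phi>) {\<xi>. norm (\<xi> + l) < \<delta>}) \<and>
    (\<forall>\<beta>. mi_order \<beta> = n -->
      (\<exists>B. \<forall>\<xi>. norm \<xi> < \<delta> -->
       (\<Sum>\<^sub>\<infinity>l\<in>int_lattice - {0}. enorm (D \<beta> (fourier \<phi>) (\<xi> + l))) <= ennreal B)) \<and>
    (\<forall>\<beta>. mi_order \<beta> < n --> D \<beta> (%\<xi>. 1 - fourier \<phi> \<xi> * cnj (h \<xi>)) 0 = 0) \<and>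
    strang_fix n \<phi> \<and>
    (if p = infy then \<gamma> = N
     else N + d / enn2real p < \<gamma> \<and> \<gamma> < N + d / enn2real p + \<epsilon>)"
  note A' = A[unfolded F strang_fix_def]
  have adm: "P.admissible \<gamma>" using A by (auto simp: P.admissible_def d_def split: if_splits)
  have "\<exists>C1 C2. \<forall>g0 g j. P.good g --> (AE x in lborel. g0 x = g x) -->
   ennpowr (Lp_norm p (%x. fourier g0 (- x) - Q p M \<phi> T g0 j x)) q \<le>
   ennreal (C1 * P.r j powr (\<gamma> * q)) * (INTR \<xi>. ennreal (norm \<xi> powr (q * \<gamma>) * cmod (g \<xi>) powr q) * indicator {\<xi>. \<delta> <= norm (P.BT j *v \<xi>)} \<xi>) +
   ennreal (C2 * P.r j powr (real n * q)) * (INTR \<xi>. ennreal (norm \<xi> powr (q * real n) * cmod (g \<xi>) powr q) * indicator {\<xi>. norm (P.BT j *v \<xi>) < \<delta>} \<xi>)"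
  proof (rule P.approximation_order[OF h'(2) _ _ _ adm])
   show "1 <= n" "0 < \<delta>" "\<delta> < 1 / 2" "boundedly_differentiable n (%\<xi>. fhat \<phi>' \<xi> * cnj (h \<xi>)) {\<xi>. norm \<xi> < \<delta>}"
    using A' by blast+
   show "D \<beta> (%\<xi>. 1 - fhat \<phi>' \<xi> * cnj (h \<xi>)) 0 = 0" if "mi_order \<beta> < n" for \<beta> using A' that by blast
   show "boundedly_differentiable n (fhat \<phi>') {\<xi>. norm (\<xi> + l) < \<delta>}" if "l : int_lattice - {0}" for l using A' that by blast
   show "\<exists>B. \<forall>\<xi>. norm \<xi> < \<delta> --> (\<Sum>\<^sub>\<infinity>l\<in>int_lattice - {0}. enorm (D \<beta> (fhat \<phi>') (\<xi> + l))) <= ennreal B" if "mi_order \<beta> = n" for \<beta>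
    using A' that by blast
   show "D \<beta> (fhat \<phi>') l = 0" if "l : int_lattice - {0}" "mi_order \<beta> < n" for l \<beta> using A' that by blast
  qed
  then obtain C1 C2 where C12: "!!g0 g j. P.good g ==> (AE x in lborel. g0 x = g x) ==>
   ennpowr (Lp_norm p (%x. fourier g0 (- x) - Q p M \<phi> T g0 j x)) q \<le>
   ennreal (C1 * P.r j powr (\<gamma> * q)) * (INTR \<xi>. ennreal (norm \<xi> powr (q * \<gamma>) * cmod (g \<xi>) powr q) * indicator {\<xi>. \<delta> <= norm (P.BT j *v \<xi>)} \<xi>) +
   ennreal (C2 * P.r j powr (real n * q)) * (INTR \<xi>. ennreal (norm \<xi> powr (q * real n) * cmod (g \<xi>) powr q) * indicator {\<xi>. norm (P.BT j *v \<xi>) < \<delta>} \<xi>)"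
   by blast
  show "\<exists>C1 C2. \<forall>g. Lq_decay q (N + d + \<epsilon>) g --> (\<forall>j.
      ennpowr (err g j) q
      <= ennreal (C1 * r j powr (\<gamma> * q)) *
        (\<integral>\<^sup>+ \<xi>\<in>{\<xi>. norm (mat_powi (transpose M) (- int j) *v \<xi>) >= \<delta>}.
         ennreal (norm \<xi> powr (q * \<gamma>) * cmod (g \<xi>) powr q) \<partial>lebesgue)
       + ennreal (C2 * r j powr (real n * q)) *
        (\<integral>\<^sup>+ \<xi>\<in>{\<xi>. norm (mat_powi (transpose M) (- int j) *v \<xi>) < \<delta>}.
         ennreal (norm \<xi> powr (q * real n) * cmod (g \<xi>) powr q) \<partial>lebesgue))"
  proof (rule exI[of _ C1], rule exI[of _ C2], intro allI impI)
   fix g :: "real^'d => complex" and j :: nat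
   assume g: "Lq_decay q (N + d + \<epsilon>) g"
   obtain g' where g': "P.good g'" "AE x in lborel. g x = g' x" using good[OF g] by blast
   have g'm: "g' : bm" using g'(1) by (rule P.good_measurable)
   have sets: "{\<xi>. \<delta> <= norm (P.BT j *v \<xi>)} : sets borel" "{\<xi>. norm (P.BT j *v \<xi>) < \<delta>} : sets borel"
    by measurable
   show "ennpowr (err g j) q
      <= ennreal (C1 * r j powr (\<gamma> * q)) *
        (\<integral>\<^sup>+ \<xi>\<in>{\<xi>. norm (mat_powi (transpose M) (- int j) *v \<xi>) >= \<delta>}.
         ennreal (norm \<xi> powr (q * \<gamma>) * cmod (g \<xi>) powr q) \<partial>lebesgue)
       + ennreal (C2 * r j powr (real n * q)) *
        (\<integral>\<^sup>+ \<xi>\<in>{\<xi>. norm (mat_powi (transpose M) (- int j) *v \<xi>) < \<delta>}.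
         ennreal (norm \<xi> powr (q * real n) * cmod (g \<xi>) powr q) \<partial>lebesgue)"
    unfolding err_def r_def mat_powi_dilation(3)[OF M] set_nn_integral_lebesgue_cong[OF g'm sets(1) g'(2)]
     set_nn_integral_lebesgue_cong[OF g'm sets(2) g'(2)]
    by (rule C12[OF g'])
  qed
 qed
qed

end
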